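(* Assume that $g\in C^1(\mathbb R)$, $g(0)=0$; that there exists $\lambda\ge 0$ such that $g'(r)\ge-\lambda$ for all $r\in\mathbb R$; and that $\liminf_{|r|\to\infty}\big(g(r)r+(\lambda_1-\kappa)r^2\big)>0$ for some $\kappa>0$. Set $\beta(r):=g(r)+\lambda r$ and let $\widehat\beta$ be a primitive of $\beta$. Let $u_0\in\mathcal X_{\sigma0}$ with $\widehat\beta(u_0)\in L^1(\Omega)$, and let $(u,w)$ be a weak solution of the fractional Cahn-Hilliard system on $(0,\infty)$ with initial datum $u_0$. Then, for any $t\ge1$, $$\mathfrak A_\sigma u(t)+\beta(u(t))=\lambda u(t)+w(t)\in L^p(\Omega)$$ for $p=s^*:=\frac{2N}{N-2s}$ if $N>2s$, and for any $p\in[1,\infty)$ if $N\le2s$. Moreover, if $2s+4\sigma>N$, then there exist a constant $\alpha>0$ depending on $N,s,\sigma$ and a constant $C$ independent of $t$ such that $$\|u(t)\|_{C^\alpha(\overline\Omega)}\le C\quad\text{for all }t\ge1.$$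
   Context: $\Omega\subset\mathbb R^N$ is a bounded domain with smooth boundary and $s,\sigma\in(0,1)$. Functions in $L^p(\Omega)$ are identified with their extensions by zero to $\mathbb R^N$. For $a\in(0,1)$, $C_a>0$ denotes the normalization constant (depending only on $N$ and $a$) in the singular-integral definition $(-\Delta)^a u(x)=C_a\,\mathrm{p.v.}\int_{\mathbb R^N}\frac{u(x)-u(y)}{|x-y|^{N+2a}}dy$, and $$\mathcal X_{a0}:=\{v\in H^a(\mathbb R^N): v=0\text{ a.e. in }\mathbb R^N\setminus\Omega\},\qquad \|v\|_{\mathcal X_{a0}}^2:=\frac{C_a}{2}\iint_{\mathbb R^{2N}}\frac{|v(x)-v(y)|^2}{|x-y|^{N+2a}}\,dx\,dy,$$ a Hilbert space with dual $\mathcal X_{a0}'$; $\mathcal X_{a0}\hookrightarrow L^2(\Omega)\simeq L^2(\Omega)'\hookrightarrow\mathcal X_{a0}'$. The operator $\mathfrak A_a:\mathcal X_{a0}\to\mathcal X_{a0}'$ is defined by $$\langle\mathfrak A_a u,v\rangle_{\mathcal X_{a0}}=\frac{C_a}{2}\iint_{\mathbb R^{2N}}\frac{(u(x)-u(y))(v(x)-v(y))}{|x-y|^{N+2a}}\,dx\,dy .$$ $\lambda_1=\inf_{v\in\mathcal X_{\sigma0}\setminus\{0\}}\|v\|_{\mathcal X_{\sigma0}}^2/\|v\|_{L^2(\Omega)}^2>0$ is the first eigenvalue of the fractional Dirichlet Laplacian of order $\sigma$. The Hölder norm is $\|v\|_{C^\alpha(\overline\Omega)}=\sup_{x}|v(x)|+\sup_{x\ne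 y}|v(x)-v(y)|/|x-y|^\alpha$ over $x,y\in\overline\Omega$. The fractional Cahn-Hilliard system is $u_t+(-\Delta)^s w=0$, $w=(-\Delta)^\sigma u+g(u)$ in $\Omega\times(0,\infty)$, $u|_{t=0}=u_0$ in $\Omega$, $u=w=0$ in $\mathbb R^N\setminus\Omega$. Weak solution: for $0\le S<T\le\infty$, $(u,w)$ is a weak solution on $(S,T)$ if $u\in C_w([S,T);\mathcal X_{\sigma0})$ (weakly continuous), $u_t\in L^2(S,T;\mathcal X_{s0}')$, $w\in L^2(S,T;\mathcal X_{s0})$, $g(u)\in L^2_{\rm loc}(S,T;L^2(\Omega))$, and for a.e. $t\in(S,T)$: $u_t(t)+\mathfrak A_s w(t)=0$ in $\mathcal X_{s0}'$ and $w(t)=\mathfrak A_\sigma u(t)+g(u(t))$ in $\mathcal X_{\sigma0}'$; if $S=0$, having initial datum $u_0$ means $u(0)=u_0$. Here $L^p_{\rm loc}(S,T;X)$ means $L^p(S,T;X)$ if $T<\infty$ and $L^p_{\rm loc}([S,\infty);X)$ if $T=\infty$. *)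

theory Defs
  imports "HOL-Analysis.Analysis"
begin

text \<open>
  Conventions. The space \<open>\<real>\<^sup>N\<close> is a type \<open>'a :: euclidean_space\<close> with \<open>N = DIM('a)\<close>.
  Elements of Lebesgue and Sobolev spaces are represented by Borel functions \<open>'a \<Rightarrow> real\<close>; their
  equality is equality almost everywhere. A functional on such a space is a map
  \<open>('a \<Rightarrow> real) \<Rightarrow> real\<close> of which only the values on the space matter.
\<close>

section \<open>Smooth bounded domains\<close>

primrec Ck_on :: "nat \<Rightarrow> 'a::euclidean_space set \<Rightarrow> ('a \<Rightarrow> real) \<Rightarrow> bool" where
  "Ck_on 0 U f \<longleftrightarrow> continuous_on U f"
| "Ck_on (Suc k) U f \<longleftrightarrow>
     (\<exists>f'. (\<forall>x\<in>U. (f has_derivative f' x) (at x)) \<and> (\<forall>v. Ck_on k U (\<lambda>x. f' x v)))"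

definition smooth_on :: "'a::euclidean_space set \<Rightarrow> ('a \<Rightarrow> real) \<Rightarrow> bool" where
  "smooth_on U f \<longleftrightarrow> (\<forall>k. Ck_on k U f)"

text \<open>
  Near each boundary point the set is the region above the graph of a smooth function of
  \<open>N - 1\<close> variables, in some orthonormal system of coordinates: \<open>e\<close> is the direction of the last
  axis, and a function of the other \<open>N - 1\<close> coordinates is a function \<open>\<gamma>\<close> that is invariant under
  translation along \<open>e\<close>.
\<close>
definition smooth_boundary :: "'a::euclidean_space set \<Rightarrow> bool" where
  "smooth_boundary \<Omega> \<longleftrightarrow>
     (\<forall>x\<^sub>0\<in>frontier \<Omega>. \<exists>r>0. \<exists>e \<gamma>. norm e = 1 \<and> smooth_on UNIV \<gamma> \<and>
        (\<forall>x \<tau>. \<gamma> (x + \<tau> *\<^sub>R e) = \<gamma> x) \<and>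
        \<Omega> \<inter> ball x\<^sub>0 r = {x \<in> ball x\<^sub>0 r. x \<bullet> e > \<gamma> x})"

definition smooth_bounded_domain :: "'a::euclidean_space set \<Rightarrow> bool" where
  "smooth_bounded_domain \<Omega> \<longleftrightarrow>
     open \<Omega> \<and> connected \<Omega> \<and> \<Omega> \<noteq> {} \<and> bounded \<Omega> \<and> smooth_boundary \<Omega>"

section \<open>Function spaces\<close>

definition Lp :: "real \<Rightarrow> 'a::euclidean_space set \<Rightarrow> ('a \<Rightarrow> real) set" where
  "Lp p \<Omega> = {f. set_borel_measurable lborel \<Omega> f \<and>
                 set_integrable lborel \<Omega> (\<lambda>x. \<bar>f x\<bar> powr p)}"

definition L2_norm :: "'a::euclidean_space set \<Rightarrow> ('a \<Rightarrow> real) \<Rightarrow> real" where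
  "L2_norm \<Omega> f = sqrt (LINT x:\<Omega>|lborel. (f x)\<^sup>2)"

text \<open>The functional on a space of functions on \<open>\<Omega>\<close> induced by \<open>f \<in> L\<^sup>2(\<Omega>)\<close>.\<close>
definition L2_functional :: "'a::euclidean_space set \<Rightarrow> ('a \<Rightarrow> real) \<Rightarrow> ('a \<Rightarrow> real) \<Rightarrow> real" where
  "L2_functional \<Omega> f = (\<lambda>v. LINT x:\<Omega>|lborel. f x * v x)"

text \<open>
  The constant for which the singular integral \<open>(-\<Delta>)\<^sup>a\<close> on \<open>\<real>\<^sup>N\<close> has Fourier symbol
  \<open>\<bar>\<xi>\<bar>\<close> to the power \<open>2a\<close>.
\<close>
definition frac_const :: "nat \<Rightarrow> real \<Rightarrow> real" where
  "frac_const N a =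
     4 powr a * Gamma (real N / 2 + a) / (pi powr (real N / 2) * \<bar>Gamma (- a)\<bar>)"

definition frac_sobolev :: "real \<Rightarrow> ('a::euclidean_space \<Rightarrow> real) set" where
  "frac_sobolev a = {v \<in> borel_measurable lborel.
     integrable lborel (\<lambda>x. (v x)\<^sup>2) \<and>
     integrable (lborel \<Otimes>\<^sub>M lborel)
       (\<lambda>(x, y). \<bar>v x - v y\<bar>\<^sup>2 / norm (x - y) powr (real DIM('a) + 2 * a))}"

definition X0 :: "real \<Rightarrow> 'a::euclidean_space set \<Rightarrow> ('a \<Rightarrow> real) set" where
  "X0 a \<Omega> = {v \<in> frac_sobolev a. AE x in lborel. x \<notin> \<Omega> \<longrightarrow> v x = 0}"

definition X0_norm :: "real \<Rightarrow> ('a::euclidean_space \<Rightarrow> real) \<Rightarrow> real" where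
  "X0_norm a v = sqrt (frac_const DIM('a) a / 2 *
     (LINT (x, y)|(lborel \<Otimes>\<^sub>M lborel).
        \<bar>v x - v y\<bar>\<^sup>2 / norm (x - y) powr (real DIM('a) + 2 * a)))"

definition X0_dual :: "real \<Rightarrow> 'a::euclidean_space set \<Rightarrow> (('a \<Rightarrow> real) \<Rightarrow> real) set" where
  "X0_dual a \<Omega> = {l.
     (\<forall>v\<in>X0 a \<Omega>. \<forall>w\<in>X0 a \<Omega>. \<forall>b c. l (\<lambda>x. b * v x + c * w x) = b * l v + c * l w) \<and>
     (\<exists>K. \<forall>v\<in>X0 a \<Omega>. \<bar>l v\<bar> \<le> K * X0_norm a v)}"

definition X0_dual_norm :: "real \<Rightarrow> 'a::euclidean_space set \<Rightarrow> (('a \<Rightarrow> real) \<Rightarrow> real) \<Rightarrow> real" where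
  "X0_dual_norm a \<Omega> l = (SUP v\<in>{v \<in> X0 a \<Omega>. X0_norm a v \<le> 1}. \<bar>l v\<bar>)"

definition frac_op :: "real \<Rightarrow> ('a::euclidean_space \<Rightarrow> real) \<Rightarrow> ('a \<Rightarrow> real) \<Rightarrow> real" where
  "frac_op a u = (\<lambda>v. frac_const DIM('a) a / 2 *
     (LINT (x, y)|(lborel \<Otimes>\<^sub>M lborel).
        (u x - u y) * (v x - v y) / norm (x - y) powr (real DIM('a) + 2 * a)))"

definition first_eigenvalue :: "real \<Rightarrow> 'a::euclidean_space set \<Rightarrow> real" where
  "first_eigenvalue a \<Omega> =
     (INF v\<in>{v \<in> X0 a \<Omega>. \<not> (AE x in lborel. v x = 0)}. (X0_norm a v)\<^sup>2 / (L2_norm \<Omega> v)\<^sup>2)"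

text \<open>Valued in \<open>ennreal\<close>, so that a bound by a real number includes finiteness.\<close>
definition holder_norm :: "real \<Rightarrow> 'a::euclidean_space set \<Rightarrow> ('a \<Rightarrow> real) \<Rightarrow> ennreal" where
  "holder_norm \<alpha> K v =
     (SUP x\<in>K. ennreal \<bar>v x\<bar>) +
     (SUP (x, y)\<in>{(x, y). x \<in> K \<and> y \<in> K \<and> x \<noteq> y}. ennreal (\<bar>v x - v y\<bar> / norm (x - y) powr \<alpha>))"

section \<open>Vector-valued functions of time\<close>

text \<open>
  Bochner spaces over an interval \<open>I\<close> with values in a set \<open>X\<close> of real functions carrying a norm
  \<open>nrm\<close>. The spaces above depend on \<open>\<Omega>\<close> and are therefore not types, so the Bochner integral of the
  library does not apply to them. Strong measurability is approximation in norm, almost everywhere,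
  by simple functions.
\<close>
definition strongly_measurable_on ::
  "real set \<Rightarrow> ('c \<Rightarrow> real) set \<Rightarrow> (('c \<Rightarrow> real) \<Rightarrow> real) \<Rightarrow> (real \<Rightarrow> 'c \<Rightarrow> real) \<Rightarrow> bool" where
  "strongly_measurable_on I X nrm f \<longleftrightarrow>
     (\<exists>F :: nat \<Rightarrow> real \<Rightarrow> 'c \<Rightarrow> real.
        (\<forall>k. finite (F k ` I) \<and> F k ` I \<subseteq> X \<and> (\<forall>y. {t \<in> I. F k t = y} \<in> sets lebesgue)) \<and>
        (AE t in lebesgue_on I. (\<lambda>k. nrm (\<lambda>z. F k t z - f t z)) \<longlonglongrightarrow> 0))"

definition L2_Bochner ::
  "real set \<Rightarrow> ('c \<Rightarrow> real) set \<Rightarrow> (('c \<Rightarrow> real) \<Rightarrow> real) \<Rightarrow> (real \<Rightarrow> 'c \<Rightarrow> real) set" where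
  "L2_Bochner I X nrm = {f. (AE t in lebesgue_on I. f t \<in> X) \<and>
     strongly_measurable_on I X nrm f \<and> integrable (lebesgue_on I) (\<lambda>t. (nrm (f t))\<^sup>2)}"

definition L2_loc_Bochner ::
  "real \<Rightarrow> ereal \<Rightarrow> ('c \<Rightarrow> real) set \<Rightarrow> (('c \<Rightarrow> real) \<Rightarrow> real) \<Rightarrow> (real \<Rightarrow> 'c \<Rightarrow> real) set" where
  "L2_loc_Bochner S T X nrm =
     (if T < \<infinity> then L2_Bochner (einterval S T) X nrm
      else {f. \<forall>R>S. f \<in> L2_Bochner {S<..<R} X nrm})"

definition test_function :: "real \<Rightarrow> ereal \<Rightarrow> (real \<Rightarrow> real) \<Rightarrow> bool" where
  "test_function S T \<phi> \<longleftrightarrow> smooth_on UNIV \<phi> \<and>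
     (\<exists>a b. S < a \<and> ereal b < T \<and> (\<forall>t. t \<notin> {a..b} \<longrightarrow> \<phi> t = 0))"

text \<open>
  \<open>u\<^sub>t = \<eta>\<close> in the sense of distributions on \<open>(S, T)\<close> with values in the dual of \<open>X0 a \<Omega>\<close>, where
  \<open>u(t)\<close> is regarded as an element of that dual through \<open>L\<^sup>2(\<Omega>)\<close>. Both vector-valued integrals are
  functionals and are compared by evaluation on \<open>X0 a \<Omega>\<close>.
\<close>
definition has_time_derivative ::
  "real \<Rightarrow> 'a::euclidean_space set \<Rightarrow> real \<Rightarrow> ereal \<Rightarrow>
   (real \<Rightarrow> 'a \<Rightarrow> real) \<Rightarrow> (real \<Rightarrow> ('a \<Rightarrow> real) \<Rightarrow> real) \<Rightarrow> bool" where
  "has_time_derivative a \<Omega> S T u \<eta> \<longleftrightarrow>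
     (\<forall>\<phi>. test_function S T \<phi> \<longrightarrow> (\<forall>v\<in>X0 a \<Omega>.
        (LINT t|lebesgue_on (einterval S T). deriv \<phi> t * L2_functional \<Omega> (u t) v) =
        - (LINT t|lebesgue_on (einterval S T). \<phi> t * \<eta> t v)))"

definition weakly_continuous ::
  "real \<Rightarrow> 'a::euclidean_space set \<Rightarrow> real \<Rightarrow> ereal \<Rightarrow> (real \<Rightarrow> 'a \<Rightarrow> real) \<Rightarrow> bool" where
  "weakly_continuous a \<Omega> S T u \<longleftrightarrow>
     (\<forall>t. S \<le> t \<and> ereal t < T \<longrightarrow> u t \<in> X0 a \<Omega>) \<and>
     (\<forall>l\<in>X0_dual a \<Omega>. continuous_on {t. S \<le> t \<and> ereal t < T} (\<lambda>t. l (u t)))"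

definition weak_solution ::
  "real \<Rightarrow> real \<Rightarrow> 'a::euclidean_space set \<Rightarrow> (real \<Rightarrow> real) \<Rightarrow> real \<Rightarrow> ereal \<Rightarrow>
   (real \<Rightarrow> 'a \<Rightarrow> real) \<Rightarrow> (real \<Rightarrow> 'a \<Rightarrow> real) \<Rightarrow> bool" where
  "weak_solution s \<sigma> \<Omega> g S T u w \<longleftrightarrow>
     weakly_continuous \<sigma> \<Omega> S T u \<and>
     w \<in> L2_Bochner (einterval S T) (X0 s \<Omega>) (X0_norm s) \<and>
     (\<lambda>t x. g (u t x)) \<in> L2_loc_Bochner S T (Lp 2 \<Omega>) (L2_norm \<Omega>) \<and>
     (\<exists>u\<^sub>t. u\<^sub>t \<in> L2_Bochner (einterval S T) (X0_dual s \<Omega>) (X0_dual_norm s \<Omega>) \<and>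
        has_time_derivative s \<Omega> S T u u\<^sub>t \<and>
        (AE t in lebesgue_on (einterval S T).
           (\<forall>v\<in>X0 s \<Omega>. u\<^sub>t t v + frac_op s (w t) v = 0) \<and>
           (\<forall>v\<in>X0 \<sigma> \<Omega>. L2_functional \<Omega> (w t) v =
               frac_op \<sigma> (u t) v + L2_functional \<Omega> (\<lambda>x. g (u t x)) v)))"

end

(* Testing the two equations with time increments of u shows that the energy of w grows at most at
   a controlled rate; with the finite dissipation this bounds w(t) in X_s0 uniformly for t >= 1, and a
   limit of good times gives the stationary equation for u(t) at every such t. The right-hand side
   lam u + w is then bounded in L^p by the Sobolev embedding, by bootstrapping with powers of u as test
   functions. If 2s + 4 sigma > N, Stampacchia truncation bounds u(t), and the oscillation
   of u(t) decays geometrically on shrinking balls, near the boundary because of exterior balls. *)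
theory Submission
 imports Defs
begin

text \<open>No time derivative of \<open>w\<close> is available, and \<open>w\<close> is given at
  almost every time only. The argument therefore works with \<open>incr h t\<close>, the inverse of
  the operator of order \<open>s\<close> applied to \<open>u t - u (t + h)\<close>. In weak form it
  is the time integral of \<open>w\<close> over \<open>[t, t + h]\<close>, so a bound of order
  \<open>h\<close> for it is a bound for \<open>w\<close>. The loss caused by the nonconvex part of
  \<open>g\<close> is an L^2 norm; it is split between the energy norm of order \<open>sig\<close>
  and the dual norm of order \<open>s\<close>, which is the task of Ehrling's inequality. The energy
  norm of \<open>u t\<close> is not followed in time but read off the stationary equation and the
  liminf condition. The threshold \<open>2 s + 4 sig > N\<close> expresses that
  \<open>1 - 1/p - 2/q\<close> is positive for the critical Sobolev exponents \<open>p\<close> of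
  order \<open>s\<close> and \<open>q\<close> of order \<open>sig\<close>. Since the Hoelder
  exponent may depend on \<open>N\<close>, \<open>s\<close>, \<open>sig\<close> only, it is fixed
  together with \<open>theta\<close> from integrals of the kernel; domain, nonlinearity and solution
  enter through the starting radius \<open>r0\<close> and amplitude \<open>Q0\<close>.\<close>

lemmas L1_integrable_bound = Bochner_Integration.integrable_bound
 and L1_integrable_add = Bochner_Integration.integrable_add and L1_integrable_diff = Bochner_Integration.integrable_diff
 and L1_integral_cong = Bochner_Integration.integral_cong and L1_integral_add = Bochner_Integration.integral_add
 and L1_integral_diff = Bochner_Integration.integral_diff and L1_integral_nonneg = Bochner_Integration.integral_nonneg
 and L1_integral_zero = Bochner_Integration.integral_zero

abbreviation seq_tendsto :: "(nat => 'a::topological_space) => 'a => bool" (infixr "---->" 60) where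
 "X ----> l \<equiv> X \<longlonglongrightarrow> l"

abbreviation lborel2 :: "('a::euclidean_space \<times> 'a) measure" where
 "lborel2 \<equiv> lborel \<Otimes>\<^sub>M lborel"

abbreviation L2sq :: "('a::euclidean_space => real) => real" where
 "L2sq v \<equiv> LBINT x. (v x)^2"

abbreviation Lq_integrable :: "real => ('a::euclidean_space => real) => bool" where
 "Lq_integrable q v \<equiv> integrable lborel (%x. abs (v x) powr q)"

abbreviation Lq_int :: "real => ('a::euclidean_space => real) => real" where
 "Lq_int q v \<equiv> LBINT x. abs (v x) powr q"

section \<open>Square-integrable functions\<close>

text \<open>The measure is a parameter because the same facts serve functions on the space and
  difference quotients on pairs of points.\<close>

definition L2_fun :: "'b measure => ('b => real) => bool" where
 "L2_fun M f \<longleftrightarrow> f \<in> borel_measurable M & integrable M (%x. (f x)^2)"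

lemma L2D:
 assumes "L2_fun M f"
 shows "f \<in> borel_measurable M" "integrable M (%x. (f x)^2)" using assms by(auto simp: L2_fun_def)

lemma L2_mult_integrable:
 assumes f: "L2_fun M f" and g: "L2_fun M g"
 shows "integrable M (%x. f x * g x)" proof(rule L1_integrable_bound)
 show "integrable M (%x. (f x)^2 + (g x)^2)" using f g by(auto simp: L2_fun_def)
 show "(%x. f x * g x) \<in> borel_measurable M" using f g by(auto simp: L2_fun_def)
 have "abs (a * b) <= a^2 + b^2" for a b :: real proof -
  have "0 <= (abs a - abs b)^2" "0 <= abs a * abs b" by auto
  thus ?thesis unfolding power2_diff abs_mult power2_abs by linarith
 qed
 thus "AE x in M. norm (f x * g x) <= norm ((f x)^2 + (g x)^2)" by(auto intro: AE_I2)
qed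

lemma L2_lincomb:
 assumes f: "L2_fun M f" and g: "L2_fun M g"
 shows "L2_fun M (%x. b * f x + c * g x)" unfolding L2_fun_def proof
 show "(%x. b * f x + c * g x) \<in> borel_measurable M" using f g by(auto simp: L2_fun_def)
 have "(%x. (b * f x + c * g x)^2) = (%x. b^2 * (f x)^2 + (2 * b * c) * (f x * g x) + c^2 * (g x)^2)"
  by(auto simp: fun_eq_iff power2_eq_square algebra_simps)
 thus "integrable M (%x. (b * f x + c * g x)^2)" using f g L2_mult_integrable[OF f g]
  by(auto simp: L2_fun_def intro!: L1_integrable_add integrable_mult_right)
qed

lemma L2_dominated:
 assumes g: "L2_fun M g" and f: "f \<in> borel_measurable M" and le: "AE x in M. abs (f x) <= abs (g x)"
 shows "L2_fun M f" "(LINT x|M. (f x)^2) <= (LINT x|M. (g x)^2)" proof -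
 have le': "AE x in M. (f x)^2 <= (g x)^2" using le by eventually_elim (simp add: abs_le_square_iff)
 have i: "integrable M (%x. (f x)^2)" by(rule L1_integrable_bound[OF L2D(2)[OF g]])
   (use f le' in auto)
 thus "L2_fun M f" using f by(simp add: L2_fun_def)
 show "(LINT x|M. (f x)^2) <= (LINT x|M. (g x)^2)" by(rule integral_mono_AE[OF i L2D(2)[OF g] le'])
qed

lemma integral_CS:
 assumes f: "L2_fun M f" and g: "L2_fun M g"
 shows "abs (LINT x|M. f x * g x) <= sqrt (LINT x|M. (f x)^2) * sqrt (LINT x|M. (g x)^2)" proof -
 let ?A = "LINT x|M. (f x)^2" and ?B = "LINT x|M. (g x)^2" and ?C = "LINT x|M. f x * g x"
 have nn: "?A >= 0" "?B >= 0" by(auto intro: integral_nonneg_AE)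
 have q: "0 <= b^2 * ?A + 2 * b * c * ?C + c^2 * ?B" for b c proof -
  have "(LINT x|M. (b * f x + c * g x)^2) = (LINT x|M. b^2 * (f x)^2 + (2 * b * c) * (f x * g x) + c^2 * (g x)^2)"
   by(rule L1_integral_cong) (auto simp: power2_eq_square algebra_simps)
  also have "... = b^2 * ?A + (2 * b * c) * ?C + c^2 * ?B" using f g L2_mult_integrable[OF f g] by(simp add: L2_fun_def)
  finally have "b^2 * ?A + (2 * b * c) * ?C + c^2 * ?B = (LINT x|M. (b * f x + c * g x)^2)" by simp
  also have "... >= 0" by(rule integral_nonneg_AE) simp
  finally show ?thesis .
 qed
 have "?C^2 <= ?A * ?B" proof(cases "?B = 0")
  case True have "?C = 0" proof(rule ccontr)
   assume "?C ~= 0"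
   have "0 <= ?A + 2 * c * ?C" for c using q[of 1 c] True by simp
   \<comment> \<open>With this \<open>c\<close> the affine function of \<open>c\<close> takes the
     value -1.\<close>
   from this[of "- (?A + 1) / (2 * ?C)"] \<open>?C ~= 0\<close> have "0 <= ?A - (?A + 1)" by(simp add: field_simps)
   thus False by simp
  qed
  thus ?thesis using True by simp
 next case False hence B: "?B > 0" using nn(2) by linarith
  have "0 <= ?B^2 * ?A + 2 * ?B * (- ?C) * ?C + (- ?C)^2 * ?B" by(rule q)
  also have "... = ?B * (?A * ?B - ?C^2)" by(simp add: power2_eq_square algebra_simps)
  finally show ?thesis using B by(simp add: zero_le_mult_iff)
 qed
 hence "sqrt (?C^2) <= sqrt (?A * ?B)" by(rule real_sqrt_le_mono)
 thus ?thesis by(simp add: real_sqrt_mult)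
qed

text \<open>Lower semicontinuity of the norm along almost everywhere convergent sequences. It takes
  the place of weak compactness wherever a truncation is removed or a limit is identified.\<close>

lemma L2_Fatou:
 fixes f :: "nat => 'b => real"
 assumes f: "!!n. L2_fun M (f n)" and bd: "!!n. (LINT x|M. (f n x)^2) <= K"
  and lim: "AE x in M. (%n. f n x) ----> F x" and F: "F \<in> borel_measurable M"
 shows "L2_fun M F" "(LINT x|M. (F x)^2) <= K" proof -
 have "0 <= (LINT x|M. (f 0 x)^2)" by(rule integral_nonneg_AE) simp
 with bd[of 0] have K: "0 <= K" by linarith
 have mf[measurable]: "!!n. f n \<in> borel_measurable M" using f by(auto simp: L2_fun_def)
 note F[measurable]
 have "(\<integral>\<^sup>+ x. ennreal ((F x)^2) \<partial>M) = (\<integral>\<^sup>+ x. liminf (%n. ennreal ((f n x)^2)) \<partial>M)"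
 proof(rule nn_integral_cong_AE)
  show "AE x in M. ennreal ((F x)^2) = liminf (%n. ennreal ((f n x)^2))" using lim proof eventually_elim
   case (elim x) hence "(%n. ennreal ((f n x)^2)) ----> ennreal ((F x)^2)" by(intro tendsto_ennrealI tendsto_power)
   thus ?case using lim_imp_Liminf[OF trivial_limit_sequentially] by force
  qed qed
 also have "... <= liminf (%n. \<integral>\<^sup>+ x. ennreal ((f n x)^2) \<partial>M)" by(rule nn_integral_liminf) auto
 also have "... <= liminf (%n::nat. ennreal K)" proof(rule Liminf_mono, rule always_eventually, rule allI)
  fix n have "(\<integral>\<^sup>+ x. ennreal ((f n x)^2) \<partial>M) = ennreal (LINT x|M. (f n x)^2)"
   using f[of n] by(intro nn_integral_eq_integral) (auto simp: L2_fun_def)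
  also have "... <= ennreal K" using bd by(intro ennreal_leI)
  finally show "(\<integral>\<^sup>+ x. ennreal ((f n x)^2) \<partial>M) <= ennreal K" .
 qed
 also have "... = ennreal K" by(simp add: Liminf_const)
 finally have le: "(\<integral>\<^sup>+ x. ennreal ((F x)^2) \<partial>M) <= ennreal K" .
 hence "integrable M (%x. (F x)^2)" by(intro integrableI_bounded) (auto simp: less_top[symmetric] top_unique)
 thus "L2_fun M F" using F by(simp add: L2_fun_def)
 have "ennreal (LINT x|M. (F x)^2) <= ennreal K"
  using le \<open>integrable M (%x. (F x)\<^sup>2)\<close> by(subst nn_integral_eq_integral[symmetric]) auto
 thus "(LINT x|M. (F x)^2) <= K" using K by(simp add: ennreal_le_iff)
qed

text \<open>The sum of the weighted squares of the increments is integrable, hence finite almost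
 everywhere, which bounds the increments by a geometric sequence.\<close>
lemma L2_fast_Cauchy_converges:
 fixes f :: "nat => 'b => real"
 assumes f: "!!n. L2_fun M (f n)" and fast: "!!n. (LINT x|M. (f (Suc n) x - f n x)^2) <= (1 / 4) ^ n"
 shows "AE x in M. convergent (%n. f n x)" proof -
 define d where "d n x = f (Suc n) x - f n x" for n x
 have d: "L2_fun M (d n)" for n using L2_lincomb[OF f[of "Suc n"] f[of n], of 1 "-1"] by(simp add: d_def[abs_def])
 have [measurable]: "d n \<in> borel_measurable M" for n using d by(auto simp: L2_fun_def)
 have "(\<integral>\<^sup>+ x. (\<Sum>n. ennreal (2 ^ n * (d n x)^2)) \<partial>M) = (\<Sum>n. \<integral>\<^sup>+ x. ennreal (2 ^ n * (d n x)^2) \<partial>M)"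
  by(rule nn_integral_suminf) auto
 also have "... <= (\<Sum>n. ennreal ((1/2) ^ n))" proof(rule suminf_le)
  fix n have "(\<integral>\<^sup>+ x. ennreal (2 ^ n * (d n x)^2) \<partial>M) = ennreal (LINT x|M. 2 ^ n * (d n x)^2)"
   using d[of n] by(intro nn_integral_eq_integral) (auto simp: L2_fun_def)
  also have "... = ennreal (2 ^ n * (LINT x|M. (d n x)^2))" by simp
  also have "... <= ennreal (2 ^ n * (1/4) ^ n)" using fast[of n] by(intro ennreal_leI mult_left_mono) (auto simp: d_def)
  also have "(2::real) ^ n * (1/4) ^ n = (1/2) ^ n" by(simp flip: power_mult_distrib)
  finally show "(\<integral>\<^sup>+ x. ennreal (2 ^ n * (d n x)^2) \<partial>M) <= ennreal ((1/2) ^ n)" .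
 qed auto
 also have "... = ennreal (\<Sum>n. (1/2) ^ n)" by(rule suminf_ennreal2) (auto intro: summable_geometric)
 also have "... < \<infinity>" by simp
 finally have "(\<integral>\<^sup>+ x. (\<Sum>n. ennreal (2 ^ n * (d n x)^2)) \<partial>M) ~= \<infinity>" by(rule less_imp_neq)
 hence "AE x in M. (\<Sum>n. ennreal (2 ^ n * (d n x)^2)) ~= \<infinity>" by(rule nn_integral_PInf_AE[rotated]) measurable
 thus ?thesis proof eventually_elim
  case (elim x) define S where "S = enn2real (\<Sum>n. ennreal (2 ^ n * (d n x)^2))"
  have S: "(\<Sum>n. ennreal (2 ^ n * (d n x)^2)) = ennreal S" using elim unfolding S_def by(metis ennreal_enn2real infinity_ennreal_def less_top)
  have S0: "S >= 0" unfolding S_def by(rule enn2real_nonneg)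
  have b: "abs (d n x) <= sqrt S * (sqrt (1/2)) ^ n" for n proof -
   have "h n <= suminf h" for h :: "nat => ennreal" using sum_le_suminf[of h "{n}"] by simp
   hence "ennreal (2 ^ n * (d n x)^2) <= ennreal S" unfolding S[symmetric] .
   hence "2 ^ n * (d n x)^2 <= S" using S0 by(simp add: ennreal_le_iff)
   hence "(d n x)^2 <= S * (1/2) ^ n" by(simp add: field_simps)
   hence "sqrt ((d n x)^2) <= sqrt (S * (1/2) ^ n)" by(rule real_sqrt_le_mono)
   thus ?thesis unfolding real_sqrt_abs by(simp add: real_sqrt_mult real_sqrt_power)
  qed
  have "summable (%n. sqrt S * (sqrt (1/2)) ^ n)" by(intro summable_mult summable_geometric) auto
  hence "summable (%n. d n x)" by(rule summable_comparison_test'[where N=0]) (use b in auto)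
  hence "convergent (%n. \<Sum>i<n. f (Suc i) x - f i x)" by(simp add: summable_iff_convergent d_def)
  hence "convergent (%n. f n x - f 0 x)" using sum_lessThan_telescope[of "%i. f i x"] by simp
  thus ?case by(simp add: convergent_diff_const_right_iff)
 qed qed

lemma integrable_fst_times_snd:
 fixes f :: "'b => real" and g :: "'c => real"
 assumes M: "sigma_finite_measure M" and N: "sigma_finite_measure N" and f: "integrable M f" and g: "integrable N g"
 shows "integrable (M \<Otimes>\<^sub>M N) (%p. f (fst p) * g (snd p))" proof -
 interpret pair_sigma_finite M N using M N by(simp add: pair_sigma_finite_def)
 have [measurable]: "f \<in> borel_measurable M" "g \<in> borel_measurable N" using f g by auto
 show ?thesis proof(rule Fubini_integrable)
  show "integrable M (%x. LINT y|N. norm (f (fst (x, y)) * g (snd (x, y))))" using f by(simp add: abs_mult)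
  show "AE x in M. integrable N (%y. f (fst (x, y)) * g (snd (x, y)))" using g by simp
 qed measurable
qed

section \<open>The energy spaces\<close>

lemma frac_const_pos:
 assumes "0 < a" "a < 1" shows "frac_const (DIM('a::euclidean_space)) a > 0" proof -
 have "Gamma (real DIM('a) / 2 + a) > 0" using assms by(intro Gamma_real_pos) (simp add: add_nonneg_pos)
 \<comment> \<open>\<open>Gamma\<close> is 0 at its poles by convention, so \<open>- a\<close> must
   be shown not to be a pole.\<close>
 moreover have "- a \<notin> \<int>\<^sub>\<le>\<^sub>0" proof
  assume "- a \<in> \<int>\<^sub>\<le>\<^sub>0"
  then obtain n :: int where "- a = of_int n" by(auto elim!: nonpos_Ints_cases)
  hence "of_int (- n) = a" by simp
  hence "0 < real_of_int (- n)" "real_of_int (- n) < 1" using assms by auto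
  hence "0 < - n" "- n < 1" by linarith+
  thus False by simp
 qed
 hence "Gamma (- a) ~= 0" by(simp add: Gamma_eq_zero_iff)
 ultimately show ?thesis by(simp add: frac_const_def)
qed

text \<open>The exponent is halved so that the energy form becomes the L^2 inner product of two such
  quotients on pairs of points. On the diagonal the value is 0.\<close>

definition frac_diff :: "real => ('a::euclidean_space => real) => 'a \<times> 'a => real" where
 "frac_diff a v = (%(x, y). (v x - v y) / norm (x - y) powr ((real DIM('a) + 2 * a) / 2))"

lemma frac_diff_measurable [measurable]:
 assumes [measurable]: "v \<in> borel_measurable lborel"
 shows "frac_diff a v \<in> borel_measurable lborel2" unfolding frac_diff_def by measurable

lemma powr_half_mult: "(x::real) powr (c / 2) * x powr (c / 2) = x powr c" by(simp flip: powr_add)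

lemma frac_diff_mult:
 fixes u :: "'a::euclidean_space => real"
 shows "frac_diff a u (x, y) * frac_diff a v (x, y) =
  (u x - u y) * (v x - v y) / norm (x - y) powr (real DIM('a) + 2 * a)" by(simp add: frac_diff_def powr_half_mult)

lemma frac_op_eq:
 fixes u :: "'a::euclidean_space => real"
 shows "frac_op a u v = frac_const DIM('a) a / 2 *
  (LINT p|lborel2. frac_diff a u p * frac_diff a v p)" unfolding frac_op_def by(intro arg_cong2[where f="(*)"] refl L1_integral_cong)
  (auto simp: frac_diff_mult)

lemma X0_norm_eq:
 fixes v :: "'a::euclidean_space => real"
 shows "X0_norm a v = sqrt (frac_const DIM('a) a / 2 *
  (LINT p|lborel2. (frac_diff a v p)^2))" unfolding X0_norm_def by(intro arg_cong[where f=sqrt] arg_cong2[where f="(*)"] refl L1_integral_cong)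
  (auto simp: frac_diff_mult power2_eq_square)

lemma frac_sobolev_iff:
 fixes v :: "'a::euclidean_space => real"
 shows "v \<in> frac_sobolev a \<longleftrightarrow> L2_fun lborel v &
  L2_fun lborel2 (frac_diff a v)" proof -
 have "(%(x, y). (abs (v x - v y))^2 / norm (x - y) powr (real DIM('a) + 2 * a)) = (%p. (frac_diff a v p)^2)"
  by(auto simp: fun_eq_iff frac_diff_mult power2_eq_square)
 thus ?thesis unfolding frac_sobolev_def L2_fun_def by auto
qed

lemma frac_diff_lincomb:
 "frac_diff a (%x. b * u x + c * v x) = (%p. b * frac_diff a u p + c * frac_diff a v p)"
 by(auto simp: frac_diff_def fun_eq_iff add_divide_distrib[symmetric] algebra_simps)

lemma frac_sobolev_lincomb:
 assumes "u \<in> frac_sobolev a" "v \<in> frac_sobolev a"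
 shows "(%x. b * u x + c * v x) \<in> frac_sobolev a" using assms by(auto simp: frac_sobolev_iff frac_diff_lincomb intro!: L2_lincomb)

lemma frac_op_commute: "frac_op a u v = frac_op a v u" by(simp add: frac_op_eq mult.commute)

lemma frac_op_lincomb_right:
 assumes "u \<in> frac_sobolev a" "v \<in> frac_sobolev a" "w \<in> frac_sobolev a"
 shows "frac_op a u (%x. b * v x + c * w x) = b * frac_op a u v + c * frac_op a u w" proof -
 have i: "integrable lborel2 (%p. frac_diff a u p * frac_diff a v p)"
  "integrable lborel2 (%p. frac_diff a u p * frac_diff a w p)" using assms by(auto simp: frac_sobolev_iff intro: L2_mult_integrable)
 have "(%p. frac_diff a u p * frac_diff a (%x. b * v x + c * w x) p) =
   (%p. b * (frac_diff a u p * frac_diff a v p) + c * (frac_diff a u p * frac_diff a w p))" by(auto simp: frac_diff_lincomb fun_eq_iff algebra_simps)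
 thus ?thesis using i by(simp add: frac_op_eq algebra_simps)
qed

lemma frac_op_lincomb_left:
 assumes "u \<in> frac_sobolev a" "v \<in> frac_sobolev a" "w \<in> frac_sobolev a"
 shows "frac_op a (%x. b * v x + c * w x) u = b * frac_op a v u + c * frac_op a w u"
 using frac_op_lincomb_right[OF assms] by(simp add: frac_op_commute)

lemma frac_op_diff_right:
 assumes "u \<in> frac_sobolev a" "v \<in> frac_sobolev a" "w \<in> frac_sobolev a"
 shows "frac_op a u (%x. v x - w x) = frac_op a u v - frac_op a u w" using frac_op_lincomb_right[OF assms, of 1 "-1"] by simp

lemma frac_op_diff_left:
 assumes "u \<in> frac_sobolev a" "v \<in> frac_sobolev a" "w \<in> frac_sobolev a"
 shows "frac_op a (%x. v x - w x) u = frac_op a v u - frac_op a w u" using frac_op_lincomb_left[OF assms, of 1 "-1"] by simp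

lemma frac_op_add_right:
 assumes "u \<in> frac_sobolev a" "v \<in> frac_sobolev a" "w \<in> frac_sobolev a"
 shows "frac_op a u (%x. v x + w x) = frac_op a u v + frac_op a u w" using frac_op_lincomb_right[OF assms, of 1 1] by simp

lemma X0_norm_square:
 fixes v :: "'a::euclidean_space => real"
 assumes "0 < a" "a < 1"
 shows "(X0_norm a v)^2 = frac_op a v v" proof -
 have "0 <= frac_const DIM('a) a / 2 * (LINT p|lborel2. (frac_diff a v p)^2)"
  using frac_const_pos[OF assms, where 'a='a] by(intro mult_nonneg_nonneg integral_nonneg_AE) auto
 thus ?thesis by(simp add: X0_norm_eq frac_op_eq power2_eq_square)
qed

lemma X0_norm_square_eq:
 fixes v :: "'a::euclidean_space => real"
 assumes "0 < a" "a < 1"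
 shows "(X0_norm a v)^2 = frac_const DIM('a) a / 2 * (LINT p|lborel2. (frac_diff a v p)^2)"
 unfolding X0_norm_square[OF assms] by(simp add: frac_op_eq power2_eq_square)

lemma X0_norm_ge0: 
 fixes v :: "'a::euclidean_space => real"
 assumes "0 < a" "a < 1" shows "0 <= X0_norm a v" unfolding X0_norm_eq using frac_const_pos[OF assms, where 'a='a]
 by(intro real_sqrt_ge_zero mult_nonneg_nonneg integral_nonneg_AE) auto

lemma frac_op_CS:
 fixes u v :: "'a::euclidean_space => real"
 assumes a: "0 < a" "a < 1" and u: "u \<in> frac_sobolev a" and v: "v \<in> frac_sobolev a"
 shows "abs (frac_op a u v) <= X0_norm a u * X0_norm a v" proof -
 let ?c = "frac_const DIM('a) a / 2" and ?M = "lborel2 :: ('a \<times> 'a) measure"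
 have c: "?c > 0" using frac_const_pos[OF a, where 'a='a] by simp
 have "abs (frac_op a u v) = ?c * abs (LINT p|?M. frac_diff a u p * frac_diff a v p)" using c by(simp add: frac_op_eq abs_mult)
 also have "... <= ?c * (sqrt (LINT p|?M. (frac_diff a u p)^2) * sqrt (LINT p|?M. (frac_diff a v p)^2))"
  using u v c by(intro mult_left_mono integral_CS) (auto simp: frac_sobolev_iff)
 also have "... = (sqrt ?c * sqrt (LINT p|?M. (frac_diff a u p)^2)) * (sqrt ?c * sqrt (LINT p|?M. (frac_diff a v p)^2))" proof -
  have "sqrt ?c * sqrt ?c = ?c" using c by(intro real_sqrt_mult_self[THEN trans]) simp
  moreover have "x * (A * B) = (r * A) * (r * B)" if "r * r = x" for r x A B :: real using that by(auto simp: mult_ac)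
  ultimately show ?thesis by blast
 qed
 also have "... = X0_norm a u * X0_norm a v" unfolding X0_norm_eq real_sqrt_mult ..
 finally show ?thesis .
qed

lemma X0_norm_lincomb:
 assumes a: "0 < a" "a < 1" and u: "u \<in> frac_sobolev a" and v: "v \<in> frac_sobolev a"
 shows "X0_norm a (%x. b * u x + c * v x) <= abs b * X0_norm a u + abs c * X0_norm a v" proof(rule power2_le_imp_le)
 have "(X0_norm a (%x. b * u x + c * v x))^2 = b^2 * frac_op a u u + 2 * b * c * frac_op a u v + c^2 * frac_op a v v"
  unfolding X0_norm_square[OF a] using u v by(simp add: frac_op_lincomb_left frac_op_lincomb_right frac_sobolev_lincomb
    frac_op_commute[of a v u] power2_eq_square algebra_simps)
 also have "... <= (abs b)^2 * (X0_norm a u)^2 + 2 * abs b * abs c * (X0_norm a u * X0_norm a v) + (abs c)^2 * (X0_norm a v)^2" proof -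
  have "2 * b * c * frac_op a u v <= abs (2 * b * c * frac_op a u v)" by simp
  also have "... = 2 * abs b * abs c * abs (frac_op a u v)" by(simp add: abs_mult)
  also have "... <= 2 * abs b * abs c * (X0_norm a u * X0_norm a v)" by(intro mult_left_mono frac_op_CS a u v) auto
  finally show ?thesis by(simp add: X0_norm_square[OF a])
 qed
 also have "... = (abs b * X0_norm a u + abs c * X0_norm a v)^2" by(simp add: power2_eq_square algebra_simps)
 finally show "(X0_norm a (%x. b * u x + c * v x))^2 <= (abs b * X0_norm a u + abs c * X0_norm a v)^2" .
 show "0 <= abs b * X0_norm a u + abs c * X0_norm a v" using X0_norm_ge0[OF a, where 'a='a] by simp
qed

lemma X0_norm_diff_le:
 assumes a: "0 < a" "a < 1" and u: "u \<in> frac_sobolev a" and v: "v \<in> frac_sobolev a"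
 shows "X0_norm a (%x. u x - v x) <= X0_norm a u + X0_norm a v" using X0_norm_lincomb[OF assms, of 1 "-1"] by simp

lemma X0_norm_add_le:
 assumes a: "0 < a" "a < 1" and u: "u \<in> frac_sobolev a" and v: "v \<in> frac_sobolev a"
 shows "X0_norm a (%x. u x + v x) <= X0_norm a u + X0_norm a v" using X0_norm_lincomb[OF assms, of 1 1] by simp

lemma X0_norm_minus_commute: "X0_norm a (%x. u x - v x) = X0_norm a (%x. v x - u x)" proof -
 have "frac_diff a (%x. u x - v x) p = - frac_diff a (%x. v x - u x) p" for p by(cases p) (simp add: frac_diff_def minus_divide_left)
 thus ?thesis by(simp add: X0_norm_eq)
qed

lemma X0D:
 assumes "v \<in> X0 a Omega"
 shows "v \<in> frac_sobolev a" "AE x in lborel. x \<notin> Omega --> v x = 0" "v \<in> borel_measurable lborel"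
  "L2_fun lborel v" "integrable lborel (%x. (v x)^2)" using assms by(auto simp: X0_def frac_sobolev_iff L2_fun_def)

lemma X0_lincomb:
 assumes "u \<in> X0 a Omega" "v \<in> X0 a Omega"
 shows "(%x. b * u x + c * v x) \<in> X0 a Omega" proof -
 have "AE x in lborel. x \<notin> Omega --> b * u x + c * v x = 0" using X0D(2)[OF assms(1)] X0D(2)[OF assms(2)] by eventually_elim auto
 thus ?thesis using assms by(auto simp: X0_def intro: frac_sobolev_lincomb)
qed

lemma X0_diff: "u \<in> X0 a Omega ==> v \<in> X0 a Omega ==> (%x. u x - v x) \<in> X0 a Omega" using X0_lincomb[of u a Omega v 1 "-1"] by simp

lemma X0_add: "u \<in> X0 a Omega ==> v \<in> X0 a Omega ==> (%x. u x + v x) \<in> X0 a Omega" using X0_lincomb[of u a Omega v 1 1] by simp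

lemma X0_uminus: "u \<in> X0 a Omega ==> (%x. - u x) \<in> X0 a Omega" using X0_lincomb[of u a Omega u "-1" 0] by simp

lemma X0_scale: "u \<in> X0 a Omega ==> (%x. c * u x) \<in> X0 a Omega" using X0_lincomb[of u a Omega u c 0] by simp

lemma zero_in_X0: "(%x. 0) \<in> X0 a Omega" by(auto simp: X0_def frac_sobolev_iff L2_fun_def frac_diff_def case_prod_beta)

text \<open>The exceptional pairs lie in the strips \<open>N \<times> UNIV\<close> and
  \<open>UNIV \<times> N\<close>, which are null sets of the product.\<close>

lemma AE_lborel_pair:
 assumes "AE x in (lborel :: 'a::euclidean_space measure). P x"
 shows "AE p in (lborel2 :: ('a \<times> 'a) measure). P (fst p) & P (snd p)" proof -
 obtain N where N: "{x. \<not> P x} \<subseteq> N" "emeasure lborel N = 0" "N \<in> sets lborel" using assms by(auto elim!: AE_E)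
 have n1: "N \<times> UNIV \<in> null_sets (lborel2 :: ('a \<times> 'a) measure)"
  using N by(auto simp: null_sets_def lborel.emeasure_pair_measure_Times simp del: sets_lborel
    intro!: pair_measureI)
 have n2: "UNIV \<times> N \<in> null_sets (lborel2 :: ('a \<times> 'a) measure)"
  using N by(auto simp: null_sets_def lborel.emeasure_pair_measure_Times simp del: sets_lborel
    intro!: pair_measureI)
 show ?thesis by(rule AE_I'[OF null_sets.Un[OF n1 n2]]) (use N(1) in auto)
qed

lemma frac_diff_cong_AE:
 assumes "AE x in lborel. u x = v x"
 shows "AE p in lborel2. frac_diff a u p = frac_diff a v p" using AE_lborel_pair[OF assms] by eventually_elim (auto simp: frac_diff_def)

text \<open>There are two dominating functions because the test function for the oscillation is
  built from \<open>u\<close> and a cutoff, and its increments are bounded only by the sum of the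
  increments of both.\<close>

lemma frac_sobolev_contraction:
 assumes u: "u \<in> frac_sobolev a" and w: "w \<in> frac_sobolev a" and v: "v \<in> borel_measurable lborel"
  and le: "!!x. abs (v x) <= abs (u x) + abs (w x)" and diff: "!!x y. abs (v x - v y) <= abs (u x - u y) + abs (w x - w y)"
 shows "v \<in> frac_sobolev a" proof -
 have sq: "L2_fun M (%x. abs (f x) + abs (g x))" if "L2_fun M f" "L2_fun M g"
  for M and f g :: "'c => real" proof -
  have "L2_fun M (%x. abs (f x))" "L2_fun M (%x. abs (g x))" using that by(auto simp: L2_fun_def)
  from L2_lincomb[OF this, of 1 1] show ?thesis by simp
 qed
 have "L2_fun lborel v" by(rule L2_dominated[OF sq[of _ u w] v]) (use u w le in \<open>auto simp: frac_sobolev_iff\<close>)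
 moreover have "L2_fun lborel2 (frac_diff a v)" proof(rule L2_dominated[OF sq[of _ "frac_diff a u" "frac_diff a w"]])
  show "AE p in lborel2. abs (frac_diff a v p) <= abs (abs (frac_diff a u p) + abs (frac_diff a w p))"
   using diff by(auto simp: frac_diff_def abs_mult add_divide_distrib[symmetric] divide_right_mono)
 qed (use u w v in \<open>auto simp: frac_sobolev_iff\<close>)
 ultimately show ?thesis by(simp add: frac_sobolev_iff)
qed

lemma frac_sobolev_Lipschitz_comp:
 assumes u: "u \<in> frac_sobolev a" and G0: "G 0 = 0" and G: "!!r t. abs (G r - G t) <= L * abs (r - t)"
 shows "(%x. G (u x)) \<in> frac_sobolev a" proof -
 have L: "L >= 0" using G[of 1 0] by simp
 have "continuous_on UNIV G" by(rule lipschitz_on_continuous_on[of L]) (use G L in \<open>auto simp: lipschitz_on_def dist_real_def\<close>)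
 hence [measurable]: "G \<in> borel_measurable borel" by(rule borel_measurable_continuous_onI)
 have [measurable]: "u \<in> borel_measurable lborel" using u by(simp add: frac_sobolev_def)
 show ?thesis proof(rule frac_sobolev_contraction[of "%x. L * u x + 0 * u x" a "%x. L * u x + 0 * u x"])
  show "(%x. L * u x + 0 * u x) \<in> frac_sobolev a" "(%x. L * u x + 0 * u x) \<in> frac_sobolev a" by(rule frac_sobolev_lincomb[OF u u])+
  show "abs (G (u x)) <= abs (L * u x + 0 * u x) + abs (L * u x + 0 * u x)" for x using G[of "u x" 0] G0 L by(simp add: abs_mult)
  show "abs (G (u x) - G (u y)) <= abs (L * u x + 0 * u x - (L * u y + 0 * u y)) + abs (L * u x + 0 * u x - (L * u y + 0 * u y))" for x y
   using G[of "u x" "u y"] L by(simp add: abs_mult flip: right_diff_distrib)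
 qed auto
qed

lemma X0_Lipschitz_comp:
 assumes u: "u \<in> X0 a Omega" and G0: "G 0 = 0" and G: "!!r t. abs (G r - G t) <= L * abs (r - t)"
 shows "(%x. G (u x)) \<in> X0 a Omega" proof -
 have "AE x in lborel. x \<notin> Omega --> G (u x) = 0" using X0D(2)[OF u] by eventually_elim (use G0 in auto)
 moreover have "(%x. G (u x)) \<in> frac_sobolev a" by(rule frac_sobolev_Lipschitz_comp[OF X0D(1)[OF u] G0 G])
 ultimately show ?thesis by(simp add: X0_def)
qed

text \<open>Through it, energy inequalities for test functions that are functions of
  \<open>u\<close> reduce to inequalities between real numbers.\<close>

lemma frac_op_mono_pointwise:
 fixes u v w z :: "'a::euclidean_space => real"
 assumes a: "0 < a" "a < 1" and m: "u \<in> frac_sobolev a" "v \<in> frac_sobolev a" "w \<in> frac_sobolev a" "z \<in> frac_sobolev a"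
  and le: "!!x y. (u x - u y) * (v x - v y) <= (w x - w y) * (z x - z y)"
 shows "frac_op a u v <= frac_op a w z" unfolding frac_op_eq proof(intro mult_left_mono integral_mono)
 show "frac_diff a u p * frac_diff a v p <= frac_diff a w p * frac_diff a z p" for p
  using le by(cases p) (auto simp: frac_diff_mult divide_right_mono)
 show "0 <= frac_const DIM('a) a / 2" using frac_const_pos[OF a, where 'a='a] by simp
qed (use m in \<open>auto simp: frac_sobolev_iff intro: L2_mult_integrable\<close>)

text \<open>Almost everywhere convergence passes to the difference quotients on pairs, so Fatou
  applies to the function and to its quotients. The separate L^2 bound \<open>K2\<close> keeps the
  lemma independent of a domain.\<close>

lemma X0_Fatou:
 fixes v :: "nat => 'a::euclidean_space => real"
 assumes a: "0 < a" "a < 1" and v: "!!n. v n \<in> frac_sobolev a" and bd2: "!!n. (L2sq (v n)) <= K2" and bd: "!!n. X0_norm a (v n) <= K"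
  and lim: "AE x in lborel. (%n. v n x) ----> V x" and V: "V \<in> borel_measurable lborel"
 shows "V \<in> frac_sobolev a" "X0_norm a V <= K" proof -
 let ?c = "frac_const DIM('a) a / 2"
 have c: "?c > 0" using frac_const_pos[OF a, where 'a='a] by simp
 have K: "0 <= K" using bd[of 0] X0_norm_ge0[OF a, of "v 0"] by simp
 have "L2_fun lborel V" by(rule L2_Fatou[OF _ bd2 lim V]) (use v in \<open>auto simp: frac_sobolev_iff\<close>)
 moreover
 have s: "L2_fun lborel2 (frac_diff a (v n))" for n using v by(simp add: frac_sobolev_iff)
 have b: "(LINT p|lborel2. (frac_diff a (v n) p)^2) <= K^2 / ?c" for n proof -
  have "?c * (LINT p|lborel2. (frac_diff a (v n) p)^2) = (X0_norm a (v n))^2" by(simp add: X0_norm_square_eq[OF a])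
  also have "... <= K^2" using bd X0_norm_ge0[OF a] by(intro power_mono) auto
  finally show ?thesis using c by(simp add: field_simps)
 qed
 have l: "AE p in lborel2. (%n. frac_diff a (v n) p) ----> frac_diff a V p" using AE_lborel_pair[OF lim] proof eventually_elim
  case (elim p) show ?case proof(cases "fst p = snd p")
   case True thus ?thesis by(cases p) (auto simp: frac_diff_def)
  next case False with elim show ?thesis by(cases p) (auto simp: frac_diff_def intro!: tendsto_divide tendsto_diff)
  qed qed
 note F = L2_Fatou[OF s b l frac_diff_measurable[OF V]]
 ultimately show "V \<in> frac_sobolev a" using F by(simp add: frac_sobolev_iff)
 have "?c * (LINT p|lborel2. (frac_diff a V p)^2) <= K^2" using F(2) c by(simp add: field_simps)
 thus "X0_norm a V <= K" using K by(simp add: X0_norm_eq real_le_lsqrt)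
qed

section \<open>Poincare inequality, completeness and Riesz representation\<close>

text \<open>A unit ball \<open>S\<close> outside the domain, on which \<open>v\<close> vanishes, is
  compared with the points of the domain: their distances are at most \<open>2 R + 2\<close>, so the
  kernel between them is at least \<open>1 / D\<close>, and the energy controls \<open>v^2\<close>
  integrated against \<open>S\<close>.\<close>

lemma X0_Poincare:
 fixes Omega :: "'a::euclidean_space set"
 assumes a: "0 < a" "a < 1" and bd: "bounded Omega"
 shows "\<exists>C>0. \<forall>v\<in>X0 a Omega. (L2sq v) <= C * (X0_norm a v)^2" proof -
 let ?c = "frac_const DIM('a) a / 2" and ?p = "real DIM('a) + 2 * a"
 have c: "?c > 0" using frac_const_pos[OF a, where 'a='a] by simp
 obtain R where R: "R > 0" "Omega \<subseteq> ball 0 R" using bd by(metis bounded_subset_ballD)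
 obtain e :: 'a where e: "norm e = 1" using SOME_Basis norm_Basis by blast
 define S where "S = ball ((R + 1) *\<^sub>R e) 1"
 have S: "S \<inter> Omega = {}"  proof -
  have "R < norm y" if "y \<in> S" for y proof -
   have "norm ((R + 1) *\<^sub>R e) <= norm y + norm ((R+1) *\<^sub>R e - y)" using norm_triangle_ineq[of y "(R+1) *\<^sub>R e - y"] by simp
   moreover have "norm ((R+1) *\<^sub>R e - y) < 1" using that by(simp add: S_def dist_norm)
   ultimately show ?thesis using e R by simp
  qed
  thus ?thesis using R by(fastforce simp: subset_eq)
 qed
 have mS: "measure lborel S > 0" "S \<in> sets borel" "emeasure lborel S < \<infinity>"
  unfolding S_def using content_ball_pos[of 1] emeasure_bounded_finite[OF bounded_ball] by auto
 define D where "D = (2 * R + 2) powr ?p"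
 have D: "D > 0" using R by(simp add: D_def)
 have dist: "norm (x - y) powr ?p <= D" if "x \<in> Omega" "y \<in> S" for x y proof -
  have "norm x <= R" using R that by(auto simp: subset_eq less_imp_le)
  moreover have "norm y <= norm ((R+1) *\<^sub>R e) + norm (y - (R+1) *\<^sub>R e)"
   using norm_triangle_ineq[of "(R+1) *\<^sub>R e" "y - (R+1) *\<^sub>R e"] by simp
  moreover have "norm (y - (R+1) *\<^sub>R e) < 1" using that by(simp add: S_def dist_norm norm_minus_commute)
  ultimately have "norm (x - y) <= 2 * R + 2" using e R norm_triangle_ineq4[of x y] by simp
  thus ?thesis unfolding D_def using a by(intro powr_mono2) auto
 qed
 show ?thesis proof(intro exI[of _ "D / (measure lborel S * ?c)"] conjI ballI)
  show "0 < D / (measure lborel S * ?c)" using D mS c by simp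
  fix v assume v: "v \<in> X0 a Omega"
  note [measurable] = X0D(3)[OF v]
  have iS: "integrable lborel (%y. indicator S y / D :: real)" using mS by(simp add: integrable_indicator_iff)
  have ip: "integrable lborel2 (%p. (v (fst p))^2 * (indicator S (snd p) / D))"
   using integrable_fst_times_snd[OF lborel.sigma_finite_measure_axioms lborel.sigma_finite_measure_axioms X0D(5)[OF v] iS] by simp
  have "(LINT p|lborel2. (v (fst p))^2 * (indicator S (snd p) / D)) <= (LINT p|lborel2. (frac_diff a v p)^2)" proof(rule integral_mono_AE[OF ip])
   show "integrable lborel2 (%p. (frac_diff a v p)^2)" using X0D(1)[OF v] by(simp add: frac_sobolev_iff L2_fun_def)
   show "AE p in lborel2. (v (fst p))^2 * (indicator S (snd p) / D) <= (frac_diff a v p)^2" using AE_lborel_pair[OF X0D(2)[OF v]]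
   proof eventually_elim
    case (elim p) obtain x y where p: "p = (x, y)" by(cases p)
    show ?case proof(cases "v x ~= 0 & y \<in> S")
     case True hence xy: "x \<in> Omega" "y \<notin> Omega" "v y = 0" using elim S p by auto
     hence "norm (x - y) powr ?p > 0" by auto
     hence "(v x)^2 / D <= (v x)^2 / norm (x - y) powr ?p" using dist[of x y] xy True D by(intro divide_left_mono) auto
     thus ?thesis using True xy p by(simp add: frac_diff_mult power2_eq_square)
    qed (auto simp: p)
   qed qed
  moreover have "(LINT p|lborel2. (v (fst p))^2 * (indicator S (snd p) / D)) = (L2sq v) * (measure lborel S / D)" proof -
   have "(LINT p|lborel2. (v (fst p))^2 * (indicator S (snd p) / D)) =
     (LBINT x. LBINT y. (v x)^2 * (indicator S y / D))" by(subst lborel_pair.integral_fst'[OF ip, symmetric]) simp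
   also have "... = (LBINT x. (v x)^2 * (measure lborel S / D))" using mS by(intro L1_integral_cong refl) auto
   finally show ?thesis by simp
  qed
  ultimately have le: "(L2sq v) * (measure lborel S / D) <= (LINT p|lborel2. (frac_diff a v p)^2)" by(simp only:)
  have eq: "?c * (LINT p|lborel2. (frac_diff a v p)^2) = (X0_norm a v)^2" by(simp add: X0_norm_square_eq[OF a])
  have "V <= d / (m * k) * X" if "V * (m / d) <= L" "k * L = X" "m > 0" "k > 0" "d > 0"
   for V m d L k X :: real using that by(auto simp: field_simps)
  note ar = this
  show "(L2sq v) <= D / (measure lborel S * ?c) * (X0_norm a v)^2" by(rule ar[OF le eq mS(1) c D])
 qed qed

text \<open>The almost everywhere convergent subsequence is part of the conclusion because vanishing
  outside the domain and the energy bounds pass to the limit along it.\<close>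

lemma L2_complete:
 fixes f :: "nat => 'b => real"
 assumes f: "!!n. L2_fun M (f n)" and Cauchy: "!!e. e > 0 ==> \<exists>N. \<forall>m\<ge>N. \<forall>n\<ge>N. (LINT x|M. (f m x - f n x)^2) <= e"
 obtains F r where "L2_fun M F" "(%n. LINT x|M. (f n x - F x)^2) ----> 0"
  "\<forall>k::nat. r k >= k" "AE x in M. (%k. f (r k) x) ----> F x" proof -
 have "\<forall>k::nat. \<exists>N. \<forall>m\<ge>N. \<forall>n\<ge>N. (LINT x|M. (f m x - f n x)^2) <= (1/4) ^ k" using Cauchy by auto
 then obtain N where N: "!!k m n. m >= N k ==> n >= N k ==> (LINT x|M. (f m x - f n x)^2) <= (1/4) ^ k" by metis
 \<comment> \<open>Summing the thresholds makes \<open>r\<close> monotone and at least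
   \<open>N i\<close> for every \<open>i <= k\<close>.\<close>
 define r where "r k = k + (\<Sum>i\<le>k. N i)" for k
 have rN': "N i <= r k" if "i <= k" for i k proof -
  have "N i <= (\<Sum>i\<le>k. N i)" using that by(intro member_le_sum) auto
  thus ?thesis by(simp add: r_def)
 qed
 have rN: "r k >= N k" for k by(rule rN') simp
 have rS: "r (Suc k) >= r k" for k unfolding r_def by simp
 have rk: "r k >= k" for k by(simp add: r_def)
 have fast: "(LINT x|M. (f (r (Suc k)) x - f (r k) x)^2) <= (1/4) ^ k" for k by(rule N) (use rN[of k] rS[of k] in linarith)+
 have conv: "AE x in M. convergent (%k. f (r k) x)" by(rule L2_fast_Cauchy_converges[OF _ fast]) (rule f)
 have [measurable]: "f n \<in> borel_measurable M" for n using f by(simp add: L2_fun_def)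
 define F where "F x = lim (%k. f (r k) x)" for x
 have F[measurable]: "F \<in> borel_measurable M" unfolding F_def by measurable
 have lim: "AE x in M. (%k. f (r k) x) ----> F x" using conv by eventually_elim (simp add: F_def convergent_LIMSEQ_iff)
 have sub: "L2_fun M (%x. f m x - f n x)" for m n using L2_lincomb[OF f[of m] f[of n], of 1 "-1"] by simp
 \<comment> \<open>Fatou is applied to the differences from a fixed member \<open>f n\<close>, with
   the subsequence started late enough for the Cauchy bound.\<close>
 have key: "L2_fun M (%x. f n x - F x)" "(LINT x|M. (f n x - F x)^2) <= e"
  if e: "!!k. k >= K ==> (LINT x|M. (f n x - f (r k) x)^2) <= e" for n K e proof -
  have l: "AE x in M. (%k. f n x - f (r (k + K)) x) ----> f n x - F x"
   using lim by eventually_elim (intro tendsto_diff tendsto_const LIMSEQ_ignore_initial_segment)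
  note F = L2_Fatou[OF sub e l]
  show "L2_fun M (%x. f n x - F x)" by(rule F(1)) simp_all
  show "(LINT x|M. (f n x - F x)^2) <= e" by(rule F(2)) simp_all
 qed
 show ?thesis proof(rule that)
  have "L2_fun M (%x. f (N 0) x - F x)" by(rule key(1)[of 0 _ "(1/4)^0"], rule N) (simp_all add: rN')
  hence "L2_fun M (%x. 1 * f (N 0) x + (-1) * (f (N 0) x - F x))" by(intro L2_lincomb f)
  thus "L2_fun M F" by simp
  show "(%n. LINT x|M. (f n x - F x)^2) ----> 0" proof(rule LIMSEQ_I)
   fix e :: real assume "e > 0"
   then obtain K where K: "!!m n. m >= K ==> n >= K ==> (LINT x|M. (f m x - f n x)^2) <= e / 2" using Cauchy[of "e/2"] by auto
   have "norm ((LINT x|M. (f n x - F x)^2) - 0) < e" if n: "n >= K" for n proof -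
    have "(LINT x|M. (f n x - F x)^2) <= e / 2" by(rule key(2)[of K], rule K[OF n]) (rule order_trans[OF _ rk])
    moreover have "0 <= (LINT x|M. (f n x - F x)^2)" by(rule integral_nonneg_AE) simp
    ultimately show ?thesis using \<open>e > 0\<close> by simp
   qed
   thus "\<exists>no. \<forall>n\<ge>no. norm ((LINT x|M. (f n x - F x)^2) - 0) < e" by blast
  qed
 qed (use rk lim in auto)
qed

text \<open>By the Poincare inequality an energy Cauchy sequence is Cauchy in L^2, which supplies
  the candidate for the limit; Fatou applied to \<open>v n - v (r k)\<close> then upgrades the
  convergence to the energy norm.\<close>

lemma X0_complete:
 fixes v :: "nat => 'a::euclidean_space => real"
 assumes a: "0 < a" "a < 1" and bd: "bounded Omega" and v: "!!n. v n \<in> X0 a Omega"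
  and Cauchy: "!!e. e > 0 ==> \<exists>N. \<forall>m\<ge>N. \<forall>n\<ge>N. X0_norm a (%x. v m x - v n x) <= e"
 obtains V where "V \<in> X0 a Omega" "(%n. X0_norm a (%x. v n x - V x)) ----> 0" proof -
 obtain C where C: "C > 0" "!!v. v \<in> X0 a Omega ==> (L2sq v) <= C * (X0_norm a v)^2" using X0_Poincare[OF a bd] by blast
 have L2: "(LBINT x. (v m x - v n x)^2) <= C * (X0_norm a (%x. v m x - v n x))^2" for m n by(rule C(2)) (intro X0_diff v)
 have "\<exists>N. \<forall>m\<ge>N. \<forall>n\<ge>N. (LBINT x. (v m x - v n x)^2) <= e" if "e > 0" for e proof -
  have "sqrt (e / C) > 0" using that C by simp
  from Cauchy[OF this] obtain N where N: "!!m n. m >= N ==> n >= N ==> X0_norm a (%x. v m x - v n x) <= sqrt (e / C)" by blast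
  have "(LBINT x. (v m x - v n x)^2) <= e" if "m >= N" "n >= N" for m n proof -
   have "(X0_norm a (%x. v m x - v n x))^2 <= (sqrt (e / C))^2" by(intro power_mono N that X0_norm_ge0 a)
   hence "C * (X0_norm a (%x. v m x - v n x))^2 <= e" using C \<open>e > 0\<close> by(simp add: field_simps)
   thus ?thesis using L2[of m n] by linarith
  qed
  thus ?thesis by blast
 qed
 note L2C = this
 obtain F r where
  F: "L2_fun lborel F" "(%n. LBINT x. (v n x - F x)^2) ----> 0"
  "\<forall>k::nat. r k >= k" "AE x in lborel. (%k. v (r k) x) ----> F x" by(rule L2_complete[OF X0D(4)[OF v] L2C])
 have mF: "F \<in> borel_measurable lborel" using F(1) by(simp add: L2_fun_def)
 have F0: "AE x in lborel. x \<notin> Omega --> F x = 0" proof -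
  have "AE x in lborel. \<forall>n. x \<notin> Omega --> v n x = 0" unfolding AE_all_countable using X0D(2)[OF v] by blast
  with F(4) show ?thesis proof eventually_elim
   case (elim x) thus ?case using LIMSEQ_unique[of "%k. v (r k) x" "F x" 0] by auto
  qed qed
 have key: "(%x. v n x - F x) \<in> frac_sobolev a" "X0_norm a (%x. v n x - F x) <= e"
  if N: "!!m n. m >= N ==> n >= N ==> X0_norm a (%x. v m x - v n x) <= e" and n: "n >= N" for n N e proof -
  have l: "AE x in lborel. (%k. v n x - v (r (k + N)) x) ----> v n x - F x"
   using F(4) by eventually_elim (intro tendsto_diff tendsto_const LIMSEQ_ignore_initial_segment)
  have rN: "r (k + N) >= N" for k using F(3) le_trans[of N "k + N" "r (k + N)"] by simp
  have b: "X0_norm a (%x. v n x - v (r (k + N)) x) <= e" for k by(rule N[OF n rN])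
  have b2: "(LBINT x. (v n x - v (r (k + N)) x)^2) <= C * e^2" for k proof -
   have "C * (X0_norm a (%x. v n x - v (r (k + N)) x))^2 <= C * e^2" using b C by(intro mult_left_mono power_mono X0_norm_ge0 a) auto
   thus ?thesis using L2[of n "r (k + N)"] by linarith
  qed
  have s: "(%x. v n x - v (r (k + N)) x) \<in> frac_sobolev a" for k by(rule X0D(1)[OF X0_diff[OF v v]])
  have m: "(%x. v n x - F x) \<in> borel_measurable lborel" using mF X0D(3)[OF v[of n]] by simp
  show "(%x. v n x - F x) \<in> frac_sobolev a" "X0_norm a (%x. v n x - F x) <= e" by(rule X0_Fatou[OF a s b2 b l m])+
 qed
 show ?thesis proof(rule that)
  obtain N where "!!m n. m >= N ==> n >= N ==> X0_norm a (%x. v m x - v n x) <= 1" using Cauchy[of 1] by auto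
  from key(1)[OF this order_refl] have "(%x. 1 * v N x + (- 1) * (v N x - F x)) \<in> frac_sobolev a" by(intro frac_sobolev_lincomb X0D(1)[OF v])
  thus "F \<in> X0 a Omega" using F0 by(simp add: X0_def)
  show "(%n. X0_norm a (%x. v n x - F x)) ----> 0" proof(rule LIMSEQ_I)
   fix e :: real assume e: "e > 0"
   then obtain N where N: "!!m n. m >= N ==> n >= N ==> X0_norm a (%x. v m x - v n x) <= e / 2" using Cauchy[of "e/2"] by auto
   have "norm (X0_norm a (%x. v n x - F x) - 0) < e" if "n >= N" for n using key(2)[OF N that] e X0_norm_ge0[OF a, of "%x. v n x - F x"] by simp
   thus "\<exists>no. \<forall>n\<ge>no. norm (X0_norm a (%x. v n x - F x) - 0) < e" by blast
  qed qed qed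

text \<open>Minimise \<open>E(v, v) - 2 l v\<close>: by the parallelogram law minimising sequences are Cauchy.\<close>
lemma X0_Riesz:
 fixes Omega :: "'a::euclidean_space set"
 assumes a: "0 < a" "a < 1" and bd: "bounded Omega"
  and lin: "!!v w b c. v \<in> X0 a Omega ==> w \<in> X0 a Omega ==> l (%x. b * v x + c * w x) = b * l v + c * l w"
  and bound: "!!v. v \<in> X0 a Omega ==> abs (l v) <= K * X0_norm a v"
 obtains z where "z \<in> X0 a Omega" "!!v. v \<in> X0 a Omega ==> frac_op a z v = l v" proof -
 define J where "J v = (X0_norm a v)^2 - 2 * l v" for v
 have Jlow: "J v >= - (K^2)" if "v \<in> X0 a Omega" for v proof -
  have "J v >= (X0_norm a v)^2 - 2 * (K * X0_norm a v)" using bound[OF that] by(simp add: J_def)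
  moreover have "0 <= (X0_norm a v - K)^2" by simp
  ultimately show ?thesis by(simp add: power2_diff algebra_simps)
 qed
 define m where "m = (INF v\<in>X0 a Omega. J v)"
 have bdd: "bdd_below (J ` X0 a Omega)" using Jlow by(intro bdd_belowI2) auto
 have mJ: "m <= J v" if "v \<in> X0 a Omega" for v unfolding m_def by(rule cINF_lower[OF bdd that])
 have "\<exists>v\<in>X0 a Omega. J v < m + 1 / real (Suc n)" for n proof -
  have "(INF v\<in>X0 a Omega. J v) < m + 1 / real (Suc n)" by(simp add: m_def)
  thus ?thesis using bdd zero_in_X0[of a Omega] by(subst (asm) cINF_less_iff) auto
 qed
 then obtain v where v: "!!n. v n \<in> X0 a Omega" "!!n. J (v n) < m + 1 / real (Suc n)" by metis
 have expand: "(X0_norm a (%x. b * p x + c * q x))^2 = b^2 * (X0_norm a p)^2 + 2 * b * c * frac_op a p q + c^2 * (X0_norm a q)^2"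
  if "p \<in> X0 a Omega" "q \<in> X0 a Omega" for p q b c proof -
  have pq: "p \<in> frac_sobolev a" "q \<in> frac_sobolev a" using that by(auto dest: X0D)
  thus ?thesis unfolding X0_norm_square[OF a] by(simp add: frac_op_lincomb_left frac_op_lincomb_right frac_sobolev_lincomb
    frac_op_commute[of a q p] power2_eq_square algebra_simps)
 qed
 \<comment> \<open>The midpoint of \<open>v i\<close> and \<open>v j\<close> competes in the
   minimisation, so its value of \<open>J\<close> is at least \<open>m\<close>.\<close>
 have par: "(X0_norm a (%x. v i x - v j x))^2 <= 2 / real (Suc i) + 2 / real (Suc j)" for i j proof -
  have mid: "(%x. (1/2) * v i x + (1/2) * v j x) \<in> X0 a Omega" by(intro X0_lincomb v)
  have "l (%x. (1/2) * v i x + (1/2) * v j x) = (1/2) * l (v i) + (1/2) * l (v j)" by(intro lin v)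
  with mJ[OF mid] have "m <= (1/2)^2 * (X0_norm a (v i))^2 + 2 * (1/2) * (1/2) * frac_op a (v i) (v j) + (1/2)^2 * (X0_norm a (v j))^2
    - (l (v i) + l (v j))" unfolding J_def expand[OF v(1) v(1)] by simp
  moreover have "(X0_norm a (%x. v i x - v j x))^2 = (X0_norm a (v i))^2 - 2 * frac_op a (v i) (v j) + (X0_norm a (v j))^2"
   using expand[OF v(1)[of i] v(1)[of j], of 1 "-1"] by simp
  moreover have "(X0_norm a (v i))^2 - 2 * l (v i) < m + 1 / real (Suc i)" "(X0_norm a (v j))^2 - 2 * l (v j) < m + 1 / real (Suc j)"
   using v(2) by(auto simp: J_def)
  ultimately show ?thesis by(simp add: power2_eq_square)
 qed
 have "\<exists>N. \<forall>m\<ge>N. \<forall>n\<ge>N. X0_norm a (%x. v m x - v n x) <= e" if e: "e > 0" for e proof -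
  obtain N where N: "4 / e^2 < real N" using reals_Archimedean2 by blast
  have "X0_norm a (%x. v i x - v j x) <= e" if "i >= N" "j >= N" for i j proof -
   have **: "4 / e^2 < real (Suc k)" if "k >= N" for k using N that by(meson le_SucI less_le_trans of_nat_le_iff)
   have ar: "2 / r <= q / 2" if "4 / q < r" "q > 0" for r q :: real proof -
    have "r > 0" using that by(meson divide_pos_pos order.strict_trans zero_less_numeral)
    thus ?thesis using that by(simp add: field_simps)
   qed
   have *: "2 / real (Suc k) <= e^2 / 2" if "k >= N" for k by(rule ar[OF **[OF that]]) (use e in simp)
   have "(X0_norm a (%x. v i x - v j x))^2 <= e^2" using par[of i j] *[OF that(1)] *[OF that(2)] by linarith
   thus ?thesis by(rule power2_le_imp_le) (use e in simp)
  qed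
  thus ?thesis by blast
 qed
 note Cy = this
 obtain z where z: "z \<in> X0 a Omega" "(%n. X0_norm a (%x. v n x - z x)) ----> 0" by(rule X0_complete[OF a bd v(1) Cy])
 \<comment> \<open>\<open>J\<close> is continuous in the energy norm; the estimate makes this
   explicit in terms of the distance \<open>d n\<close> of \<open>v n\<close> from
   \<open>z\<close>.\<close>
 have Jz: "J z <= m" proof -
  define d where "d n = X0_norm a (%x. v n x - z x)" for n
  have "J z <= J (v n) + d n * (d n + 2 * X0_norm a z) + 2 * abs K * d n + (d n)^2" for n proof -
   have dX: "(%x. v n x - z x) \<in> X0 a Omega" by(intro X0_diff v z)
   have "l (%x. v n x - z x) = l (v n) - l z" using lin[OF v(1)[of n] z(1), of 1 "-1"] by simp
   moreover have "K * d n <= abs K * d n" unfolding d_def by(intro mult_right_mono X0_norm_ge0 a) simp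
   ultimately have 1: "l (v n) - l z <= abs K * d n" using bound[OF dX] unfolding d_def by linarith
   have e: "(X0_norm a (v n))^2 = (d n)^2 + 2 * frac_op a (%x. v n x - z x) z + (X0_norm a z)^2" using expand[OF dX z(1), of 1 1] by(simp add: d_def)
   have "abs (frac_op a (%x. v n x - z x) z) <= d n * X0_norm a z" unfolding d_def by(intro frac_op_CS a X0D(1)[OF dX] X0D(1)[OF z(1)])
   hence "(X0_norm a z)^2 <= (X0_norm a (v n))^2 + 2 * (d n * X0_norm a z)" using e zero_le_power2[of "d n"] unfolding abs_le_iff by linarith
   hence "J z <= J (v n) + 2 * (d n * X0_norm a z) + 2 * (abs K * d n)" unfolding J_def using 1 by linarith
   moreover have "0 <= d n * d n" "0 <= (d n)^2" by auto
   moreover have "d n * (d n + 2 * X0_norm a z) = d n * d n + 2 * (d n * X0_norm a z)" by(simp add: algebra_simps)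
   ultimately show ?thesis by linarith
  qed
  hence le: "J z <= m + 1 / real (Suc n) + d n * (d n + 2 * X0_norm a z) + 2 * abs K * d n + (d n)^2" for n
   using v(2)[of n] by(meson add_right_mono less_imp_le order_trans)
  have "(%n. m + 1 / real (Suc n) + d n * (d n + 2 * X0_norm a z) + 2 * abs K * d n + (d n)^2)
   ----> m + 0 + 0 * (0 + 2 * X0_norm a z) + 2 * abs K * 0 + 0^2" using z(2) unfolding d_def[symmetric]
   by(intro tendsto_intros LIMSEQ_inverse_real_of_nat[unfolded inverse_eq_divide])
  thus ?thesis using le by(intro LIMSEQ_le_const[where X="%n. m + 1 / real (Suc n) + d n * (d n + 2 * X0_norm a z) + 2 * abs K * d n + (d n)^2"]) auto
 qed
 show ?thesis proof(rule that[OF z(1)])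
  fix w assume w: "w \<in> X0 a Omega"
  define D where "D = frac_op a z w - l w"
  have q: "0 <= 2 * t * D + t^2 * (X0_norm a w)^2" for t proof -
   have "m <= J (%x. 1 * z x + t * w x)" by(intro mJ X0_lincomb z w)
   also have "... = J z + 2 * t * D + t^2 * (X0_norm a w)^2" unfolding J_def expand[OF z(1) w] lin[OF z(1) w] D_def by(simp add: algebra_simps)
   finally show ?thesis using Jz by simp
  qed
  have "D = 0" proof(cases "X0_norm a w = 0")
   case True thus ?thesis using q[of 1] q[of "-1"] by simp
  next case False define W where "W = (X0_norm a w)^2"
   have W: "W > 0" using False by(simp add: W_def)
   \<comment> \<open>\<open>- D / W\<close> minimises the quadratic polynomial in
     \<open>t\<close>.\<close>
   have "0 <= 2 * (- D / W) * D + (- D / W)^2 * W" using q[of "- D / W"] by(simp add: W_def)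
   also have "... = - (D^2 / W)" using W by(simp add: field_simps power2_eq_square)
   finally have "D^2 / W <= 0" by simp
   hence "D^2 <= 0" using W by(simp add: divide_le_0_iff)
   thus ?thesis by simp
  qed
  thus "frac_op a z w = l w" by(simp add: D_def)
 qed qed

section \<open>Integrals of powers of the norm\<close>

lemma lborel_affine_integral:
 fixes f :: "'a::euclidean_space => real"
 assumes c: "c ~= 0" and f[measurable]: "f \<in> borel_measurable borel"
 shows "integrable lborel (%x. f (t + c *\<^sub>R x)) \<longleftrightarrow> integrable lborel f"
  "abs c ^ DIM('a) * (LBINT x. f (t + c *\<^sub>R x)) = (LBINT x. f x)" proof -
 have eq: "lborel = density (distr lborel borel (%x::'a. t + c *\<^sub>R x)) (%_. ennreal (abs c^DIM('a)))"
  using lborel_affine[OF c, of t] by(simp add: ennreal_power)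
 have p: "abs c ^ DIM('a) ~= 0" using c by simp
 have "integrable lborel f \<longleftrightarrow> integrable (distr lborel borel (%x::'a. t + c *\<^sub>R x)) (%x. abs c^DIM('a) * f x)"
  by(subst eq, subst integrable_density) auto
 also have "... \<longleftrightarrow> integrable lborel (%x. abs c^DIM('a) * f (t + c *\<^sub>R x))" by(subst integrable_distr_eq) auto
 also have "... \<longleftrightarrow> integrable lborel (%x. f (t + c *\<^sub>R x))" using p by simp
 finally show "integrable lborel (%x. f (t + c *\<^sub>R x)) \<longleftrightarrow> integrable lborel f" by simp
 have "(LBINT x. f x) = (LINT x|distr lborel borel (%x::'a. t + c *\<^sub>R x). abs c^DIM('a) * f x)" by(subst eq, subst integral_density) auto
 also have "... = (LBINT x. abs c^DIM('a) * f (t + c *\<^sub>R x))" by(subst integral_distr) auto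
 finally show "abs c ^ DIM('a) * (LBINT x. f (t + c *\<^sub>R x)) = (LBINT x. f x)" by simp
qed

lemma lborel_reflect_integral:
 fixes f :: "'a::euclidean_space => real"
 assumes f: "f \<in> borel_measurable borel"
 shows "integrable lborel (%y. f (x - y)) \<longleftrightarrow> integrable lborel f"
  "(LBINT y. f (x - y)) = (LBINT y. f y)" using lborel_affine_integral[of "-1" f x] f by auto

lemma lborel_translate_integral:
 fixes f :: "'a::euclidean_space => real"
 assumes f: "f \<in> borel_measurable borel"
 shows "integrable lborel (%y. f (x + y)) \<longleftrightarrow> integrable lborel f"
  "(LBINT y. f (x + y)) = (LBINT y. f y)" using lborel_affine_integral[of 1 f x] f by auto

text \<open>A countable sum of multiples of indicators of balls dominates \<open>f\<close>. This
  takes the place of polar coordinates for powers of the norm.\<close>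

lemma integrable_dyadic:
 fixes f :: "'a::euclidean_space => real"
 assumes f[measurable]: "f \<in> borel_measurable borel" and nn: "!!z. 0 <= f z" and cov: "!!z. f z ~= 0 ==> \<exists>j. norm z < R j & f z <= c j"
  and c: "!!j::nat. 0 <= c j" and R: "!!j. 0 <= R j" and sm: "summable (%j. c j * R j ^ DIM('a))"
 shows "integrable lborel f" proof(rule integrableI_bounded)
 let ?V = "unit_ball_vol (real DIM('a))"
 have "(\<integral>\<^sup>+ z. ennreal (norm (f z)) \<partial>lborel) <= (\<integral>\<^sup>+ z. (\<Sum>j. ennreal (c j) * indicator (ball 0 (R j)) z) \<partial>(lborel :: 'a measure))"
 proof(rule nn_integral_mono)
  fix z :: 'a show "ennreal (norm (f z)) <= (\<Sum>j. ennreal (c j) * indicator (ball 0 (R j)) z)" proof(cases "f z = 0")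
   case False then obtain j where j: "norm z < R j" "f z <= c j" using cov by blast
   have g: "h n <= suminf h" for h :: "nat => ennreal" and n using sum_le_suminf[of h "{n}"] by simp
   have "ennreal (norm (f z)) <= ennreal (c j) * indicator (ball 0 (R j)) z" using j nn by(simp add: ennreal_leI)
   also have "... <= (\<Sum>j. ennreal (c j) * indicator (ball 0 (R j)) z)" by(rule g)
   finally show ?thesis .
  qed simp
 qed
 also have "... = (\<Sum>j. \<integral>\<^sup>+ z. ennreal (c j) * indicator (ball 0 (R j)) z \<partial>(lborel :: 'a measure))"
  by(intro nn_integral_suminf borel_measurable_times_ennreal borel_measurable_const borel_measurable_indicator) simp
 also have "... = (\<Sum>j. ennreal (c j * (?V * R j ^ DIM('a))))" proof(rule suminf_cong)
  fix j
  have "(\<integral>\<^sup>+ z. ennreal (c j) * indicator (ball 0 (R j)) z \<partial>(lborel :: 'a measure)) = ennreal (c j) * emeasure lborel (ball (0::'a) (R j))"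
   by(rule nn_integral_cmult_indicator) simp
  also have "... = ennreal (c j * (?V * R j ^ DIM('a)))" using R c by(simp add: emeasure_ball ennreal_mult)
  finally show "(\<integral>\<^sup>+ z. ennreal (c j) * indicator (ball 0 (R j)) z \<partial>(lborel :: 'a measure)) = ennreal (c j * (?V * R j ^ DIM('a)))" .
 qed
 also have "... = ennreal (\<Sum>j. c j * (?V * R j ^ DIM('a)))" proof(rule suminf_ennreal2)
  show "0 <= c j * (?V * R j ^ DIM('a))" for j using c R by simp
  show "summable (%j. c j * (?V * R j ^ DIM('a)))" using summable_mult[OF sm, of ?V] by(simp add: algebra_simps)
 qed
 also have "... < \<infinity>" by simp
 finally show "(\<integral>\<^sup>+ z. ennreal (norm (f z)) \<partial>lborel) < \<infinity>" .
qed simp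

lemma ex_dyadic:
 fixes t :: real
 assumes "t >= 1"
 obtains j :: nat where "2 powr real j <= t" "t < 2 powr (real j + 1)" proof -
 define k where "k = \<lfloor>log 2 t\<rfloor>"
 have "k >= 0" using assms by(simp add: k_def)
 moreover have "2 powr real_of_int k <= t & t < 2 powr (real_of_int k + 1)" using floor_log_eq_powr_iff[of t 2 k] assms by(simp add: k_def)
 ultimately show ?thesis using that[of "nat k"] by simp
qed

lemma summable_two_powr:
 assumes "e > 0" shows "summable (%j. K * 2 powr (- (real j * e)))" proof -
 have "(%j. K * 2 powr (- (real j * e))) = (%j. K * (2 powr (- e)) ^ j)" by(auto simp: fun_eq_iff powr_powr mult.commute simp flip: powr_realpow)
 moreover have "2 powr (- e) < (1::real)" using assms by(simp add: powr_less_one)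
 ultimately show ?thesis by(auto intro!: summable_mult summable_geometric)
qed

lemma integrable_norm_powr_outside:
 assumes e: "e > 0"
 shows "integrable lborel (%z::'a::euclidean_space. indicator {z. 1 <= norm z} z * norm z powr (- real DIM('a) - e))" proof(rule integrable_dyadic)
 let ?N = "real DIM('a)"
 show "(%z::'a. indicator {z. 1 <= norm z} z * norm z powr (- ?N - e) :: real) \<in> borel_measurable borel" by measurable
 fix z :: 'a show "0 <= indicator {z. 1 <= norm z} z * norm z powr (- ?N - e)" by simp
 assume "indicator {z. 1 <= norm z} z * norm z powr (- ?N - e) ~= 0"
 hence z: "1 <= norm z" by(auto simp: indicator_def split: if_splits)
 then obtain j :: nat where j: "2 powr real j <= norm z" "norm z < 2 powr (real j + 1)" by(rule ex_dyadic)
 have "norm z powr (- ?N - e) <= (2 powr real j) powr (- ?N - e)" using j z e by(intro powr_mono2') auto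
 thus "\<exists>j. norm z < 2 powr (real j + 1) & indicator {z. 1 <= norm z} z * norm z powr (- ?N - e) <= (2 powr real j) powr (- ?N - e)"
  using j z by(intro exI[of _ j]) auto
next let ?N = "real DIM('a)"
 have "(2 powr real j) powr (- ?N - e) * (2 powr (real j + 1)) ^ DIM('a) = 2 powr ?N * 2 powr (- (real j * e))" for j :: nat
  by(simp add: powr_powr powr_realpow[symmetric] powr_add[symmetric] algebra_simps)
 thus "summable (%j. (2 powr real j) powr (- ?N - e) * (2 powr (real j + 1)) ^ DIM('a))" using summable_two_powr[OF e, of "2 powr ?N"] by(simp only:)
qed auto

lemma integrable_norm_powr_inside:
 assumes e: "e > 0"
 shows "integrable lborel (%z::'a::euclidean_space. indicator {z. norm z < 1} z * norm z powr (e - real DIM('a)))" proof(rule integrable_dyadic)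
 let ?N = "real DIM('a)"
 show "(%z::'a. indicator {z. norm z < 1} z * norm z powr (e - ?N) :: real) \<in> borel_measurable borel" by measurable
 fix z :: 'a show "0 <= indicator {z. norm z < 1} z * norm z powr (e - ?N)" by simp
 assume "indicator {z. norm z < 1} z * norm z powr (e - ?N) ~= 0"
 hence z: "norm z < 1" "norm z > 0" by(auto simp: indicator_def split: if_splits)
 hence "1 <= inverse (norm z)" by(simp add: one_le_inverse)
 then obtain j :: nat where j: "2 powr real j <= inverse (norm z)" "inverse (norm z) < 2 powr (real j + 1)" by(rule ex_dyadic)
 have up: "norm z <= 2 powr (- real j)" using j(1) z by(simp add: powr_minus field_simps)
 have lo: "2 powr (- (real j + 1)) <= norm z" using less_imp_inverse_less[OF j(2)] z unfolding powr_minus inverse_inverse_eq by simp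
 \<comment> \<open>The sign of \<open>e - N\<close> is unknown, so the power is split: the upper
   bound of the shell serves the exponent \<open>e\<close>, the lower bound the exponent
   \<open>- N\<close>.\<close>
 have "norm z powr (e - ?N) = norm z powr e * norm z powr (- ?N)" by(simp flip: powr_add)
 also have "... <= (2 powr (- real j)) powr e * (2 powr (- (real j + 1))) powr (- ?N)" using up lo z e by(intro mult_mono powr_mono2 powr_mono2') auto
 \<comment> \<open>The radius is doubled because the upper bound for the norm is not strict while
   the balls are open.\<close>
 finally show "\<exists>j::nat. norm z < 2 * 2 powr (- real j) & indicator {z. norm z < 1} z * norm z powr (e - ?N)
   <= (2 powr (- real j)) powr e * (2 powr (- (real j + 1))) powr (- ?N)" using z up by(intro exI[of _ j]) (auto intro: le_less_trans)
next let ?N = "real DIM('a)"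
 have "(2 powr (- real j)) powr e * (2 powr (- (real j + 1))) powr (- ?N) * (2 * 2 powr (- real j)) ^ DIM('a) =
   2 powr (2 * ?N) * 2 powr (- (real j * e))" for j :: nat proof -
  have "2 * 2 powr (- real j) = 2 powr (1 - real j)" by(simp add: powr_diff powr_minus field_simps)
  thus ?thesis by(simp add: powr_powr powr_realpow[symmetric] powr_add[symmetric] algebra_simps)
 qed
 thus "summable (%j. (2 powr (- real j)) powr e * (2 powr (- (real j + 1))) powr (- ?N) * (2 * 2 powr (- real j)) ^ DIM('a))"
  using summable_two_powr[OF e, of "2 powr (2 * ?N)"] by(simp only:)
qed auto

text \<open>Tonelli and translation invariance. Both positions of \<open>f\<close> occur because a
  symmetric energy is estimated by a density at either point of the pair.\<close>

lemma integrable_product_shift: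
 fixes f m :: "'a::euclidean_space => real"
 assumes f: "integrable lborel f" and m: "integrable lborel m"
 shows "integrable lborel2 (%p. f (fst p) * m (fst p - snd p))"
  "(LINT p|lborel2. f (fst p) * m (fst p - snd p)) = (LBINT x. f x) * (LBINT x. m x)"
  "integrable lborel2 (%p. f (snd p) * m (fst p - snd p))"
  "(LINT p|lborel2. f (snd p) * m (fst p - snd p)) = (LBINT x. f x) * (LBINT x. m x)" proof -
 have [measurable]: "f \<in> borel_measurable lborel" "m \<in> borel_measurable lborel" using f m by auto
 have mb: "m \<in> borel_measurable borel" "(%z. m (- z)) \<in> borel_measurable borel" by simp_all
 have i: "integrable lborel2 (%p. f (fst p) * n (fst p - snd p))"
  "(LINT p|lborel2. f (fst p) * n (fst p - snd p)) = (LBINT x. f x) * (LBINT x. n x)"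
  if n: "integrable lborel n" for n proof -
  have [measurable]: "n \<in> borel_measurable lborel" using n by auto
  have nb: "n \<in> borel_measurable borel" "(%z. abs (n z)) \<in> borel_measurable borel" by simp_all
  show 1: "integrable lborel2 (%p. f (fst p) * n (fst p - snd p))" proof(rule lborel_pair.Fubini_integrable)
   have "(LBINT y. norm (f (fst (x, y)) * n (fst (x, y) - snd (x, y)))) = abs (f x) * (LBINT z. abs (n z))" for x
    using lborel_reflect_integral(2)[OF nb(2), of x] by(simp add: abs_mult)
   thus "integrable lborel (%x. LBINT y. norm (f (fst (x, y)) * n (fst (x, y) - snd (x, y))))" using f by simp
   show "AE x in lborel. integrable lborel (%y. f (fst (x, y)) * n (fst (x, y) - snd (x, y)))" using lborel_reflect_integral(1)[OF nb(1)] n by simp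
  qed measurable
  have "(LINT p|lborel2. f (fst p) * n (fst p - snd p)) = (LBINT x. LBINT y. f x * n (x - y))"
   by(subst lborel_pair.integral_fst'[OF 1, symmetric]) simp
  also have "... = (LBINT x. f x * (LBINT x. n x))" using lborel_reflect_integral(2)[OF nb(1)] by simp
  finally show "(LINT p|lborel2. f (fst p) * n (fst p - snd p)) = (LBINT x. f x) * (LBINT x. n x)" by simp
 qed
 show "integrable lborel2 (%p. f (fst p) * m (fst p - snd p))"
  "(LINT p|lborel2. f (fst p) * m (fst p - snd p)) = (LBINT x. f x) * (LBINT x. m x)" by(rule i[OF m])+
 have n: "integrable lborel (%z. m (- z))" "(LBINT z. m (- z)) = (LBINT z. m z)" using lborel_reflect_integral[OF mb(1), of 0] m by auto
 have sw: "(%p. f (snd p) * m (fst p - snd p)) = (%(x, y). (%p. f (fst p) * m (- (fst p - snd p))) (y, x))" by(auto simp: fun_eq_iff)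
 show "integrable lborel2 (%p. f (snd p) * m (fst p - snd p))" unfolding sw by(rule lborel_pair.integrable_product_swap) (rule i(1)[OF n(1)])
 show "(LINT p|lborel2. f (snd p) * m (fst p - snd p)) = (LBINT x. f x) * (LBINT x. m x)" unfolding sw
  by(subst lborel_pair.integral_product_swap) (use i[OF n(1)] n(2) in auto)
qed

section \<open>Lipschitz functions in the energy spaces and embeddings between orders\<close>

text \<open>The numerator bounds the squared increment of a function that is bounded and Lipschitz,
  and likewise the second difference of the cutoff; this makes the kernel integrable at 0 and at
  infinity.\<close>

definition kmin :: "real => 'a::euclidean_space => real" where
 "kmin a z = min 1 ((norm z)^2) / norm z powr (real DIM('a) + 2 * a)"

lemma kmin_nonneg: "0 <= kmin a z" by(simp add: kmin_def)

lemma integrable_kmin: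
 assumes a: "0 < a" "a < 1"
 shows "integrable lborel (kmin a :: 'a::euclidean_space => real)" proof(rule L1_integrable_bound)
 let ?N = "real DIM('a)"
 show "integrable lborel (%z::'a. indicator {z. 1 <= norm z} z * norm z powr (- ?N - 2 * a) +
   indicator {z. norm z < 1} z * norm z powr ((2 - 2 * a) - ?N))"
  using a by(intro L1_integrable_add integrable_norm_powr_outside integrable_norm_powr_inside) auto
 show "(kmin a :: 'a => real) \<in> borel_measurable lborel" unfolding kmin_def by measurable
 show "AE z::'a in lborel. norm (kmin a z) <= norm (indicator {z. 1 <= norm z} z * norm z powr (- ?N - 2 * a) +
   indicator {z. norm z < 1} z * norm z powr ((2 - 2 * a) - ?N))" proof(rule AE_I2)
  fix z :: 'a show "norm (kmin a z) <= norm (indicator {z. 1 <= norm z} z * norm z powr (- ?N - 2 * a) +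
   indicator {z. norm z < 1} z * norm z powr ((2 - 2 * a) - ?N))" proof(cases "1 <= norm z")
   case True have "kmin a z <= 1 / norm z powr (?N + 2 * a)" unfolding kmin_def by(intro divide_right_mono) auto
   also have "... = norm z powr (- ?N - 2 * a)" using powr_minus[of "norm z" "?N + 2 * a"] by(simp add: inverse_eq_divide)
   finally show ?thesis using True by(simp add: kmin_nonneg)
  next case False have "kmin a z <= norm z powr ((2 - 2 * a) - ?N)" proof(cases "z = 0")
    case False have "kmin a z <= (norm z)^2 / norm z powr (?N + 2 * a)" unfolding kmin_def by(intro divide_right_mono) auto
    also have "... = norm z powr (2 - (?N + 2 * a))" using False by(subst powr_diff) (simp add: powr_numeral)
    finally show ?thesis by(simp add: algebra_simps)
   qed (simp add: kmin_def)
   thus ?thesis using False by(simp add: kmin_nonneg)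
  qed qed qed

text \<open>One constant \<open>B\<close> bounds both the function and its Lipschitz constant, so
  that the energy norm is linear in \<open>B\<close> with a factor that depends on the domain and
  the order alone.\<close>

lemma Lipschitz_in_X0:
 fixes Omega :: "'a::euclidean_space set"
 assumes a: "0 < a" "a < 1" and bd: "bounded Omega"
 shows "\<exists>C>0. \<forall>phi B. B >= 0 --> (\<forall>x. abs (phi x) <= B) --> (\<forall>x y. abs (phi x - phi y) <= B * norm (x - y)) -->
   (\<forall>x. x \<notin> Omega --> phi x = 0) --> phi \<in> X0 a Omega & X0_norm a phi <= C * B" proof -
 let ?c = "frac_const DIM('a) a / 2"
 have c: "?c > 0" using frac_const_pos[OF a, where 'a='a] by simp
 obtain R where R: "R > 0" "Omega \<subseteq> ball 0 R" using bd by(metis bounded_subset_ballD)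
 let ?S = "ball (0::'a) R" and ?M = "lborel2 :: ('a \<times> 'a) measure"
 have iS: "integrable lborel (indicator ?S :: 'a => real)"
  using emeasure_bounded_finite[OF bounded_ball, of "0::'a" R] by(simp add: integrable_indicator_iff)
 note sh = integrable_product_shift[OF iS integrable_kmin[OF a]]
 \<comment> \<open>Increments vanish unless one of the two points lies in the ball around the
   domain; each summand covers one of the two possibilities.\<close>
 let ?H = "%p. indicator ?S (fst p) * kmin a (fst p - snd p) + indicator ?S (snd p) * kmin a (fst p - snd p) :: real"
 have iH: "integrable ?M ?H" by(intro L1_integrable_add sh)
 define J where "J = (LINT p|?M. ?H p)"
 have J: "J >= 0" unfolding J_def by(intro integral_nonneg_AE AE_I2) (simp add: kmin_nonneg)
 show ?thesis proof(intro exI[of _ "sqrt (?c * (4 * J)) + 1"] conjI allI impI)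
  show "0 < sqrt (?c * (4 * J)) + 1" using c J by(intro add_nonneg_pos real_sqrt_ge_zero) auto
  fix phi :: "'a => real" and B :: real
  assume B: "B >= 0" and b1: "\<forall>x. abs (phi x) <= B" and b2: "\<forall>x y. abs (phi x - phi y) <= B * norm (x - y)"
   and z: "\<forall>x. x \<notin> Omega --> phi x = 0"
  have "continuous_on UNIV phi" by(rule lipschitz_on_continuous_on[of B]) (use b2 B in \<open>auto simp: lipschitz_on_def dist_norm\<close>)
  hence m: "phi \<in> borel_measurable lborel" by(simp add: borel_measurable_continuous_onI)
  have s1: "L2_fun lborel phi" proof(rule L2_dominated[OF _ m])
   have "(%x. (B * indicator ?S x)^2) = (%x. B^2 * indicator ?S x)" by(auto simp: fun_eq_iff indicator_def)
   thus "L2_fun lborel (%x. B * indicator ?S x)" using iS by(simp add: L2_fun_def)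
   show "AE x in lborel. abs (phi x) <= abs (B * indicator ?S x)" using b1 z R B by(intro AE_I2) (force simp: indicator_def)
  qed
  have pt: "(frac_diff a phi p)^2 <= 4 * B^2 * ?H p" for p proof -
   obtain x y where p: "p = (x, y)" by(cases p)
   show ?thesis proof(cases "x \<in> ?S \<or> y \<in> ?S")
    case False hence "phi x = 0" "phi y = 0" using z R by auto
    thus ?thesis using B by(simp add: p frac_diff_def kmin_nonneg)
   next case True have "abs (phi x - phi y) <= 2 * B" using b1[rule_format, of x] b1[rule_format, of y] by linarith
    hence 1: "(phi x - phi y)^2 <= 4 * B^2 * 1" using B abs_le_square_iff[of "phi x - phi y" "2 * B"] by(simp add: power_mult_distrib)
    have "(phi x - phi y)^2 <= (B * norm (x - y))^2" using b2 B abs_le_square_iff[of "phi x - phi y" "B * norm (x - y)"] by simp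
    also have "... = B^2 * (norm (x - y))^2" by(simp add: power_mult_distrib)
    also have "... <= 4 * B^2 * (norm (x - y))^2" by(intro mult_right_mono) auto
    finally have "(phi x - phi y)^2 <= 4 * B^2 * min 1 ((norm (x - y))^2)" using 1 by(simp add: min_def)
    hence "(phi x - phi y)^2 / norm (x - y) powr (real DIM('a) + 2 * a) <= 4 * B^2 * kmin a (x - y)"
     unfolding kmin_def times_divide_eq_right by(intro divide_right_mono) auto
    also have "... <= 4 * B^2 * ?H p" using True by(intro mult_left_mono) (auto simp: p indicator_def kmin_nonneg)
    finally show ?thesis by(simp add: p power2_eq_square frac_diff_mult)
   qed qed
  have i2: "integrable ?M (%p. (frac_diff a phi p)^2)" proof(rule L1_integrable_bound)
   show "integrable ?M (%p. 4 * B^2 * ?H p)" by(intro integrable_mult_right iH)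
   show "(%p. (frac_diff a phi p)^2) \<in> borel_measurable ?M" using frac_diff_measurable[OF m] by measurable
   show "AE p in ?M. norm ((frac_diff a phi p)^2) <= norm (4 * B^2 * ?H p)"
    using pt by(intro AE_I2) (simp add: abs_of_nonneg order_trans[OF pt abs_ge_self])
  qed
  have s2: "L2_fun ?M (frac_diff a phi)" using i2 frac_diff_measurable[OF m] by(simp add: L2_fun_def)
  show "phi \<in> X0 a Omega" using s1 s2 z by(simp add: X0_def frac_sobolev_iff)
  have "(LINT p|?M. (frac_diff a phi p)^2) <= (LINT p|?M. 4 * B^2 * ?H p)" by(rule integral_mono[OF i2 integrable_mult_right[OF iH] pt])
  also have "... = 4 * B^2 * J" unfolding J_def by(rule integral_mult_right_zero)
  finally have "?c * (LINT p|?M. (frac_diff a phi p)^2) <= ?c * (4 * B^2 * J)" using c by(intro mult_left_mono) auto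
  hence "X0_norm a phi <= sqrt (?c * (4 * B^2 * J))" unfolding X0_norm_eq by(rule real_sqrt_le_mono)
  also have "?c * (4 * B^2 * J) = (?c * (4 * J)) * B^2" by simp
  also have "sqrt ... = sqrt (?c * (4 * J)) * B" unfolding real_sqrt_mult using B by simp
  also have "... <= (sqrt (?c * (4 * J)) + 1) * B" using B by(intro mult_right_mono) auto
  finally show "X0_norm a phi <= (sqrt (?c * (4 * J)) + 1) * B" .
 qed qed

text \<open>Pairs at distance less than 1 are handled by comparing the kernels, since the one of
  lower order is smaller there. For the other pairs the kernel of order \<open>b\<close> is
  integrable and the L^2 norm suffices, which the Poincare inequality bounds.\<close>

lemma X0_embedding:
 fixes Omega :: "'a::euclidean_space set"
 assumes b: "0 < b" "b <= a" and a: "a < 1" and bd: "bounded Omega"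
 shows "\<exists>C>0. \<forall>v\<in>X0 a Omega. v \<in> X0 b Omega & X0_norm b v <= C * X0_norm a v" proof -
 have a': "0 < a" "a < 1" and b': "0 < b" "b < 1" using a b by auto
 let ?M = "lborel2 :: ('a \<times> 'a) measure"
 let ?ca = "frac_const DIM('a) a / 2" and ?cb = "frac_const DIM('a) b / 2"
 have c: "?ca > 0" "?cb > 0" using frac_const_pos[OF a', where 'a='a] frac_const_pos[OF b', where 'a='a] by auto
 obtain P where P: "P > 0" "!!v. v \<in> X0 a Omega ==> (L2sq v) <= P * (X0_norm a v)^2" using X0_Poincare[OF a' bd] by blast
 define m :: "'a => real" where "m z = indicator {z. 1 <= norm z} z * norm z powr (- real DIM('a) - 2 * b)" for z
 have im: "integrable lborel m" unfolding m_def using b by(intro integrable_norm_powr_outside) auto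
 have m0: "m z >= 0" for z by(simp add: m_def)
 define J where "J = (LBINT z. m z)"
 have J: "J >= 0" unfolding J_def by(intro integral_nonneg_AE AE_I2 m0)
 define K where "K = ?cb * (1 / ?ca + 4 * (P * J))"
 have K: "K > 0" unfolding K_def using c P J by(intro mult_pos_pos add_pos_nonneg) auto
 show ?thesis proof(intro exI[of _ "sqrt K"] conjI ballI)
  show "sqrt K > 0" using K by simp
  fix v assume v: "v \<in> X0 a Omega"
  note [measurable] = X0D(3)[OF v]
  note sh = integrable_product_shift[OF X0D(5)[OF v] im]
  let ?H = "%p. (frac_diff a v p)^2 + 2 * ((v (fst p))^2 * m (fst p - snd p) + (v (snd p))^2 * m (fst p - snd p))"
  have id: "integrable ?M (%p. (frac_diff a v p)^2)" using X0D(1)[OF v] by(simp add: frac_sobolev_iff L2_fun_def)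
  have iH: "integrable ?M ?H" by(intro L1_integrable_add integrable_mult_right id sh)
  have pt: "(frac_diff b v p)^2 <= ?H p" for p proof -
   obtain x y where p: "p = (x, y)" by(cases p)
   have e: "(frac_diff b v p)^2 = (v x - v y)^2 / norm (x - y) powr (real DIM('a) + 2 * b)"
    "(frac_diff a v p)^2 = (v x - v y)^2 / norm (x - y) powr (real DIM('a) + 2 * a)" by(simp_all add: p power2_eq_square frac_diff_mult)
   show ?thesis proof(cases "1 <= norm (x - y)")
    case True have "0 <= (v x + v y)^2" by simp
    hence "(v x - v y)^2 <= 2 * ((v x)^2 + (v y)^2)" by(simp add: power2_eq_square algebra_simps)
    hence "(frac_diff b v p)^2 <= 2 * ((v x)^2 + (v y)^2) / norm (x - y) powr (real DIM('a) + 2 * b)" unfolding e by(intro divide_right_mono) auto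
    also have "... = 2 * ((v x)^2 + (v y)^2) * m (x - y)"
     using True powr_minus[of "norm (x - y)" "real DIM('a) + 2 * b"] by(simp add: m_def field_simps)
    also have "... <= ?H p" by(simp add: p algebra_simps)
    finally show ?thesis .
   next case False have "(frac_diff b v p)^2 <= (frac_diff a v p)^2" proof(cases "x = y")
     case False have "norm (x - y) powr (real DIM('a) + 2 * a) <= norm (x - y) powr (real DIM('a) + 2 * b)"
      using \<open>\<not> 1 <= norm (x - y)\<close> b by(intro powr_mono') auto
     thus ?thesis unfolding e using False by(intro divide_left_mono) auto
    qed (simp add: e)
    also have "... <= ?H p" by(simp add: m0)
    finally show ?thesis .
   qed qed
  have mb: "frac_diff b v \<in> borel_measurable ?M" by measurable
  have i2: "integrable ?M (%p. (frac_diff b v p)^2)" proof(rule L1_integrable_bound[OF iH])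
   show "AE p in ?M. norm ((frac_diff b v p)^2) <= norm (?H p)" proof(rule AE_I2)
    fix p show "norm ((frac_diff b v p)^2) <= norm (?H p)" using order_trans[OF pt[of p] abs_ge_self] by simp
   qed
  qed (use mb in measurable)
  have s2: "L2_fun ?M (frac_diff b v)" using mb i2 by(simp add: L2_fun_def)
  thus "v \<in> X0 b Omega" using v by(simp add: X0_def frac_sobolev_iff)
  have "(LINT p|?M. (frac_diff b v p)^2) <= (LINT p|?M. ?H p)" by(rule integral_mono[OF i2 iH pt])
  also have "... = (LINT p|?M. (frac_diff a v p)^2) + 2 * ((L2sq v) * J + (L2sq v) * J)" using sh id by(simp add: J_def)
  also have "... <= (X0_norm a v)^2 / ?ca + 2 * (P * (X0_norm a v)^2 * J + P * (X0_norm a v)^2 * J)"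
  proof(intro add_mono mult_left_mono mult_right_mono P(2)[OF v] J)
   show "(LINT p|?M. (frac_diff a v p)^2) <= (X0_norm a v)^2 / ?ca" using c(1) unfolding X0_norm_square_eq[OF a'] by(simp add: field_simps)
  qed auto
  also have "... = (1 / ?ca + 4 * (P * J)) * (X0_norm a v)^2" by(simp add: algebra_simps)
  finally have "?cb * (LINT p|?M. (frac_diff b v p)^2) <= ?cb * ((1 / ?ca + 4 * (P * J)) * (X0_norm a v)^2)" using c(2) by(intro mult_left_mono) auto
  hence "X0_norm b v <= sqrt (?cb * ((1 / ?ca + 4 * (P * J)) * (X0_norm a v)^2))" unfolding X0_norm_eq[of b] by(rule real_sqrt_le_mono)
  also have "... = sqrt (K * (X0_norm a v)^2)" by(simp add: K_def mult.assoc)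
  also have "... = sqrt K * X0_norm a v" unfolding real_sqrt_mult by(simp add: X0_norm_ge0[OF a'])
  finally show "X0_norm b v <= sqrt K * X0_norm a v" .
 qed qed

section \<open>The Sobolev inequality\<close>

text \<open>Average over the ball of radius \<open>t\<close>; the second term uses \<open>r <= k + r\<^sup>q / k\<^bsup>q-1\<^esup>\<close> with the \<open>k\<close>
 that balances both parts.\<close>
lemma pointwise_ball_average:
 fixes v :: "'a::euclidean_space => real"
 assumes q: "1 < q" and v[measurable]: "v \<in> borel_measurable lborel" and iq: "Lq_integrable q v" and Ip: "(Lq_int q v) <= I" "I > 0"
  and iD: "integrable lborel (%y. (frac_diff a v (x, y))^2)" and D: "(LBINT y. (frac_diff a v (x, y))^2) <= D" and a: "a > 0" and t: "t > 0"
 defines "V == unit_ball_vol (real DIM('a))"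
 shows "abs (v x) <= sqrt (D / V) * t powr a + 2 * (I / (V * t powr real DIM('a))) powr (1 / q)" proof -
 let ?N = "real DIM('a)" and ?B = "ball x t"
 have V: "V > 0" by(simp add: V_def)
 have D0: "D >= 0" by(rule order_trans[OF integral_nonneg_AE D]) simp
 define m where "m = V * t powr ?N"
 have m: "m > 0" using V t by(simp add: m_def)
 have mB: "measure lborel ?B = m" using t by(simp add: content_ball m_def V_def powr_realpow)
 have iB: "integrable lborel (indicator ?B :: 'a => real)"
  using emeasure_bounded_finite[OF bounded_ball, of x t] by(simp add: integrable_indicator_iff)
 define L where "L = (I / m) powr (1 / q)"
 have L: "L > 0" using Ip m by(simp add: L_def)
 have Lq: "L powr q = I / m" using q Ip m by(simp add: L_def powr_powr)
 let ?f = "%y. frac_diff a v (x, y)" and ?g = "%y. indicator ?B y * norm (x - y) powr ((?N + 2 * a) / 2) :: real"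
 have sf: "L2_fun lborel ?f" proof -
  have "?f = (%y. (v x - v y) / norm (x - y) powr ((?N + 2 * a) / 2))" by(simp add: frac_diff_def)
  hence "?f \<in> borel_measurable lborel" by simp
  thus ?thesis using iD by(simp add: L2_fun_def)
 qed
 have g2: "(?g y)^2 <= t powr (?N + 2 * a) * indicator ?B y" for y proof(cases "y \<in> ?B")
  case True have "(?g y)^2 = norm (x - y) powr (?N + 2 * a)" using True by(simp add: power2_eq_square powr_half_mult)
  also have "... <= t powr (?N + 2 * a)" using True a by(intro powr_mono2) (auto simp: dist_norm)
  finally show ?thesis using True by simp
 qed simp
 have gm: "?g \<in> borel_measurable lborel" by(intro borel_measurable_times borel_measurable_integrable[OF iB]) simp
 have ig2: "integrable lborel (%y. (?g y)^2)" proof(rule L1_integrable_bound[OF integrable_mult_right[OF iB, of "t powr (?N + 2 * a)"]])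
  show "(%y. (?g y)^2) \<in> borel_measurable lborel" by(intro borel_measurable_power gm)
 qed (use g2 in \<open>auto intro!: AE_I2\<close>)
 have sg: "L2_fun lborel ?g" using ig2 gm by(simp add: L2_fun_def)
 have fg: "abs (?f y * ?g y) = indicator ?B y * abs (v x - v y)" for y by(simp add: frac_diff_def abs_mult)
 have "(LBINT y. (?g y)^2) <= (LBINT y. t powr (?N + 2 * a) * indicator ?B y)" by(rule integral_mono[OF ig2 integrable_mult_right[OF iB] g2])
 also have "... = t powr (?N + 2 * a) * m" using mB by simp
 finally have G: "(LBINT y. (?g y)^2) <= t powr (?N + 2 * a) * m" .
 have ab: "L2_fun lborel (%y. abs (?f y))" using sf by(simp add: L2_fun_def)
 have i1: "integrable lborel (%y. abs (?f y) * ?g y)" by(rule L2_mult_integrable[OF ab sg])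
 have "(LBINT y. abs (?f y) * ?g y) <= sqrt (LBINT y. (abs (?f y))^2) * sqrt (LBINT y. (?g y)^2)" using integral_CS[OF ab sg] by linarith
 also have "... <= sqrt D * sqrt (t powr (?N + 2 * a) * m)"
  using D G D0 by(intro mult_mono real_sqrt_le_mono real_sqrt_ge_zero integral_nonneg_AE) auto
 finally have 1: "(LBINT y. abs (?f y) * ?g y) <= sqrt D * sqrt (t powr (?N + 2 * a) * m)" .
 have young: "r <= L + L powr (1 - q) * r powr q" if "r >= 0" for r proof(cases "r <= L")
  case True thus ?thesis by(simp add: add_increasing2)
 next case False have "r = r powr q * r powr (1 - q)" using False L by(simp flip: powr_add)
  also have "... <= r powr q * L powr (1 - q)" using False L q by(intro mult_left_mono powr_mono2') auto
  finally show ?thesis using L by(simp add: mult.commute)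
 qed
 let ?k = "%y. L * indicator ?B y + L powr (1 - q) * abs (v y) powr q"
 have ik: "integrable lborel ?k" by(intro L1_integrable_add integrable_mult_right iB iq)
 have "(LBINT y. ?k y) = L * m + L powr (1 - q) * (LBINT y. abs (v y) powr q)" using iB iq mB by simp
 also have "... <= L * m + L powr (1 - q) * I" using Ip by(intro add_left_mono mult_left_mono) auto
 also have "L powr (1 - q) * I = L * m" proof -
  have "L powr (1 - q) * I = L / L powr q * I" using L by(simp add: powr_diff)
  thus ?thesis using Lq Ip m by simp
 qed
 finally have 2: "(LBINT y. ?k y) <= 2 * L * m" by simp
 have "abs (v x) * m = (LBINT y. abs (v x) * indicator ?B y)" using mB by simp
 also have "... <= (LBINT y. abs (?f y) * ?g y + ?k y)" proof(rule integral_mono)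
  fix y show "abs (v x) * indicator ?B y <= abs (?f y) * ?g y + ?k y" proof(cases "y \<in> ?B")
   case True have "abs (?f y) * ?g y = abs (v x - v y)" using fg[of y] True by(simp add: abs_mult)
   thus ?thesis using young[of "abs (v y)"] True by simp
  qed simp
 qed (intro integrable_mult_right iB L1_integrable_add i1 ik)+
 also have "... = (LBINT y. abs (?f y) * ?g y) + (LBINT y. ?k y)" by(rule L1_integral_add[OF i1 ik])
 also have "... <= sqrt D * sqrt (t powr (?N + 2 * a) * m) + 2 * L * m" using 1 2 by linarith
 finally have "abs (v x) * m <= sqrt D * sqrt (t powr (?N + 2 * a) * m) + 2 * L * m" .
 moreover have "sqrt D * sqrt (t powr (?N + 2 * a) * m) = sqrt (D / V) * t powr a * m" proof -
  have "t powr (?N + 2 * a) = t powr ?N * (t powr a)^2" unfolding power2_eq_square powr_add[symmetric] by simp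
  moreover have "t powr ?N = m / V" using V by(simp add: m_def)
  ultimately have "t powr (?N + 2 * a) * m = (t powr a * m)^2 / V" by(simp add: power2_eq_square)
  moreover have "sqrt ((t powr a * m)^2) = t powr a * m" using m by simp
  ultimately show ?thesis by(simp add: real_sqrt_divide)
 qed
 ultimately have "abs (v x) * m <= (sqrt (D / V) * t powr a + 2 * L) * m" by(simp add: algebra_simps)
 from mult_right_le_imp_le[OF this m] show ?thesis unfolding L_def m_def .
qed

text \<open>This is \<open>L2_Fatou\<close> for the square roots.\<close>

lemma integrable_Fatou:
 fixes f :: "nat => 'b => real"
 assumes f: "!!n. integrable M (f n)" and nn: "!!n x. 0 <= f n x" and bd: "!!n. (LINT x|M. f n x) <= K"
  and lim: "AE x in M. (%n. f n x) ----> F x" and F: "F \<in> borel_measurable M" and Fnn: "!!x. 0 <= F x"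
 shows "integrable M F" "(LINT x|M. F x) <= K" proof -
 have s: "L2_fun M (%x. sqrt (f n x))" for n using f[of n] nn by(simp add: L2_fun_def)
 have l: "AE x in M. (%n. sqrt (f n x)) ----> sqrt (F x)" using lim by eventually_elim (rule tendsto_real_sqrt)
 have b: "(LINT x|M. (sqrt (f n x))^2) <= K" for n using bd nn by simp
 have m: "(%x. sqrt (F x)) \<in> borel_measurable M" using F by simp
 from L2_Fatou[OF s b l m] show "integrable M F" "(LINT x|M. F x) <= K" using Fnn by(simp_all add: L2_fun_def)
qed

lemma X0_norm_Lipschitz_comp:
 fixes v :: "'a::euclidean_space => real"
 assumes a: "0 < a" "a < 1" and v: "v \<in> frac_sobolev a" and G0: "G 0 = 0" and G: "!!r t. abs (G r - G t) <= L * abs (r - t)"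
 shows "X0_norm a (%x. G (v x)) <= L * X0_norm a v" proof -
 have L: "L >= 0" using G[of 1 0] by simp
 have Gv: "(%x. G (v x)) \<in> frac_sobolev a" by(rule frac_sobolev_Lipschitz_comp[OF v G0 G])
 have Lv: "(%x. L * v x + 0 * v x) \<in> frac_sobolev a" by(rule frac_sobolev_lincomb[OF v v])
 have "(X0_norm a (%x. G (v x)))^2 <= frac_op a (%x. L * v x + 0 * v x) (%x. L * v x + 0 * v x)" unfolding X0_norm_square[OF a]
 proof(rule frac_op_mono_pointwise[OF a Gv Gv Lv Lv])
  fix x y have "(G (v x) - G (v y))^2 <= (L * (v x - v y))^2"
   using G[of "v x" "v y"] L abs_le_square_iff[of "G (v x) - G (v y)" "L * (v x - v y)"] by(simp add: abs_mult)
  thus "(G (v x) - G (v y)) * (G (v x) - G (v y)) <= (L * v x + 0 * v x - (L * v y + 0 * v y)) * (L * v x + 0 * v x - (L * v y + 0 * v y))"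
   by(simp add: power2_eq_square algebra_simps)
 qed
 also have "... = (L * X0_norm a v)^2"
  unfolding power_mult_distrib X0_norm_square[OF a] frac_op_lincomb_left[OF Lv v v] frac_op_lincomb_right[OF v v v] by(simp add: power2_eq_square)
 finally show ?thesis by(rule power2_le_imp_le) (simp add: L X0_norm_ge0[OF a])
qed

text \<open>Let \<open>I\<close> be the integral of the \<open>q\<close>-th power and
  \<open>D\<close> the integral of the squared quotients at \<open>x\<close>. The best radius in
  \<open>pointwise_ball_average\<close> bounds the \<open>q\<close>-th power of \<open>v x\<close>
  by a multiple of \<open>I powr (1 - 2 / q) * D\<close>. After integration over \<open>x\<close>
  this power of \<open>I\<close> is divided out, which requires \<open>I\<close> to be finite
  beforehand.\<close>

lemma Sobolev_critical_a_priori: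
 fixes v :: "'a::euclidean_space => real"
 assumes a: "0 < a" "a < 1" and Na: "2 * a < real DIM('a)" and v: "v \<in> frac_sobolev a"
 defines "q == 2 * real DIM('a) / (real DIM('a) - 2 * a)" and "V == unit_ball_vol (real DIM('a))"
 assumes iq: "Lq_integrable q v"
 shows "(Lq_int q v) <=
  (sqrt ((1 / sqrt V + 2 / V powr (1 / q)) powr q / (frac_const DIM('a) a / 2)) * X0_norm a v) powr q" proof -
 let ?N = "real DIM('a)" and ?M = "lborel2 :: ('a \<times> 'a) measure"
 let ?ca = "frac_const DIM('a) a / 2"
 define I where "I = (Lq_int q v)"
 define c where "c = 1 / sqrt V + 2 / V powr (1 / q)"
 have V: "V > 0" by(simp add: V_def)
 have ca: "?ca > 0" using frac_const_pos[OF a, where 'a='a] by simp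
 have q: "q > 2" using Na a unfolding q_def by(simp add: field_simps)
 have q1: "1 < q" using q by simp
 have e1: "1 / 2 - a / ?N = 1 / q" using Na unfolding q_def by(simp add: field_simps)
 have e2: "2 * a / ?N = 1 - 2 / q" using e1 by(simp add: field_simps)
 have c: "c > 0" using V unfolding c_def by(intro add_pos_pos divide_pos_pos) auto
 have I0: "I >= 0" unfolding I_def by(intro integral_nonneg_AE) simp
 have vm: "v \<in> borel_measurable lborel" using v by(simp add: frac_sobolev_def)
 have iD: "integrable ?M (%p. (frac_diff a v p)^2)" using v by(simp add: frac_sobolev_iff L2_fun_def)
 show ?thesis proof(cases "I = 0")
  case True thus ?thesis using I_def by simp
 next case False hence I: "I > 0" using I0 by simp
  have pt: "abs (v x) powr q <= c powr q * (I powr (1 - 2 / q) * D)"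
   if i: "integrable lborel (%y. (frac_diff a v (x, y))^2)" and DD: "(LBINT y. (frac_diff a v (x, y))^2) <= D" "D > 0"
   for x D proof -
   \<comment> \<open>This radius turns both terms of the average into multiples of
     \<open>E powr (1 / q)\<close>.\<close>
   define t where "t = (I powr (2 / q) / D) powr (1 / ?N)"
   have t: "t > 0" using I DD by(simp add: t_def)
   have tN: "t powr ?N = I powr (2 / q) / D" using I DD by(simp add: t_def powr_powr)
   have ta: "t powr a = I powr ((2 / q) * (a / ?N)) / D powr (a / ?N)" using I DD by(simp add: t_def powr_powr powr_divide)
   define E where "E = I powr (1 - 2 / q) * D"
   have E: "E > 0" using I DD by(simp add: E_def)
   have Eq: "E powr (1 / q) = I powr ((2 / q) * (a / ?N)) * D powr (1 / q)" proof -
    have "(1 - 2 / q) * (1 / q) = (2 / q) * (a / ?N)" unfolding e2[symmetric] by simp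
    thus ?thesis using I DD unfolding E_def by(simp add: powr_mult powr_powr)
   qed
   have "sqrt (D / V) * t powr a = E powr (1 / q) / sqrt V" proof -
    have "1 / 2 = 1 / q + a / ?N" using e1 by linarith
    hence "D powr (1 / 2) = D powr (1 / q) * D powr (a / ?N)" by(simp only: powr_add)
    hence "sqrt D = D powr (1 / q) * D powr (a / ?N)" using DD by(simp add: powr_half_sqrt)
    thus ?thesis using DD unfolding ta Eq by(simp add: real_sqrt_divide)
   qed
   moreover have "(I / (V * t powr ?N)) powr (1 / q) = E powr (1 / q) / V powr (1 / q)" proof -
    have "I / (V * t powr ?N) = E / V" proof -
     have "I powr (1 - 2 / q) = I / I powr (2 / q)" using I by(simp add: powr_diff)
     thus ?thesis unfolding tN E_def using DD by simp
    qed
    thus ?thesis using E V by(simp add: powr_divide)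
   qed
   moreover have "abs (v x) <= sqrt (D / V) * t powr a + 2 * (I / (V * t powr ?N)) powr (1 / q)"
    unfolding V_def by(rule pointwise_ball_average[OF q1 vm iq _ I i DD(1) a(1) t]) (simp add: I_def)
   ultimately have "abs (v x) <= c * E powr (1 / q)" by(simp add: c_def algebra_simps)
   hence "abs (v x) powr q <= (c * E powr (1 / q)) powr q" using q by(intro powr_mono2) auto
   also have "... = c powr q * E" using c E q by(simp add: powr_mult powr_powr)
   finally show ?thesis by(simp add: E_def)
  qed
  have pt': "abs (v x) powr q <= c powr q * (I powr (1 - 2 / q) * (LBINT y. (frac_diff a v (x, y))^2))"
   if i: "integrable lborel (%y. (frac_diff a v (x, y))^2)" for x proof -
   define D where "D = (LBINT y. (frac_diff a v (x, y))^2)"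
   have D0: "D >= 0" unfolding D_def by(intro integral_nonneg_AE) simp
   define k where "k = c powr q * I powr (1 - 2 / q)"
   have k: "k > 0" using c I by(simp add: k_def)
   \<comment> \<open>The radius is defined for positive \<open>D\<close> only; hence the detour over
     \<open>D + e / k\<close>.\<close>
   have "abs (v x) powr q <= k * D + e" if e: "e > 0" for e proof -
    have "abs (v x) powr q <= c powr q * (I powr (1 - 2 / q) * (D + e / k))"
     using e k D0 by(intro pt[OF i]) (auto simp: D_def[symmetric] add_nonneg_pos)
    also have "... = k * (D + e / k)" by(simp add: k_def)
    also have "... = k * D + e" using k by(simp add: field_simps)
    finally show ?thesis .
   qed
   hence "abs (v x) powr q <= k * D" by(rule field_le_epsilon)
   thus ?thesis by(simp add: k_def D_def mult.assoc)
  qed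
  define DD where "DD = (LINT p|?M. (frac_diff a v p)^2)"
  have DD0: "DD >= 0" unfolding DD_def by(intro integral_nonneg_AE) simp
  have "I <= (LBINT x. c powr q * (I powr (1 - 2 / q) * (LBINT y. (frac_diff a v (x, y))^2)))" unfolding I_def[symmetric]
   by(subst I_def, rule integral_mono_AE[OF iq])
    (use lborel_pair.integrable_fst'[OF iD] in simp,
     use lborel_pair.AE_integrable_fst'[OF iD] pt' in \<open>auto elim!: eventually_mono\<close>)
  also have "... = c powr q * (I powr (1 - 2 / q) * DD)" using lborel_pair.integral_fst'[OF iD] by(simp add: DD_def)
  finally have "I <= c powr q * (I powr (1 - 2 / q) * DD)" .
  moreover have "I = I powr (1 - 2 / q) * I powr (2 / q)" using I by(simp flip: powr_add)
  ultimately have "I powr (1 - 2 / q) * I powr (2 / q) <= I powr (1 - 2 / q) * (c powr q * DD)" by(simp add: algebra_simps)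
  hence "I powr (2 / q) <= c powr q * DD" using I by simp
  hence "(I powr (2 / q)) powr (q / 2) <= (c powr q * DD) powr (q / 2)" using q by(intro powr_mono2) auto
  hence le: "I <= (c powr q * DD) powr (q / 2)" using I q by(simp add: powr_powr)
  have "c powr q * DD = (sqrt (c powr q / ?ca) * X0_norm a v)^2" unfolding power_mult_distrib X0_norm_square_eq[OF a] DD_def using ca c by simp
  moreover have "((sqrt (c powr q / ?ca) * X0_norm a v)^2) powr (q / 2) = (sqrt (c powr q / ?ca) * X0_norm a v) powr q" proof -
   have nn: "0 <= sqrt (c powr q / ?ca) * X0_norm a v" using X0_norm_ge0[OF a, of v] ca by simp
   have "(z^2) powr (q / 2) = z powr q" if "z >= 0" for z :: real proof(cases "z = 0")
    case False hence "z^2 = z powr 2" using that by(simp add: powr_numeral)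
    thus ?thesis by(simp add: powr_powr)
   qed simp
   thus ?thesis using nn .
  qed
  ultimately show ?thesis using le unfolding c_def I_def by simp
 qed qed

text \<open>Truncations of \<open>v\<close> are bounded and live in a bounded set, so the a priori
  inequality applies to them with bounds independent of the level. Fatou removes the
  truncation.\<close>

lemma X0_Sobolev_critical:
 fixes Omega :: "'a::euclidean_space set"
 assumes a: "0 < a" "a < 1" and Na: "2 * a < real DIM('a)" and bd: "bounded Omega"
 defines "q == 2 * real DIM('a) / (real DIM('a) - 2 * a)"
 shows "\<exists>C>0. \<forall>v\<in>X0 a Omega. Lq_integrable q v &
  (Lq_int q v) <= (C * X0_norm a v) powr q" proof -
 let ?V = "unit_ball_vol (real DIM('a))"
 define C where "C = sqrt ((1 / sqrt ?V + 2 / ?V powr (1 / q)) powr q / (frac_const DIM('a) a / 2))"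
 have V: "?V > 0" by(rule unit_ball_vol_pos) simp
 have "1 / sqrt r + 2 / r powr (1 / q) > 0" if "r > 0" for r using that by(intro add_pos_pos divide_pos_pos) auto
 from this[OF V] have "1 / sqrt ?V + 2 / ?V powr (1 / q) > 0" .
 hence C: "C > 0" unfolding C_def using frac_const_pos[OF a, where 'a='a] by simp
 have q: "q > 0" using Na a unfolding q_def by simp
 obtain R where R: "R > 0" "Omega \<subseteq> ball 0 R" using bd by(metis bounded_subset_ballD)
 have iS: "integrable lborel (indicator (ball (0::'a) R) :: 'a => real)"
  using emeasure_bounded_finite[OF bounded_ball, of "0::'a" R] by(simp add: integrable_indicator_iff)
 show ?thesis proof(intro exI[of _ C] conjI ballI C)
  fix v assume v: "v \<in> X0 a Omega"
  note [measurable] = X0D(3)[OF v]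
  define G where "G k r = max (- real k) (min (real k) r)" for k and r :: real
  have G: "G k 0 = 0" "abs (G k r - G k t) <= 1 * abs (r - t)" "abs (G k r) <= real k" for k r t by(auto simp: G_def max_def min_def)
  have Gv: "(%x. G k (v x)) \<in> X0 a Omega" for k by(rule X0_Lipschitz_comp[OF v G(1) G(2)])
  have i: "integrable lborel (%x. abs (G k (v x)) powr q)" for k proof(rule L1_integrable_bound[OF integrable_mult_right[OF iS, of "real k powr q"]])
   show "(%x. abs (G k (v x)) powr q) \<in> borel_measurable lborel" using X0D(3)[OF Gv[of k]] by measurable
   show "AE x in lborel. norm (abs (G k (v x)) powr q) <= norm (real k powr q * indicator (ball 0 R) x)" using X0D(2)[OF v] proof eventually_elim
    case (elim x) show ?case proof(cases "x \<in> ball 0 R")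
     case True thus ?thesis using G(3)[of k "v x"] q by(auto intro: powr_mono2)
    next case False hence "v x = 0" using elim R by blast
     thus ?thesis by(simp add: G)
    qed qed qed
  have b: "(LBINT x. abs (G k (v x)) powr q) <= (C * X0_norm a v) powr q" for k proof -
   have "(LBINT x. abs (G k (v x)) powr q) <= (C * X0_norm a (%x. G k (v x))) powr q" unfolding C_def q_def
    by(rule Sobolev_critical_a_priori[OF a Na X0D(1)[OF Gv]]) (rule i[of k, unfolded q_def])
   also have "... <= (C * X0_norm a v) powr q"
    using X0_norm_Lipschitz_comp[OF a X0D(1)[OF v] G(1)[of k] G(2)] C q X0_norm_ge0[OF a, of "%x. G k (v x)"] by(intro powr_mono2 mult_left_mono) auto
   finally show ?thesis .
  qed
  have l: "AE x in lborel. (%k. abs (G k (v x)) powr q) ----> abs (v x) powr q" proof(rule AE_I2)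
   fix x obtain n where n: "abs (v x) <= real n" using real_arch_simple by blast
   have "\<forall>\<^sub>F k in sequentially. abs (G k (v x)) powr q = abs (v x) powr q" unfolding eventually_sequentially
   proof(intro exI[of _ n] allI impI)
    fix k assume "n <= k"
    hence "abs (v x) <= real k" using n by linarith
    hence "G k (v x) = v x" by(auto simp: G_def max_def min_def)
    thus "abs (G k (v x)) powr q = abs (v x) powr q" by simp
   qed
   thus "(%k. abs (G k (v x)) powr q) ----> abs (v x) powr q" by(rule tendsto_eventually)
  qed
  have m: "(%x. abs (v x) powr q) \<in> borel_measurable lborel" by measurable
  have nn: "0 <= abs (G k (v x)) powr q" "0 <= abs (v x) powr q" for k x by auto
  show "Lq_integrable q v" "(Lq_int q v) <= (C * X0_norm a v) powr q" by(rule integrable_Fatou[OF i nn(1) b l m nn(2)])+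
 qed qed

definition Sobolev_exponent :: "nat => real => real => bool" where
 "Sobolev_exponent N a q \<longleftrightarrow> 2 < q & (2 * a < real N --> q <= 2 * real N / (real N - 2 * a))"

text \<open>The exponent \<open>q\<close> is critical for the order \<open>N (1/2 - 1/q)\<close>, which is at most \<open>a\<close>.\<close>
lemma X0_Sobolev:
 fixes Omega :: "'a::euclidean_space set"
 assumes a: "0 < a" "a < 1" and bd: "bounded Omega" and q: "Sobolev_exponent DIM('a) a q"
 obtains C where "C > 0"
  "!!v. v \<in> X0 a Omega ==> Lq_integrable q v"
  "!!v. v \<in> X0 a Omega ==> (Lq_int q v) <= (C * X0_norm a v) powr q" proof -
 let ?N = "real DIM('a)"
 define b where "b = ?N * (1 / 2 - 1 / q)"
 have N: "?N > 0" by simp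
 have q2: "q > 2" using q by(simp add: Sobolev_exponent_def)
 have "0 < 1 / 2 - 1 / q" using q2 by(simp add: field_simps)
 hence b0: "0 < b" unfolding b_def using N by(intro mult_pos_pos) auto
 have bN: "2 * b < ?N" using q2 N by(simp add: b_def field_simps)
 have ba: "b <= a" proof(cases "2 * a < ?N")
  case True hence "q <= 2 * ?N / (?N - 2 * a)" using q by(simp add: Sobolev_exponent_def)
  hence "q * (?N - 2 * a) <= 2 * ?N" using True by(simp add: field_simps)
  thus ?thesis using q2 by(simp add: b_def field_simps)
 next case False thus ?thesis using bN by simp
 qed
 have b1: "b < 1" using ba a by simp
 have qb: "2 * ?N / (?N - 2 * b) = q" using q2 N by(simp add: b_def field_simps)
 obtain C where C: "C > 0" "!!v. v \<in> X0 b Omega ==> Lq_integrable q v &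
  (Lq_int q v) <= (C * X0_norm b v) powr q" using X0_Sobolev_critical[OF b0 b1 bN bd] unfolding qb by blast
 obtain K where K: "K > 0" "!!v. v \<in> X0 a Omega ==> v \<in> X0 b Omega & X0_norm b v <= K * X0_norm a v"
  using X0_embedding[OF b0 ba a(2) bd] by blast
 show ?thesis proof(rule that[of "C * K"])
  show "C * K > 0" using C K by simp
  fix v assume v: "v \<in> X0 a Omega"
  show "Lq_integrable q v" using C K v by blast
  have "(Lq_int q v) <= (C * X0_norm b v) powr q" using C K v by blast
  also have "... <= (C * (K * X0_norm a v)) powr q" using C K(2)[OF v] q2 X0_norm_ge0[OF b0 b1, of v] by(intro powr_mono2 mult_left_mono) auto
  finally show "(Lq_int q v) <= (C * K * X0_norm a v) powr q" by(simp add: mult.assoc)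
 qed qed

lemma ex_Sobolev_exponent:
 assumes "0 < a" shows "\<exists>q. Sobolev_exponent N a q" proof(cases "2 * a < real N")
 case True hence "2 < 2 * real N / (real N - 2 * a)" using assms by(simp add: field_simps)
 thus ?thesis by(auto simp: Sobolev_exponent_def)
next case False thus ?thesis by(intro exI[of _ 3]) (simp add: Sobolev_exponent_def)
qed

section \<open>Approximation by bounded functions and Ehrling's inequality\<close>

text \<open>Above the threshold, \<open>r^2\<close> equals its own power \<open>1 - q / 2\<close>
  times \<open>abs r powr q\<close>, and that exponent is negative. The first term will be paid by a
  small measure, the second by higher integrability.\<close>

lemma square_le_threshold:
 fixes r :: real
 assumes "mu > 0" "q > 2"
 shows "r^2 <= mu + mu powr (1 - q / 2) * abs r powr q" proof(cases "r^2 <= mu")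
 case True have "0 <= mu powr (1 - q / 2) * abs r powr q" by simp
 with True show ?thesis by linarith
next case False hence r: "mu < r^2" "abs r > 0" using assms by auto
 have r2: "r^2 = abs r powr 2" using r by(simp add: powr_numeral)
 have "r^2 = (r^2) powr (1 - q / 2) * abs r powr q" unfolding r2 powr_powr using r by(simp flip: powr_add)
 also have "... <= mu powr (1 - q / 2) * abs r powr q" using r assms by(intro mult_right_mono powr_mono2') auto
 finally show ?thesis using assms by linarith
qed

text \<open>Higher integrability makes the mass of \<open>v\<close> in a thin boundary strip small.\<close>
lemma X0_boundary_strip:
 fixes Omega :: "'a::euclidean_space set"
 assumes a: "0 < a" "a < 1" and op: "open Omega" and bd: "bounded Omega" and e: "e > 0"
 obtains d where "d > 0" "!!v. v \<in> X0 a Omega ==>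
   (LBINT x. indicator {y \<in> Omega. infdist y (- Omega) <= d} x * (v x)^2) <= e * (X0_norm a v)^2" proof -
 define T where "T d = {y \<in> Omega. infdist y (- Omega) <= d}" for d
 obtain q where q: "Sobolev_exponent DIM('a) a q" using ex_Sobolev_exponent[OF a(1)] by blast
 have q2: "q > 2" using q by(simp add: Sobolev_exponent_def)
 obtain C where C: "C > 0" "!!v. v \<in> X0 a Omega ==> Lq_integrable q v"
  "!!v. v \<in> X0 a Omega ==> (Lq_int q v) <= (C * X0_norm a v) powr q" using X0_Sobolev[OF a bd q] by blast
 obtain P where P: "P > 0" "!!v. v \<in> X0 a Omega ==> (L2sq v) <= P * (X0_norm a v)^2" using X0_Poincare[OF a bd] by blast
 have Tm[measurable]: "T d \<in> sets borel" for d proof -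
  have "closed {y. infdist y (- Omega) <= d}" by(intro closed_Collect_le continuous_intros)
  hence "Omega \<inter> {y. infdist y (- Omega) <= d} \<in> sets borel" using op by(intro sets.Int) auto
  thus ?thesis by(simp add: T_def Int_def)
 qed
 have Tfin: "emeasure lborel (T d) < \<infinity>" for d by(rule emeasure_bounded_finite) (rule bounded_subset[OF bd], auto simp: T_def)
 have ne: "- Omega ~= {}" using bd not_bounded_UNIV by(metis Compl_UNIV_eq double_compl)
 \<comment> \<open>The strips shrink to the empty set because every point of an open set has
   positive distance from the complement.\<close>
 have "(%n. measure lborel (T (1 / real (Suc n)))) ----> measure lborel (\<Inter>n. T (1 / real (Suc n)))" proof(rule Lim_measure_decseq)
  show "decseq (%n. T (1 / real (Suc n)))" proof(rule decseq_SucI)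
   fix n have "1 / real (Suc (Suc n)) <= 1 / real (Suc n)" by(simp add: field_simps)
   thus "T (1 / real (Suc (Suc n))) \<subseteq> T (1 / real (Suc n))" unfolding T_def by fastforce
  qed
  show "emeasure lborel (T (1 / real (Suc n))) ~= \<infinity>" for n using Tfin[of "1 / real (Suc n)"] by simp
 qed auto
 moreover have "(\<Inter>n. T (1 / real (Suc n))) = {}" proof(rule ccontr)
  assume "(\<Inter>n. T (1 / real (Suc n))) ~= {}"
  then obtain y where y: "!!n. y \<in> T (1 / real (Suc n))" by blast
  have "infdist y (- Omega) <= 0" proof(rule field_le_epsilon)
   fix e :: real assume "e > 0"
   then obtain n where "inverse (real (Suc n)) < e" using reals_Archimedean by blast
   thus "infdist y (- Omega) <= 0 + e" using y[of n] by(simp add: T_def inverse_eq_divide)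
  qed
  hence "infdist y (- Omega) = 0" using infdist_nonneg[of y "- Omega"] by simp
  hence "y \<in> - Omega" using in_closed_iff_infdist_zero[of "- Omega" y] op ne by(simp add: closed_def)
  thus False using y[of 0] by(simp add: T_def)
 qed
 ultimately have lim: "(%n. measure lborel (T (1 / real (Suc n)))) ----> 0" by simp
 \<comment> \<open>\<open>K\<close> solves
   \<open>K powr (1 - q / 2) * C powr q = e / 2\<close>.\<close>
 define K where "K = (e / 2 / C powr q) powr (1 / (1 - q / 2))"
 have K: "K > 0" using e C(1) by(simp add: K_def)
 have KC: "K powr (1 - q / 2) * C powr q = e / 2" using e C(1) q2 by(simp add: K_def powr_powr)
 have "e / (2 * K) > 0" using e K by simp
 from order_tendstoD(2)[OF lim this] obtain n where n: "measure lborel (T (1 / real (Suc n))) < e / (2 * K)"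
  unfolding eventually_sequentially by blast
 define d where "d = 1 / real (Suc n)"
 show ?thesis proof(rule that[of d])
  show "d > 0" by(simp add: d_def)
  fix v assume v: "v \<in> X0 a Omega"
  note vm[measurable] = X0D(3)[OF v]
  define m where "m = X0_norm a v"
  have m0: "m >= 0" using X0_norm_ge0[OF a] by(simp add: m_def)
  have iT: "integrable lborel (indicator (T d) :: 'a => real)" using Tfin[of d] by(simp add: integrable_indicator_iff)
  have iTv: "integrable lborel (%x. indicator (T d) x * (v x)^2)" proof(rule L1_integrable_bound[OF X0D(5)[OF v]])
   show "(%x. indicator (T d) x * (v x)^2) \<in> borel_measurable lborel"
    by(intro borel_measurable_times borel_measurable_integrable[OF iT]) measurable
  qed (auto simp: indicator_def)
  have "(LBINT x. indicator (T d) x * (v x)^2) <= e * m^2" proof(cases "m = 0")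
   case True have "(LBINT x. indicator (T d) x * (v x)^2) <= (L2sq v)" by(rule integral_mono[OF iTv X0D(5)[OF v]]) (auto simp: indicator_def)
   also have "... <= P * m^2" using P(2)[OF v] by(simp add: m_def)
   finally show ?thesis using True by simp
  next case False hence m: "m > 0" using m0 by simp
   \<comment> \<open>A threshold proportional to the squared energy norm makes both terms quadratic
     in that norm.\<close>
   define mu where "mu = K * m^2"
   have mu: "mu > 0" using K m by(simp add: mu_def)
   have "(LBINT x. indicator (T d) x * (v x)^2) <= (LBINT x. mu * indicator (T d) x + mu powr (1 - q / 2) * abs (v x) powr q)"
   proof(rule integral_mono[OF iTv])
    show "integrable lborel (%x. mu * indicator (T d) x + mu powr (1 - q / 2) * abs (v x) powr q)"
     by(intro L1_integrable_add integrable_mult_right iT C(2) v)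
    show "indicator (T d) x * (v x)^2 <= mu * indicator (T d) x + mu powr (1 - q / 2) * abs (v x) powr q" for x
     using square_le_threshold[OF mu q2, of "v x"] by(cases "x \<in> T d") auto
   qed
   also have "... = mu * measure lborel (T d) + mu powr (1 - q / 2) * (Lq_int q v)" using iT C(2)[OF v] by simp
   also have "... <= mu * (e / (2 * K)) + mu powr (1 - q / 2) * (C * m) powr q"
    using n mu C(3)[OF v] unfolding m_def d_def by(intro add_mono mult_left_mono) auto
   also have "mu * (e / (2 * K)) = e / 2 * m^2" using K by(simp add: mu_def)
   also have "mu powr (1 - q / 2) * (C * m) powr q = (K powr (1 - q / 2) * C powr q) * m^2" proof -
    have m2: "m^2 = m powr 2" using m by(simp add: powr_numeral)
    have "(m^2) powr (1 - q / 2) * m powr q = m^2" unfolding m2 powr_powr powr_add[symmetric] by(simp add: field_simps)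
    thus ?thesis using K C(1) m unfolding mu_def by(simp add: powr_mult mult_ac)
   qed
   also have "e / 2 * m^2 + (K powr (1 - q / 2) * C powr q) * m^2 = e * m^2" unfolding KC by simp
   finally show ?thesis .
  qed
  thus "(LBINT x. indicator {y \<in> Omega. infdist y (- Omega) <= d} x * (v x)^2) <= e * (X0_norm a v)^2" by(simp add: T_def m_def)
 qed qed

text \<open>A normalised cone: Lipschitz continuity is all that the mollified functions have to
  inherit. The mass of the cone is at least its value \<open>d / 2\<close> times the measure of the
  ball of radius \<open>d / 2\<close>, which gives the bound on \<open>k\<close>.\<close>

lemma ex_mollifier:
 fixes d :: real
 assumes d: "d > 0"
 obtains rho :: "'a::euclidean_space => real" and k where
  "k > 0" "k * d powr (real DIM('a) + 1) <= 2 powr (real DIM('a) + 1) / unit_ball_vol (real DIM('a))"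
  "\<forall>z. 0 <= rho z" "\<forall>z. rho z <= k * d" "\<forall>z z'. abs (rho z - rho z') <= k * norm (z - z')"
  "\<forall>z. rho z ~= 0 --> norm z < d" "rho \<in> borel_measurable borel" "integrable lborel rho" "(LBINT z. rho z) = 1" proof -
 let ?N = "real DIM('a)" and ?V = "unit_ball_vol (real DIM('a))"
 have V: "?V > 0" by(rule unit_ball_vol_pos) simp
 define h :: "'a => real" where "h z = max 0 (d - norm z)" for z
 have hm[measurable]: "h \<in> borel_measurable borel" unfolding h_def by measurable
 have ib: "integrable lborel (indicator (ball (0::'a) r) :: 'a => real)" for r
  using emeasure_bounded_finite[OF bounded_ball, of "0::'a" r] by(simp add: integrable_indicator_iff)
 have ih: "integrable lborel h" proof(rule L1_integrable_bound[OF integrable_mult_right[OF ib[of d], of d]])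
  have "abs (h z) <= d * indicator (ball 0 d) z" for z using d norm_ge_zero[of z] by(auto simp: h_def indicator_def)
  thus "AE z in lborel. norm (h z) <= norm (d * indicator (ball 0 d) z)" using d by(intro AE_I2) simp
 qed simp
 define c where "c = (LBINT z. h z)"
 have "(LBINT z. d / 2 * indicator (ball (0::'a) (d / 2)) z) <= c"
  unfolding c_def by(rule integral_mono[OF integrable_mult_right[OF ib] ih]) (auto simp: h_def indicator_def max_def)
 also have "(LBINT z. d / 2 * indicator (ball (0::'a) (d / 2)) z) = d / 2 * (?V * (d / 2) ^ DIM('a))" using d by(simp add: content_ball)
 also have "(d / 2) ^ DIM('a) = (d / 2) powr ?N" using d by(simp add: powr_realpow)
 also have "d / 2 * (?V * (d / 2) powr ?N) = ?V * (d / 2) powr (?N + 1)" using d by(simp add: powr_add)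
 finally have cl: "?V * (d / 2) powr (?N + 1) <= c" .
 moreover have "?V * (d / 2) powr (?N + 1) > 0" using V d by simp
 ultimately have c: "c > 0" by linarith
 show ?thesis proof(rule that[of "1 / c" "%z. h z / c"])
  show "1 / c > 0" using c by simp
  have e1: "d powr (?N + 1) = 2 powr (?N + 1) * (d / 2) powr (?N + 1)" using d by(simp add: powr_mult[symmetric])
  have l1: "(d / 2) powr (?N + 1) <= c / ?V" using cl V by(simp add: field_simps)
  have "d powr (?N + 1) <= 2 powr (?N + 1) * (c / ?V)" unfolding e1 by(rule mult_left_mono[OF l1]) simp
  thus "1 / c * d powr (?N + 1) <= 2 powr (?N + 1) / ?V" using c V by(simp add: field_simps)
  show "\<forall>z. 0 <= h z / c" using c by(simp add: h_def)
  show "\<forall>z. h z / c <= 1 / c * d" using c d by(simp add: h_def divide_right_mono)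
  show "\<forall>z z'. abs (h z / c - h z' / c) <= 1 / c * norm (z - z')" proof(intro allI)
   fix z z' have "abs (h z - h z') <= norm (z - z')" using norm_triangle_ineq3[of z z'] by(auto simp: h_def max_def)
   hence "abs (h z - h z') / c <= norm (z - z') / c" using c by(intro divide_right_mono) auto
   thus "abs (h z / c - h z' / c) <= 1 / c * norm (z - z')" using c by(simp add: diff_divide_distrib[symmetric])
  qed
  show "\<forall>z. h z / c ~= 0 --> norm z < d" by(auto simp: h_def max_def split: if_splits)
  show "(%z. h z / c) \<in> borel_measurable borel" by measurable
  show "integrable lborel (%z. h z / c)" using ih by simp
  show "(LBINT z. h z / c) = 1" using c by(simp add: c_def)
 qed qed

text \<open>Cut off a boundary strip and mollify: the approximation stays supported in the domain.\<close>
lemma X0_approximation: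
 fixes Omega :: "'a::euclidean_space set"
 assumes a: "0 < a" "a < 1" and b: "0 < b" "b < 1" and op: "open Omega" and bd: "bounded Omega" and e: "e > 0"
 obtains C where "C > 0" "!!v. v \<in> X0 a Omega ==> \<exists>phi\<in>X0 b Omega.
   (\<forall>x. abs (phi x) <= C * sqrt (L2sq v)) & X0_norm b phi <= C * sqrt (L2sq v) &
   (LBINT x. (v x - phi x)^2) <= e * (X0_norm a v)^2" proof -
 let ?N = "real DIM('a)" and ?V = "unit_ball_vol (real DIM('a))" and ?M = "lborel2 :: ('a \<times> 'a) measure"
 let ?ca = "frac_const DIM('a) a / 2"
 have ca: "?ca > 0" using frac_const_pos[OF a, where 'a='a] by simp
 have V: "?V > 0" by(rule unit_ball_vol_pos) simp
 have e4: "e / 4 > 0" using e by simp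
 obtain d0 where d0: "d0 > 0" "!!v. v \<in> X0 a Omega ==>
   (LBINT x. indicator {y \<in> Omega. infdist y (- Omega) <= d0} x * (v x)^2) <= e / 4 * (X0_norm a v)^2"
  using X0_boundary_strip[OF a op bd e4] by blast
 define W where "W = 2 powr (?N + 1) / ?V"
 have W: "W > 0" using V by(simp add: W_def)
 \<comment> \<open>At this radius the part of the error that comes from the energy of
   \<open>v\<close> is at most half of the permitted error.\<close>
 define d1 where "d1 = (e * ?ca / (4 * W)) powr (1 / (2 * a))"
 have d1: "d1 > 0" using e ca W unfolding d1_def by simp
 have d1a: "d1 powr (2 * a) = e * ?ca / (4 * W)" using a e ca W by(simp add: d1_def powr_powr)
 define d where "d = min d0 d1"
 have d: "d > 0" "d <= d0" "d <= d1" using d0 d1 by(auto simp: d_def)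
 obtain rho :: "'a => real" and k where k: "k > 0" "k * d powr (?N + 1) <= 2 powr (?N + 1) / ?V"
  "\<forall>z. 0 <= rho z" "\<forall>z. rho z <= k * d" "\<forall>z z'. abs (rho z - rho z') <= k * norm (z - z')"
  "\<forall>z. rho z ~= 0 --> norm z < d" "rho \<in> borel_measurable borel" "integrable lborel rho" "(LBINT z. rho z) = 1"
  by(rule ex_mollifier[OF d(1)])
 note rho = k(1) k(2)[folded W_def] k(3)[rule_format] k(4)[rule_format] k(5)[rule_format] k(6)[rule_format] k(7-9)
 note [measurable] = rho(7)
 define D where "D = {y \<in> Omega. infdist y (- Omega) > d}"
 define T where "T = {y \<in> Omega. infdist y (- Omega) <= d0}"
 have Dm[measurable]: "D \<in> sets borel" proof -
  have "open {y. d < infdist y (- Omega)}" by(intro open_Collect_less continuous_intros)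
  hence "Omega \<inter> {y. d < infdist y (- Omega)} \<in> sets borel" using op by(intro sets.Int) auto
  thus ?thesis by(simp add: D_def Int_def)
 qed
 have Tm[measurable]: "T \<in> sets borel" proof -
  have "closed {y. infdist y (- Omega) <= d0}" by(intro closed_Collect_le continuous_intros)
  hence "Omega \<inter> {y. infdist y (- Omega) <= d0} \<in> sets borel" using op by(intro sets.Int) auto
  thus ?thesis by(simp add: T_def Int_def)
 qed
 have iD: "integrable lborel (indicator D :: 'a => real)" proof -
  have "D \<subseteq> Omega" by(auto simp: D_def)
  from emeasure_bounded_finite[OF bounded_subset[OF bd this]] show ?thesis using Dm by(simp add: integrable_indicator_iff)
 qed
 obtain L where L: "L > 0" "!!phi B. B >= 0 ==> (\<forall>x. abs (phi x) <= B) ==> (\<forall>x y. abs (phi x - phi y) <= B * norm (x - y)) ==>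
   (\<forall>x. x \<notin> Omega --> phi x = 0) ==> phi \<in> X0 b Omega & X0_norm b phi <= L * B" using Lipschitz_in_X0[OF b bd] by blast
 \<comment> \<open>Per unit of the L^2 norm of \<open>v\<close>, this bounds both the supremum and
   the Lipschitz constant of the mollified function; it degenerates as \<open>d\<close> tends to
   0.\<close>
 define B0 where "B0 = k * (d + 1) * sqrt (measure lborel D)"
 have B0: "B0 >= 0" using rho(1) d by(simp add: B0_def)
 show ?thesis proof(rule that[of "(L + 1) * (B0 + 1)"])
  show "(L + 1) * (B0 + 1) > 0" using L(1) B0 by(intro mult_pos_pos) auto
  fix v assume v: "v \<in> X0 a Omega"
  note vm[measurable] = X0D(3)[OF v]
  define S where "S = sqrt (L2sq v)"
  have S: "S >= 0" unfolding S_def by(intro real_sqrt_ge_zero integral_nonneg_AE) simp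
  define w where "w y = indicator D y * v y" for y
  have ind2: "(indicator D y)^2 = (indicator D y :: real)" for y by(simp add: indicator_def)
  have sD: "L2_fun lborel (indicator D :: 'a => real)" using iD by(simp add: L2_fun_def ind2)
  have sv: "L2_fun lborel (%x. abs (v x))" using X0D(4)[OF v] by(simp add: L2_fun_def)
  have wm[measurable]: "w \<in> borel_measurable lborel" unfolding w_def by(intro borel_measurable_times borel_measurable_integrable[OF iD]) simp
  have iw: "integrable lborel w" unfolding w_def by(rule L2_mult_integrable[OF sD X0D(4)[OF v]])
  have wabs: "abs (w y) = indicator D y * abs (v y)" for y by(simp add: w_def indicator_def)
  have w1: "(LBINT y. abs (w y)) <= sqrt (measure lborel D) * S" proof -
   have "(LBINT y. abs (w y)) <= sqrt (LBINT y. (indicator D y)^2) * sqrt (LBINT y. (abs (v y))^2)"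
    unfolding wabs using integral_CS[OF sD sv] by linarith
   thus ?thesis by(simp add: ind2 S_def)
  qed
  define phi where "phi x = (LBINT y. rho (x - y) * w y)" for x
  have irhow: "integrable lborel (%y. rho (x - y) * w y)" for x proof(rule L1_integrable_bound[OF integrable_mult_right[OF iw, of "k * d"]])
   show "AE y in lborel. norm (rho (x - y) * w y) <= norm (k * d * w y)" proof(rule AE_I2)
    fix y have "rho (x - y) * abs (w y) <= k * d * abs (w y)" by(rule mult_right_mono[OF rho(4)]) simp
    thus "norm (rho (x - y) * w y) <= norm (k * d * w y)" using rho(1,3) d(1) by(simp add: abs_mult)
   qed
  qed simp
  have iaw: "integrable lborel (%y. abs (w y))" using iw by simp
  have phi1: "abs (phi x) <= B0 * S" for x proof -
   have "abs (phi x) <= (LBINT y. abs (rho (x - y) * w y))" unfolding phi_def by(rule integral_abs_bound)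
   also have "... <= (LBINT y. (k * d) * abs (w y))" proof(rule integral_mono)
    show "abs (rho (x - y) * w y) <= k * d * abs (w y)" for y unfolding abs_mult using rho(3,4)[of "x - y"] by(intro mult_right_mono) auto
   qed (use irhow iaw in simp_all)
   also have "... = (k * d) * (LBINT y. abs (w y))" by(rule integral_mult_right_zero)
   also have "... <= (k * (d + 1)) * (sqrt (measure lborel D) * S)" using rho(1) d w1 by(intro mult_mono mult_left_mono integral_nonneg_AE) auto
   finally show ?thesis by(simp add: B0_def mult.assoc)
  qed
  have phi2: "abs (phi x - phi x') <= B0 * S * norm (x - x')" for x x' proof -
   have "phi x - phi x' = (LBINT y. rho (x - y) * w y - rho (x' - y) * w y)" unfolding phi_def by(rule L1_integral_diff[symmetric, OF irhow irhow])
   hence "abs (phi x - phi x') <= (LBINT y. abs (rho (x - y) * w y - rho (x' - y) * w y))" using integral_abs_bound by simp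
   also have "... <= (LBINT y. (k * norm (x - x')) * abs (w y))" proof(rule integral_mono)
    show "abs (rho (x - y) * w y - rho (x' - y) * w y) <= k * norm (x - x') * abs (w y)" for y
     unfolding left_diff_distrib[symmetric] abs_mult using rho(5)[of "x - y" "x' - y"] by(intro mult_right_mono) auto
    show "integrable lborel (%y. abs (rho (x - y) * w y - rho (x' - y) * w y))" by(intro integrable_abs L1_integrable_diff irhow)
   qed (use iaw in simp)
   also have "... = (k * norm (x - x')) * (LBINT y. abs (w y))" by(rule integral_mult_right_zero)
   also have "... <= (k * norm (x - x')) * (sqrt (measure lborel D) * S)" using rho(1) w1 by(intro mult_left_mono) auto
   also have "... <= (k * (d + 1) * norm (x - x')) * (sqrt (measure lborel D) * S)" using rho(1) d S by(intro mult_right_mono mult_nonneg_nonneg) auto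
   finally show ?thesis by(simp add: B0_def mult_ac)
  qed
  have phi3: "phi x = 0" if "x \<notin> Omega" for x proof -
   have "rho (x - y) * w y = 0" for y proof(rule ccontr)
    assume "rho (x - y) * w y ~= 0"
    hence "norm (x - y) < d" "y \<in> D" using rho(6) by(auto simp: w_def indicator_def split: if_splits)
    moreover have "infdist y (- Omega) <= dist y x" using that by(intro infdist_le) auto
    ultimately show False by(simp add: D_def dist_norm norm_minus_commute)
   qed
   thus ?thesis by(simp only: phi_def L1_integral_zero)
  qed
  have phiX: "phi \<in> X0 b Omega & X0_norm b phi <= L * (B0 * S)" by(rule L(2)) (use B0 S phi1 phi2 phi3 in auto)
  have phim: "phi \<in> borel_measurable lborel" using phiX X0D(3) by blast
  define t where "t y = indicator T y * (v y)^2" for y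
  have it: "integrable lborel t" proof -
   have "(indicator T :: 'a => real) \<in> borel_measurable lborel" by(rule borel_measurable_indicator) simp
   hence "t \<in> borel_measurable lborel" unfolding t_def by measurable
   thus ?thesis by(rule L1_integrable_bound[OF X0D(5)[OF v]]) (auto simp: t_def indicator_def)
  qed
  have t1: "(LBINT y. t y) <= e / 4 * (X0_norm a v)^2" using d0(2)[OF v] by(simp add: t_def T_def)
  \<comment> \<open>\<open>k * d\<close> bounds \<open>rho\<close>, the power of \<open>d\<close>
    bounds the inverse kernel on the support of \<open>rho\<close>, and 2 comes from squaring a
    sum.\<close>
  define A where "A = 2 * (k * d * d powr (?N + 2 * a))"
  have A: "A * (LINT p|?M. (frac_diff a v p)^2) <= e / 2 * (X0_norm a v)^2" proof -
   have "A = 2 * (k * d powr (?N + 1) * d powr (2 * a))" using d(1) by(simp add: A_def powr_add)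
   also have "... <= 2 * (W * (e * ?ca / (4 * W)))" unfolding d1a[symmetric] using rho(1,2) d a W by(intro mult_left_mono mult_mono powr_mono2) auto
   also have "... = e / 2 * ?ca" using W by simp
   finally have "A * (LINT p|?M. (frac_diff a v p)^2) <= (e / 2 * ?ca) * (LINT p|?M. (frac_diff a v p)^2)"
    by(intro mult_right_mono integral_nonneg_AE) auto
   thus ?thesis unfolding X0_norm_square_eq[OF a] by(simp add: mult.assoc)
  qed
  let ?H = "%p. A * (frac_diff a v p)^2 + 2 * (t (snd p) * rho (fst p - snd p))"
  have id: "integrable ?M (%p. (frac_diff a v p)^2)" using X0D(1)[OF v] by(simp add: frac_sobolev_iff L2_fun_def)
  note sh = integrable_product_shift[OF it rho(8)]
  have iH: "integrable ?M ?H" by(intro L1_integrable_add integrable_mult_right id sh)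
  have LH: "(LINT p|?M. ?H p) <= e * (X0_norm a v)^2" proof -
   have "(LINT p|?M. ?H p) = A * (LINT p|?M. (frac_diff a v p)^2) + 2 * ((LBINT y. t y) * 1)" using id sh rho(9) by simp
   thus ?thesis using A t1 by simp
  qed
  have pt: "rho (x - y) * (v x - w y)^2 <= ?H (x, y)" if y: "y \<notin> Omega --> v y = 0" for x y proof -
   have "(v y - w y)^2 <= t y" proof(cases "y \<in> Omega & y \<notin> D")
    case True hence "y \<in> T" "w y = 0" using d by(auto simp: D_def T_def w_def)
    thus ?thesis by(simp add: t_def)
   next case False hence "w y = v y" using y by(auto simp: w_def D_def)
    thus ?thesis by(simp add: t_def)
   qed
   moreover have "(v x - w y)^2 <= 2 * (v x - v y)^2 + 2 * (v y - w y)^2"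
    using zero_le_power2[of "(v x - v y) - (v y - w y)"] by(simp add: power2_eq_square algebra_simps)
   ultimately have "(v x - w y)^2 <= 2 * (v x - v y)^2 + 2 * t y" by linarith
   hence "rho (x - y) * (v x - w y)^2 <= rho (x - y) * (2 * (v x - v y)^2 + 2 * t y)" by(intro mult_left_mono rho(3))
   also have "... = 2 * (rho (x - y) * (v x - v y)^2) + 2 * (t y * rho (x - y))" by(simp add: algebra_simps)
   also have "2 * (rho (x - y) * (v x - v y)^2) <= A * (frac_diff a v (x, y))^2" proof(cases "rho (x - y) = 0 \<or> x = y")
    case True have "A >= 0" using rho(1) d(1) by(simp add: A_def)
    thus ?thesis using True by auto
   next case False hence n: "norm (x - y) < d" "norm (x - y) > 0" using rho(6) by auto
    have "(v x - v y)^2 = (frac_diff a v (x, y))^2 * norm (x - y) powr (?N + 2 * a)" using n by(simp add: power2_eq_square frac_diff_mult)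
    also have "... <= (frac_diff a v (x, y))^2 * d powr (?N + 2 * a)" using n a by(intro mult_left_mono powr_mono2) auto
    finally have "rho (x - y) * (v x - v y)^2 <= (k * d) * ((frac_diff a v (x, y))^2 * d powr (?N + 2 * a))"
     using rho(1,3,4) d(1) by(intro mult_mono) auto
    thus ?thesis by(simp add: A_def mult_ac)
   qed
   finally show ?thesis by simp
  qed
  \<comment> \<open>Jensen's inequality for the probability density \<open>rho\<close>, obtained
    from Cauchy-Schwarz with both factors weighted by its square root.\<close>
  have L2: "AE x in lborel. (v x - phi x)^2 <= (LBINT y. ?H (x, y))" using lborel_pair.AE_integrable_fst'[OF iH] proof eventually_elim
   case (elim x) let ?f = "%y. sqrt (rho (x - y))" and ?g = "%y. sqrt (rho (x - y)) * (v x - w y)"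
   have irho: "integrable lborel (%y. rho (x - y))" "(LBINT y. rho (x - y)) = 1" using lborel_reflect_integral[OF rho(7), of x] rho(8,9) by auto
   have g2: "(?g y)^2 = rho (x - y) * (v x - w y)^2" for y by(simp add: power_mult_distrib rho(3))
   have sf: "L2_fun lborel ?f" using irho rho(3) by(simp add: L2_fun_def)
   have le: "AE y in lborel. (?g y)^2 <= ?H (x, y)" unfolding g2 using X0D(2)[OF v] by eventually_elim (rule pt)
   have gm: "?g \<in> borel_measurable lborel" by measurable
   have ig2: "integrable lborel (%y. (?g y)^2)" proof(rule L1_integrable_bound[OF elim])
    show "AE y in lborel. norm ((?g y)^2) <= norm (?H (x, y))" using le proof eventually_elim
     case (elim y) show ?case using order_trans[OF elim abs_ge_self] by simp
    qed
   qed (use gm in measurable)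
   have sg: "L2_fun lborel ?g" using ig2 gm by(simp add: L2_fun_def)
   have "v x - phi x = (LBINT y. v x * rho (x - y)) - (LBINT y. rho (x - y) * w y)" using irho by(simp add: phi_def)
   also have "... = (LBINT y. v x * rho (x - y) - rho (x - y) * w y)" by(rule L1_integral_diff[symmetric, OF integrable_mult_right[OF irho(1)] irhow])
   also have "... = (LBINT y. ?f y * ?g y)" using rho(3) by(intro L1_integral_cong refl) (simp add: algebra_simps flip: mult.assoc)
   finally have "abs (v x - phi x) <= sqrt (LBINT y. (?f y)^2) * sqrt (LBINT y. (?g y)^2)" using integral_CS[OF sf sg] by simp
   also have "(LBINT y. (?f y)^2) = 1" using irho(2) rho(3) by simp
   finally have "abs (v x - phi x) <= sqrt (LBINT y. (?g y)^2)" by simp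
   hence "(v x - phi x)^2 <= (LBINT y. (?g y)^2)" using sqrt_ge_absD by blast
   also have "... <= (LBINT y. ?H (x, y))" by(rule integral_mono_AE[OF ig2 elim le])
   finally show ?case .
  qed
  have "(LBINT x. (v x - phi x)^2) <= (LBINT x. LBINT y. ?H (x, y))" proof(rule integral_mono_AE[OF _ _ L2])
   show "integrable lborel (%x. LBINT y. ?H (x, y))" by(rule lborel_pair.integrable_fst'[OF iH])
   have "L2_fun lborel phi" using phiX X0D(4) by blast
   from L2_lincomb[OF X0D(4)[OF v] this, of 1 "-1"]
   show "integrable lborel (%x. (v x - phi x)^2)" by(simp add: L2_fun_def)
  qed
  also have "... = (LINT p|?M. ?H p)" by(rule lborel_pair.integral_fst'[OF iH])
  also have "... <= e * (X0_norm a v)^2" by(rule LH)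
  finally have est: "(LBINT x. (v x - phi x)^2) <= e * (X0_norm a v)^2" .
  have c1: "B0 * S <= (L + 1) * (B0 + 1) * S" "L * (B0 * S) <= (L + 1) * (B0 + 1) * S" proof -
   have "0 <= L * S" "0 <= B0 * S" "0 <= L * (B0 * S)" using L(1) B0 S by auto
   moreover have "(L + 1) * (B0 + 1) * S = L * (B0 * S) + L * S + B0 * S + S" by(simp add: algebra_simps)
   ultimately show "B0 * S <= (L + 1) * (B0 + 1) * S" "L * (B0 * S) <= (L + 1) * (B0 + 1) * S" using S by linarith+
  qed
  show "\<exists>phi\<in>X0 b Omega. (\<forall>x. abs (phi x) <= (L + 1) * (B0 + 1) * sqrt (L2sq v)) &
    X0_norm b phi <= (L + 1) * (B0 + 1) * sqrt (L2sq v) &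
    (LBINT x. (v x - phi x)^2) <= e * (X0_norm a v)^2" unfolding S_def[symmetric] proof(intro bexI[of _ phi] conjI allI)
   show "abs (phi x) <= (L + 1) * (B0 + 1) * S" for x by(rule order_trans[OF phi1 c1(1)])
   show "X0_norm b phi <= (L + 1) * (B0 + 1) * S" using phiX c1(2) by linarith
  qed (use phiX est in auto)
 qed qed

text \<open>Here \<open>m\<close> bounds the norm of \<open>v\<close> in the dual of the space of
  order \<open>b\<close>. With an approximation \<open>phi\<close> from that space, the squared L^2
  norm is the pairing of \<open>v\<close> with \<open>v - phi\<close> plus the pairing with
  \<open>phi\<close>. Since the energy norm of \<open>phi\<close> is at most a multiple of the L^2
  norm of \<open>v\<close>, one factor of the latter cancels.\<close>

lemma X0_Ehrling:
 fixes Omega :: "'a::euclidean_space set"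
 assumes a: "0 < a" "a < 1" and b: "0 < b" "b < 1" and op: "open Omega" and bd: "bounded Omega" and e: "e > 0"
 obtains C where "C > 0" "!!v m. v \<in> X0 a Omega ==> m >= 0 ==>
   (!!phi. phi \<in> X0 b Omega ==> abs (LBINT x. v x * phi x) <= m * X0_norm b phi) ==>
   (L2sq v) <= e * (X0_norm a v)^2 + C * m^2" proof -
 obtain C where C: "C > 0" "!!v. v \<in> X0 a Omega ==> \<exists>phi\<in>X0 b Omega.
   (\<forall>x. abs (phi x) <= C * sqrt (L2sq v)) & X0_norm b phi <= C * sqrt (L2sq v) &
   (LBINT x. (v x - phi x)^2) <= e / 2 * (X0_norm a v)^2" using X0_approximation[OF a b op bd half_gt_zero[OF e]] by blast
 show ?thesis proof(rule that[of "2 * C^2"])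
  show "2 * C^2 > 0" using C by simp
  fix v m assume v: "v \<in> X0 a Omega" and m: "m >= 0" and bound: "!!phi. phi \<in> X0 b Omega ==> abs (LBINT x. v x * phi x) <= m * X0_norm b phi"
  define S where "S = sqrt (L2sq v)"
  have S: "S >= 0" unfolding S_def by(intro real_sqrt_ge_zero integral_nonneg_AE) simp
  have S2: "(L2sq v) = S^2" unfolding S_def by(rule real_sqrt_pow2[symmetric]) (intro integral_nonneg_AE, simp)
  obtain phi where phi: "phi \<in> X0 b Omega" "X0_norm b phi <= C * S"
   "(LBINT x. (v x - phi x)^2) <= e / 2 * (X0_norm a v)^2" using C(2)[OF v] unfolding S_def by blast
  have sd: "L2_fun lborel (%x. v x - phi x)" using L2_lincomb[OF X0D(4)[OF v] X0D(4)[OF phi(1)], of 1 "-1"] by simp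
  note i = L2_mult_integrable[OF X0D(4)[OF v] sd] L2_mult_integrable[OF X0D(4)[OF v] X0D(4)[OF phi(1)]]
  define R where "R = sqrt (LBINT x. (v x - phi x)^2)"
  have R2: "R^2 <= e / 2 * (X0_norm a v)^2" proof -
   have "R^2 = (LBINT x. (v x - phi x)^2)" unfolding R_def by(rule real_sqrt_pow2) (intro integral_nonneg_AE, simp)
   thus ?thesis using phi(3) by simp
  qed
  have "S^2 = (LBINT x. v x * (v x - phi x) + v x * phi x)"
   unfolding S2[symmetric] by(intro L1_integral_cong refl) (simp add: power2_eq_square algebra_simps)
  also have "... = (LBINT x. v x * (v x - phi x)) + (LBINT x. v x * phi x)" by(rule L1_integral_add[OF i])
  also have "... <= S * R + m * (C * S)" proof(rule add_mono)
   show "(LBINT x. v x * (v x - phi x)) <= S * R" using integral_CS[OF X0D(4)[OF v] sd] unfolding S_def R_def by linarith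
   have "m * X0_norm b phi <= m * (C * S)" using phi(2) m by(intro mult_left_mono) auto
   thus "(LBINT x. v x * phi x) <= m * (C * S)" using bound[OF phi(1)] by linarith
  qed
  finally have "S * S <= S * (R + m * C)" by(simp add: power2_eq_square algebra_simps)
  hence SR: "S <= R + m * C" if "S > 0" using that by simp
  have "S^2 <= 2 * R^2 + 2 * (m * C)^2" proof(cases "S > 0")
   case True have "S^2 <= (R + m * C)^2" using SR[OF True] S by(intro power_mono) auto
   also have "... <= 2 * R^2 + 2 * (m * C)^2" using zero_le_power2[of "R - m * C"] by(simp add: power2_eq_square algebra_simps)
   finally show ?thesis .
  next case False hence "S = 0" using S by simp
   thus ?thesis by simp
  qed
  thus "(L2sq v) <= e * (X0_norm a v)^2 + 2 * C^2 * m^2" unfolding S2 using R2 by(simp add: power_mult_distrib mult_ac)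
 qed qed

section \<open>Boundedness of subsolutions\<close>

text \<open>Positive upper bounds \<open>A\<close> and \<open>B\<close> stand in for the norms, so
  Young's inequality can be applied to quotients without a case distinction for vanishing
  norms.\<close>

lemma integral_Holder:
 fixes f g :: "'b => real"
 assumes pq: "p > 1" "q > 1" "1 / p + 1 / q = 1" and [measurable]: "f \<in> borel_measurable M" "g \<in> borel_measurable M"
  and f: "integrable M (%x. abs (f x) powr p)" "(LINT x|M. abs (f x) powr p) <= A powr p"
  and g: "integrable M (%x. abs (g x) powr q)" "(LINT x|M. abs (g x) powr q) <= B powr q" and AB: "A > 0" "B > 0"
 shows "integrable M (%x. f x * g x)" "(LINT x|M. abs (f x * g x)) <= A * B" proof -
 let ?k = "%x. A * B * (abs (f x) powr p / (p * A powr p) + abs (g x) powr q / (q * B powr q))"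
 have ik: "integrable M ?k" using f(1) g(1) by simp
 have le: "abs (f x * g x) <= ?k x" for x proof -
  have "(abs (f x) / A) * (abs (g x) / B) <= (abs (f x) / A) powr p / p + (abs (g x) / B) powr q / q" by(rule Youngs_inequality) (use pq AB in auto)
  also have "... = abs (f x) powr p / (p * A powr p) + abs (g x) powr q / (q * B powr q)" using AB by(simp add: powr_divide mult.commute)
  finally have "(A * B) * ((abs (f x) / A) * (abs (g x) / B)) <= ?k x" using AB by(intro mult_left_mono) auto
  moreover have "(A * B) * ((abs (f x) / A) * (abs (g x) / B)) = abs (f x * g x)" using AB by(simp add: abs_mult)
  ultimately show ?thesis by simp
 qed
 show i: "integrable M (%x. f x * g x)" proof(rule L1_integrable_bound[OF ik])
  show "AE x in M. norm (f x * g x) <= norm (?k x)" using le by(intro AE_I2) (metis abs_ge_self order_trans real_norm_def)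
 qed simp
 have "(LINT x|M. abs (f x * g x)) <= (LINT x|M. ?k x)" by(rule integral_mono[OF integrable_abs[OF i] ik le])
 also have "... = A * B * ((LINT x|M. abs (f x) powr p) / (p * A powr p) + (LINT x|M. abs (g x) powr q) / (q * B powr q))" using f(1) g(1) by simp
 also have "... <= A * B * (1 / p + 1 / q)" proof(intro mult_left_mono add_mono)
  show "(LINT x|M. abs (f x) powr p) / (p * A powr p) <= 1 / p" using f(2) pq AB by(simp add: field_simps)
  show "(LINT x|M. abs (g x) powr q) / (q * B powr q) <= 1 / q" using g(2) pq AB by(simp add: field_simps)
 qed (use AB in auto)
 finally show "(LINT x|M. abs (f x * g x)) <= A * B" using pq by simp
qed

text \<open>On the levels \<open>k n\<close>, which increase to \<open>d\<close>, the measure decays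
  like \<open>2 powr (- (n * q / beta))\<close>: \<open>d\<close> is chosen such that the
  superlinear power on the right reproduces this rate exactly.\<close>

lemma Stampacchia_iteration:
 fixes mu :: "real => real"
 assumes nn: "!!k. 0 <= mu k" and anti: "!!k l. k <= l ==> mu l <= mu k"
  and mu0: "mu 0 <= m0" "m0 > 0" and A: "A > 0" and q: "q > 0" and beta: "beta > 0"
  and step: "!!k l. 0 <= k ==> k < l ==> mu l <= (A / (l - k)) powr q * mu k powr (1 + beta)"
 shows "mu (A * m0 powr (beta / q) * 2 powr (1 + 1 / beta)) = 0" proof -
 define d where "d = A * m0 powr (beta / q) * 2 powr (1 + 1 / beta)"
 have d: "d > 0" using A mu0 by(simp add: d_def)
 define k where "k n = d * (1 - 2 powr (- real n))" for n
 have k0: "0 <= k n" for n proof -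
  have "2 powr (- real n) <= (2::real) powr 0" by(intro powr_mono) auto
  thus ?thesis unfolding k_def using d by(intro mult_nonneg_nonneg) auto
 qed
 have kd: "k n <= d" for n unfolding k_def using d by(simp add: mult_left_le)
 have kS: "k (Suc n) - k n = d * 2 powr (- real (Suc n))" for n proof -
  have "2 powr (- real n) = 2 * 2 powr (- real (Suc n))" by(simp add: powr_diff powr_minus field_simps powr_add)
  thus ?thesis unfolding k_def by(simp add: algebra_simps)
 qed
 have main: "mu (k n) <= m0 * 2 powr (- (real n * q / beta))" for n proof(induction n)
  case 0 thus ?case using mu0 by(simp add: k_def)
 next case (Suc n) have lt: "k n < k (Suc n)" using kS[of n] d by(simp add: algebra_simps)
  have "mu (k (Suc n)) <= (A / (d * 2 powr (- real (Suc n)))) powr q * mu (k n) powr (1 + beta)" using step[OF k0 lt] by(simp add: kS)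
  also have "... <= (A / (d * 2 powr (- real (Suc n)))) powr q * (m0 * 2 powr (- (real n * q / beta))) powr (1 + beta)"
   using Suc nn beta by(intro mult_left_mono powr_mono2) auto
  also have "A / (d * 2 powr (- real (Suc n))) = m0 powr (- beta / q) * 2 powr (real n - 1 / beta)" proof -
   have "2 powr (1 + 1 / beta) * 2 powr (- real (Suc n)) = (2::real) powr (- (real n - 1 / beta))" by(simp flip: powr_add)
   hence "d * 2 powr (- real (Suc n)) = A * m0 powr (beta / q) * 2 powr (- (real n - 1 / beta))" by(simp add: d_def mult.assoc)
   moreover have "(2::real) powr (real n - 1 / beta) = 1 / 2 powr (- (real n - 1 / beta))"
    using powr_minus_divide[of 2 "- (real n - 1 / beta)"] by simp
   moreover have "m0 powr (- beta / q) = 1 / m0 powr (beta / q)" using powr_minus_divide[of m0 "beta / q"] by simp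
   ultimately show ?thesis using A by(simp only: times_divide_times_eq mult_1_left mult.assoc) simp
  qed
  also have "(m0 powr (- beta / q) * 2 powr (real n - 1 / beta)) powr q * (m0 * 2 powr (- (real n * q / beta))) powr (1 + beta)
    = (m0 powr (- beta) * m0 powr (1 + beta)) * (2 powr ((real n - 1 / beta) * q) * 2 powr (- (real n * q / beta) * (1 + beta)))"
   using mu0 q by(simp add: powr_mult powr_powr mult_ac)
  also have "m0 powr (- beta) * m0 powr (1 + beta) = m0" using mu0 by(simp flip: powr_add)
  also have "(2::real) powr ((real n - 1 / beta) * q) * 2 powr (- (real n * q / beta) * (1 + beta)) = 2 powr (- (real (Suc n) * q / beta))"
   unfolding powr_add[symmetric] using beta by(intro arg_cong2[where f="(powr)"] refl) (simp add: field_simps)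
  finally show ?case .
 qed
 have "mu d <= 0" proof(rule field_le_epsilon)
  fix e :: real assume e: "e > 0"
  have "(%n. m0 * (2 powr (- (q / beta))) ^ n) ----> m0 * 0" proof(intro tendsto_mult tendsto_const LIMSEQ_power_zero)
   show "norm (2 powr (- (q / beta)) :: real) < 1" using q beta by(simp add: powr_less_one)
  qed
  hence "\<forall>\<^sub>F n in sequentially. m0 * (2 powr (- (q / beta))) ^ n < e" using e by(intro order_tendstoD(2)) auto
  then obtain n where n: "m0 * (2 powr (- (q / beta))) ^ n < e" unfolding eventually_sequentially by blast
  have "mu d <= mu (k n)" by(rule anti[OF kd])
  also have "... <= m0 * 2 powr (- (real n * q / beta))" by(rule main)
  also have "2 powr (- (real n * q / beta)) = ((2::real) powr (- (q / beta))) ^ n" by(simp add: powr_realpow[symmetric] powr_powr mult.commute)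
  finally show "mu d <= 0 + e" using n by simp
 qed
 thus ?thesis using nn[of d] by(simp add: d_def)
qed

text \<open>Chebyshev and Sobolev bound the measure of a higher level set by the energy of the
  truncation. The energy inequality and two applications of Hoelder bound this energy by a power of
  the measure of the lower level set. The bound \<open>m0\<close> is kept explicit because
  \<open>m0 powr delta\<close> provides the smallness on small balls.\<close>

lemma Stampacchia_bound:
 fixes Omega :: "'a::euclidean_space set" and phi h :: "'a => real"
 assumes a: "0 < a" "a < 1" and q: "q > 2" and C: "C > 0" and Sob: "!!v. v \<in> X0 a Omega ==> Lq_integrable q v"
   "!!v. v \<in> X0 a Omega ==> (Lq_int q v) <= (C * X0_norm a v) powr q" and p: "p > 1" and delta: "delta = 1 - 1 / p - 2 / q" "delta > 0"
  and h: "h \<in> borel_measurable lborel" "Lq_integrable p h"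
   "(Lq_int p h) <= H powr p" and H: "H > 0" and phiX: "!!k. k >= 0 ==> (%x. max 0 (phi x - k)) \<in> X0 a Omega"
  and phiE: "!!k. k >= 0 ==> (X0_norm a (%x. max 0 (phi x - k)))^2 <= (LBINT x. abs (h x * max 0 (phi x - k)))"
  and phim: "phi \<in> borel_measurable lborel" and B: "B \<in> sets borel" "emeasure lborel B < \<infinity>" "measure lborel B <= m0" "m0 > 0"
  and phiB: "AE x in lborel. x \<notin> B --> phi x <= 0"
 shows "AE x in lborel. phi x <= 2 powr (1 + 1 / (q * delta)) * C^2 * H * m0 powr delta" proof -
 note phim[measurable]
 define S where "S k = {x \<in> B. phi x > k}" for k
 have Sm[measurable]: "S k \<in> sets borel" for k proof -
  have "B \<inter> {x. phi x > k} \<in> sets borel" using B(1) phim by(intro sets.Int) (simp_all add: borel_measurable_iff_greater)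
  thus ?thesis by(simp add: S_def Int_def)
 qed
 have Sfin: "emeasure lborel (S k) < \<infinity>" for k proof -
  have "emeasure lborel (S k) <= emeasure lborel B" using B(1) by(intro emeasure_mono) (auto simp: S_def)
  thus ?thesis using B(2) by(rule le_less_trans)
 qed
 have iS: "integrable lborel (indicator (S k) :: 'a => real)" for k using Sfin[of k] Sm by(simp add: integrable_indicator_iff)
 define mu where "mu k = measure lborel (S k)" for k
 have nn: "0 <= mu k" for k by(simp add: mu_def)
 have anti: "mu l <= mu k" if "k <= l" for k l
  unfolding mu_def by(rule measure_mono_fmeasurable) (use that Sfin[of k] in \<open>auto simp: S_def[of k] S_def[of l] fmeasurable_def Sm[unfolded S_def]\<close>)
 have mu0: "mu 0 <= m0" proof -
  have "mu 0 <= measure lborel B"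
   unfolding mu_def by(rule measure_mono_fmeasurable) (use B in \<open>auto simp: S_def fmeasurable_def Sm[unfolded S_def]\<close>)
  thus ?thesis using B(3) by simp
 qed
 define p' where "p' = 1 / (1 - 1 / p)"
 have p': "p' > 1" using p by(simp add: p'_def field_simps)
 have ip': "1 / p' = 1 - 1 / p" by(simp add: p'_def)
 have qp': "q / p' > 1" proof -
  have "1 / q > 0" "2 / q = 1 / q + 1 / q" using q by auto
  hence "1 - 1 / p > 1 / q" using delta by linarith
  hence "q * (1 / p') > 1" using q unfolding ip' by(simp add: field_simps)
  thus ?thesis by simp
 qed
 \<comment> \<open>The Hoelder partner of \<open>q / p'\<close>: it trades the norm of exponent
   \<open>p'\<close> for that of exponent \<open>q\<close> and a power of the measure of the level
   set.\<close>
 define r where "r = 1 / (1 - p' / q)"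
 have ir: "1 / r = 1 - p' / q" by(simp add: r_def)
 have r1: "r > 1" using qp' p' q by(simp add: r_def field_simps)
 have step: "mu l <= (C^2 * H / (l - k)) powr q * mu k powr (1 + q * delta)" if k: "0 <= k" and kl: "k < l" for k l proof(cases "mu k = 0")
  case True hence "mu l = 0" using anti[of k l] nn[of l] kl by simp
  thus ?thesis by simp
 next case False hence mk: "mu k > 0" using nn[of k] by simp
  define psi where "psi x = max 0 (phi x - k)" for x
  have psim[measurable]: "psi \<in> borel_measurable lborel" unfolding psi_def by measurable
  have psiX: "psi \<in> X0 a Omega" using phiX[OF k] by(simp add: psi_def[abs_def])
  define n where "n = X0_norm a psi"
  have n0: "n >= 0" unfolding n_def by(rule X0_norm_ge0[OF a])
  have iq: "Lq_integrable q psi" "(Lq_int q psi) <= (C * n) powr q" using Sob psiX by(auto simp: n_def)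
  have cheb: "(l - k) powr q * mu l <= (C * n) powr q" proof -
   have "(l - k) powr q * mu l = (LBINT x. (l - k) powr q * indicator (S l) x)" by(simp add: mu_def)
   also have "... <= (Lq_int q psi)" proof(rule integral_mono[OF integrable_mult_right[OF iS] iq(1)])
    fix x show "(l - k) powr q * indicator (S l) x <= abs (psi x) powr q" proof(cases "x \<in> S l")
     case True hence "l - k <= psi x" by(auto simp: psi_def S_def le_max_iff_disj)
     hence "(l - k) powr q <= abs (psi x) powr q" using kl q by(intro powr_mono2) auto
     thus ?thesis using True by simp
    qed simp
   qed
   finally show ?thesis using iq(2) by simp
  qed
  show ?thesis proof(cases "n = 0")
   case True hence "mu l <= 0" using cheb kl by(simp add: mult_le_0_iff)
   hence "mu l = 0" using nn[of l] by simp
   thus ?thesis by simp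
  next case False hence n: "n > 0" using n0 by simp
   have psiS: "AE x in lborel. x \<notin> S k --> psi x = 0" using phiB by eventually_elim (use k in \<open>auto simp: psi_def S_def\<close>)
   have pw: "abs (abs (psi x) powr p') powr (q / p') = abs (psi x) powr q" for x using p' by(simp add: powr_powr)
   have "(LBINT x. abs (abs (psi x) powr p' * indicator (S k) x)) <= ((C * n) powr p') * (mu k powr (1 / r))"
   proof(rule integral_Holder(2)[OF qp' r1])
    show "1 / (q / p') + 1 / r = 1" using q p' by(simp add: ir)
    show "integrable lborel (%x. abs (abs (psi x) powr p') powr (q / p'))" unfolding pw by(rule iq(1))
    show "(LBINT x. abs (abs (psi x) powr p') powr (q / p')) <= ((C * n) powr p') powr (q / p')" unfolding pw using iq(2) p' by(simp add: powr_powr)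
    have ind: "abs (indicator (S k) x) powr r = (indicator (S k) x :: real)" for x by(simp add: indicator_def)
    show "integrable lborel (%x. abs (indicator (S k) x :: real) powr r)" unfolding ind by(rule iS)
    show "(LBINT x. abs (indicator (S k) x :: real) powr r) <= (mu k powr (1 / r)) powr r" unfolding ind using r1 mk by(simp add: powr_powr mu_def)
    show "(indicator (S k) :: 'a => real) \<in> borel_measurable lborel" using iS by(rule borel_measurable_integrable)
   qed (use C n mk in auto)
   moreover have eq: "AE x in lborel. abs (psi x) powr p' = abs (abs (psi x) powr p' * indicator (S k) x)"
    using psiS by eventually_elim (auto simp: indicator_def)
   moreover have Sr: "(indicator (S k) :: 'a => real) \<in> borel_measurable lborel" using iS by(rule borel_measurable_integrable)
   moreover have "(LBINT x. abs (psi x) powr p') = (LBINT x. abs (abs (psi x) powr p' * indicator (S k) x))"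
    by(rule integral_cong_AE[OF _ _ eq]) (use Sr in measurable)
   ultimately have Lp': "(LBINT x. abs (psi x) powr p') <= (C * n * mu k powr (1 / (r * p'))) powr p'"
    using C n mk p' by(simp add: powr_mult powr_powr)
   have ip'i: "integrable lborel (%x. abs (psi x) powr p')" proof(rule L1_integrable_bound[OF L1_integrable_add[OF iS[of k] iq(1)]])
    show "AE x in lborel. norm (abs (psi x) powr p') <= norm (indicator (S k) x + abs (psi x) powr q)" using psiS proof eventually_elim
     case (elim x) show ?case proof(cases "x \<in> S k")
      case True have "abs (psi x) powr p' <= 1 + abs (psi x) powr q" proof(cases "abs (psi x) <= 1")
       case True hence "abs (psi x) powr p' <= 1 powr p'" using p' by(intro powr_mono2) auto
       thus ?thesis by(simp add: add_increasing2)
      next case False have "p' <= q" using qp' p' by(simp add: field_simps)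
       hence "abs (psi x) powr p' <= abs (psi x) powr q" using False by(intro powr_mono) auto
       thus ?thesis by simp
      qed
      thus ?thesis using True by simp
     qed (use elim in simp)
    qed
   qed measurable
   have "n^2 <= (LBINT x. abs (h x * psi x))" using phiE[OF k] by(simp add: n_def psi_def[abs_def])
   also have "... <= H * (C * n * mu k powr (1 / (r * p')))"
    by(rule integral_Holder(2)[OF p p' _ h(1) psim h(2,3) ip'i Lp' H]) (use C n mk in \<open>auto simp: ip'\<close>)
   finally have "n * n <= n * (H * C * mu k powr (1 / (r * p')))" by(simp add: power2_eq_square mult_ac)
   hence "n <= H * C * mu k powr (1 / (r * p'))" using n by(simp add: mult_le_cancel_left)
   hence "(C * n) powr q <= (C * (H * C * mu k powr (1 / (r * p')))) powr q" using C n q by(intro powr_mono2 mult_left_mono) auto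
   also have "... = (C^2 * H) powr q * mu k powr (q / (r * p'))" using C H mk by(simp add: powr_mult powr_powr power2_eq_square mult_ac)
   \<comment> \<open>It is the positive \<open>delta\<close> that lifts this exponent above 1 and
     makes the recursion superlinear.\<close>
   also have "q / (r * p') = 1 + q * delta" proof -
    have "q / (r * p') = q * ((1 / r) * (1 / p'))" by simp
    also have "... = q * ((1 / p') - 1 / q)" unfolding ir using p' q by(simp add: field_simps)
    also have "... = q * (1 - 1 / p) - 1" unfolding ip' using q by(simp add: field_simps)
    also have "... = 1 + q * delta" unfolding delta(1) using q by(simp add: algebra_simps)
    finally show ?thesis .
   qed
   finally have "(l - k) powr q * mu l <= (C^2 * H) powr q * mu k powr (1 + q * delta)" using cheb by simp
   hence "mu l <= (C^2 * H) powr q * mu k powr (1 + q * delta) / (l - k) powr q" using kl by(simp add: pos_le_divide_eq mult.commute)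
   thus ?thesis using C H kl by(simp add: powr_divide)
  qed qed
 have "mu (C^2 * H * m0 powr (q * delta / q) * 2 powr (1 + 1 / (q * delta))) = 0"
  by(rule Stampacchia_iteration[OF nn anti mu0 B(4) _ _ _ step]) (use C H q delta(2) in auto)
 moreover define d where "d = 2 powr (1 + 1 / (q * delta)) * C^2 * H * m0 powr delta"
 ultimately have "mu d = 0" using q by(simp add: mult_ac)
 hence "emeasure lborel (S d) = 0" using Sfin[of d] by(auto simp: mu_def measure_def enn2real_eq_0_iff)
 hence "S d \<in> null_sets lborel" using Sm by(simp add: null_sets_def)
 hence "AE x in lborel. x \<notin> S d" by(rule AE_not_in)
 hence "AE x in lborel. phi x <= d" using phiB proof eventually_elim
  case (elim x) have "0 <= d" using C H B(4) by(simp add: d_def)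
  thus ?case using elim by(auto simp: S_def not_less)
 qed
 thus ?thesis by(simp add: d_def)
qed

section \<open>Oscillation decay\<close>

text \<open>A concave paraboloid, cut off at 0. The kink at the sphere is convex, so the function is
  semiconvex: its second differences are bounded on the side that is needed against nonnegative test
  functions.\<close>

definition cutoff :: "'a::euclidean_space => real => 'a => real" where
 "cutoff x0 s x = max 0 (1 - (norm (x - x0) / s)^2)"

lemma cutoff_bounds: "0 <= cutoff x0 s x" "cutoff x0 s x <= 1" by(auto simp: cutoff_def)

lemma cutoff_outside: "s > 0 ==> x \<notin> ball x0 s ==> cutoff x0 s x = 0" by(simp add: cutoff_def dist_norm norm_minus_commute)

lemma cutoff_Lipschitz:
 assumes s: "s > 0"
 shows "abs (cutoff x0 s x - cutoff x0 s y) <= 2 / s * norm (x - y)" proof -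
 have cl: "cutoff x0 s z = 1 - (min 1 (norm (z - x0) / s))^2" for z proof(cases "norm (z - x0) / s <= 1")
  case True hence "(norm (z - x0) / s)^2 <= 1" using s by(intro power_le_one) auto
  thus ?thesis using True by(simp add: cutoff_def min_def)
 next case False hence "1 <= (norm (z - x0) / s)^2" by(intro one_le_power) auto
  thus ?thesis using False by(simp add: cutoff_def min_def)
 qed
 define p q where "p = min 1 (norm (x - x0) / s)" and "q = min 1 (norm (y - x0) / s)"
 have pq: "0 <= p" "p <= 1" "0 <= q" "q <= 1" using s by(auto simp: p_def q_def)
 have "abs (p - q) <= abs (norm (x - x0) / s - norm (y - x0) / s)" by(auto simp: p_def q_def min_def)
 also have "... = abs (norm (x - x0) - norm (y - x0)) / s" using s by(simp add: diff_divide_distrib[symmetric])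
 also have "... <= norm (x - y) / s" using norm_triangle_ineq3[of "x - x0" "y - x0"] s by(intro divide_right_mono) auto
 finally have d: "abs (p - q) <= norm (x - y) / s" .
 have "abs (cutoff x0 s x - cutoff x0 s y) = abs (p - q) * abs (p + q)"
  unfolding cl p_def[symmetric] q_def[symmetric] abs_mult[symmetric] by(simp add: power2_eq_square algebra_simps abs_minus_commute)
 also have "... <= (norm (x - y) / s) * 2" using d pq by(intro mult_mono) auto
 finally show ?thesis by(simp add: mult.commute)
qed

text \<open>At \<open>x\<close> the cutoff equals the paraboloid, elsewhere it is at least the
  paraboloid, and for the paraboloid the second difference follows from the parallelogram
  law.\<close>

lemma cutoff_semiconvex:
 assumes s: "s > 0" and x: "x \<in> ball x0 s"
 shows "2 * cutoff x0 s x - cutoff x0 s (x + z) - cutoff x0 s (x - z) <= 2 * min 1 ((norm z / s)^2)" proof -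
 have "2 * cutoff x0 s x <= 2" "0 <= cutoff x0 s (x + z)" "0 <= cutoff x0 s (x - z)" using cutoff_bounds[of x0 s] by auto
 hence 1: "2 * cutoff x0 s x - cutoff x0 s (x + z) - cutoff x0 s (x - z) <= 2" by linarith
 have "norm (x - x0) / s <= 1" using x s by(simp add: dist_norm norm_minus_commute)
 hence "(norm (x - x0) / s)^2 <= 1" using s by(intro power_le_one) auto
 hence e: "cutoff x0 s x = 1 - (norm (x - x0) / s)^2" by(simp add: cutoff_def)
 have l: "cutoff x0 s y >= 1 - (norm (y - x0) / s)^2" for y by(simp add: cutoff_def)
 define w where "w = x - x0"
 have "(norm (w + z))^2 + (norm (w - z))^2 = 2 * (norm w)^2 + 2 * (norm z)^2" by(simp add: power2_norm_eq_inner inner_simps inner_commute)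
 hence "((norm (w + z))^2 + (norm (w - z))^2) / s^2 = (2 * (norm w)^2 + 2 * (norm z)^2) / s^2" by simp
 hence "(norm (w + z) / s)^2 + (norm (w - z) / s)^2 = 2 * (norm w / s)^2 + 2 * (norm z / s)^2" by(simp add: power_divide add_divide_distrib)
 moreover have xz: "x + z - x0 = w + z" "x - z - x0 = w - z" by(auto simp: w_def)
 ultimately have 2: "2 * cutoff x0 s x - cutoff x0 s (x + z) - cutoff x0 s (x - z) <= 2 * (norm z / s)^2"
  using e[folded w_def] l[of "x + z", unfolded xz] l[of "x - z", unfolded xz] by linarith
 show ?thesis using 1 2 by(simp add: min_def)
qed

lemma cutoff_in_X0:
 fixes x0 :: "'a::euclidean_space"
 assumes a: "0 < a" "a < 1" and s: "s > 0"
 shows "cutoff x0 s \<in> X0 a (ball x0 s)" proof -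
 obtain C where C: "C > 0" "!!phi B. B >= 0 ==> (\<forall>x. abs (phi x) <= B) ==> (\<forall>x y. abs (phi x - phi y) <= B * norm (x - y)) ==>
   (\<forall>x. x \<notin> ball x0 s --> phi x = 0) ==> phi \<in> X0 a (ball x0 s) & X0_norm a phi <= C * B"
  using Lipschitz_in_X0[OF a bounded_ball, of x0 s] by blast
 have "abs (cutoff x0 s x - cutoff x0 s y) <= (2 / s + 1) * norm (x - y)" for x y
  using cutoff_Lipschitz[OF s, of x0 x y] by(simp add: distrib_right add_increasing2)
 moreover have "abs (cutoff x0 s x) <= 2 / s + 1" for x using cutoff_bounds[of x0 s x] s by(simp add: add_increasing)
 ultimately have "cutoff x0 s \<in> X0 a (ball x0 s) & X0_norm a (cutoff x0 s) <= C * (2 / s + 1)"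
  using cutoff_outside[OF s, of _ x0] s by(intro C(2)) (simp_all add: add_nonneg_nonneg)
 thus ?thesis ..
qed

text \<open>The increments in \<open>y\<close> are rewritten as second differences \<open>2 eta(x) - eta(x+z) - eta(x-z)\<close>, for which
 the kernel is integrable.\<close>
lemma frac_op_cutoff_le:
 fixes x0 :: "'a::euclidean_space"
 assumes a: "0 < a" "a < 1" and s: "s > 0" and psi: "psi \<in> frac_sobolev a" and nn: "!!x. 0 <= psi x"
  and supp: "!!x. x \<notin> ball x0 s ==> psi x = 0"
 shows "frac_op a (cutoff x0 s) psi <=
  frac_const DIM('a) a * (LBINT z. kmin a (z::'a)) * s powr (- 2 * a) * (LBINT x. psi x)" proof -
 let ?N = "real DIM('a)" and ?M = "lborel2 :: ('a \<times> 'a) measure" and ?eta = "cutoff x0 s"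
 have c: "frac_const DIM('a) a > 0" using frac_const_pos[OF a, where 'a='a] by simp
 have psim[measurable]: "psi \<in> borel_measurable borel" using psi by(simp add: frac_sobolev_def)
 have etaX: "?eta \<in> frac_sobolev a" using cutoff_in_X0[OF a s] by(rule X0D(1))
 have etam[measurable]: "?eta \<in> borel_measurable borel" using X0D(3)[OF cutoff_in_X0[OF a s]] by simp
 have iB: "integrable lborel (indicator (ball x0 s) :: 'a => real)"
  using emeasure_bounded_finite[OF bounded_ball, of x0 s] by(simp add: integrable_indicator_iff)
 have sB: "L2_fun lborel (indicator (ball x0 s) :: 'a => real)" proof -
  have "(indicator (ball x0 s) x)^2 = (indicator (ball x0 s) x :: real)" for x by(simp add: indicator_def)
  thus ?thesis using iB by(simp add: L2_fun_def)
 qed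
 have spsi: "L2_fun lborel psi" using psi by(simp add: frac_sobolev_iff)
 have "integrable lborel (%x. indicator (ball x0 s) x * psi x)" by(rule L2_mult_integrable[OF sB spsi])
 moreover have "indicator (ball x0 s) x * psi x = psi x" for x using supp[of x] by(auto simp: indicator_def)
 ultimately have ipsi: "integrable lborel psi" by simp
 define J where "J = (LBINT x. psi x)"
 have J: "J >= 0" unfolding J_def by(intro integral_nonneg_AE AE_I2 nn)
 define k where "k z = 1 / norm z powr (?N + 2 * a)" for z :: 'a
 have km[measurable]: "k \<in> borel_measurable borel" unfolding k_def by measurable
 have k0: "k z >= 0" for z by(simp add: k_def)
 have kneg: "k (- z) = k z" for z by(simp add: k_def)
 let ?f = "%p. frac_diff a ?eta p * frac_diff a psi p"
 \<comment> \<open>The integrand in the coordinates \<open>x\<close> and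
   \<open>z = y - x\<close>.\<close>
 define g where "g x z = (?eta x - ?eta (x + z)) * (psi x - psi (x + z)) * k z" for x z
 have fg: "?f (x, x + z) = g x z" for x z by(simp add: frac_diff_mult g_def k_def)
 have iF: "integrable ?M ?f" using etaX psi by(auto simp: frac_sobolev_iff intro: L2_mult_integrable)
 have tr: "integrable lborel (%z. g x z) \<longleftrightarrow> integrable lborel (%y. ?f (x, y))"
   "(LBINT z. g x z) = (LBINT y. ?f (x, y))"
   "(LBINT z. abs (g x z)) = (LBINT y. abs (?f (x, y)))" for x proof -
  have fe: "(%y. ?f (x, y)) = (%y. (?eta x - ?eta y) * (psi x - psi y) / norm (x - y) powr (?N + 2 * a))" by(simp add: frac_diff_mult)
  have fm: "(%y. ?f (x, y)) \<in> borel_measurable borel" unfolding fe by measurable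
  have fm': "(%y. abs (?f (x, y))) \<in> borel_measurable borel" using fm by simp
  show "integrable lborel (%z. g x z) \<longleftrightarrow> integrable lborel (%y. ?f (x, y))" "(LBINT z. g x z) = (LBINT y. ?f (x, y))"
   using lborel_translate_integral[OF fm, of x] unfolding fg by auto
  show "(LBINT z. abs (g x z)) = (LBINT y. abs (?f (x, y)))" using lborel_translate_integral(2)[OF fm', of x] unfolding fg by auto
 qed
 have iG: "integrable ?M (%p. g (fst p) (snd p))" proof(rule lborel_pair.Fubini_integrable)
  show "(%p. g (fst p) (snd p)) \<in> borel_measurable ?M" unfolding g_def by measurable
  show "integrable lborel (%x. LBINT y. norm (g (fst (x, y)) (snd (x, y))))"
   using lborel_pair.integrable_fst'[OF integrable_abs[OF iF]] by(simp add: tr(3))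
  show "AE x in lborel. integrable lborel (%y. g (fst (x, y)) (snd (x, y)))" using lborel_pair.AE_integrable_fst'[OF iF] by(simp add: tr(1))
 qed
 have swap: "(LINT p|?M. ?f p) = (LBINT z. LBINT x. g x z)" proof -
  have "(LINT p|?M. ?f p) = (LBINT x. LBINT y. ?f (x, y))" by(rule lborel_pair.integral_fst'[OF iF, symmetric])
  also have "... = (LBINT x. LBINT z. g x z)" by(simp only: tr(2))
  also have "... = (LBINT z. LBINT x. g x z)" by(rule lborel_pair.Fubini_integral[symmetric]) (use iG in \<open>simp add: case_prod_unfold\<close>)
  finally show ?thesis .
 qed
 have bnd: "integrable lborel (%x. h x * psi x)" if "h \<in> borel_measurable borel" "!!x. abs (h x) <= 4" for h
 proof(rule L1_integrable_bound[OF integrable_mult_right[OF ipsi, of 4]])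
  show "(%x. h x * psi x) \<in> borel_measurable lborel" using that(1) by simp
  show "AE x in lborel. norm (h x * psi x) <= norm (4 * psi x)" using that(2) nn by(intro AE_I2) (simp add: abs_mult mult_right_mono)
 qed
 have cb: "abs (?eta x - ?eta y) <= 4" for x y using cutoff_bounds[of x0 s x] cutoff_bounds[of x0 s y] by(simp add: abs_le_iff)
 \<comment> \<open>Translating \<open>x\<close> in the term with \<open>psi (x + z)\<close> collects
   all increments of the cutoff in front of \<open>psi x\<close>.\<close>
 have inner: "(LBINT x. g x z) <= 2 * min 1 ((norm z / s)^2) * k z * J" for z proof -
  have m1: "(%x. ?eta x - ?eta (x + z)) \<in> borel_measurable borel" "(%x. ?eta (x - z) - ?eta x) \<in> borel_measurable borel" by measurable
  have i1: "integrable lborel (%x. (?eta x - ?eta (x + z)) * psi x)" by(rule bnd[OF m1(1) cb])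
  have i2: "integrable lborel (%x. (?eta (x - z) - ?eta x) * psi x)" by(rule bnd[OF m1(2) cb])
  have m2: "(%x. (?eta (x - z) - ?eta x) * psi x) \<in> borel_measurable borel" by measurable
  have i3: "integrable lborel (%x. (?eta x - ?eta (x + z)) * psi (x + z))"
   "(LBINT x. (?eta x - ?eta (x + z)) * psi (x + z)) = (LBINT x. (?eta (x - z) - ?eta x) * psi x)"
   using lborel_translate_integral[OF m2, of z] i2 by(simp_all add: add.commute)
  have "(LBINT x. g x z) = (LBINT x. k z * ((?eta x - ?eta (x + z)) * psi x - (?eta x - ?eta (x + z)) * psi (x + z)))"
   by(intro L1_integral_cong refl) (simp add: g_def algebra_simps)
  also have "... = k z * ((LBINT x. (?eta x - ?eta (x + z)) * psi x) - (LBINT x. (?eta (x - z) - ?eta x) * psi x))" using i1 i3 by simp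
  finally have e1: "(LBINT x. g x z) = k z * ((LBINT x. (?eta x - ?eta (x + z)) * psi x) - (LBINT x. (?eta (x - z) - ?eta x) * psi x))" .
  have "(LBINT x. (?eta x - ?eta (x + z)) * psi x) - (LBINT x. (?eta (x - z) - ?eta x) * psi x)
    = (LBINT x. (?eta x - ?eta (x + z)) * psi x - (?eta (x - z) - ?eta x) * psi x)" by(rule L1_integral_diff[symmetric, OF i1 i2])
  also have "... <= (LBINT x. 2 * min 1 ((norm z / s)^2) * psi x)"
  proof(rule integral_mono[OF L1_integrable_diff[OF i1 i2] integrable_mult_right[OF ipsi]])
   fix x
   show "(?eta x - ?eta (x + z)) * psi x - (?eta (x - z) - ?eta x) * psi x <= 2 * min 1 ((norm z / s)^2) * psi x" proof(cases "x \<in> ball x0 s")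
    case True have "(2 * ?eta x - ?eta (x + z) - ?eta (x - z)) * psi x <= 2 * min 1 ((norm z / s)^2) * psi x"
     by(rule mult_right_mono[OF cutoff_semiconvex[OF s True] nn])
    thus ?thesis by(simp add: algebra_simps)
   next case False thus ?thesis using supp by simp
   qed qed
  also have "(LBINT x. 2 * min 1 ((norm z / s)^2) * psi x) = 2 * min 1 ((norm z / s)^2) * J" unfolding J_def by(rule integral_mult_right_zero)
  finally have "(LBINT x. g x z) <= k z * (2 * min 1 ((norm z / s)^2) * J)" unfolding e1 by(rule mult_left_mono) (rule k0)
  thus ?thesis by(simp add: mult_ac)
 qed
 \<comment> \<open>Scaling by \<open>s\<close> reduces the kernel to \<open>kmin\<close>; together
   with the Jacobian this produces the factor \<open>s powr (- 2 * a)\<close>.\<close>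
 have kk: "min 1 ((norm z / s)^2) * k z = s powr (- (?N + 2 * a)) * kmin a (0 + (1 / s) *\<^sub>R z)" for z proof -
  have "norm ((1 / s) *\<^sub>R z) = norm z / s" using s by simp
  hence "kmin a (0 + (1 / s) *\<^sub>R z) = min 1 ((norm z / s)^2) / (norm z / s) powr (?N + 2 * a)" by(simp only: kmin_def add_0)
  also have "(norm z / s) powr (?N + 2 * a) = norm z powr (?N + 2 * a) / s powr (?N + 2 * a)" using s by(simp add: powr_divide)
  finally have e: "kmin a (0 + (1 / s) *\<^sub>R z) = min 1 ((norm z / s)^2) * k z * s powr (?N + 2 * a)" by(simp add: k_def)
  have "s powr (?N + 2 * a) > 0" using s by simp
  thus ?thesis unfolding e powr_minus by(simp add: field_simps)
 qed
 have kmm: "(kmin a :: 'a => real) \<in> borel_measurable borel" using borel_measurable_integrable[OF integrable_kmin[OF a]] by simp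
 have ikk: "integrable lborel (%z::'a. kmin a (0 + (1 / s) *\<^sub>R z))"
  using lborel_affine_integral(1)[OF _ kmm, of "1 / s" 0] s integrable_kmin[OF a, where 'a='a] by simp
 have "abs (1 / s) ^ DIM('a) * (LBINT z. kmin a (0 + (1 / s) *\<^sub>R (z::'a))) = (LBINT z. kmin a (z::'a))"
  by(rule lborel_affine_integral(2)[OF _ kmm]) (use s in simp)
 moreover have "abs (1 / s) ^ DIM('a) = s powr (- ?N)" using s by(simp add: powr_minus powr_realpow power_one_over inverse_eq_divide)
 ultimately have "s powr ?N * (s powr (- ?N) * (LBINT z. kmin a (0 + (1 / s) *\<^sub>R (z::'a)))) = s powr ?N * (LBINT z. kmin a (z::'a))" by simp
 moreover have "s powr ?N * s powr (- ?N) = 1" using s by(simp flip: powr_add)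
 ultimately have Ik: "(LBINT z. kmin a (0 + (1 / s) *\<^sub>R (z::'a))) = s powr ?N * (LBINT z. kmin a (z::'a))" by(simp flip: mult.assoc)
 have "(LINT p|?M. ?f p) <= (LBINT z. 2 * J * s powr (- (?N + 2 * a)) * kmin a (0 + (1 / s) *\<^sub>R (z::'a)))" unfolding swap
 proof(rule integral_mono)
  show "integrable lborel (%z. LBINT x. g x z)" by(rule lborel_pair.integrable_snd) (use iG in \<open>simp add: case_prod_unfold\<close>)
  show "integrable lborel (%z::'a. 2 * J * s powr (- (?N + 2 * a)) * kmin a (0 + (1 / s) *\<^sub>R z))" by(rule integrable_mult_right[OF ikk])
  show "(LBINT x. g x z) <= 2 * J * s powr (- (?N + 2 * a)) * kmin a (0 + (1 / s) *\<^sub>R z)" for z proof -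
   have "(LBINT x. g x z) <= 2 * J * (min 1 ((norm z / s)^2) * k z)" using inner[of z] by(simp only: mult_ac)
   thus ?thesis unfolding kk by(simp only: mult.assoc)
  qed qed
 also have "... = 2 * J * s powr (- (?N + 2 * a)) * (LBINT z. kmin a (0 + (1 / s) *\<^sub>R (z::'a)))" by(rule integral_mult_right_zero)
 also have "... = 2 * J * (s powr (- (?N + 2 * a)) * s powr ?N) * (LBINT z. kmin a (z::'a))" unfolding Ik by simp
 also have "s powr (- (?N + 2 * a)) * s powr ?N = s powr (- 2 * a)" by(simp flip: powr_add)
 finally have "frac_const DIM('a) a / 2 * (LINT p|?M. ?f p) <= frac_const DIM('a) a / 2 * (2 * J * s powr (- 2 * a) * (LBINT z. kmin a (z::'a)))"
  using c by(intro mult_left_mono) auto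
 thus ?thesis unfolding frac_op_eq J_def by(simp add: mult_ac)
qed

text \<open>Weighted arithmetic-geometric mean. It makes the tail of exponent \<open>alpha\<close>
  small with \<open>alpha\<close> while its growth of order \<open>sig\<close> stays integrable
  against the kernel.\<close>

lemma powr_minus_one_le:
 fixes r :: real
 assumes r: "r >= 1" and b: "0 < b" "b <= a"
 shows "r powr b - 1 <= b / a * r powr a" proof -
 define t where "t = r powr a"
 have t: "t > 0" using r by(simp add: t_def)
 have "t powr (b / a) * 1 powr (1 - b / a) <= (b / a) * t + (1 - b / a) * 1" by(rule Youngs_inequality_0) (use b t in auto)
 moreover have "t powr (b / a) = r powr b" using b by(simp add: t_def powr_powr)
 moreover have "b / a >= 0" using b by simp
 ultimately show ?thesis by(simp add: t_def algebra_simps)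
qed

text \<open>Four cases, according to which of \<open>px\<close>, \<open>py\<close> vanish. Where
  \<open>px\<close> is positive, \<open>ux\<close> lies exactly \<open>px\<close> above the lowered
  level \<open>M - t * ex\<close>; where it is 0, \<open>ux\<close> exceeds that level at most by
  the tail \<open>Tx\<close> and stays below it by the gain \<open>Ax\<close>.\<close>

lemma oscillation_integrand_le:
 fixes ux uy px py ex ey Tx Ty Ax Ay :: real
 assumes Q: "Q >= 0" and p: "0 <= px" "0 <= py" and T: "0 <= Tx" "0 <= Ty"
  and x: "px > 0 ==> ux = M - t * ex + px & Tx = 0 & Ax = 0" "px = 0 ==> ux <= M - t * ex + Q * Tx - Q / 4 * Ax"
  and y: "py > 0 ==> uy = M - t * ey + py & Ty = 0 & Ay = 0" "py = 0 ==> uy <= M - t * ey + Q * Ty - Q / 4 * Ay"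
 shows "(px - py)^2 - t * ((ex - ey) * (px - py)) - Q * (Ty * px + Tx * py) + Q / 4 * (Ay * px + Ax * py)
  <= (ux - uy) * (px - py)" proof(cases "px > 0")
 case px: True
 show ?thesis proof(cases "py > 0")
  case True have e: "ux = M - t * ex + px" "uy = M - t * ey + py" "Tx = 0" "Ty = 0" "Ax = 0" "Ay = 0" using x(1)[OF px] y(1)[OF True] by auto
  show ?thesis unfolding e by(simp add: power2_eq_square algebra_simps)
 next case False hence py: "py = 0" using p by simp
  have e: "ux = M - t * ex + px" "Tx = 0" "Ax = 0" using x(1)[OF px] by auto
  have "(M - t * ex + px) - (M - t * ey + Q * Ty - Q / 4 * Ay) <= ux - uy" using e y(2)[OF py] by linarith
  hence "((M - t * ex + px) - (M - t * ey + Q * Ty - Q / 4 * Ay)) * px <= (ux - uy) * px" using p by(intro mult_right_mono) auto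
  thus ?thesis unfolding e py by(simp add: power2_eq_square algebra_simps)
 qed
next case False hence px: "px = 0" using p by simp
 show ?thesis proof(cases "py > 0")
  case True have e: "uy = M - t * ey + py" "Ty = 0" "Ay = 0" using y(1)[OF True] by auto
  have "(M - t * ey + py) - (M - t * ex + Q * Tx - Q / 4 * Ax) <= uy - ux" using e x(2)[OF px] by linarith
  hence "((M - t * ey + py) - (M - t * ex + Q * Tx - Q / 4 * Ax)) * py <= (uy - ux) * py" using p by(intro mult_right_mono) auto
  thus ?thesis unfolding e px by(simp add: power2_eq_square algebra_simps)
 next case False hence "py = 0" using p by simp
  thus ?thesis using px by simp
 qed qed

text \<open>Outside \<open>ball x0 (2 s)\<close> the function may exceed its bound \<open>M\<close> by \<open>Q\<close> times a slowly growing tail.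
 The set \<open>A\<close>, on which \<open>u\<close> is at most the mean level, yields through the jumps a positive term that
 absorbs both the tail and the error of the cutoff.\<close>
lemma oscillation_test:
 fixes x0 :: "'a::euclidean_space" and u :: "'a => real" and sig :: real
 defines "c == frac_const DIM('a) sig" and "N == real DIM('a)"
 assumes sig: "0 < sig" "sig < 1" and s: "s > 0" and alpha: "0 < alpha" "alpha <= sig" and theta: "0 < theta" "theta <= 1 / 4" and Q: "Q > 0"
  and const: "theta * (c * (LBINT z. kmin sig (z::'a))) +
    alpha * (c / sig * 2 powr (N + 3 * sig) * (LBINT w. indicator {w::'a. 1 <= norm w} w * norm w powr (- N - sig)))
    <= c / 4 * c0 * 9 powr (- (N + 2 * sig))" and u: "u \<in> X0 sig Omega" and inside: "AE y in lborel. y \<in> ball x0 (2 * s) --> u y <= M"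
  and outside: "AE y in lborel. y \<notin> ball x0 (2 * s) --> u y <= M + Q * ((2 * norm (y - x0) / s) powr alpha - 1)"
  and A: "A \<in> sets borel" "A \<subseteq> ball x0 (8 * s)" "measure lborel A >= c0 * s powr N"
  and uA: "AE y in lborel. y \<in> A --> u y <= M - Q / 2" and ext: "ball x0 (2 * s) \<subseteq> Omega \<or> Q / 4 <= M" and k: "k >= 0"
 defines "psi == %x. max 0 (max 0 (min (u x - M) 0 + theta * Q * cutoff x0 s x) - k)"
 shows "psi \<in> X0 sig Omega" "frac_op sig psi psi <= frac_op sig u psi" proof -
 let ?M = "lborel2 :: ('a \<times> 'a) measure" and ?eta = "cutoff x0 s"
 have c: "c > 0" using frac_const_pos[OF sig, where 'a='a] by(simp add: c_def)
 have N: "N > 0" by(simp add: N_def)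
 have etaX: "?eta \<in> frac_sobolev sig" using cutoff_in_X0[OF sig s] by(rule X0D(1))
 have etam[measurable]: "?eta \<in> borel_measurable borel" using X0D(3)[OF cutoff_in_X0[OF sig s]] by simp
 have um[measurable]: "u \<in> borel_measurable borel" using X0D(3)[OF u] by simp
 have tQ: "theta * Q >= 0" "theta * Q <= Q / 4" using theta Q by(auto simp: mult_right_mono[of theta "1/4" Q, simplified])
 \<comment> \<open>The bump is at most \<open>Q / 4\<close>, half of the drop \<open>Q / 2\<close>
   on \<open>A\<close>. Hence \<open>psi\<close> vanishes on \<open>A\<close>, and also outside the
   domain when \<open>Q / 4 <= M\<close>.\<close>
 have tQe: "theta * Q * ?eta x <= Q / 4" "0 <= theta * Q * ?eta x" for x proof -
  have "theta * Q * ?eta x <= theta * Q * 1" using tQ theta(1) Q cutoff_bounds by(intro mult_left_mono) auto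
  thus "theta * Q * ?eta x <= Q / 4" using tQ by simp
  show "0 <= theta * Q * ?eta x" using tQ theta(1) Q cutoff_bounds by(intro mult_nonneg_nonneg) auto
 qed
 have nn: "0 <= psi x" for x by(simp add: psi_def)
 have supp: "psi x = 0" if "x \<notin> ball x0 s" for x using cutoff_outside[OF s that] k by(simp add: psi_def)
 have leeta: "psi x <= theta * Q * ?eta x" for x using tQe(2)[of x] k by(auto simp: psi_def max_def min_def)
 have mono: "abs (psi x - psi y) <= abs (u x - u y) + abs (theta * Q * ?eta x - theta * Q * ?eta y)" for x y proof -
  have 1: "abs (max 0 r - max 0 t) <= abs (r - t)" "abs (min r 0 - min t 0) <= abs (r - t)" for r t :: real by(auto simp: max_def min_def)
  have "abs (psi x - psi y) <= abs ((max 0 (min (u x - M) 0 + theta * Q * ?eta x) - k) - (max 0 (min (u y - M) 0 + theta * Q * ?eta y) - k))"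
   unfolding psi_def by(rule 1)
  also have "... = abs (max 0 (min (u x - M) 0 + theta * Q * ?eta x) - max 0 (min (u y - M) 0 + theta * Q * ?eta y))" by simp
  also have "... <= abs ((min (u x - M) 0 + theta * Q * ?eta x) - (min (u y - M) 0 + theta * Q * ?eta y))" by(rule 1)
  also have "... <= abs (min (u x - M) 0 - min (u y - M) 0) + abs (theta * Q * ?eta x - theta * Q * ?eta y)" by linarith
  finally show ?thesis using 1(2)[of "u x - M" "u y - M"] by simp
 qed
 have psim[measurable]: "psi \<in> borel_measurable borel" unfolding psi_def by measurable
 have psiS: "psi \<in> frac_sobolev sig" proof(rule frac_sobolev_contraction[of "%x. 1 * u x + 0 * u x" _ "%x. theta * Q * ?eta x + 0 * u x"])
  show "(%x. 1 * u x + 0 * u x) \<in> frac_sobolev sig" "(%x. theta * Q * ?eta x + 0 * u x) \<in> frac_sobolev sig"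
   by(rule frac_sobolev_lincomb[OF X0D(1)[OF u] X0D(1)[OF u]], rule frac_sobolev_lincomb[OF etaX X0D(1)[OF u]])
  show "abs (psi x) <= abs (1 * u x + 0 * u x) + abs (theta * Q * ?eta x + 0 * u x)" for x using leeta[of x] nn[of x] by simp
  show "abs (psi x - psi y) <= abs (1 * u x + 0 * u x - (1 * u y + 0 * u y)) + abs (theta * Q * ?eta x + 0 * u x - (theta * Q * ?eta y + 0 * u y))" for x y
   using mono[of x y] by simp
 qed simp
 have zpsi: "AE x in lborel. x \<notin> Omega --> psi x = 0" using X0D(2)[OF u] proof eventually_elim
  case (elim x) show ?case proof
   assume x: "x \<notin> Omega"
   hence ux: "u x = 0" using elim by simp
   show "psi x = 0" proof(cases "x \<in> ball x0 s")
    case True hence "x \<in> ball x0 (2 * s)" using s by simp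
    hence "Q / 4 <= M" using ext x by blast
    hence "theta * Q * ?eta x <= M" using tQe(1)[of x] by linarith
    moreover have "min (u x - M) 0 <= - M" using ux by simp
    ultimately have "min (u x - M) 0 + theta * Q * ?eta x <= 0" by linarith
    thus ?thesis using k unfolding psi_def by(simp only: max_absorb1 diff_0 neg_le_0_iff_le)
   qed (rule supp)
  qed qed
 show psiX: "psi \<in> X0 sig Omega" using psiS zpsi by(simp add: X0_def)
 have ipsi: "integrable lborel psi" proof(rule L1_integrable_bound)
  have "integrable lborel (indicator (ball x0 s) :: 'a => real)"
   using emeasure_bounded_finite[OF bounded_ball, of x0 s] by(simp add: integrable_indicator_iff)
  thus "integrable lborel (%x. Q / 4 * indicator (ball x0 s) x)" by(rule integrable_mult_right)
  show "AE x in lborel. norm (psi x) <= norm (Q / 4 * indicator (ball x0 s) x)" proof(rule AE_I2)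
   fix x show "norm (psi x) <= norm (Q / 4 * indicator (ball x0 s) x)"
    using supp[of x] nn[of x] order_trans[OF leeta tQe(1), of x] by(cases "x \<in> ball x0 s") auto
  qed
 qed simp
 define J where "J = (LBINT x. psi x)"
 have J: "J >= 0" unfolding J_def by(intro integral_nonneg_AE AE_I2 nn)
 define m where "m w = indicator {w. 1 <= norm w} w * norm w powr (- N - sig)" for w :: 'a
 have im: "integrable lborel m" unfolding m_def N_def by(rule integrable_norm_powr_outside) (rule sig)
 have mm: "m \<in> borel_measurable borel" using borel_measurable_integrable[OF im] by simp
 \<comment> \<open>A majorant of tail times kernel that depends on \<open>y\<close> alone, so that
   the double integral factorises. The power of 2 collects \<open>2 powr sig\<close> from the tail
   and \<open>2 powr (N + 2 * sig)\<close> from halving the distance.\<close>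
 define g where "g y = alpha / sig * 2 powr (N + 3 * sig) * s powr (- (N + 2 * sig)) * m (- (1 / s) *\<^sub>R x0 + (1 / s) *\<^sub>R y)" for y
 have g0: "g y >= 0" for y using alpha sig by(simp add: g_def m_def)
 have s1: "1 / s ~= 0" using s by simp
 have ig: "integrable lborel g" unfolding g_def by(rule integrable_mult_right, rule lborel_affine_integral(1)[OF s1 mm, THEN iffD2, OF im])
 have Ig: "(LBINT y. g y) = alpha / sig * 2 powr (N + 3 * sig) * (LBINT w. m w) * s powr (- 2 * sig)" proof -
  have "abs (1 / s) ^ DIM('a) * (LBINT y. m (- (1 / s) *\<^sub>R x0 + (1 / s) *\<^sub>R y)) = (LBINT w. m w)"
   by(rule lborel_affine_integral(2)[OF s1 mm])
  moreover have "abs (1 / s) ^ DIM('a) = s powr (- N)" using s by(simp add: N_def powr_minus powr_realpow power_one_over inverse_eq_divide)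
  ultimately have "s powr N * (s powr (- N) * (LBINT y. m (- (1 / s) *\<^sub>R x0 + (1 / s) *\<^sub>R y))) = s powr N * (LBINT w. m w)" by simp
  moreover have "s powr N * s powr (- N) = 1" using s by(simp flip: powr_add)
  ultimately have e: "(LBINT y. m (- (1 / s) *\<^sub>R x0 + (1 / s) *\<^sub>R y)) = s powr N * (LBINT w. m w)" by(simp flip: mult.assoc)
  have "(LBINT y. g y) = alpha / sig * 2 powr (N + 3 * sig) * s powr (- (N + 2 * sig)) * (LBINT y. m (- (1 / s) *\<^sub>R x0 + (1 / s) *\<^sub>R y))"
   unfolding g_def by(rule integral_mult_right_zero)
  also have "... = alpha / sig * 2 powr (N + 3 * sig) * (LBINT w. m w) * (s powr (- (N + 2 * sig)) * s powr N)" unfolding e by(simp only: mult_ac)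
  also have "s powr (- (N + 2 * sig)) * s powr N = s powr (- 2 * sig)" by(simp flip: powr_add)
  finally show ?thesis .
 qed
 define T where "T y = (if y \<in> ball x0 (2 * s) then 0 else (2 * norm (y - x0) / s) powr alpha - 1)" for y
 have far: "1 <= 2 * norm (y - x0) / s" if "y \<notin> ball x0 (2 * s)" for y using that s by(simp add: dist_norm norm_minus_commute)
 have T0: "T y >= 0" for y using far[of y] alpha by(auto simp: T_def ge_one_powr_ge_zero)
 have Tg: "T y / norm (x - y) powr (N + 2 * sig) <= g y" if x: "x \<in> ball x0 s" for x y proof(cases "y \<in> ball x0 (2 * s)")
  case True thus ?thesis using g0 by(simp add: T_def)
 next case False define rho where "rho = norm (y - x0)"
  have rho: "rho >= 2 * s" using False by(simp add: rho_def dist_norm norm_minus_commute)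
  have "rho <= norm (x - y) + norm (x - x0)" unfolding rho_def using norm_triangle_ineq[of "y - x" "x - x0"] by(simp add: norm_minus_commute)
  hence xy: "rho / 2 <= norm (x - y)" using x rho by(simp add: dist_norm norm_minus_commute)
  have "T y <= alpha / sig * (2 * rho / s) powr sig" using powr_minus_one_le[OF far[OF False] alpha] False by(simp add: T_def rho_def)
  moreover have "(rho / 2) powr (N + 2 * sig) <= norm (x - y) powr (N + 2 * sig)" using xy rho s N sig by(intro powr_mono2) auto
  moreover have "(rho / 2) powr (N + 2 * sig) > 0" using rho s by simp
  ultimately have "T y / norm (x - y) powr (N + 2 * sig) <= alpha / sig * (2 * rho / s) powr sig / (rho / 2) powr (N + 2 * sig)"
   using T0[of y] by(intro frac_le) auto
  also have "... = g y" proof -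
   have "- (1 / s) *\<^sub>R x0 + (1 / s) *\<^sub>R y = (1 / s) *\<^sub>R (y - x0)" by(simp add: algebra_simps)
   hence nw: "norm (- (1 / s) *\<^sub>R x0 + (1 / s) *\<^sub>R y) = rho / s" using s by(simp add: rho_def)
   have "1 <= rho / s" using rho s by(simp add: field_simps)
   hence mem: "- (1 / s) *\<^sub>R x0 + (1 / s) *\<^sub>R y \<in> {w. 1 <= norm w}" by(simp only: mem_Collect_eq nw)
   have mw: "m (- (1 / s) *\<^sub>R x0 + (1 / s) *\<^sub>R y) = (rho / s) powr (- N - sig)" unfolding m_def indicator_simps(1)[OF mem] nw by simp
   have r: "rho / s > 0" using rho s by simp
   have 1: "(2 * rho / s) powr sig = 2 powr sig * (rho / s) powr sig" using r powr_mult[of 2 "rho / s" sig] by simp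
   have "rho / 2 = (s / 2) * (rho / s)" using s by simp
   hence 2: "(rho / 2) powr (N + 2 * sig) = s powr (N + 2 * sig) / 2 powr (N + 2 * sig) * (rho / s) powr (N + 2 * sig)"
    using r s by(simp only: powr_mult powr_divide)
   have "- N - sig = sig - (N + 2 * sig)" by simp
   hence 3: "(rho / s) powr (- N - sig) = (rho / s) powr sig / (rho / s) powr (N + 2 * sig)" by(simp only: powr_diff)
   have "N + 3 * sig = sig + (N + 2 * sig)" by simp
   hence 4: "2 powr (N + 3 * sig) = 2 powr sig * (2 powr (N + 2 * sig) :: real)" by(simp only: powr_add)
   show ?thesis unfolding g_def mw 1 2 3 4 powr_minus_divide by(simp add: mult_ac)
  qed
  finally show ?thesis .
 qed
 \<comment> \<open>A lower bound for the kernel between the ball of radius \<open>s\<close> and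
   \<open>A\<close>, whose points are at most \<open>9 * s\<close> apart.\<close>
 define B where "B = (9 * s) powr (- (N + 2 * sig))"
 have B0: "B > 0" using s by(simp add: B_def)
 have Ab: "B <= 1 / norm (x - y) powr (N + 2 * sig)" if x: "x \<in> ball x0 s" and y: "y \<in> A" and ne: "x ~= y" for x y proof -
  have "norm (x - y) <= norm (x - x0) + norm (y - x0)" using norm_triangle_ineq4[of "x - x0" "y - x0"] by simp
  moreover have "norm (x - x0) < s" "norm (y - x0) < 8 * s" using x y A(2) by(auto simp: dist_norm norm_minus_commute)
  ultimately have "norm (x - y) <= 9 * s" by linarith
  hence "norm (x - y) powr (N + 2 * sig) <= (9 * s) powr (N + 2 * sig)" using N sig by(intro powr_mono2) auto
  moreover have "norm (x - y) powr (N + 2 * sig) > 0" using ne by simp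
  ultimately show ?thesis unfolding B_def powr_minus_divide by(intro divide_left_mono mult_pos_pos) auto
 qed
 have iA: "integrable lborel (indicator A :: 'a => real)"
  using emeasure_bounded_finite[OF bounded_subset[OF bounded_ball A(2)]] A(1) by(simp add: integrable_indicator_iff)
 note sf = lborel.sigma_finite_measure_axioms
 \<comment> \<open>The lower bound for the integrand of \<open>frac_op sig u psi\<close>: the two
   energy terms and products of functions of one variable, whose integrals are products.\<close>
 let ?L = "%p. (frac_diff sig psi p)^2 - theta * Q * (frac_diff sig ?eta p * frac_diff sig psi p)
   - Q * (psi (fst p) * g (snd p) + g (fst p) * psi (snd p))
   + Q / 4 * B * (psi (fst p) * indicator A (snd p) + indicator A (fst p) * psi (snd p))"
 have i1: "integrable ?M (%p. (frac_diff sig psi p)^2)" using psiS by(simp add: frac_sobolev_iff L2_fun_def)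
 have i2: "integrable ?M (%p. frac_diff sig ?eta p * frac_diff sig psi p)" using psiS etaX by(auto simp: frac_sobolev_iff intro: L2_mult_integrable)
 note i3 = integrable_fst_times_snd[OF sf sf ipsi ig] integrable_fst_times_snd[OF sf sf ig ipsi]
  integrable_fst_times_snd[OF sf sf ipsi iA] integrable_fst_times_snd[OF sf sf iA ipsi]
 have prod: "(LINT p|?M. f (fst p) * h (snd p)) = (LBINT x. f x) * (LBINT x. h x)"
  if "integrable ?M (%p. f (fst p) * h (snd p))" for f h :: "'a => real" by(subst lborel_pair.integral_fst'[OF that, symmetric]) simp
 have iL: "integrable ?M ?L" by(intro L1_integrable_add L1_integrable_diff integrable_mult_right i1 i2 i3)
 have iU: "integrable ?M (%p. frac_diff sig u p * frac_diff sig psi p)"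
  using psiS X0D(1)[OF u] by(auto simp: frac_sobolev_iff intro: L2_mult_integrable)
 define good where "good x \<longleftrightarrow> (x \<in> ball x0 (2 * s) --> u x <= M) &
   (x \<notin> ball x0 (2 * s) --> u x <= M + Q * ((2 * norm (x - x0) / s) powr alpha - 1)) & (x \<in> A --> u x <= M - Q / 2)" for x
 have aeg: "AE x in lborel. good x" using inside outside uA by eventually_elim (auto simp: good_def)
 \<comment> \<open>These two facts provide the hypotheses of \<open>oscillation_integrand_le\<close>
   with the level \<open>M + k\<close>.\<close>
 have pos: "u x = (M + k) - theta * Q * ?eta x + psi x & T x = 0 & x \<in> ball x0 s & x \<notin> A" if g: "good x" and p: "psi x > 0" for x proof -
  have xb: "x \<in> ball x0 s" using supp[of x] p by fastforce
  hence xb2: "x \<in> ball x0 (2 * s)" using s by simp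
  hence uM: "u x <= M" using g by(simp add: good_def)
  have mn: "min (u x - M) 0 = u x - M" using uM by simp
  have e: "u x = (M + k) - theta * Q * ?eta x + psi x" using p k unfolding psi_def mn by(simp add: max_def split: if_splits)
  have "x \<notin> A" proof
   assume "x \<in> A"
   hence "u x <= M - Q / 2" using g by(simp add: good_def)
   thus False using e tQe(1)[of x] k p Q by linarith
  qed
  thus ?thesis using e xb xb2 by(simp add: T_def)
 qed
 have zer: "u x <= (M + k) - theta * Q * ?eta x + Q * T x - Q / 4 * indicator A x" if g: "good x" and p: "psi x = 0" for x proof(cases "x \<in> A")
  case True hence "u x <= M - Q / 2" using g by(simp add: good_def)
  moreover have "Q * T x >= 0" using T0[of x] Q by simp
  ultimately show ?thesis using True tQe(1)[of x] k by simp
 next case False show ?thesis proof(cases "x \<in> ball x0 (2 * s)")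
   case True hence uM: "u x <= M" using g by(simp add: good_def)
   have "min (u x - M) 0 + theta * Q * ?eta x <= k" using p k unfolding psi_def by(simp add: max_def split: if_splits)
   moreover have "min (u x - M) 0 = u x - M" using uM by simp
   moreover have "T x = 0" "indicator A x = (0::real)" using True False by(auto simp: T_def)
   ultimately show ?thesis by simp
  next case nb: False
   hence "x \<notin> ball x0 s" using s by simp
   hence "?eta x = 0" by(rule cutoff_outside[OF s])
   moreover have "u x <= M + Q * T x" using g nb by(simp add: good_def T_def)
   ultimately show ?thesis using False k by simp
  qed qed
 have le: "AE p in ?M. ?L p <= frac_diff sig u p * frac_diff sig psi p" using AE_lborel_pair[OF aeg] proof eventually_elim
  case (elim p) obtain x y where p: "p = (x, y)" by(cases p)
  have gx: "good x" and gy: "good y" using elim by(auto simp: p)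
  define d where "d = norm (x - y) powr (N + 2 * sig)"
  have d0: "d >= 0" by(simp add: d_def)
  have main: "(psi x - psi y)^2 - theta * Q * ((?eta x - ?eta y) * (psi x - psi y)) - Q * (T y * psi x + T x * psi y)
    + Q / 4 * (indicator A y * psi x + indicator A x * psi y) <= (u x - u y) * (psi x - psi y)"
  proof(rule oscillation_integrand_le[where M = "M + k"])
   show "u x = (M + k) - theta * Q * ?eta x + psi x & T x = 0 & indicator A x = (0::real)" if "psi x > 0" using pos[OF gx that] by simp
   show "u y = (M + k) - theta * Q * ?eta y + psi y & T y = 0 & indicator A y = (0::real)" if "psi y > 0" using pos[OF gy that] by simp
  qed (use Q nn T0 zer[OF gx] zer[OF gy] in auto)
  have t1: "T z' * psi z / d <= psi z * g z'" if "d = norm (z - z') powr (N + 2 * sig)" for z z' proof(cases "z \<in> ball x0 s")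
   case True have "psi z * (T z' / norm (z - z') powr (N + 2 * sig)) <= psi z * g z'" by(rule mult_left_mono[OF Tg[OF True] nn])
   thus ?thesis using that by(simp add: mult.commute)
  qed (simp add: supp)
  have t2: "B * (psi z * indicator A z') <= indicator A z' * psi z / d" if "d = norm (z - z') powr (N + 2 * sig)" "good z" for z z'
  proof(cases "z' \<in> A & psi z > 0")
   case True hence "z \<in> ball x0 s" "z ~= z'" using pos[OF that(2)] by auto
   hence "B * psi z <= 1 / norm (z - z') powr (N + 2 * sig) * psi z" using True nn by(intro mult_right_mono Ab) auto
   thus ?thesis using True that by simp
  next case False thus ?thesis using nn[of z] by(auto simp: indicator_def less_le)
  qed
  have dxy: "d = norm (y - x) powr (N + 2 * sig)" by(simp add: d_def norm_minus_commute)
  have "T y * psi x / d + T x * psi y / d <= psi x * g y + g x * psi y" using t1[OF d_def] t1[OF dxy] by(simp add: mult.commute)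
  hence "Q * (T y * psi x / d + T x * psi y / d) <= Q * (psi x * g y + g x * psi y)" by(rule mult_left_mono) (use Q in simp)
  hence T2: "Q * (T y * psi x + T x * psi y) / d <= Q * (psi x * g y + g x * psi y)"
   by(simp only: add_divide_distrib[symmetric] times_divide_eq_right)
  have "B * (psi x * indicator A y + indicator A x * psi y) <= indicator A y * psi x / d + indicator A x * psi y / d"
   using t2[OF d_def gx] t2[OF dxy gy] by(simp add: algebra_simps)
  hence "Q / 4 * (B * (psi x * indicator A y + indicator A x * psi y)) <= Q / 4 * (indicator A y * psi x / d + indicator A x * psi y / d)"
   by(rule mult_left_mono) (use Q in simp)
  hence A2: "Q / 4 * B * (psi x * indicator A y + indicator A x * psi y) <= Q / 4 * (indicator A y * psi x + indicator A x * psi y) / d"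
   by(simp only: add_divide_distrib[symmetric] times_divide_eq_right mult.assoc)
  have "((psi x - psi y)^2 - theta * Q * ((?eta x - ?eta y) * (psi x - psi y)) - Q * (T y * psi x + T x * psi y)
    + Q / 4 * (indicator A y * psi x + indicator A x * psi y)) / d <= (u x - u y) * (psi x - psi y) / d" by(rule divide_right_mono[OF main d0])
  hence "(psi x - psi y)^2 / d - theta * Q * ((?eta x - ?eta y) * (psi x - psi y) / d) - Q * (T y * psi x + T x * psi y) / d
    + Q / 4 * (indicator A y * psi x + indicator A x * psi y) / d <= (u x - u y) * (psi x - psi y) / d"
   by(simp add: add_divide_distrib diff_divide_distrib)
  moreover have "(psi x - psi y)^2 / d = (frac_diff sig psi p)^2" "(?eta x - ?eta y) * (psi x - psi y) / d = frac_diff sig ?eta p * frac_diff sig psi p"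
   "(u x - u y) * (psi x - psi y) / d = frac_diff sig u p * frac_diff sig psi p" by(simp_all add: p frac_diff_mult power2_eq_square d_def N_def)
  ultimately show ?case using T2 A2 by(simp only: p fst_conv snd_conv)
 qed
 have "(LINT p|?M. ?L p) <= (LINT p|?M. frac_diff sig u p * frac_diff sig psi p)" by(rule integral_mono_AE[OF iL iU le])
 moreover have "(LINT p|?M. ?L p) = (LINT p|?M. (frac_diff sig psi p)^2) - theta * Q * (LINT p|?M. frac_diff sig ?eta p * frac_diff sig psi p)
   - Q * (2 * (J * (LBINT y. g y))) + Q / 4 * B * (2 * (J * measure lborel A))" proof -
  have "(LINT p|?M. ?L p) = (LINT p|?M. (frac_diff sig psi p)^2) - theta * Q * (LINT p|?M. frac_diff sig ?eta p * frac_diff sig psi p)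
   - Q * ((LINT p|?M. psi (fst p) * g (snd p)) + (LINT p|?M. g (fst p) * psi (snd p)))
   + Q / 4 * B * ((LINT p|?M. psi (fst p) * indicator A (snd p)) + (LINT p|?M. indicator A (fst p) * psi (snd p)))" using i1 i2 i3 by simp
  thus ?thesis unfolding prod[OF i3(1)] prod[OF i3(2)] prod[OF i3(3)] prod[OF i3(4)] by(simp add: J_def)
 qed
 ultimately have "c / 2 * ((LINT p|?M. (frac_diff sig psi p)^2) - theta * Q * (LINT p|?M. frac_diff sig ?eta p * frac_diff sig psi p)
   - Q * (2 * (J * (LBINT y. g y))) + Q / 4 * B * (2 * (J * measure lborel A))) <= c / 2 * (LINT p|?M. frac_diff sig u p * frac_diff sig psi p)"
  using c by(intro mult_left_mono) auto
 hence E1: "frac_op sig psi psi - theta * Q * frac_op sig ?eta psi - c * Q * (J * (LBINT y. g y)) + c * Q / 4 * B * (J * measure lborel A)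
   <= frac_op sig u psi" unfolding frac_op_eq c_def[symmetric] by(simp add: power2_eq_square algebra_simps)
 have Eeta: "frac_op sig ?eta psi <= c * (LBINT z. kmin sig (z::'a)) * s powr (- 2 * sig) * J"
  unfolding c_def J_def by(rule frac_op_cutoff_le[OF sig s psiS nn supp])
 define S where "S = s powr (- 2 * sig)"
 have S: "S > 0" using s by(simp add: S_def)
 \<comment> \<open>The gain from \<open>A\<close> scales like \<open>s powr (- 2 * sig)\<close>, as
   do the cutoff error and the tail. Therefore the condition \<open>const\<close> does not contain
   the radius.\<close>
 have BA: "c0 * 9 powr (- (N + 2 * sig)) * S <= B * measure lborel A" proof -
  have b1: "B * (c0 * s powr N) <= B * measure lborel A" using A(3) B0 by(intro mult_left_mono) auto
  have b2: "B = 9 powr (- (N + 2 * sig)) * s powr (- (N + 2 * sig))" using s by(simp add: B_def powr_mult)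
  have b3: "s powr (- (N + 2 * sig)) * s powr N = S" by(simp add: S_def flip: powr_add)
  have "c0 * 9 powr (- (N + 2 * sig)) * S = B * (c0 * s powr N)" unfolding b2 b3[symmetric] by(simp only: mult_ac)
  from this[symmetric] b1 show ?thesis by(simp only:)
 qed
 have a1: "theta * Q * frac_op sig ?eta psi <= theta * Q * (c * (LBINT z. kmin sig (z::'a)) * S * J)"
  using Eeta tQ(1) unfolding S_def by(intro mult_left_mono) auto
 have a2: "c * Q / 4 * (J * (c0 * 9 powr (- (N + 2 * sig)) * S)) <= c * Q / 4 * (J * (B * measure lborel A))"
  using BA J c Q by(intro mult_left_mono) auto
 have a3: "c * Q * (J * (LBINT y. g y)) = c * Q * (J * (alpha / sig * 2 powr (N + 3 * sig) * (LBINT w. m w) * S))" unfolding Ig S_def ..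
 have "0 <= (Q * S * J) * (c / 4 * c0 * 9 powr (- (N + 2 * sig)) - (theta * (c * (LBINT z. kmin sig (z::'a))) +
    alpha * (c / sig * 2 powr (N + 3 * sig) * (LBINT w. m w))))" using const Q S J unfolding m_def by(intro mult_nonneg_nonneg) auto
 hence "theta * Q * (c * (LBINT z. kmin sig (z::'a)) * S * J) + c * Q * (J * (alpha / sig * 2 powr (N + 3 * sig) * (LBINT w. m w) * S))
   <= c * Q / 4 * (J * (c0 * 9 powr (- (N + 2 * sig)) * S))" by(simp add: algebra_simps)
 moreover have "c * Q / 4 * B * (J * measure lborel A) = c * Q / 4 * (J * (B * measure lborel A))" by simp
 ultimately show "frac_op sig psi psi <= frac_op sig u psi" using E1 a1 a2 a3 by linarith
qed

section \<open>Exterior balls of smooth domains\<close>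

text \<open>Near \<open>x0\<close> the graph function differs from its linearisation by a function
  with Lipschitz constant 1/3. A ball pushed from a boundary point into the half space below the
  linearised graph then stays below the graph itself, with one radius for all boundary points
  nearby.\<close>

lemma smooth_boundary_exterior_balls_local:
 fixes Omega :: "'a::euclidean_space set"
 assumes sm: "smooth_boundary Omega" and op: "open Omega" and x0: "x0 \<in> frontier Omega"
 shows "\<exists>rho>0. \<forall>x\<in>frontier Omega \<inter> ball x0 rho. \<forall>r. 0 < r & r <= rho -->
  (\<exists>y. ball y (r / 4) \<subseteq> ball x r & ball y (r / 4) \<inter> Omega = {})" proof -
 obtain r0 e gamma where r0: "r0 > 0" and e: "norm e = 1" and gamma: "smooth_on UNIV gamma"
  and inv: "!!x tau. gamma (x + tau *\<^sub>R e) = gamma x" and graph: "Omega \<inter> ball x0 r0 = {x \<in> ball x0 r0. x \<bullet> e > gamma x}"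
  using sm x0 unfolding smooth_boundary_def by blast
 have "Ck_on (Suc 0) UNIV gamma" using gamma unfolding smooth_on_def by blast
 then obtain D where D: "!!x. (gamma has_derivative D x) (at x)" and Dc: "!!v. continuous_on UNIV (%x. D x v)" by auto
 have lin: "linear (D x)" for x using D[of x] by(rule has_derivative_linear)
 \<comment> \<open>Summed over the \<open>N\<close> basis vectors this deviation of the partial
   derivatives amounts to 1/3.\<close>
 define b where "b = 1 / (3 * real DIM('a))"
 have b: "b > 0" by(simp add: b_def)
 have "\<forall>i\<in>Basis. \<exists>d>0. \<forall>x. dist x x0 < d --> abs (D x i - D x0 i) < b" proof
  fix i :: 'a have "isCont (%x. D x i) x0" using Dc[of i] by(simp add: continuous_on_eq_continuous_at)
  thus "\<exists>d>0. \<forall>x. dist x x0 < d --> abs (D x i - D x0 i) < b" using b unfolding continuous_at_eps_delta dist_real_def by blast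
 qed
 then obtain d where d: "!!i. i \<in> Basis ==> d i > 0" "!!i x. i \<in> Basis ==> dist x x0 < d i ==> abs (D x i - D x0 i) < b" by metis
 define R where "R = Min (insert r0 (d ` Basis))"
 have R: "R > 0" "R <= r0" "!!i. i \<in> Basis ==> R <= d i" proof -
  show "R > 0" using d(1) r0 by(auto simp: R_def)
  show "R <= r0" unfolding R_def by(rule Min_le) auto
  show "R <= d i" if "i \<in> Basis" for i unfolding R_def by(rule Min_le) (use that in auto)
 qed
 have onb: "onorm (%v. D x v - D x0 v) <= 1 / 3" if x: "x \<in> ball x0 R" for x proof(rule onorm_le)
  fix v have ex: "D y v = (\<Sum>i\<in>Basis. (v \<bullet> i) * D y i)" for y proof -
   have "D y v = D y (\<Sum>i\<in>Basis. (v \<bullet> i) *\<^sub>R i)" by(simp add: euclidean_representation)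
   also have "... = (\<Sum>i\<in>Basis. (v \<bullet> i) * D y i)" using lin[of y] by(simp add: linear_sum linear_scale)
   finally show ?thesis .
  qed
  have "abs (D x v - D x0 v) = abs (\<Sum>i\<in>Basis. (v \<bullet> i) * (D x i - D x0 i))"
   unfolding ex[of x] ex[of x0] by(simp add: sum_subtractf right_diff_distrib)
  also have "... <= (\<Sum>i\<in>Basis. abs ((v \<bullet> i) * (D x i - D x0 i)))" by(rule sum_abs)
  also have "... <= (\<Sum>i\<in>(Basis::'a set). norm v * b)" proof(rule sum_mono)
   fix i :: 'a assume i: "i \<in> Basis"
   have "dist x x0 < d i" using x R(3)[OF i] by(simp add: dist_commute)
   hence "abs (D x i - D x0 i) <= b" using d(2)[OF i] by(simp add: less_imp_le)
   thus "abs ((v \<bullet> i) * (D x i - D x0 i)) <= norm v * b" unfolding abs_mult using Basis_le_norm[OF i, of v] by(intro mult_mono) auto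
  qed
  also have "... = 1 / 3 * norm v" by(simp add: b_def)
  finally show "norm (D x v - D x0 v) <= 1 / 3 * norm v" by simp
 qed
 have mv: "abs ((gamma x - D x0 x) - (gamma y - D x0 y)) <= 1 / 3 * norm (x - y)" if "x \<in> ball x0 R" "y \<in> ball x0 R" for x y proof -
  have "norm ((gamma x - D x0 x) - (gamma y - D x0 y)) <= 1 / 3 * norm (x - y)"
  proof(rule differentiable_bound[of "ball x0 R" "%z. gamma z - D x0 z" "%z v. D z v - D x0 v"])
   fix z assume "z \<in> ball x0 R"
   have "bounded_linear (D x0)" using D[of x0] by(rule has_derivative_bounded_linear)
   hence "(D x0 has_derivative D x0) (at z within ball x0 R)" by(rule bounded_linear_imp_has_derivative)
   moreover have "(gamma has_derivative D z) (at z within ball x0 R)" using D[of z] by(rule has_derivative_at_withinI)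
   ultimately show "((%z. gamma z - D x0 z) has_derivative (%v. D z v - D x0 v)) (at z within ball x0 R)" by(intro has_derivative_diff)
  qed (use onb that in auto)
  thus ?thesis by simp
 qed
 have De: "D x0 e = 0" proof -
  have "((%t. gamma (x0 + t *\<^sub>R e)) has_derivative (%t. D (x0 + 0 *\<^sub>R e) (t *\<^sub>R e))) (at 0)"
   by(rule has_derivative_compose[of "%t. x0 + t *\<^sub>R e" "%t. t *\<^sub>R e" 0 UNIV, OF _ D])
    (auto intro!: derivative_eq_intros)
  hence "((%t::real. gamma x0) has_derivative (%t. D x0 (t *\<^sub>R e))) (at 0)" by(simp add: inv)
  moreover have "((%t::real. gamma x0) has_derivative (%t. 0)) (at 0)" by simp
  ultimately have "(%t. D x0 (t *\<^sub>R e)) = (%t. 0)" by(rule has_derivative_unique)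
  thus ?thesis by(metis scaleR_one)
 qed
 \<comment> \<open>The downward normal of the linearised graph. As \<open>gamma\<close> is constant
   along \<open>e\<close>, \<open>n \<bullet> e\<close> is -1, so \<open>n\<close> has length at
   least 1.\<close>
 define n where "n = (\<Sum>i\<in>Basis. D x0 i *\<^sub>R i) - e"
 have nv: "n \<bullet> v = D x0 v - v \<bullet> e" for v proof -
  have "D x0 v = D x0 (\<Sum>i\<in>Basis. (v \<bullet> i) *\<^sub>R i)" by(simp add: euclidean_representation)
  also have "... = (\<Sum>i\<in>Basis. (v \<bullet> i) * D x0 i)" using lin[of x0] by(simp add: linear_sum linear_scale)
  finally have "D x0 v = (\<Sum>i\<in>Basis. D x0 i * (v \<bullet> i))" by(simp add: mult.commute)
  thus ?thesis unfolding n_def inner_diff_left inner_sum_left inner_scaleR_left by(simp add: inner_commute)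
 qed
 have "e \<bullet> e = 1" using e by(simp add: norm_eq_1)
 hence "n \<bullet> e = - 1" using nv[of e] De by simp
 hence n1: "norm n >= 1" using Cauchy_Schwarz_ineq2[of n e] e by simp
 hence n0: "n ~= 0" by fastforce
 show ?thesis proof(intro exI[of _ "R / 2"] conjI ballI allI impI)
  show "R / 2 > 0" using R by simp
  fix x r assume x: "x \<in> frontier Omega \<inter> ball x0 (R / 2)" and r: "0 < r & r <= R / 2"
  have xR: "x \<in> ball x0 R" using x R by simp
  have "x \<notin> Omega" using x op by(simp add: frontier_def interior_open)
  hence xg: "x \<bullet> e <= gamma x" using graph xR R(2) by fastforce
  \<comment> \<open>Around this centre the points \<open>z\<close> of the ball of radius
    \<open>r / 4\<close> satisfy \<open>n \<bullet> (z - x) > r / 4 > norm (z - x) / 3\<close>,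
    which exceeds the deviation of the graph from its linearisation.\<close>
  define y where "y = x + (r / 2 / norm n) *\<^sub>R n"
  have ny: "norm (y - x) = r / 2" using n0 r by(simp add: y_def)
  have close: "norm (z - x) < 3 * r / 4 & n \<bullet> (z - x) > r / 4" if z: "z \<in> ball y (r / 4)" for z proof
   have zy: "norm (z - y) < r / 4" using z by(simp add: dist_norm norm_minus_commute)
   have "norm (z - x) <= norm (z - y) + norm (y - x)" using norm_triangle_ineq[of "z - y" "y - x"] by simp
   thus "norm (z - x) < 3 * r / 4" using zy ny by simp
   have "n \<bullet> (z - x) = n \<bullet> (z - y) + n \<bullet> (y - x)" by(simp add: inner_diff_right)
   moreover have "n \<bullet> (y - x) = r / 2 * norm n" using n0 by(simp add: y_def dot_square_norm power2_eq_square)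
   moreover have "abs (n \<bullet> (z - y)) <= norm n * norm (z - y)" by(rule Cauchy_Schwarz_ineq2)
   moreover have "norm n * norm (z - y) < norm n * (r / 4)" using zy n1 by(intro mult_strict_left_mono) auto
   ultimately have "n \<bullet> (z - x) > r / 4 * norm n" by(simp add: abs_le_iff algebra_simps)
   moreover have "r / 4 * norm n >= r / 4 * 1" using n1 r by(intro mult_left_mono) auto
   ultimately show "n \<bullet> (z - x) > r / 4" by simp
  qed
  show "\<exists>y. ball y (r / 4) \<subseteq> ball x r & ball y (r / 4) \<inter> Omega = {}" proof(intro exI[of _ y] conjI)
   show "ball y (r / 4) \<subseteq> ball x r" proof
    fix z assume "z \<in> ball y (r / 4)"
    from close[OF this] r show "z \<in> ball x r" by(simp add: dist_norm norm_minus_commute)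
   qed
   show "ball y (r / 4) \<inter> Omega = {}" proof(rule ccontr)
    assume "ball y (r / 4) \<inter> Omega ~= {}"
    then obtain z where z: "z \<in> ball y (r / 4)" "z \<in> Omega" by blast
    note c = close[OF z(1)]
    have "norm (z - x0) <= norm (z - x) + norm (x - x0)" using norm_triangle_ineq[of "z - x" "x - x0"] by simp
    moreover have "norm (x - x0) < R / 2" using x by(simp add: dist_norm norm_minus_commute)
    ultimately have "norm (z - x0) < R" using c r by linarith
    hence zR: "z \<in> ball x0 R" by(simp add: dist_norm norm_minus_commute)
    hence zg: "z \<bullet> e > gamma z" using z(2) graph R(2) by fastforce
    have "D x0 z - D x0 x = D x0 (z - x)" using lin[of x0] by(simp add: linear_diff)
    hence "abs (gamma z - gamma x - D x0 (z - x)) <= 1 / 3 * norm (z - x)" using mv[OF zR xR] by(simp add: algebra_simps)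
    moreover have "n \<bullet> (z - x) = D x0 (z - x) - (z \<bullet> e - x \<bullet> e)" by(simp add: nv inner_diff_left)
    ultimately have "n \<bullet> (z - x) < 1 / 3 * norm (z - x)" using zg xg by linarith
    thus False using c by simp
   qed qed qed qed

text \<open>A finite subcover of the compact boundary makes the radius uniform. What the oscillation
  argument takes from it is a fixed share of the complement in every small ball around a boundary
  point.\<close>

lemma exterior_balls:
 fixes Omega :: "'a::euclidean_space set"
 assumes Omega: "smooth_bounded_domain Omega"
 obtains R where "R > 0" "!!x r. x \<in> frontier Omega ==> 0 < r ==> r <= R ==>
  \<exists>y. ball y (r / 4) \<subseteq> ball x r & ball y (r / 4) \<inter> Omega = {}" proof -
 have sm: "smooth_boundary Omega" and op: "open Omega" and bd: "bounded Omega" using Omega by(auto simp: smooth_bounded_domain_def)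
 have "\<forall>x0\<in>frontier Omega. \<exists>rho>0. \<forall>x\<in>frontier Omega \<inter> ball x0 rho. \<forall>r. 0 < r & r <= rho -->
  (\<exists>y. ball y (r / 4) \<subseteq> ball x r & ball y (r / 4) \<inter> Omega = {})"
  using smooth_boundary_exterior_balls_local[OF sm op] by blast
 then obtain rho where rho: "!!x0. x0 \<in> frontier Omega ==> rho x0 > 0"
  "!!x0 x r. x0 \<in> frontier Omega ==> x \<in> frontier Omega \<inter> ball x0 (rho x0) ==> 0 < r & r <= rho x0 ==>
   \<exists>y. ball y (r / 4) \<subseteq> ball x r & ball y (r / 4) \<inter> Omega = {}" by metis
 have cp: "compact (frontier Omega)" by(rule compact_frontier_bounded[OF bd])
 obtain C where C: "C \<subseteq> frontier Omega" "finite C" "frontier Omega \<subseteq> (\<Union>x\<in>C. ball x (rho x))"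
  by(rule compactE_image[OF cp, of "frontier Omega" "%x. ball x (rho x)"]) (use rho(1) in \<open>force\<close>)+
 define R where "R = Min (insert 1 (rho ` C))"
 have R: "R > 0" "!!x. x \<in> C ==> R <= rho x" using C rho(1) by(auto simp: R_def subset_iff)
 show ?thesis proof(rule that[OF R(1)])
  fix x r assume x: "x \<in> frontier Omega" and r: "0 < r" "r <= R"
  then obtain x0 where x0: "x0 \<in> C" "x \<in> ball x0 (rho x0)" using C(3) by blast
  show "\<exists>y. ball y (r / 4) \<subseteq> ball x r & ball y (r / 4) \<inter> Omega = {}"
   by(rule rho(2)[of x0]) (use x0 C(1) x r R(2)[OF x0(1)] in auto)
 qed qed

section \<open>Geometric decay of the oscillation and Hoelder continuity\<close>

text \<open>The gain \<open>K3\<close> is divided equally between the cutoff error, controlled by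
  \<open>theta\<close>, and the tail, controlled by \<open>alpha\<close>. The choice of
  \<open>theta\<close> comes first because the decay factor that limits \<open>alpha\<close> depends
  on it.\<close>

lemma oscillation_constants:
 fixes K1 K2 K3 :: real
 assumes sig: "sig > 0" and K: "K1 >= 0" "K2 >= 0" "K3 > 0" and gamma: "gamma > 0"
 obtains theta alpha where "0 < theta" "theta <= 1 / 4" "0 < alpha" "alpha <= sig" "alpha <= gamma" "theta * K1 + alpha * K2 <= K3" "1 - theta / 2 <= 4 powr (- alpha)"
proof -
 define theta where "theta = min (1 / 4) (K3 / (2 * (K1 + 1)))"
 have theta: "0 < theta" "theta <= 1 / 4" proof -
  show "0 < theta" using K by(simp add: theta_def)
  show "theta <= 1 / 4" unfolding theta_def by(rule min.cobounded1)
 qed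
 have t1: "theta * K1 <= K3 / 2" proof -
  have "theta * K1 <= K3 / (2 * (K1 + 1)) * K1" using K by(intro mult_right_mono) (auto simp: theta_def)
  also have "... <= K3 / 2" using K by(simp add: field_simps)
  finally show ?thesis .
 qed
 \<comment> \<open>The exponent for which \<open>4 powr (- L)\<close> equals
   \<open>1 - theta / 2\<close>.\<close>
 define L where "L = - ln (1 - theta / 2) / ln 4"
 have "ln (1 - theta / 2) < 0" using theta by(subst ln_less_zero_iff) auto
 hence L: "L > 0" unfolding L_def by(intro divide_pos_pos) auto
 define alpha where "alpha = min (min sig gamma) (min L (K3 / (2 * (K2 + 1))))"
 have alpha: "0 < alpha" "alpha <= sig" "alpha <= gamma" "alpha <= L" "alpha <= K3 / (2 * (K2 + 1))" using sig gamma L K by(auto simp: alpha_def)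
 have t2: "alpha * K2 <= K3 / 2" proof -
  have "alpha * K2 <= K3 / (2 * (K2 + 1)) * K2" using K alpha by(intro mult_right_mono) auto
  also have "... <= K3 / 2" using K by(simp add: field_simps)
  finally show ?thesis .
 qed
 have "4 powr (- L) <= 4 powr (- alpha)" using alpha by(intro powr_mono) auto
 moreover have "4 powr (- L) = 1 - theta / 2" using theta by(simp add: L_def powr_def)
 ultimately show ?thesis using that theta alpha t1 t2 by auto
qed

text \<open>The Stampacchia bound on the ball of radius \<open>s\<close> gives
  \<open>phi <= theta * Q / 4\<close>, by the smallness condition. On the half ball the cutoff is at
  least 3/4, so \<open>u\<close> lies there at least \<open>theta * Q / 2\<close> below
  \<open>M\<close>.\<close>

lemma oscillation_step:
 fixes x0 :: "'a::euclidean_space" and u h :: "'a => real" and sig :: real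
 defines "c == frac_const DIM('a) sig" and "N == real DIM('a)" and "V == unit_ball_vol (real DIM('a))"
 assumes sig: "0 < sig" "sig < 1" and s: "s > 0" and alpha: "0 < alpha" "alpha <= sig" and theta: "0 < theta" "theta <= 1 / 4" and Q: "Q > 0"
  and const: "theta * (c * (LBINT z. kmin sig (z::'a))) +
    alpha * (c / sig * 2 powr (N + 3 * sig) * (LBINT w. indicator {w::'a. 1 <= norm w} w * norm w powr (- N - sig)))
    <= c / 4 * V * 9 powr (- (N + 2 * sig))" and q: "q > 2" and C: "C > 0" and Sob: "!!v. v \<in> X0 sig Omega ==> Lq_integrable q v"
   "!!v. v \<in> X0 sig Omega ==> (Lq_int q v) <= (C * X0_norm sig v) powr q" and p: "p > 1" and delta: "delta = 1 - 1 / p - 2 / q" "delta > 0"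
  and h: "h \<in> borel_measurable lborel" "Lq_integrable p h"
   "(Lq_int p h) <= H powr p" and H: "H > 0"
  and u: "u \<in> X0 sig Omega" and eq: "!!phi. phi \<in> X0 sig Omega ==> frac_op sig u phi = (LBINT x. h x * phi x)"
  and inside: "AE y in lborel. y \<in> ball x0 (2 * s) --> u y <= M"
  and outside: "AE y in lborel. y \<notin> ball x0 (2 * s) --> u y <= M + Q * ((2 * norm (y - x0) / s) powr alpha - 1)"
  and A: "A \<in> sets borel" "A \<subseteq> ball x0 (8 * s)" "measure lborel A >= V * s powr N"
  and uA: "AE y in lborel. y \<in> A --> u y <= M - Q / 2" and ext: "ball x0 (2 * s) \<subseteq> Omega \<or> Q / 4 <= M"
  and small: "2 powr (1 + 1 / (q * delta)) * C^2 * H * (V powr delta * s powr (N * delta)) <= theta * Q / 4"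
 shows "AE y in lborel. y \<in> ball x0 (s / 2) --> u y <= M - theta * Q / 2" proof -
 let ?eta = "cutoff x0 s"
 have V: "V > 0" unfolding V_def by(rule unit_ball_vol_pos) simp
 define phi where "phi x = max 0 (min (u x - M) 0 + theta * Q * ?eta x)" for x
 note T = oscillation_test[OF sig s alpha theta Q const[unfolded c_def N_def] u inside outside A(1,2) A(3)[unfolded N_def] uA ext]
 have X: "(%x. max 0 (phi x - k)) \<in> X0 sig Omega" if "k >= 0" for k unfolding phi_def by(rule T(1)[OF that])
 have E: "(X0_norm sig (%x. max 0 (phi x - k)))^2 <= (LBINT x. abs (h x * max 0 (phi x - k)))" if k: "k >= 0" for k proof -
  have "frac_op sig (%x. max 0 (phi x - k)) (%x. max 0 (phi x - k)) <= frac_op sig u (%x. max 0 (phi x - k))" unfolding phi_def by(rule T(2)[OF k])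
  also have "... = (LBINT x. h x * max 0 (phi x - k))" by(rule eq[OF X[OF k]])
  also have "... <= (LBINT x. abs (h x * max 0 (phi x - k)))" using integral_abs_bound by(rule order_trans[OF abs_ge_self])
  finally show ?thesis unfolding X0_norm_square[OF sig] .
 qed
 have "(%x. max 0 (phi x - 0)) \<in> X0 sig Omega" by(rule X) simp
 moreover have "max 0 (phi x - 0) = phi x" for x by(simp add: phi_def)
 ultimately have phiX: "phi \<in> X0 sig Omega" by simp
 have mb: "measure lborel (ball x0 s) <= V * s powr N" using s by(simp add: content_ball V_def N_def powr_realpow)
 have m0: "V * s powr N > 0" using V s by simp
 have "AE x in lborel. phi x <= 2 powr (1 + 1 / (q * delta)) * C^2 * H * (V * s powr N) powr delta"
 proof(rule Stampacchia_bound[OF sig q C Sob p delta h H X E X0D(3)[OF phiX] _ _ mb m0])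
  show "AE x in lborel. x \<notin> ball x0 s --> phi x <= 0" using cutoff_outside[OF s, of _ x0] by(intro AE_I2) (simp add: phi_def)
 qed (auto simp: emeasure_bounded_finite[OF bounded_ball, unfolded infinity_ennreal_def])
 moreover have "(V * s powr N) powr delta = V powr delta * s powr (N * delta)" using V s by(simp add: powr_mult powr_powr)
 ultimately have bd: "AE x in lborel. phi x <= theta * Q / 4" using small by(auto elim: eventually_mono)
 show ?thesis using bd inside proof eventually_elim
  case (elim y) show ?case proof
   assume y: "y \<in> ball x0 (s / 2)"
   hence n: "norm (y - x0) / s <= 1 / 2" using s by(simp add: dist_norm norm_minus_commute field_simps)
   have "(norm (y - x0) / s)^2 <= (1 / 2)^2" using n s by(intro power_mono) auto
   hence "3 / 4 <= ?eta y" by(simp add: cutoff_def power2_eq_square le_max_iff_disj)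
   hence "theta * Q * (3 / 4) <= theta * Q * ?eta y" using theta Q by(intro mult_left_mono) auto
   moreover have "y \<in> ball x0 (2 * s)" using y s by simp
   hence "min (u y - M) 0 = u y - M" using elim by simp
   hence "u y - M + theta * Q * ?eta y <= phi y" by(simp add: phi_def)
   ultimately show "u y <= M - theta * Q / 2" using elim by linarith
  qed qed qed

lemma frac_op_uminus_left: "u \<in> frac_sobolev a ==> v \<in> frac_sobolev a ==> frac_op a (%x. - u x) v = - frac_op a u v"
 using frac_op_lincomb_left[of v a u u "-1" 0] by simp

text \<open>On every scale the step is applied to \<open>u\<close> or to \<open>- u\<close>,
  whichever is below the mean level on a large enough set. Inside the domain one of the two
  half-level sets is large; near the boundary the exterior ball is, and there \<open>u\<close> is
  0.\<close>

lemma oscillation_decay: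
 fixes Omega :: "'a::euclidean_space set" and u h :: "'a => real" and sig :: real
 defines "c == frac_const DIM('a) sig" and "N == real DIM('a)" and "V == unit_ball_vol (real DIM('a))"
 assumes sig: "0 < sig" "sig < 1" and alpha: "0 < alpha" "alpha <= sig" and theta: "0 < theta" "theta <= 1 / 4"
  and const: "theta * (c * (LBINT z. kmin sig (z::'a))) +
    alpha * (c / sig * 2 powr (N + 3 * sig) * (LBINT w. indicator {w::'a. 1 <= norm w} w * norm w powr (- N - sig)))
    <= c / 4 * V * 9 powr (- (N + 2 * sig))" and decay: "1 - theta / 2 <= 4 powr (- alpha)" and q: "q > 2" and C: "C > 0"
  and Sob: "!!v. v \<in> X0 sig Omega ==> Lq_integrable q v"
   "!!v. v \<in> X0 sig Omega ==> (Lq_int q v) <= (C * X0_norm sig v) powr q"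
  and p: "p > 1" and delta: "delta = 1 - 1 / p - 2 / q" "delta > 0" "alpha <= N * delta" and h: "h \<in> borel_measurable lborel" "Lq_integrable p h"
   "(Lq_int p h) <= H powr p" and H: "H > 0"
  and u: "u \<in> X0 sig Omega" and eq: "!!phi. phi \<in> X0 sig Omega ==> frac_op sig u phi = (LBINT x. h x * phi x)" and op: "open Omega"
  and R: "!!x r. x \<in> frontier Omega ==> 0 < r ==> r <= R ==> \<exists>y. ball y (r / 4) \<subseteq> ball x r & ball y (r / 4) \<inter> Omega = {}"
  and r0: "r0 > 0" "3 * r0 <= R" and U: "AE x in lborel. abs (u x) <= U" and Q0: "Q0 > 0" "2 * U <= Q0"
   "2 powr (1 + 1 / (q * delta)) * C^2 * H * (V powr delta * (r0 / 2) powr (N * delta)) <= theta * Q0 / 4"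
 shows "\<exists>m. AE y in lborel. y \<in> ball x0 (r0 * (1 / 4) ^ j) --> m <= u y & u y <= m + Q0 * 4 powr (- alpha * real j)" proof -
 define r where "r j = r0 * (1 / 4) ^ j" for j
 define Q where "Q j = Q0 * 4 powr (- alpha * real j)" for j
 have r: "r j > 0" "r j <= r0" "r (Suc j) = r j / 4" for j using r0 by(auto simp: r_def power_le_one mult_left_le)
 have Qp: "Q j > 0" for j using Q0 by(simp add: Q_def)
 have QS: "Q (Suc j) = 4 powr (- alpha) * Q j" for j proof -
  have "- alpha * real (Suc j) = - alpha + - alpha * real j" by(simp add: algebra_simps)
  thus ?thesis unfolding Q_def by(simp only: powr_add) (simp add: mult_ac)
 qed
 have V: "V > 0" unfolding V_def by(rule unit_ball_vol_pos) simp
 \<comment> \<open>The contribution of \<open>h\<close> scales with exponent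
   \<open>N * delta >= alpha\<close>, so its smallness on the first scale is inherited by all later
   ones.\<close>
 have small: "2 powr (1 + 1 / (q * delta)) * C^2 * H * (V powr delta * (r j / 2) powr (N * delta)) <= theta * Q j / 4" for j proof -
  have e14: "(1 / 4) ^ j = (4::real) powr (- real j)" by(simp add: powr_minus powr_realpow power_one_over inverse_eq_divide)
  have e1: "(r j / 2) powr (N * delta) = (r0 / 2) powr (N * delta) * (4 powr (- real j)) powr (N * delta)"
   unfolding r_def e14 using r0 powr_mult[of "r0 / 2" "4 powr (- real j)" "N * delta"] by simp
  have "4 powr (- real j) <= (4::real) powr 0" by(intro powr_mono) auto
  hence "(4 powr (- real j)) powr (N * delta) <= ((4::real) powr (- real j)) powr alpha" using delta(3) by(intro powr_mono') auto
  also have "(4 powr (- real j)) powr alpha = 4 powr (- alpha * real j)" by(simp add: powr_powr mult.commute)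
  finally have e2: "(4 powr (- real j)) powr (N * delta) <= 4 powr (- alpha * real j)" .
  have le: "(r j / 2) powr (N * delta) <= (r0 / 2) powr (N * delta) * 4 powr (- alpha * real j)" unfolding e1 by(rule mult_left_mono[OF e2]) simp
  define Z where "Z = 2 powr (1 + 1 / (q * delta)) * C^2 * H * V powr delta"
  have Z: "Z >= 0" using C H by(simp add: Z_def)
  have "Z * (r j / 2) powr (N * delta) <= Z * ((r0 / 2) powr (N * delta) * 4 powr (- alpha * real j))" by(rule mult_left_mono[OF le Z])
  also have "... = (Z * (r0 / 2) powr (N * delta)) * 4 powr (- alpha * real j)" by(simp only: mult.assoc)
  also have "... <= (theta * Q0 / 4) * 4 powr (- alpha * real j)" using Q0(3) by(intro mult_right_mono) (simp_all add: Z_def mult.assoc)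
  finally show ?thesis by(simp add: Z_def Q_def mult.assoc)
 qed
 have um: "u \<in> borel_measurable borel" using X0D(3)[OF u] by simp
 have mu: "(%x. - u x) \<in> X0 sig Omega" by(rule X0_uminus[OF u])
 have mh: "(%x. - h x) \<in> borel_measurable lborel" "integrable lborel (%x. abs (- h x) powr p)" "(LBINT x. abs (- h x) powr p) <= H powr p"
  using h by auto
 have meq: "frac_op sig (%x. - u x) phi = (LBINT x. - h x * phi x)" if "phi \<in> X0 sig Omega" for phi
  using frac_op_uminus_left[OF X0D(1)[OF u] X0D(1)[OF that]] eq[OF that] by simp
 \<comment> \<open>Besides the oscillation on the ball the invariant carries a bound on the growth
   outside it, since the operator is nonlocal.\<close>
 let ?inv = "%j m. (AE y in lborel. y \<in> ball x0 (r j) --> m <= u y & u y <= m + Q j) &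
  (AE y in lborel. y \<notin> ball x0 (r j) --> u y <= m + Q j * (4 * norm (y - x0) / r j) powr alpha &
    m + Q j - Q j * (4 * norm (y - x0) / r j) powr alpha <= u y)"
 have step: "(AE y in lborel. y \<in> ball x0 (r j / 4) --> u y <= m + Q j - theta * Q j / 2) \<or>
   (AE y in lborel. y \<in> ball x0 (r j / 4) --> m + theta * Q j / 2 <= u y)" if inv: "?inv j m" for j m proof -
  define s where "s = r j / 2"
  have s: "s > 0" using r[of j] by(simp add: s_def)
  have rs: "ball x0 (2 * s) = ball x0 (r j)" "ball x0 (s / 2) = ball x0 (r j / 4)" by(auto simp: s_def)
  have ns: "2 * norm (y - x0) / s = 4 * norm (y - x0) / r j" for y by(simp add: s_def)
  have small': "2 powr (1 + 1 / (q * delta)) * C^2 * H * (V powr delta * s powr (N * delta)) <= theta * Q j / 4" using small[of j] by(simp add: s_def)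
  have i1: "AE y in lborel. y \<in> ball x0 (r j) --> m <= u y & u y <= m + Q j"
   and i2: "AE y in lborel. y \<notin> ball x0 (r j) --> u y <= m + Q j * (4 * norm (y - x0) / r j) powr alpha &
    m + Q j - Q j * (4 * norm (y - x0) / r j) powr alpha <= u y" using inv by auto
  have in1: "AE y in lborel. y \<in> ball x0 (2 * s) --> u y <= m + Q j" unfolding rs using i1 by eventually_elim auto
  have in2: "AE y in lborel. y \<in> ball x0 (2 * s) --> - u y <= - m" unfolding rs using i1 by eventually_elim auto
  have out1: "AE y in lborel. y \<notin> ball x0 (2 * s) --> u y <= m + Q j + Q j * ((2 * norm (y - x0) / s) powr alpha - 1)"
   unfolding rs ns using i2 by eventually_elim (simp add: algebra_simps)
  have out2: "AE y in lborel. y \<notin> ball x0 (2 * s) --> - u y <= - m + Q j * ((2 * norm (y - x0) / s) powr alpha - 1)"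
   unfolding rs ns using i2 by eventually_elim (simp add: algebra_simps)
  have up: "AE y in lborel. y \<in> ball x0 (r j / 4) --> u y <= m + Q j - theta * Q j / 2"
   if A: "A \<in> sets borel" "A \<subseteq> ball x0 (8 * s)" "measure lborel A >= V * s powr N"
    and uA: "AE y in lborel. y \<in> A --> u y <= m + Q j - Q j / 2" and ext: "ball x0 (2 * s) \<subseteq> Omega \<or> Q j / 4 <= m + Q j" for A
   using oscillation_step[OF sig s alpha theta Qp[of j] const[unfolded c_def N_def V_def] q C Sob p delta(1,2) h H u eq in1 out1 A(1,2) A(3)[unfolded V_def N_def] uA ext small'[unfolded V_def N_def]]
   unfolding rs .
  have down: "AE y in lborel. y \<in> ball x0 (r j / 4) --> - u y <= - m - theta * Q j / 2"
   if A: "A \<in> sets borel" "A \<subseteq> ball x0 (8 * s)" "measure lborel A >= V * s powr N"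
    and uA: "AE y in lborel. y \<in> A --> - u y <= - m - Q j / 2" and ext: "ball x0 (2 * s) \<subseteq> Omega \<or> Q j / 4 <= - m" for A
   using oscillation_step[OF sig s alpha theta Qp[of j] const[unfolded c_def N_def V_def] q C Sob p delta(1,2) mh H mu meq in2 out2 A(1,2) A(3)[unfolded V_def N_def] uA ext small'[unfolded V_def N_def]]
   unfolding rs .
  have down': ?thesis if "AE y in lborel. y \<in> ball x0 (r j / 4) --> - u y <= - m - theta * Q j / 2"
   by(rule disjI2) (use that in \<open>auto elim!: eventually_mono\<close>)
  show ?thesis proof(cases "ball x0 (r j) \<subseteq> Omega")
   case True hence ext: "ball x0 (2 * s) \<subseteq> Omega" unfolding rs .
   \<comment> \<open>The two sets cover a ball of radius \<open>2 * s\<close>, whose measure is at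
     least twice the required one.\<close>
   define A1 where "A1 = ball x0 (r j) \<inter> {y. u y <= m + Q j / 2}"
   define A2 where "A2 = ball x0 (r j) \<inter> {y. m + Q j / 2 <= u y}"
   have mA: "A1 \<in> sets borel" "A2 \<in> sets borel" unfolding A1_def A2_def
    using um[unfolded borel_measurable_iff_le] um[unfolded borel_measurable_iff_ge] by(auto intro!: sets.Int)
   have sub: "A1 \<subseteq> ball x0 (8 * s)" "A2 \<subseteq> ball x0 (8 * s)" using r(1)[of j] by(auto simp: A1_def A2_def s_def)
   have "A1 \<union> A2 = ball x0 (r j)" by(auto simp: A1_def A2_def)
   hence "measure lborel (ball x0 (r j)) <= measure lborel A1 + measure lborel A2" using measure_Un_le[of A1 lborel A2] mA by simp
   moreover have "measure lborel (ball x0 (r j)) = V * (2 powr N * s powr N)" proof -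
    have "r j = 2 * s" by(simp add: s_def)
    thus ?thesis using s by(simp add: content_ball V_def N_def powr_realpow power_mult_distrib)
   qed
   moreover have "2 * (V * s powr N) <= V * (2 powr N * s powr N)" proof -
    have "(2::real) powr 1 <= 2 powr N" by(intro powr_mono) (auto simp: N_def Suc_leI)
    hence "2 * (V * s powr N) <= 2 powr N * (V * s powr N)" using V by(intro mult_right_mono) auto
    thus ?thesis by(simp only: mult_ac)
   qed
   ultimately have "V * s powr N <= measure lborel A1 \<or> V * s powr N <= measure lborel A2" by linarith
   thus ?thesis proof
    assume l: "V * s powr N <= measure lborel A1"
    have "AE y in lborel. y \<in> A1 --> u y <= m + Q j - Q j / 2" by(intro AE_I2) (auto simp: A1_def)
    from up[OF mA(1) sub(1) l this] ext show ?thesis by blast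
   next assume l: "V * s powr N <= measure lborel A2"
    have "AE y in lborel. y \<in> A2 --> - u y <= - m - Q j / 2" by(intro AE_I2) (auto simp: A2_def)
    from down[OF mA(2) sub(2) l this] ext show ?thesis using down' by blast
   qed
  \<comment> \<open>For a boundary point \<open>z\<close> within \<open>2 * s\<close> of
    \<open>x0\<close>, the exterior ball inside \<open>ball z (6 * s)\<close> has radius
    \<open>6 * s / 4\<close> and lies in \<open>ball x0 (8 * s)\<close>. As
    \<open>6 * s = 3 * r j\<close>, this uses \<open>3 * r0 <= R\<close>.\<close>
  next case False define A where "A = ball x0 (8 * s) - Omega"
   have mA: "A \<in> sets borel" unfolding A_def using op by(intro sets.Diff) auto
   have sub: "A \<subseteq> ball x0 (8 * s)" by(auto simp: A_def)
   have fin: "A \<in> fmeasurable lborel" using emeasure_bounded_finite[OF bounded_subset[OF bounded_ball sub]] mA by(simp add: fmeasurable_def)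
   have bl: "V * s powr N <= measure lborel A" if "ball y t \<subseteq> A" "s <= t" for y t proof -
    have "V * s powr N <= V * t powr N" using that s V by(intro mult_left_mono powr_mono2) (auto simp: N_def)
    also have "... = measure lborel (ball y t)" using that s by(simp add: content_ball V_def N_def powr_realpow)
    also have "... <= measure lborel A" by(rule measure_mono_fmeasurable[OF that(1) _ fin]) simp
    finally show ?thesis .
   qed
   have mA': "V * s powr N <= measure lborel A" proof(cases "ball x0 (r j) \<inter> Omega = {}")
    case True show ?thesis by(rule bl[of x0 "r j"]) (use True s in \<open>auto simp: A_def s_def\<close>)
   next case nd: False
    have "ball x0 (r j) \<inter> frontier Omega ~= {}" by(rule connected_Int_frontier[OF connected_ball]) (use nd False in auto)
    then obtain z where z: "z \<in> frontier Omega" "z \<in> ball x0 (r j)" by blast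
    have "6 * s <= R" using r(2)[of j] r0(2) by(simp add: s_def)
    then obtain y where y: "ball y (6 * s / 4) \<subseteq> ball z (6 * s)" "ball y (6 * s / 4) \<inter> Omega = {}"
     using R[OF z(1), of "6 * s"] s by auto
    have "ball z (6 * s) \<subseteq> ball x0 (8 * s)" proof
     fix w assume "w \<in> ball z (6 * s)"
     thus "w \<in> ball x0 (8 * s)" using z(2) dist_triangle[of x0 w z] by(simp add: s_def)
    qed
    hence "ball y (6 * s / 4) \<subseteq> A" using y by(auto simp: A_def)
    thus ?thesis by(rule bl) (use s in simp)
   qed
   have zero: "AE y in lborel. y \<in> A --> u y = 0" using X0D(2)[OF u] by eventually_elim (auto simp: A_def)
   \<comment> \<open>On \<open>A\<close> the value 0 is compared with the mean level; the sign also
     yields the condition under which the test function vanishes outside the domain.\<close>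
   show ?thesis proof(cases "0 <= m + Q j / 2")
    case True have "AE y in lborel. y \<in> A --> u y <= m + Q j - Q j / 2" using zero by eventually_elim (use True in auto)
    moreover have "Q j / 4 <= m + Q j" using True Qp[of j] by simp
    ultimately show ?thesis using up[OF mA sub mA'] by blast
   next case False have "AE y in lborel. y \<in> A --> - u y <= - m - Q j / 2" using zero by eventually_elim (use False in auto)
    moreover have "Q j / 4 <= - m" using False Qp[of j] by simp
    ultimately show ?thesis using down[OF mA sub mA'] down' by blast
   qed qed qed
 have "\<exists>m. ?inv j m" for j proof(induction j)
  case 0 have Q00: "Q 0 = Q0" by(simp add: Q_def)
  \<comment> \<open>The first interval is centred at 0 and has length
    \<open>Q0 >= 2 * U\<close>.\<close>
  have "?inv 0 (- Q0 / 2)" proof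
   show "AE y in lborel. y \<in> ball x0 (r 0) --> - Q0 / 2 <= u y & u y <= - Q0 / 2 + Q 0"
    using U by eventually_elim (use Q0 in \<open>auto simp: Q_def abs_le_iff\<close>)
   show "AE y in lborel. y \<notin> ball x0 (r 0) --> u y <= - Q0 / 2 + Q 0 * (4 * norm (y - x0) / r 0) powr alpha &
     - Q0 / 2 + Q 0 - Q 0 * (4 * norm (y - x0) / r 0) powr alpha <= u y" using U proof eventually_elim
    case (elim y) show ?case proof
     assume y: "y \<notin> ball x0 (r 0)"
     have "1 <= 4 * norm (y - x0) / r 0" using y r(1)[of 0] by(simp add: dist_norm norm_minus_commute)
     hence "1 <= (4 * norm (y - x0) / r 0) powr alpha" using alpha by(intro ge_one_powr_ge_zero) auto
     hence "Q0 * 1 <= Q0 * (4 * norm (y - x0) / r 0) powr alpha" using Q0 by(intro mult_left_mono) auto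
     thus "u y <= - Q0 / 2 + Q 0 * (4 * norm (y - x0) / r 0) powr alpha &
      - Q0 / 2 + Q 0 - Q 0 * (4 * norm (y - x0) / r 0) powr alpha <= u y" using elim Q0(2) unfolding Q00 abs_le_iff by(intro conjI) linarith+
    qed qed qed
  thus ?case by blast
 next case (Suc j) then obtain m where inv: "?inv j m" by blast
  \<comment> \<open>Shrinking the radius by 4 multiplies the growth term by
    \<open>4 powr alpha\<close>, which the decrease of \<open>Q\<close> compensates: the outer bound
    is the same on all scales.\<close>
  have tail: "Q (Suc j) * (4 * norm (y - x0) / r (Suc j)) powr alpha = Q j * (4 * norm (y - x0) / r j) powr alpha" for y proof -
   have "4 * norm (y - x0) / r (Suc j) = 4 * (4 * norm (y - x0) / r j)" by(simp add: r(3))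
   hence "(4 * norm (y - x0) / r (Suc j)) powr alpha = 4 powr alpha * (4 * norm (y - x0) / r j) powr alpha" using r(1)[of j] by(simp only: powr_mult)
   moreover have "4 powr (- alpha) * 4 powr alpha = (1::real)" by(simp flip: powr_add)
   ultimately show ?thesis unfolding QS by(simp add: mult_ac)
  qed
  have new: "?inv (Suc j) m'" if m': "m <= m'" "m' + Q (Suc j) <= m + Q j"
   and io: "AE y in lborel. y \<in> ball x0 (r j / 4) --> m' <= u y & u y <= m' + Q (Suc j)" for m' proof
   show "AE y in lborel. y \<in> ball x0 (r (Suc j)) --> m' <= u y & u y <= m' + Q (Suc j)" using io by(simp add: r(3))
   have i1: "AE y in lborel. y \<in> ball x0 (r j) --> m <= u y & u y <= m + Q j"
    and i2: "AE y in lborel. y \<notin> ball x0 (r j) --> u y <= m + Q j * (4 * norm (y - x0) / r j) powr alpha &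
     m + Q j - Q j * (4 * norm (y - x0) / r j) powr alpha <= u y" using inv by auto
   show "AE y in lborel. y \<notin> ball x0 (r (Suc j)) --> u y <= m' + Q (Suc j) * (4 * norm (y - x0) / r (Suc j)) powr alpha &
     m' + Q (Suc j) - Q (Suc j) * (4 * norm (y - x0) / r (Suc j)) powr alpha <= u y" unfolding tail using i1 i2 proof eventually_elim
    case (elim y) show ?case proof
     assume y: "y \<notin> ball x0 (r (Suc j))"
     hence "1 <= 4 * norm (y - x0) / r j" using r(1)[of j] by(simp add: r(3) dist_norm norm_minus_commute)
     hence "1 <= (4 * norm (y - x0) / r j) powr alpha" using alpha by(intro ge_one_powr_ge_zero) auto
     hence "Q j * 1 <= Q j * (4 * norm (y - x0) / r j) powr alpha" using Qp[of j] by(intro mult_left_mono) auto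
     thus "u y <= m' + Q j * (4 * norm (y - x0) / r j) powr alpha & m' + Q (Suc j) - Q j * (4 * norm (y - x0) / r j) powr alpha <= u y"
      using elim m' by(cases "y \<in> ball x0 (r j)") auto
    qed qed qed
  have QSl: "Q j - theta * Q j / 2 <= Q (Suc j)" "Q (Suc j) <= Q j" proof -
   have "(1 - theta / 2) * Q j <= 4 powr (- alpha) * Q j" using decay Qp[of j] by(intro mult_right_mono) auto
   thus "Q j - theta * Q j / 2 <= Q (Suc j)" unfolding QS by(simp add: algebra_simps)
   have "4 powr (- alpha) <= (4::real) powr 0" using alpha by(intro powr_mono) auto
   hence "4 powr (- alpha) * Q j <= 1 * Q j" using Qp[of j] by(intro mult_right_mono) auto
   thus "Q (Suc j) <= Q j" unfolding QS by simp
  qed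
  have i1: "AE y in lborel. y \<in> ball x0 (r j) --> m <= u y & u y <= m + Q j" using inv by auto
  have sub: "y \<in> ball x0 (r j)" if "y \<in> ball x0 (r j / 4)" for y using that r(1)[of j] by simp
  from step[OF inv] show ?case proof
   assume *: "AE y in lborel. y \<in> ball x0 (r j / 4) --> u y <= m + Q j - theta * Q j / 2"
   have "?inv (Suc j) m" proof(rule new)
    show "AE y in lborel. y \<in> ball x0 (r j / 4) --> m <= u y & u y <= m + Q (Suc j)" using * i1 by eventually_elim (use sub QSl in force)
   qed (use QSl in auto)
   thus ?thesis by blast
  next assume *: "AE y in lborel. y \<in> ball x0 (r j / 4) --> m + theta * Q j / 2 <= u y"
   have "?inv (Suc j) (m + Q j - Q (Suc j))" proof(rule new)
    show "AE y in lborel. y \<in> ball x0 (r j / 4) --> m + Q j - Q (Suc j) <= u y & u y <= m + Q j - Q (Suc j) + Q (Suc j)"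
     using * i1 by eventually_elim (use sub QSl in force)
   qed (use QSl in auto)
   thus ?thesis by blast
  qed qed
 from this[of j] show ?thesis unfolding r_def Q_def by blast
qed

lemma AE_lborel_nonempty_open:
 fixes S :: "'a::euclidean_space set"
 assumes "AE y in lborel. P y" "open S" "S ~= {}"
 obtains y where "y \<in> S" "P y" proof -
 have "\<exists>y\<in>S. P y" proof(rule ccontr)
  assume n: "\<not> (\<exists>y\<in>S. P y)"
  obtain N where N: "{x. \<not> P x} \<subseteq> N" "emeasure lborel N = 0" "N \<in> sets lborel" using assms(1) by(auto elim!: AE_E)
  have "S \<subseteq> N" using n N(1) by blast
  obtain x e where x: "x \<in> S" "e > 0" "ball x e \<subseteq> S" using assms(2,3) by(meson openE ex_in_conv)
  have "emeasure lborel (ball x e) <= emeasure lborel N" using x \<open>S \<subseteq> N\<close> N(3) by(intro emeasure_mono) auto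
  hence "emeasure lborel (ball x e) = 0" using N(2) by simp
  hence "measure lborel (ball x e) = 0" by(simp add: measure_def)
  thus False using x(2) by simp
 qed
 thus ?thesis using that by blast
qed

text \<open>The Hoelder continuous representative is the limit of the nested essential ranges.\<close>
lemma Hoelder_representative:
 fixes u :: "'a::euclidean_space => real"
 assumes r0: "r0 > 0" and alpha: "alpha > 0" and Q0: "Q0 > 0" and U: "AE x in lborel. abs (u x) <= U" and U0: "U >= 0"
  and osc: "!!x0 j. \<exists>m. AE y in lborel. y \<in> ball x0 (r0 * (1 / 4) ^ j) --> m <= u y & u y <= m + Q0 * 4 powr (- alpha * real j)"
 obtains v where "AE x in lborel. v x = u x" "!!x. abs (v x) <= U + Q0"
  "!!x y. abs (v x - v y) <= 2 * (U + Q0) * (8 / r0) powr alpha * norm (x - y) powr alpha" proof -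
 define r where "r j = r0 * (1 / 4) ^ j" for j
 define Q where "Q j = Q0 * 4 powr (- alpha * real j)" for j
 have rp: "r j > 0" for j using r0 by(simp add: r_def)
 have Qp: "Q j > 0" for j using Q0 by(simp add: Q_def)
 have "\<forall>x0 j. \<exists>m. AE y in lborel. y \<in> ball x0 (r j) --> m <= u y & u y <= m + Q j" using osc by(simp add: r_def Q_def)
 then obtain m where m: "!!x0 j. AE y in lborel. y \<in> ball x0 (r j) --> m x0 j <= u y & u y <= m x0 j + Q j" by metis
 \<comment> \<open>Balls with the same centre share a set of positive measure, so any two of the
   intervals intersect.\<close>
 have cross: "m x0 i <= m x0 j + Q j" for x0 i j proof -
  have ae: "AE y in lborel. (y \<in> ball x0 (r i) --> m x0 i <= u y) & (y \<in> ball x0 (r j) --> u y <= m x0 j + Q j)"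
   using m[of x0 i] m[of x0 j] by eventually_elim auto
  have "ball x0 (min (r i) (r j)) ~= {}" using rp[of i] rp[of j] by auto
  from AE_lborel_nonempty_open[OF ae open_ball this] obtain y where
   "y \<in> ball x0 (min (r i) (r j))" "(y \<in> ball x0 (r i) --> m x0 i <= u y) & (y \<in> ball x0 (r j) --> u y <= m x0 j + Q j)" by blast
  thus ?thesis by auto
 qed
 define v where "v x0 = (SUP j. m x0 j)" for x0
 have v1: "m x0 j <= v x0" "v x0 <= m x0 j + Q j" for x0 j proof -
  have "bdd_above (range (m x0))" using cross by(intro bdd_aboveI2[where M = "m x0 0 + Q 0"]) auto
  thus "m x0 j <= v x0" unfolding v_def by(rule cSUP_upper[OF UNIV_I])
  show "v x0 <= m x0 j + Q j" unfolding v_def by(rule cSUP_least) (use cross in auto)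
 qed
 have near: "AE y in lborel. y \<in> ball x0 (r j) --> abs (u y - v x0) <= Q j" for x0 j
  using m[of x0 j] by eventually_elim (use v1[of x0 j] in \<open>auto simp: abs_le_iff\<close>)
 have Q0': "Q 0 = Q0" by(simp add: Q_def)
 have bound: "abs (v x0) <= U + Q0" for x0 proof -
  have "AE y in lborel. (y \<in> ball x0 (r 0) --> abs (u y - v x0) <= Q 0) & abs (u y) <= U" using near[of x0 0] U by eventually_elim auto
  moreover have "ball x0 (r 0) ~= {}" using rp[of 0] by auto
  ultimately obtain y where "y \<in> ball x0 (r 0)" "(y \<in> ball x0 (r 0) --> abs (u y - v x0) <= Q 0) & abs (u y) <= U"
   using AE_lborel_nonempty_open[OF _ open_ball] by blast
  thus ?thesis unfolding Q0' by linarith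
 qed
 have closeb: "abs (v x - v y) <= 2 * Q j" if "norm (x - y) < r j" for x y j proof -
  have "AE z in lborel. (z \<in> ball x (r j) --> abs (u z - v x) <= Q j) & (z \<in> ball y (r j) --> abs (u z - v y) <= Q j)"
   using near[of x j] near[of y j] by eventually_elim auto
  moreover have "open (ball x (r j) \<inter> ball y (r j))" by auto
  moreover have "ball x (r j) \<inter> ball y (r j) ~= {}" proof -
   have "x \<in> ball x (r j) \<inter> ball y (r j)" using that rp[of j] by(simp add: dist_norm norm_minus_commute)
   thus ?thesis by blast
  qed
  ultimately obtain z where "z \<in> ball x (r j) \<inter> ball y (r j)"
   "(z \<in> ball x (r j) --> abs (u z - v x) <= Q j) & (z \<in> ball y (r j) --> abs (u z - v y) <= Q j)" using AE_lborel_nonempty_open by blast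
  hence "abs (u z - v x) <= Q j" "abs (u z - v y) <= Q j" by auto
  thus ?thesis by linarith
 qed
 have hold: "abs (v x - v y) <= 2 * (U + Q0) * (8 / r0) powr alpha * norm (x - y) powr alpha" for x y proof(cases "x = y")
  case False define d where "d = norm (x - y)"
  have d: "d > 0" using False by(simp add: d_def)
  have e8: "(8 / r0) powr alpha * d powr alpha = (8 * d / r0) powr alpha" using powr_mult[of "8 / r0" d alpha] r0 d by simp
  have "abs (v x - v y) <= 2 * (U + Q0) * (8 * d / r0) powr alpha" proof(cases "2 * d >= r0")
   case True hence "1 <= 8 * d / r0" using r0 d by(simp add: field_simps)
   hence "1 <= (8 * d / r0) powr alpha" using alpha by(intro ge_one_powr_ge_zero) auto
   hence "2 * (U + Q0) * 1 <= 2 * (U + Q0) * (8 * d / r0) powr alpha" using U0 Q0 by(intro mult_left_mono) auto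
   moreover have "abs (v x - v y) <= 2 * (U + Q0) * 1" using abs_triangle_ineq4[of "v x" "v y"] bound[of x] bound[of y] by simp
   ultimately show ?thesis by(rule order_trans[rotated])
  next case False have "1 <= r0 / (2 * d)" using False d r0 by(simp add: field_simps)
   \<comment> \<open>\<open>j\<close> is the scale comparable to \<open>d\<close>:
     \<open>4 powr j <= r0 / (2 * d) < 4 powr (j + 1)\<close>, taken from a dyadic scale by halving
     the exponent.\<close>
   then obtain j where j: "2 powr (2 * real j) <= r0 / (2 * d)" "r0 / (2 * d) < 2 powr (2 * (real j + 1))" proof -
    assume that: "!!j. 2 powr (2 * real j) <= r0 / (2 * d) ==> r0 / (2 * d) < 2 powr (2 * (real j + 1)) ==> thesis" and ge: "1 <= r0 / (2 * d)"
    obtain k :: nat where k: "2 powr real k <= r0 / (2 * d)" "r0 / (2 * d) < 2 powr (real k + 1)" using ge by(rule ex_dyadic)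
    have kn: "2 * (k div 2) <= k" "k + 1 <= 2 * (k div 2 + 1)" by presburger+
    have k2: "2 * real (k div 2) <= real k" "real k + 1 <= 2 * (real (k div 2) + 1)"
     using of_nat_mono[OF kn(1), where 'a=real] of_nat_mono[OF kn(2), where 'a=real] by simp_all
    have "2 powr (2 * real (k div 2)) <= (2::real) powr real k" "(2::real) powr (real k + 1) <= 2 powr (2 * (real (k div 2) + 1))"
     by(rule powr_mono[OF k2(1)], simp, rule powr_mono[OF k2(2)], simp)
    thus thesis using k by(intro that[of "k div 2"]) linarith+
   qed
   have p4: "2 powr (2 * t) = (4::real) powr t" for t proof -
    have "(4::real) powr t = (2 powr 2) powr t" by(simp add: powr_numeral)
    thus ?thesis by(simp only: powr_powr)
   qed
   have r4: "r j = r0 / 4 powr real j" by(simp add: r_def power_one_over powr_realpow)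
   have "d < r j" proof -
    have "d * 4 powr real j <= r0 / 2" using j(1) d unfolding p4 by(simp add: field_simps)
    hence "d * 4 powr real j < r0" using r0 by linarith
    thus ?thesis unfolding r4 by(simp add: pos_less_divide_eq)
   qed
   hence "abs (v x - v y) <= 2 * Q j" using closeb by(simp add: d_def)
   moreover have "Q j <= (U + Q0) * (8 * d / r0) powr alpha" proof -
    have "r0 < 2 * d * 4 powr (real j + 1)" using j(2) d unfolding p4 by(simp add: field_simps)
    hence "r0 < 8 * d * 4 powr real j" by(simp add: powr_add)
    hence "4 powr (- real j) <= 8 * d / r0" using r0 unfolding powr_minus_divide by(simp add: field_simps)
    hence "(4 powr (- real j)) powr alpha <= (8 * d / r0) powr alpha" using alpha by(intro powr_mono2) auto
    moreover have "Q j = Q0 * (4 powr (- real j)) powr alpha" by(simp add: Q_def powr_powr mult.commute)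
    ultimately show ?thesis using U0 Q0 by(simp only:) (intro mult_mono, auto)
   qed
   ultimately have "abs (v x - v y) <= 2 * ((U + Q0) * (8 * d / r0) powr alpha)" by linarith
   thus ?thesis by(simp only: mult.assoc)
  qed
  thus ?thesis unfolding d_def[symmetric] e8[symmetric] by(simp only: mult.assoc)
 qed simp
 \<comment> \<open>Countably many centres keep the exceptional sets together null, and closeness of
   \<open>v\<close> at nearby points extends the comparison to all centres.\<close>
 obtain D :: "'a set" where D: "countable D" "!!X. open X ==> X ~= {} ==> \<exists>d\<in>D. d \<in> X" using countable_dense_exists by blast
 have ae: "AE y in lborel. \<forall>x0\<in>D. \<forall>j. y \<in> ball x0 (r j) --> abs (u y - v x0) <= Q j"
  unfolding AE_ball_countable[OF D(1)] AE_all_countable using near by blast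
 have "(%j. 3 * (Q0 * (4 powr (- alpha)) ^ j)) ----> 3 * (Q0 * 0)" proof(intro tendsto_mult tendsto_const LIMSEQ_power_zero)
  show "norm (4 powr (- alpha) :: real) < 1" using alpha by(simp add: powr_less_one)
 qed
 moreover have "Q0 * (4 powr (- alpha)) ^ j = Q j" for j by(simp add: Q_def powr_realpow[symmetric] powr_powr)
 ultimately have Qlim: "(%j. 3 * Q j) ----> 0" by simp
 have "AE y in lborel. v y = u y" using ae proof eventually_elim
  case (elim y) have "abs (u y - v y) <= 3 * Q j" for j proof -
   have "ball y (r j) ~= {}" using rp[of j] by auto
   then obtain x0 where x0: "x0 \<in> D" "x0 \<in> ball y (r j)" using D(2)[OF open_ball] by blast
   have "abs (u y - v x0) <= Q j" using elim x0 by(simp add: dist_commute)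
   moreover have "abs (v x0 - v y) <= 2 * Q j" using x0(2) by(intro closeb) (simp add: dist_norm norm_minus_commute)
   ultimately show ?thesis by linarith
  qed
  hence "abs (u y - v y) <= 0" using LIMSEQ_le_const[OF Qlim] by blast
  thus ?case by simp
 qed
 thus ?thesis using bound hold by(rule that)
qed

section \<open>Distributional derivatives in one variable\<close>

lemma Ck_on_scale:
 fixes f :: "real => real"
 shows "Ck_on k UNIV f ==> Ck_on k UNIV (%x. f x * c)" proof(induction k arbitrary: f)
 case 0 thus ?case by(auto intro!: continuous_intros)
next case (Suc k) then obtain F where F: "!!x. (f has_derivative F x) (at x)" "!!v. Ck_on k UNIV (%x. F x v)" by auto
 have "((%x. f x * c) has_derivative (%v. F x v * c)) (at x)" for x by(rule has_derivative_mult_left[OF F(1)])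
 thus ?case using Suc.IH[OF F(2)] by(auto intro!: exI[of _ "%x v. F x v * c"])
qed

text \<open>For functions of one variable the family of directional derivatives is replaced by the
  ordinary derivative, of which the others are multiples.\<close>

lemma Ck_on_Suc_real:
 fixes f :: "real => real"
 shows "Ck_on (Suc k) UNIV f \<longleftrightarrow> (\<exists>f'. (\<forall>x. (f has_real_derivative f' x) (at x)) & Ck_on k UNIV f')" proof
 assume "Ck_on (Suc k) UNIV f"
 then obtain F where F: "!!x. (f has_derivative F x) (at x)" "!!v. Ck_on k UNIV (%x. F x v)" by auto
 have "(f has_real_derivative F x 1) (at x)" for x proof -
  have "linear (F x)" using F(1) by(rule has_derivative_linear)
  hence "F x = (*) (F x 1)" by(auto simp: fun_eq_iff linear_iff) (metis mult.commute mult.right_neutral)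
  thus ?thesis using F(1)[of x] by(simp add: has_field_derivative_def)
 qed
 thus "\<exists>f'. (\<forall>x. (f has_real_derivative f' x) (at x)) & Ck_on k UNIV f'" using F(2)[of 1] by(intro exI[of _ "%x. F x 1"]) blast
next assume "\<exists>f'. (\<forall>x. (f has_real_derivative f' x) (at x)) & Ck_on k UNIV f'"
 then obtain f' where f': "!!x. (f has_real_derivative f' x) (at x)" "Ck_on k UNIV f'" by blast
 show "Ck_on (Suc k) UNIV f" using f'(1) Ck_on_scale[OF f'(2)] by(auto simp: has_field_derivative_def intro!: exI[of _ "%x v. f' x * v"])
qed

declare Ck_on.simps(2) [simp del]

lemma Ck_on_pred:
 fixes f :: "real => real"
 shows "Ck_on (Suc k) UNIV f ==> Ck_on k UNIV f" proof(induction k arbitrary: f)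
 case 0 then obtain f' where "!!x. (f has_real_derivative f' x) (at x)" by(auto simp: Ck_on_Suc_real)
 thus ?case by(auto intro!: continuous_at_imp_continuous_on DERIV_isCont)
next case (Suc k) then obtain f' where "!!x. (f has_real_derivative f' x) (at x)" "Ck_on (Suc k) UNIV f'" using Ck_on_Suc_real[of "Suc k" f] by blast
 thus ?case using Suc.IH[of f'] Ck_on_Suc_real[of k f] by blast
qed

lemma Ck_on_add:
 fixes f g :: "real => real"
 shows "Ck_on k UNIV f ==> Ck_on k UNIV g ==> Ck_on k UNIV (%x. f x + g x)" proof(induction k arbitrary: f g)
 case 0 thus ?case by(auto intro!: continuous_intros)
next case (Suc k) obtain f' where f': "!!x. (f has_real_derivative f' x) (at x)" "Ck_on k UNIV f'" using Suc.prems(1) Ck_on_Suc_real[of k f] by blast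
 obtain g' where g': "!!x. (g has_real_derivative g' x) (at x)" "Ck_on k UNIV g'" using Suc.prems(2) Ck_on_Suc_real[of k g] by blast
 show ?case unfolding Ck_on_Suc_real by(intro exI[of _ "%x. f' x + g' x"] conjI allI DERIV_add f' g' Suc.IH)
qed

lemma Ck_on_mult:
 fixes f g :: "real => real"
 shows "Ck_on k UNIV f ==> Ck_on k UNIV g ==> Ck_on k UNIV (%x. f x * g x)" proof(induction k arbitrary: f g)
 case 0 thus ?case by(auto intro!: continuous_intros)
next case (Suc k) obtain f' where f': "!!x. (f has_real_derivative f' x) (at x)" "Ck_on k UNIV f'" using Suc.prems(1) Ck_on_Suc_real[of k f] by blast
 obtain g' where g': "!!x. (g has_real_derivative g' x) (at x)" "Ck_on k UNIV g'" using Suc.prems(2) Ck_on_Suc_real[of k g] by blast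
 show ?case unfolding Ck_on_Suc_real by(intro exI[of _ "%x. f' x * g x + g' x * f x"] conjI allI DERIV_mult f' g' Ck_on_add Suc.IH
    Ck_on_pred[OF Suc.prems(1)] Ck_on_pred[OF Suc.prems(2)])
qed

lemma Ck_on_affine:
 fixes f :: "real => real"
 shows "Ck_on k UNIV f ==> Ck_on k UNIV (%x. f (c * x + d))" proof(induction k arbitrary: f)
 case 0 hence "continuous_on UNIV (%x. f (c * x + d))" by(auto intro!: continuous_on_compose2[of UNIV f] continuous_intros)
 thus ?case by simp
next case (Suc k) obtain f' where f': "!!x. (f has_real_derivative f' x) (at x)" "Ck_on k UNIV f'" using Suc.prems Ck_on_Suc_real[of k f] by blast
 show ?case unfolding Ck_on_Suc_real proof(intro exI[of _ "%x. f' (c * x + d) * c"] conjI allI)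
  show "((%x. f (c * x + d)) has_real_derivative f' (c * x + d) * c) (at x)" for x by(rule DERIV_chain2[OF f'(1)]) (auto intro!: derivative_eq_intros)
  show "Ck_on k UNIV (%x. f' (c * x + d) * c)" by(intro Ck_on_scale Suc.IH f')
 qed qed

text \<open>The functions \<open>t\<^sup>-\<^sup>n exp (-1/t)\<close>, extended by zero, are stable under differentiation up to linear
 combinations.\<close>
definition flat :: "nat => real => real" where
 "flat n t = (if t > 0 then (1 / t) ^ n * exp (- (1 / t)) else 0)"

lemma flat_tendsto: "(flat n \<longlongrightarrow> 0) (at_right 0)" proof -
 have "((%y::real. y ^ n / exp y) \<longlongrightarrow> 0) at_top" by(rule tendsto_power_div_exp_0)
 hence "((%t::real. inverse t ^ n / exp (inverse t)) \<longlongrightarrow> 0) (at_right 0)"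
  by(rule filterlim_compose[OF _ filterlim_inverse_at_top_right])
 moreover have "\<forall>\<^sub>F t in at_right (0::real). inverse t ^ n / exp (inverse t) = flat n t"
  using eventually_at_right_less[of 0] by eventually_elim (simp add: flat_def exp_minus inverse_eq_divide)
 ultimately show ?thesis by(rule Lim_transform_eventually)
qed

text \<open>Only the point 0 is delicate: from the left the quotient is 0, from the right it is
  \<open>flat (n + 1)\<close>, which tends to 0.\<close>

lemma flat_derivative: "(flat n has_real_derivative flat (n + 2) t - real n * flat (n + 1) t) (at t)" proof -
 consider "t > 0" | "t < 0" | "t = 0" by linarith
 thus ?thesis proof cases
  case 1 have "((%t. (1 / t) ^ n * exp (- (1 / t))) has_real_derivative flat (n + 2) t - real n * flat (n + 1) t) (at t)" proof -
   have d1: "((%t. 1 / t) has_real_derivative - ((1 / t)^2)) (at t)" using 1 by(auto intro!: derivative_eq_intros simp: power2_eq_square)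
   have d2: "((%t. (1 / t) ^ n) has_real_derivative real n * (- ((1 / t)^2) * (1 / t) ^ (n - Suc 0))) (at t)" by(rule DERIV_power[OF d1])
   have d3: "((%t. exp (- (1 / t))) has_real_derivative exp (- (1 / t)) * (- (- ((1 / t)^2)))) (at t)" by(rule DERIV_fun_exp[OF DERIV_minus[OF d1]])
   have e: "real n * (- ((1 / t)^2) * (1 / t) ^ (n - Suc 0)) = - (real n * (1 / t) ^ (n + 1))" by(cases n) (simp_all add: power2_eq_square)
   show ?thesis using DERIV_mult[OF d2 d3] 1 unfolding e by(simp add: flat_def power2_eq_square algebra_simps)
  qed
  thus ?thesis by(rule has_field_derivative_transform_within_open[where S = "{0<..}"]) (use 1 in \<open>auto simp: flat_def\<close>)
 next case 2 have "((%t. 0::real) has_real_derivative flat (n + 2) t - real n * flat (n + 1) t) (at t)"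
   using 2 by(auto intro!: derivative_eq_intros simp: flat_def)
  thus ?thesis by(rule has_field_derivative_transform_within_open[where S = "{..<0}"]) (use 2 in \<open>auto simp: flat_def\<close>)
 next case 3 have "((%h. (flat n (0 + h) - flat n 0) / h) \<longlongrightarrow> 0) (at 0)" unfolding filterlim_at_split proof
   have "\<forall>\<^sub>F h in at_left (0::real). 0 = (flat n (0 + h) - flat n 0) / h" by(auto simp: eventually_at_filter flat_def)
   thus "((%h. (flat n (0 + h) - flat n 0) / h) \<longlongrightarrow> 0) (at_left 0)" by(rule Lim_transform_eventually[rotated]) simp
   have "\<forall>\<^sub>F h in at_right (0::real). flat (n + 1) h = (flat n (0 + h) - flat n 0) / h"
    using eventually_at_right_less[of 0] by eventually_elim (simp add: flat_def field_simps)
   thus "((%h. (flat n (0 + h) - flat n 0) / h) \<longlongrightarrow> 0) (at_right 0)" by(rule Lim_transform_eventually[rotated]) (rule flat_tendsto)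
  qed
  thus ?thesis using 3 by(simp add: DERIV_def flat_def)
 qed qed

lemma Ck_on_flat: "Ck_on k UNIV (flat n)" proof(induction k arbitrary: n)
 case 0 show ?case using flat_derivative[of n] by(auto intro!: continuous_at_imp_continuous_on DERIV_isCont)
next case (Suc k) have "Ck_on k UNIV (%t. flat (n + 2) t + flat (n + 1) t * (- real n))" by(intro Ck_on_add Ck_on_scale Suc)
 hence "Ck_on k UNIV (%t. flat (n + 2) t - real n * flat (n + 1) t)" by(simp add: mult.commute)
 thus ?case unfolding Ck_on_Suc_real using flat_derivative[of n] by(intro exI[of _ "%t. flat (n + 2) t - real n * flat (n + 1) t"]) blast
qed

text \<open>\<open>rho\<close> is the product of two flat exponentials, in \<open>t\<close> and in
  \<open>1 - t\<close>, and \<open>Phi\<close> is its primitive. The mass \<open>c\<close> is not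
  normalised; it cancels where the step is applied.\<close>

lemma ex_smooth_step:
 obtains Phi rho :: "real => real" and c where "c > 0" "!!k. Ck_on k UNIV Phi" "!!t. (Phi has_real_derivative rho t) (at t)"
  "continuous_on UNIV rho" "!!t. rho t >= 0" "!!t. t \<notin> {0..1} ==> rho t = 0"
  "!!t. t <= 0 ==> Phi t = 0" "!!t. t >= 1 ==> Phi t = c" "!!t. 0 <= Phi t & Phi t <= c"
  "integrable lborel rho" "(LBINT t. rho t) = c" proof -
 define rho where "rho t = flat 0 t * flat 0 ((- 1) * t + 1)" for t
 have rhoC: "Ck_on k UNIV rho" for k unfolding rho_def by(intro Ck_on_mult Ck_on_flat Ck_on_affine)
 have rhoc: "continuous_on UNIV rho" using rhoC[of 0] by simp
 have rho0: "rho t >= 0" for t by(simp add: rho_def flat_def)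
 have rhos: "rho t = 0" if "t \<notin> {0<..<1}" for t using that by(auto simp: rho_def flat_def)
 have rhop: "rho (1/2) > 0" by(simp add: rho_def flat_def)
 \<comment> \<open>The lower limit -1 lies to the left of the support, so the derivative is
   two-sided on the support; near points \<open>t <= -1\<close> the integral is 0.\<close>
 have "\<exists>Phi. \<forall>t. (Phi has_real_derivative rho t) (at t)" proof(intro exI[of _ "%t. integral {-1..t} rho"] allI)
  fix t show "((%t. integral {-1..t} rho) has_real_derivative rho t) (at t)" proof(cases "t > -1")
   case True have "((%x. integral {-1..x} rho) has_real_derivative rho t) (at t within {-1..t+1})"
    by(rule integral_has_real_derivative) (use True rhoc continuous_on_subset in auto)
   moreover have "at t within {-1..t+1} = at t" using True by(intro at_within_interior) auto
   ultimately show ?thesis by simp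
  next case False have "((%t. 0::real) has_real_derivative rho t) (at t)" using False rhos[of t] by simp
   thus ?thesis proof(rule has_field_derivative_transform_within_open[where S = "{..<0}"])
    fix x :: real assume "x \<in> {..<0}"
    hence "integral {-1..x} rho = integral {-1..x} (%t. 0)" by(intro integral_cong rhos) auto
    thus "0 = integral {-1..x} rho" by simp
   qed (use False in auto)
  qed qed
 then obtain Phi0 where Phi0: "!!t. (Phi0 has_real_derivative rho t) (at t)" by blast
 define Phi where "Phi t = Phi0 t - Phi0 0" for t
 have Phi: "(Phi has_real_derivative rho t) (at t)" for t unfolding Phi_def using DERIV_diff[OF Phi0[of t] DERIV_const[of "Phi0 0"]] by simp
 have mono: "Phi s <= Phi t" if "s <= t" for s t by(rule DERIV_nonneg_imp_nondecreasing[OF that]) (use Phi rho0 in blast)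
 have cons: "Phi s = Phi t" if st: "s <= t" and z: "!!x. s < x ==> x < t ==> rho x = 0" for s t proof(cases "s = t")
  case False hence "\<exists>z. z > s & z < t & Phi t - Phi s = (t - s) * rho z" using st by(intro MVT2) (auto intro: Phi)
  thus ?thesis using z by auto
 qed simp
 have z1: "Phi t = 0" if "t <= 0" for t using cons[of t 0] that rhos by(auto simp: Phi_def)
 have z2: "Phi t = Phi 1" if "t >= 1" for t using cons[of 1 t] that rhos by auto
 have c: "Phi 1 > 0" proof(rule ccontr)
  assume "\<not> Phi 1 > 0"
  hence "Phi t = 0" if "0 <= t" "t <= 1" for t using mono[OF that(1)] mono[OF that(2)] z1[of 0] by simp
  hence "((%t. 0::real) has_real_derivative rho (1/2)) (at (1/2))"
   by(intro has_field_derivative_transform_within_open[OF Phi, where S = "{0<..<1}"]) auto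
  hence "rho (1/2) = 0" using DERIV_unique[OF _ DERIV_const] by blast
  thus False using rhop by simp
 qed
 have CkP: "Ck_on k UNIV Phi" for k proof(cases k)
  case 0 thus ?thesis using Phi by(auto intro!: continuous_at_imp_continuous_on DERIV_isCont)
 next case (Suc n) thus ?thesis using Phi rhoC[of n] by(auto simp: Ck_on_Suc_real)
 qed
 have hi: "(rho has_integral (Phi 1 - Phi 0)) {0..1}" by(rule fundamental_theorem_of_calculus)
   (use Phi in \<open>auto simp: has_real_derivative_iff_has_vector_derivative[symmetric] intro: has_field_derivative_at_within\<close>)
 have si: "set_integrable lborel {0..1} rho"
  unfolding set_integrable_def by(rule borel_integrable_compact[unfolded scaleR_conv_of_real]) (use rhoc continuous_on_subset in auto)
 have ind: "indicator {0..1} t *\<^sub>R rho t = rho t" for t proof(cases "t \<in> {0..1}")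
  case False hence "rho t = 0" by(intro rhos) auto
  thus ?thesis by simp
 qed simp
 have irho: "integrable lborel rho" using si by(simp only: set_integrable_def ind)
 have "(LINT t:{0..1}|lborel. rho t) = integral {0..1} rho" by(rule set_borel_integral_eq_integral(2)[OF si])
 hence "(LBINT t. rho t) = integral {0..1} rho" unfolding set_lebesgue_integral_def ind .
 hence L: "(LBINT t. rho t) = Phi 1" using integral_unique[OF hi] z1[of 0] by simp
 show ?thesis proof(rule that[of "Phi 1" Phi rho])
  show "0 <= Phi t & Phi t <= Phi 1" for t using z1[of t] z2[of t] mono[of 0 t] mono[of t 1] z1[of 0] c by(cases "t <= 0"; cases "t >= 1") auto
  show "rho t = 0" if "t \<notin> {0..1}" for t by(rule rhos) (use that in auto)
 qed (fact c CkP Phi rhoc rho0 z1 z2 irho L)+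
qed

lemma lebesgue_on_integral_eq:
 fixes f :: "real => real"
 assumes "S \<in> sets lebesgue"
 shows "(LINT t|lebesgue_on S. f t) = (LINT t|lebesgue. indicator S t * f t)"
  "integrable (lebesgue_on S) f \<longleftrightarrow> integrable lebesgue (%t. indicator S t * f t)"
 using assms by(simp_all add: integral_restrict_space integrable_restrict_space)

text \<open>Test with smooth approximations of the indicator of \<open>[a, b]\<close>.\<close>
lemma distributional_derivative_integral:
 fixes f g :: "real => real"
 assumes f: "continuous_on {0..} f" and g: "!!a b. 0 < a ==> a <= b ==> integrable (lebesgue_on {a..b}) g"
  and weak: "!!phi. test_function 0 \<infinity> phi ==>
   (LINT t|lebesgue_on {0<..}. deriv phi t * f t) = - (LINT t|lebesgue_on {0<..}. phi t * g t)" and ab: "0 < a" "a <= b"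
 shows "f b - f a = (LINT t|lebesgue_on {a..b}. g t)" proof -
 obtain Phi rho :: "real => real" and c where c: "c > 0" and CkP: "!!k. Ck_on k UNIV Phi" and Phi: "!!t. (Phi has_real_derivative rho t) (at t)"
  and rhoc: "continuous_on UNIV rho" and rho0: "!!t. rho t >= 0" and rhos: "!!t. t \<notin> {0..1} ==> rho t = 0"
  and P0: "!!t. t <= 0 ==> Phi t = 0" and P1: "!!t. t >= 1 ==> Phi t = c" and Pb: "!!t. 0 <= Phi t & Phi t <= c"
  and irho: "integrable lborel rho" and Lrho: "(LBINT t. rho t) = c" by(rule ex_smooth_step, rule that)
 have Phim[measurable]: "Phi \<in> borel_measurable borel" using CkP[of 0] by(auto intro: borel_measurable_continuous_onI)
 have rhom[measurable]: "rho \<in> borel_measurable borel" using rhoc by(rule borel_measurable_continuous_onI)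
 \<comment> \<open>\<open>f\<close> is extended constantly to negative times, to have a continuous
   function on the whole line.\<close>
 define F where "F t = f (max 0 t)" for t
 have Fc: "continuous_on UNIV F" unfolding F_def by(rule continuous_on_compose2[OF f]) (auto intro!: continuous_intros)
 have Fm[measurable]: "F \<in> borel_measurable borel" using Fc by(rule borel_measurable_continuous_onI)
 define n where "n k = real (Suc k)" for k
 have n1: "n k >= 1" for k by(simp add: n_def)
 have approx: "(%k. LBINT t. n k * rho (n k * t + (- n k * d)) * F t) ----> c * F d" for d proof -
  have eq: "(LBINT t. n k * rho (n k * t + (- n k * d)) * F t) = (LBINT s. rho s * F (d + (1 / n k) * s))" for k proof -
   have m: "(%t. n k * rho (n k * t + (- n k * d)) * F t) \<in> borel_measurable borel" by measurable
   have nk: "1 / n k ~= 0" "n k ~= 0" using n1[of k] by auto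
   have 1: "abs (1 / n k) ^ DIM(real) * (LBINT x. n k * rho (n k * (d + (1 / n k) *\<^sub>R x) + (- n k * d)) * F (d + (1 / n k) *\<^sub>R x))
     = (LBINT t. n k * rho (n k * t + (- n k * d)) * F t)" by(rule lborel_affine_integral(2)[OF nk(1) m])
   have 2: "n k * rho (n k * (d + (1 / n k) *\<^sub>R x) + (- n k * d)) * F (d + (1 / n k) *\<^sub>R x) = n k * (rho x * F (d + (1 / n k) * x))" for x
   proof -
    have "n k * (d + (1 / n k) *\<^sub>R x) + (- n k * d) = x" using nk by(simp add: distrib_left)
    thus ?thesis by(simp only: mult.assoc real_scaleR_def)
   qed
   have 3: "abs (1 / n k) ^ DIM(real) * (n k * X) = X" for X using n1[of k] by simp
   show ?thesis using 1[symmetric] unfolding 2 integral_mult_right_zero 3 .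
  qed
  obtain B where B: "!!t. t \<in> {d..d + 1} ==> abs (F t) <= B" proof -
   have "compact (F ` {d..d + 1})" by(intro compact_continuous_image continuous_on_subset[OF Fc]) auto
   hence "bounded (F ` {d..d + 1})" by(rule compact_imp_bounded)
   then obtain B where "\<forall>x\<in>F ` {d..d + 1}. abs x <= B" unfolding bounded_real by blast
   thus ?thesis by(intro that) blast
  qed
  have "(%k. LBINT s. rho s * F (d + (1 / n k) * s)) ----> (LBINT s. rho s * F d)"
  proof(rule integral_dominated_convergence[where w = "%s. B * rho s"])
   show "AE s in lborel. (%k. rho s * F (d + (1 / n k) * s)) ----> rho s * F d" proof(rule AE_I2)
    fix s
    have "(%k. d + (1 / n k) * s) ----> d + 0 * s" unfolding n_def by(intro tendsto_intros LIMSEQ_inverse_real_of_nat[unfolded inverse_eq_divide])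
    hence "(%k. F (d + (1 / n k) * s)) ----> F d" using Fc by(intro continuous_on_tendsto_compose[OF Fc]) auto
    thus "(%k. rho s * F (d + (1 / n k) * s)) ----> rho s * F d" by(intro tendsto_intros)
   qed
   show "AE s in lborel. norm (rho s * F (d + (1 / n k) * s)) <= B * rho s" for k proof(rule AE_I2)
    fix s show "norm (rho s * F (d + (1 / n k) * s)) <= B * rho s" proof(cases "s \<in> {0..1}")
     case True have "(1 / n k) * s <= 1 * 1" using True n1[of k] by(intro mult_mono) auto
     hence "d + (1 / n k) * s \<in> {d..d + 1}" using True n1[of k] by auto
     hence "rho s * abs (F (d + (1 / n k) * s)) <= rho s * B" by(intro mult_left_mono B rho0)
     thus ?thesis using rho0[of s] by(simp only: real_norm_def abs_mult abs_of_nonneg mult.commute)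
    qed (simp add: rhos)
   qed
  qed (use irho in simp_all)
  thus ?thesis unfolding eq using Lrho by simp
 qed
 \<comment> \<open>It rises from 0 to \<open>c\<close> on \<open>[a, a + 1/n]\<close> and falls back
   on \<open>[b, b + 1/n]\<close>, hence is supported in \<open>[a, b + 1]\<close>.\<close>
 define phi where "phi k t = Phi (n k * t + (- n k * a)) + Phi (n k * t + (- n k * b)) * (- 1)" for k t
 define D where "D k t = n k * rho (n k * t + (- n k * a)) - n k * rho (n k * t + (- n k * b))" for k t
 have D: "(phi k has_real_derivative D k t) (at t)" for k t
  unfolding phi_def[abs_def] D_def by(auto intro!: derivative_eq_intros DERIV_chain2[OF Phi])
 have supp: "phi k t = 0" "D k t = 0" if "t \<notin> {a..b + 1}" for k t proof -
  have "phi k t = 0 & D k t = 0" proof(cases "t < a")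
   case True have "n k * (t - a) < 0" "n k * (t - b) < 0" using True ab n1[of k] by(auto simp: mult_less_0_iff)
   thus ?thesis by(simp add: phi_def D_def algebra_simps P0 rhos)
  next case False hence t: "t > b + 1" using that by auto
   have "1 * 1 < n k * (t - b)" using t n1[of k] by(intro mult_le_less_imp_less) auto
   moreover have "n k * (t - b) <= n k * (t - a)" using ab n1[of k] by(intro mult_left_mono) auto
   ultimately show ?thesis by(simp add: phi_def D_def algebra_simps P1 rhos)
  qed
  thus "phi k t = 0" "D k t = 0" by auto
 qed
 have test: "test_function 0 \<infinity> (phi k)" for k unfolding test_function_def smooth_on_def proof(intro conjI allI)
  show "\<exists>a' b'. 0 < a' & ereal b' < \<infinity> & (\<forall>t. t \<notin> {a'..b'} --> phi k t = 0)"
   using ab supp(1) by(intro exI[where x = a] exI[where x = "b + 1"]) auto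
  show "Ck_on j UNIV (phi k)" for j unfolding phi_def[abs_def] by(intro Ck_on_add Ck_on_scale Ck_on_affine CkP)
 qed
 have phim[measurable]: "phi k \<in> borel_measurable borel" for k unfolding phi_def[abs_def] by measurable
 have Dm[measurable]: "D k \<in> borel_measurable borel" for k unfolding D_def[abs_def] by measurable
 have lhs: "(LINT t|lebesgue_on {0<..}. deriv (phi k) t * f t) =
   (LBINT t. n k * rho (n k * t + (- n k * a)) * F t) - (LBINT t. n k * rho (n k * t + (- n k * b)) * F t)" for k proof -
  have dD: "deriv (phi k) t = D k t" for t by(rule DERIV_imp_deriv[OF D])
  have "(LINT t|lebesgue_on {0<..}. deriv (phi k) t * f t) = (LINT t|lebesgue. indicator {0<..} t * (D k t * f t))"
   unfolding dD by(rule lebesgue_on_integral_eq) simp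
  also have "... = (LINT t|lebesgue. D k t * F t)" proof(intro L1_integral_cong refl)
   fix t show "indicator {0<..} t * (D k t * f t) = D k t * F t" using supp(2)[of t k] ab by(cases "t > 0") (auto simp: F_def)
  qed
  also have "... = (LBINT t. D k t * F t)" by(rule integral_completion) measurable
  also have "... = (LBINT t. n k * rho (n k * t + (- n k * a)) * F t - n k * rho (n k * t + (- n k * b)) * F t)" by(simp add: D_def left_diff_distrib)
  also have "... = (LBINT t. n k * rho (n k * t + (- n k * a)) * F t) - (LBINT t. n k * rho (n k * t + (- n k * b)) * F t)"
  proof(rule L1_integral_diff)
   have "integrable lborel (%t. n k * rho (n k * t + (- n k * d)) * F t)" for d proof -
    have "integrable lborel (%t. indicator {d..d + 1} t *\<^sub>R (n k * rho (n k * t + (- n k * d)) * F t))" by(rule borel_integrable_compact)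
      (auto intro!: continuous_intros continuous_on_compose2[OF rhoc] continuous_on_subset[OF Fc])
    moreover have "indicator {d..d + 1} t *\<^sub>R (n k * rho (n k * t + (- n k * d)) * F t) = n k * rho (n k * t + (- n k * d)) * F t" for t
    proof(cases "t \<in> {d..d + 1}")
     case False have "n k * (t - d) \<notin> {0..1}" proof(cases "t < d")
      case True hence "n k * (t - d) < 0" using n1[of k] by(auto simp: mult_less_0_iff)
      thus ?thesis by simp
     next case nd: False
      hence "t - d > 1" using False by auto
      hence "1 * 1 < n k * (t - d)" using n1[of k] by(intro mult_le_less_imp_less) auto
      thus ?thesis by simp
     qed
     hence "rho (n k * t + (- n k * d)) = 0" by(intro rhos) (simp add: algebra_simps)
     thus ?thesis by simp
    qed simp
    ultimately show ?thesis by(simp only:)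
   qed
   thus "integrable lborel (%t. n k * rho (n k * t + (- n k * a)) * F t)" "integrable lborel (%t. n k * rho (n k * t + (- n k * b)) * F t)" by auto
  qed
  finally show ?thesis .
 qed
 have lhs_lim: "(%k. LINT t|lebesgue_on {0<..}. deriv (phi k) t * f t) ----> c * F a - c * F b" unfolding lhs by(intro tendsto_diff approx)
 have ig: "integrable lebesgue (%t. indicator {a..b + 1} t * g t)" using g[of a "b + 1"] ab by(simp add: lebesgue_on_integral_eq)
 \<comment> \<open>The limit carries the half-open interval: both steps start at their base point,
   where \<open>Phi\<close> is still 0.\<close>
 have rhs_lim: "(%k. LINT t|lebesgue_on {0<..}. phi k t * g t) ----> (LINT t|lebesgue. (c * indicator {a<..b} t) * (indicator {a..b + 1} t * g t))"
 proof -
  have eq: "(LINT t|lebesgue_on {0<..}. phi k t * g t) = (LINT t|lebesgue. phi k t * (indicator {a..b + 1} t * g t))" for k proof -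
   have "(LINT t|lebesgue_on {0<..}. phi k t * g t) = (LINT t|lebesgue. indicator {0<..} t * (phi k t * g t))" by(rule lebesgue_on_integral_eq) simp
   also have "... = (LINT t|lebesgue. phi k t * (indicator {a..b + 1} t * g t))" proof(intro L1_integral_cong refl)
    fix t show "indicator {0<..} t * (phi k t * g t) = phi k t * (indicator {a..b + 1} t * g t)"
     using supp(1)[of t k] ab by(cases "t \<in> {a..b + 1}") auto
   qed
   finally show ?thesis .
  qed
  have gm: "(%t. indicator {a..b + 1} t * g t) \<in> borel_measurable lebesgue" using ig by(rule borel_measurable_integrable)
  have phim': "phi k \<in> borel_measurable lebesgue" for k using phim[of k] by(intro measurable_completion) simp
  show ?thesis unfolding eq proof(rule integral_dominated_convergence[where w = "%t. c * abs (indicator {a..b + 1} t * g t)"])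
   have "(indicator {a<..b} :: real => real) \<in> borel_measurable lebesgue" by(rule borel_measurable_indicator) simp
   thus "(%t. (c * indicator {a<..b} t) * (indicator {a..b + 1} t * g t)) \<in> borel_measurable lebesgue"
    by(rule borel_measurable_times[OF borel_measurable_times[OF borel_measurable_const] gm])
   show "(%t. phi k t * (indicator {a..b + 1} t * g t)) \<in> borel_measurable lebesgue" for k using phim' gm by(rule borel_measurable_times)
   show "integrable lebesgue (%t. c * abs (indicator {a..b + 1} t * g t))" by(intro integrable_mult_right integrable_abs ig)
   show "AE t in lebesgue. norm (phi k t * (indicator {a..b + 1} t * g t)) <= c * abs (indicator {a..b + 1} t * g t)" for k proof(rule AE_I2)
    fix t have "abs (phi k t) <= c" using Pb[of "n k * t + (- n k * a)"] Pb[of "n k * t + (- n k * b)"] unfolding phi_def by linarith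
    thus "norm (phi k t * (indicator {a..b + 1} t * g t)) <= c * abs (indicator {a..b + 1} t * g t)"
     unfolding real_norm_def abs_mult[of "phi k t"] by(rule mult_right_mono) simp
   qed
   show "AE t in lebesgue. (%k. phi k t * (indicator {a..b + 1} t * g t)) ----> (c * indicator {a<..b} t) * (indicator {a..b + 1} t * g t)"
   proof(intro AE_I2 tendsto_mult tendsto_const)
    fix t have st: "(%k. Phi (n k * t + (- n k * d))) ----> (if d < t then c else 0)" for d proof(cases "d < t")
     case True obtain K :: nat where K: "1 / (t - d) < real K" using reals_Archimedean2 by blast
     have "\<forall>\<^sub>F k in sequentially. Phi (n k * t + (- n k * d)) = c" unfolding eventually_sequentially proof(intro exI[of _ K] allI impI)
      fix k assume "K <= k"
      hence "1 / (t - d) < n k" using K by(simp add: n_def)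
      hence "1 < n k * (t - d)" using True by(simp add: field_simps)
      thus "Phi (n k * t + (- n k * d)) = c" by(intro P1) (simp add: algebra_simps)
     qed
     thus ?thesis using True by(simp add: tendsto_eventually)
    next case False have "Phi (n k * t + (- n k * d)) = 0" for k proof(rule P0)
      have "n k * (t - d) <= 0" using False n1[of k] by(intro mult_nonneg_nonpos) auto
      thus "n k * t + (- n k * d) <= 0" by(simp add: algebra_simps)
     qed
     thus ?thesis using False by simp
    qed
    have "(%k. phi k t) ----> (if a < t then c else 0) + (if b < t then c else 0) * (- 1)" unfolding phi_def by(intro tendsto_intros st)
    also have "(if a < t then c else 0) + (if b < t then c else 0) * (- 1) = c * indicator {a<..b} t" using ab by(auto simp: indicator_def)
    finally show "(%k. phi k t) ----> c * indicator {a<..b} t" .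
   qed qed qed
 have "(%k. - (LINT t|lebesgue_on {0<..}. phi k t * g t)) ----> c * F a - c * F b" using lhs_lim unfolding weak[OF test] .
 from LIMSEQ_unique[OF this tendsto_minus[OF rhs_lim]]
 have "c * F a - c * F b = - (LINT t|lebesgue. (c * indicator {a<..b} t) * (indicator {a..b + 1} t * g t))" .
 also have "(LINT t|lebesgue. (c * indicator {a<..b} t) * (indicator {a..b + 1} t * g t)) = (LINT t|lebesgue. c * (indicator {a<..b} t * g t))"
  by(intro L1_integral_cong refl) (auto simp: indicator_def)
 also have "... = c * (LINT t|lebesgue. indicator {a<..b} t * g t)" by(rule integral_mult_right_zero)
 also have "(LINT t|lebesgue. indicator {a<..b} t * g t) = (LINT t|lebesgue. indicator {a..b} t * g t)" proof(rule integral_cong_AE)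
  have iab: "integrable lebesgue (%t. indicator {a..b} t * g t)" using g[of a b] ab by(simp add: lebesgue_on_integral_eq)
  thus m: "(%t. indicator {a..b} t * g t) \<in> borel_measurable lebesgue" by(rule borel_measurable_integrable)
  have "(indicator {a<..b} :: real => real) \<in> borel_measurable lebesgue" by(rule borel_measurable_indicator) simp
  hence "(%t. indicator {a<..b} t * (indicator {a..b} t * g t)) \<in> borel_measurable lebesgue" using m by(rule borel_measurable_times)
  moreover have "(%t. indicator {a<..b} t * (indicator {a..b} t * g t)) = (%t. indicator {a<..b} t * g t)" by(auto simp: fun_eq_iff indicator_def)
  ultimately show "(%t. indicator {a<..b} t * g t) \<in> borel_measurable lebesgue" by simp
  have "{a} \<in> null_sets lebesgue" by(rule null_sets_completionI[OF countable_imp_null_set_lborel]) simp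
  hence "AE t in lebesgue. t \<notin> {a}" by(rule AE_not_in)
  thus "AE t in lebesgue. indicator {a<..b} t * g t = indicator {a..b} t * g t" by eventually_elim (auto simp: indicator_def)
 qed
 finally have "c * (F b - F a) = c * (LINT t|lebesgue. indicator {a..b} t * g t)" by(simp add: algebra_simps)
 hence "F b - F a = (LINT t|lebesgue. indicator {a..b} t * g t)" using c by simp
 thus ?thesis using ab by(subst lebesgue_on_integral_eq) (auto simp: F_def max_def)
qed

section \<open>Regularity in time\<close>

abbreviation ip :: "('a::euclidean_space => real) => ('a => real) => real" where
 "ip f v == (LBINT x. f x * v x)"

lemma ip_diff_left:
 assumes "L2_fun lborel f" "L2_fun lborel g" "L2_fun lborel v"
 shows "ip (%x. f x - g x) v = ip f v - ip g v" unfolding left_diff_distrib by(intro L1_integral_diff L2_mult_integrable assms)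

lemma ip_commute: "ip f v = ip v f" by(simp only: mult.commute)

lemma L2_diff:
 assumes "L2_fun M f" "L2_fun M g"
 shows "L2_fun M (%x. f x - g x)" using L2_lincomb[OF assms, of 1 "-1"] by simp

lemma has_integral_le_negligible:
 fixes f g :: "real => real"
 assumes f: "(f has_integral i) S" and g: "(g has_integral j) S" and N: "negligible N" and le: "!!x. x \<in> S - N ==> f x <= g x"
 shows "i <= j" proof(rule has_integral_le)
 show "((%x. if x \<in> N then 0 else f x) has_integral i) S" by(rule has_integral_spike[OF N _ f]) auto
 show "((%x. if x \<in> N then 0 else g x) has_integral j) S" by(rule has_integral_spike[OF N _ g]) auto
qed (use le in auto)

text \<open>The facts about a weak solution that the regularity theory uses; \<open>N\<close> is the set of exceptional
 times and \<open>V\<close> collects the values of simple functions that approximate \<open>w\<close>.\<close>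
locale cahn_hilliard_flow =
 fixes Omega :: "'a::euclidean_space set" and s sig lam W :: real and g :: "real => real"
  and u w :: "real => 'a => real" and N :: "real set" and V :: "('a => real) set"
 assumes s: "0 < s" "s < 1" and sig: "0 < sig" "sig < 1" and op: "open Omega" and bd: "bounded Omega"
  and lam: "lam >= 0" and g_mono: "!!r t. r <= t ==> g r + lam * r <= g t + lam * t" and g_cont: "continuous_on UNIV g" and g0: "g 0 = 0"
  and g_Lip: "!!T. \<exists>L. \<forall>r\<in>{-T..T}. \<forall>t\<in>{-T..T}. abs (g r - g t) <= L * abs (r - t)"
  and u_X0: "!!t. t >= 0 ==> u t \<in> X0 sig Omega" and u_cont: "!!phi. phi \<in> X0 sig Omega ==> continuous_on {0..} (%t. frac_op sig (u t) phi)"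
  and N: "negligible N" and w_X0: "!!t. t > 0 ==> t \<notin> N ==> w t \<in> X0 s Omega"
  and g_L2: "!!t. t > 0 ==> t \<notin> N ==> L2_fun lborel (%x. g (u t x))"
  and eq: "!!t v. t > 0 ==> t \<notin> N ==> v \<in> X0 sig Omega ==> ip (w t) v = frac_op sig (u t) v + ip (%x. g (u t x)) v"
  and flux: "!!v a b. v \<in> X0 s Omega ==> 0 < a ==> a <= b ==>
   ((%t. frac_op s (w t) v) has_integral (ip (u a) v - ip (u b) v)) {a..b}"
  and w2: "!!a b. 0 < a ==> a <= b ==> (%t. (X0_norm s (w t))^2) integrable_on {a..b}"
   "!!a b. 0 < a ==> a <= b ==> integral {a..b} (%t. (X0_norm s (w t))^2) <= W" and V: "countable V" "V \<subseteq> X0 s Omega"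
   "!!t e. t > 0 ==> t \<notin> N ==> e > 0 ==> \<exists>v\<in>V. X0_norm s (%x. v x - w t x) < e"
begin

text \<open>The Riesz representative of \<open>u t - u (t + h)\<close>, so its energy norm is the
  dual norm of this increment. By the first equation it is the integral of \<open>w\<close> over
  \<open>[t, t + h]\<close>, here obtained without integrating vector-valued functions.\<close>

definition incr :: "real => real => 'a => real" where
 "incr h t = (SOME z. z \<in> X0 s Omega & (\<forall>v\<in>X0 s Omega. frac_op s z v = ip (%x. u t x - u (t + h) x) v))"

lemma incr:
 assumes "t >= 0" "h >= 0"
 shows "incr h t \<in> X0 s Omega" "!!v. v \<in> X0 s Omega ==> frac_op s (incr h t) v = ip (u t) v - ip (u (t + h)) v" proof -
 have sq: "L2_fun lborel (u t)" "L2_fun lborel (u (t + h))"  using assms by(simp_all add: X0D(4)[OF u_X0])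
 define d where "d x = u t x - u (t + h) x" for x
 have d: "L2_fun lborel d" unfolding d_def by(rule L2_diff[OF sq])
 obtain C where C: "C > 0" "!!v. v \<in> X0 s Omega ==> (L2sq v) <= C * (X0_norm s v)^2" using X0_Poincare[OF s bd] by blast
 have "\<exists>z. z \<in> X0 s Omega & (\<forall>v\<in>X0 s Omega. frac_op s z v = ip d v)" proof(rule X0_Riesz[OF s bd, where l = "ip d"])
  fix z assume "z \<in> X0 s Omega" "!!v. v \<in> X0 s Omega ==> frac_op s z v = ip d v"
  thus ?thesis by(intro exI[of _ z] conjI ballI)
 next fix v v' b c assume v: "v \<in> X0 s Omega" "v' \<in> X0 s Omega"
  have "ip d (%x. b * v x + c * v' x) = (LBINT x. b * (d x * v x) + c * (d x * v' x))" by(simp add: algebra_simps)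
  also have "... = b * ip d v + c * ip d v'" using L2_mult_integrable[OF d X0D(4)[OF v(1)]] L2_mult_integrable[OF d X0D(4)[OF v(2)]] by simp
  finally show "ip d (%x. b * v x + c * v' x) = b * ip d v + c * ip d v'" .
 next fix v assume v: "v \<in> X0 s Omega"
  have "abs (ip d v) <= sqrt (L2sq d) * sqrt (L2sq v)" by(rule integral_CS[OF d X0D(4)[OF v]])
  also have "... <= sqrt (L2sq d) * (sqrt C * X0_norm s v)" proof(intro mult_left_mono)
   have "sqrt (L2sq v) <= sqrt (C * (X0_norm s v)^2)" using C(2)[OF v] by(rule real_sqrt_le_mono)
   thus "sqrt (L2sq v) <= sqrt C * X0_norm s v" using X0_norm_ge0[OF s, of v] by(simp add: real_sqrt_mult)
  qed simp
  finally show "abs (ip d v) <= (sqrt (L2sq d) * sqrt C) * X0_norm s v" by(simp only: mult.assoc)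
 qed
 hence *: "incr h t \<in> X0 s Omega & (\<forall>v\<in>X0 s Omega. frac_op s (incr h t) v = ip d v)" unfolding incr_def d_def by(rule someI_ex)
 thus "incr h t \<in> X0 s Omega" ..
 show "frac_op s (incr h t) v = ip (u t) v - ip (u (t + h)) v" if v: "v \<in> X0 s Omega" for v proof -
  have "frac_op s (incr h t) v = ip d v" using * v by(simp only:)
  thus ?thesis unfolding d_def ip_diff_left[OF sq X0D(4)[OF v]] .
 qed qed

text \<open>In weak form the time derivative of \<open>incr h\<close> is
  \<open>w (t + h) - w t\<close>; the test function has to be constant in time.\<close>

lemma incr_integral:
 assumes t: "0 < t1" "t1 <= t2" and h: "h >= 0" and v: "v \<in> X0 s Omega"
 shows "((%tau. frac_op s (w (tau + h)) v - frac_op s (w tau) v) has_integral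
  (frac_op s (incr h t2) v - frac_op s (incr h t1) v)) {t1..t2}" proof -
 have "((%t. frac_op s (w t) v) has_integral (ip (u (t1 + h)) v - ip (u (t2 + h)) v)) {t1 + h..t2 + h}" using t h by(intro flux v) auto
 from has_integral_shift_real_ivl[OF this, of h]
 have "((%t. frac_op s (w (t + h)) v) has_integral (ip (u (t1 + h)) v - ip (u (t2 + h)) v)) {t1..t2}" by simp
 from has_integral_diff[OF this flux[OF v t]] show ?thesis using t h by(simp add: incr(2) v algebra_simps)
qed

text \<open>It dominates the sum of the two norms of \<open>w\<close> and is integrable because the
  squared norm is.\<close>

abbreviation rate :: "real => real => real" where
 "rate h tau == 2 + (X0_norm s (w (tau + h)))^2 + (X0_norm s (w tau))^2"

lemma rate_integrable:
 assumes t: "0 < t1" "t1 <= t2" and h: "h >= 0"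
 shows "rate h integrable_on {t1..t2}" proof -
 have "(%t. (X0_norm s (w t))^2) integrable_on {t1 + h..t2 + h}" using t h by(intro w2) auto
 from integrable_shift_real_ivl[OF this, of h]
 have "(%t. (X0_norm s (w (t + h)))^2) integrable_on {t1..t2}" by simp
 thus ?thesis using w2(1)[OF t] by(intro integrable_add integrable_const_ivl)
qed

definition bad :: "real => real set" where "bad h = N \<union> {tau. tau + h \<in> N}"

lemma bad: "negligible (bad h)" proof -
 have "{tau. tau + h \<in> N} = (+) (- h) ` N" by(force simp: image_iff algebra_simps)
 thus ?thesis using N negligible_translation[OF N, of "- h"] by(simp add: bad_def)
qed

lemma good:
 assumes "tau \<notin> bad h" "tau > 0" "h >= 0"
 shows "w tau \<in> X0 s Omega" "w (tau + h) \<in> X0 s Omega" using assms w_X0[of tau] w_X0[of "tau + h"] by(auto simp: bad_def)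

lemma flux_diff_le:
 assumes tau: "tau \<notin> bad h" "tau > 0" "h >= 0" and v: "v \<in> X0 s Omega"
 shows "frac_op s (w (tau + h)) v - frac_op s (w tau) v <= rate h tau * X0_norm s v" proof -
 have sq: "x <= 1 + x^2" for x :: real using zero_le_power2[of "x - 1/2"] by(simp add: power2_diff field_simps)
 have "abs (frac_op s (w (tau + h)) v) <= X0_norm s (w (tau + h)) * X0_norm s v" "abs (frac_op s (w tau) v) <= X0_norm s (w tau) * X0_norm s v"
  by(intro frac_op_CS s X0D(1)[OF v] X0D(1)[OF good(2)[OF tau]] X0D(1)[OF good(1)[OF tau]])+
 moreover have "(X0_norm s (w (tau + h)) + X0_norm s (w tau)) * X0_norm s v <= rate h tau * X0_norm s v"
  using sq[of "X0_norm s (w (tau + h))"] sq[of "X0_norm s (w tau)"] by(intro mult_right_mono X0_norm_ge0 s) linarith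
 ultimately show ?thesis unfolding distrib_right by linarith
qed

text \<open>The difference itself serves as the test function, and one factor of its norm is divided
  out.\<close>

lemma incr_diff_norm:
 assumes t: "0 < t1" "t1 <= t2" and h: "h >= 0"
 shows "X0_norm s (%x. incr h t2 x - incr h t1 x) <= integral {t1..t2} (rate h)" proof -
 have X: "incr h t2 \<in> X0 s Omega" "incr h t1 \<in> X0 s Omega" using t h by(auto intro: incr)
 define zeta where "zeta x = incr h t2 x - incr h t1 x" for x
 have zeta: "zeta \<in> X0 s Omega" unfolding zeta_def by(rule X0_diff[OF X])
 have n0: "0 <= integral {t1..t2} (rate h)" by(intro Henstock_Kurzweil_Integration.integral_nonneg rate_integrable t h) auto
 have "(X0_norm s zeta)^2 = frac_op s (incr h t2) zeta - frac_op s (incr h t1) zeta"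
  using frac_op_diff_left[OF X0D(1)[OF zeta] X0D(1)[OF X(1)] X0D(1)[OF X(2)]] unfolding X0_norm_square[OF s] zeta_def[symmetric] .
 also have "... <= integral {t1..t2} (rate h) * X0_norm s zeta" proof(rule has_integral_le_negligible[OF incr_integral[OF t h zeta] _ bad])
  show "((%tau. rate h tau * X0_norm s zeta) has_integral integral {t1..t2} (rate h) * X0_norm s zeta) {t1..t2}"
   by(intro has_integral_mult_left integrable_integral rate_integrable t h)
 qed (use t h in \<open>auto intro!: flux_diff_le zeta\<close>)
 finally have "X0_norm s zeta * X0_norm s zeta <= integral {t1..t2} (rate h) * X0_norm s zeta" by(simp only: power2_eq_square)
 thus ?thesis using n0 X0_norm_ge0[OF s, of zeta] unfolding zeta_def[symmetric] by(cases "X0_norm s zeta = 0") (auto simp: mult_le_cancel_right)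
qed

lemma Ehrling:
 assumes "e > 0"
 shows "\<exists>C>0. \<forall>v\<in>X0 sig Omega. \<forall>m\<ge>0. (\<forall>phi\<in>X0 s Omega. abs (ip v phi) <= m * X0_norm s phi) -->
   (L2sq v) <= e * (X0_norm sig v)^2 + C * m^2" proof(rule X0_Ehrling[OF sig s op bd assms])
 fix C assume C: "C > 0" and *: "!!v m. v \<in> X0 sig Omega ==> m >= 0 ==>
   (!!phi. phi \<in> X0 s Omega ==> abs (ip v phi) <= m * X0_norm s phi) ==>
   (L2sq v) <= e * (X0_norm sig v)^2 + C * m^2"
 show ?thesis proof(intro exI[of _ C] conjI C ballI allI impI)
  fix v and m :: real assume "v \<in> X0 sig Omega" "m >= 0" and phi: "\<forall>phi\<in>X0 s Omega. abs (ip v phi) <= m * X0_norm s phi"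
  thus "(L2sq v) <= e * (X0_norm sig v)^2 + C * m^2" by(intro * bspec[OF phi])
 qed qed

lemma g_semimonotone:
 assumes v: "v \<in> X0 sig Omega" "v' \<in> X0 sig Omega" and gL: "L2_fun lborel (%x. g (v x))" "L2_fun lborel (%x. g (v' x))"
 shows "- ip (%x. g (v x) - g (v' x)) (%x. v x - v' x) <= lam * (LBINT x. (v x - v' x)^2)" proof -
 note d = X0_diff[OF v]
 have "ip (%x. g (v x) - g (v' x)) (%x. v x - v' x) >= (LBINT x. - lam * (v x - v' x)^2)" proof(rule integral_mono)
  show "integrable lborel (%x. - lam * (v x - v' x)^2)" using X0D(5)[OF d] by simp
  show "integrable lborel (%x. (g (v x) - g (v' x)) * (v x - v' x))" by(intro L2_mult_integrable L2_diff gL X0D(4)[OF v(1)] X0D(4)[OF v(2)])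
  fix x have "(a - b) * ((g a + lam * a) - (g b + lam * b)) >= 0" for a b
   using g_mono[of a b] g_mono[of b a] by(cases "a <= b") (auto intro!: mult_nonneg_nonneg mult_nonpos_nonpos)
  from this[of "v x" "v' x"]
  show "- lam * (v x - v' x)^2 <= (g (v x) - g (v' x)) * (v x - v' x)" by(simp add: power2_eq_square algebra_simps)
 qed
 thus ?thesis by simp
qed

text \<open>Both equations turn the left-hand side into minus the energy of the increment of \<open>u\<close>, up to the
 nonconvex part of the nonlinearity, which Ehrling's inequality absorbs.\<close>
lemma flux_incr_le:
 obtains C where "C > 0" "!!h tau. h >= 0 ==> tau > 0 ==> tau \<notin> bad h ==>
  frac_op s (w (tau + h)) (incr h tau) - frac_op s (w tau) (incr h tau) <= C * (X0_norm s (incr h tau))^2" proof -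
 \<comment> \<open>With this parameter \<open>lam\<close> times the L^2 norm squared costs at most
   the available energy of the increment.\<close>
 obtain C where C: "C > 0" "!!v m. v \<in> X0 sig Omega ==> m >= 0 ==>
   \<forall>phi\<in>X0 s Omega. abs (ip v phi) <= m * X0_norm s phi ==>
   (L2sq v) <= 1 / (lam + 1) * (X0_norm sig v)^2 + C * m^2" using Ehrling[of "1 / (lam + 1)"] lam by(auto simp: add_nonneg_pos)
 show ?thesis proof(rule that[of "lam * C + 1"])
  show "lam * C + 1 > 0" using lam C(1) by(simp add: add_nonneg_pos)
  fix h tau :: real assume h: "h >= 0" "tau > 0" "tau \<notin> bad h"
  define z where "z = incr h tau"
  define d where "d x = u tau x - u (tau + h) x" for x
  have z: "z \<in> X0 s Omega" unfolding z_def using h by(intro incr) auto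
  have uX: "u tau \<in> X0 sig Omega" "u (tau + h) \<in> X0 sig Omega" using h by(auto intro: u_X0)
  have d: "d \<in> X0 sig Omega" unfolding d_def by(rule X0_diff[OF uX])
  have wX: "w tau \<in> X0 s Omega" "w (tau + h) \<in> X0 s Omega" using good h by auto
  have zv: "frac_op s z v = ip d v" if "v \<in> X0 s Omega" for v unfolding z_def d_def using incr(2)[OF _ _ that, of tau h] h
   by(simp add: ip_diff_left X0D(4)[OF that] X0D(4)[OF uX(1)] X0D(4)[OF uX(2)])
  have N: "tau \<notin> N" "tau + h \<notin> N" using h by(auto simp: bad_def)
  have gL: "L2_fun lborel (%x. g (u tau x))" "L2_fun lborel (%x. g (u (tau + h) x))" using g_L2 N h by auto
  \<comment> \<open>By the definition of \<open>z\<close> the two terms are pairings of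
    \<open>w\<close> with the increment \<open>d\<close> of \<open>u\<close>, which is admissible in
    the second equation.\<close>
  have "frac_op s (w (tau + h)) z - frac_op s (w tau) z = ip (w (tau + h)) d - ip (w tau) d"
   using zv[OF wX(1)] zv[OF wX(2)] by(simp only: frac_op_commute[of s _ z] ip_commute[of _ d])
  also have "... = (frac_op sig (u (tau + h)) d + ip (%x. g (u (tau + h) x)) d) - (frac_op sig (u tau) d + ip (%x. g (u tau x)) d)"
   using eq[OF h(2) N(1) d] eq[OF add_pos_nonneg[OF h(2,1)] N(2) d] by(simp only:)
  also have "... = - frac_op sig d d + - ip (%x. g (u tau x) - g (u (tau + h) x)) d" unfolding ip_diff_left[OF gL X0D(4)[OF d]]
   using frac_op_diff_left[OF X0D(1)[OF d] X0D(1)[OF uX(1)] X0D(1)[OF uX(2)]] by(simp add: d_def[abs_def])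
  also have "- ip (%x. g (u tau x) - g (u (tau + h) x)) d <= lam * (L2sq d)" unfolding d_def by(rule g_semimonotone[OF uX gL])
  finally have 1: "frac_op s (w (tau + h)) z - frac_op s (w tau) z <= - ((X0_norm sig d)^2) + lam * (L2sq d)" by(simp add: X0_norm_square[OF sig])
  have "(L2sq d) <= 1 / (lam + 1) * (X0_norm sig d)^2 + C * (X0_norm s z)^2" proof(rule C(2)[OF d X0_norm_ge0[OF s]], intro ballI)
   fix phi assume phi: "phi \<in> X0 s Omega"
   show "abs (ip d phi) <= X0_norm s z * X0_norm s phi" unfolding zv[OF phi, symmetric] by(rule frac_op_CS[OF s X0D(1)[OF z] X0D(1)[OF phi]])
  qed
  hence "lam * (L2sq d) <= lam * (1 / (lam + 1) * (X0_norm sig d)^2 + C * (X0_norm s z)^2)" by(rule mult_left_mono[OF _ lam])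
  also have "... = lam / (lam + 1) * (X0_norm sig d)^2 + lam * C * (X0_norm s z)^2" by(simp add: distrib_left)
  also have "lam / (lam + 1) * (X0_norm sig d)^2 <= 1 * (X0_norm sig d)^2" by(rule mult_right_mono) (use lam in simp_all)
  finally have "lam * (L2sq d) <= (X0_norm sig d)^2 + lam * C * (X0_norm s z)^2" by simp
  thus "frac_op s (w (tau + h)) (incr h tau) - frac_op s (w tau) (incr h tau) <= (lam * C + 1) * (X0_norm s (incr h tau))^2"
   using 1 zero_le_power2[of "X0_norm s z"] unfolding z_def[symmetric] distrib_right mult_1_left by linarith
 qed qed


text \<open>The difference of the squared norms is the energy form of \<open>z t2 - z t1\<close> and
  the fixed function \<open>z t1 + z t2\<close>, to which \<open>incr_integral\<close> applies. At
  an intermediate time both summands are replaced by \<open>z tau\<close>; each replacement costs at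
  most the integral of the rate, so the total error is quadratic in that integral.\<close>

lemma incr_growth_step:
 assumes C: "C > 0" "!!h tau. h >= 0 ==> tau > 0 ==> tau \<notin> bad h ==>
   frac_op s (w (tau + h)) (incr h tau) - frac_op s (w tau) (incr h tau) <= C * (X0_norm s (incr h tau))^2"
  and t: "0 < t1" "t1 <= t2" and h: "h >= 0" and S: "!!tau. t1 <= tau ==> tau <= t2 ==> (X0_norm s (incr h tau))^2 <= S"
 shows "(X0_norm s (incr h t2))^2 - (X0_norm s (incr h t1))^2 <= 2 * C * S * (t2 - t1) + 2 * (integral {t1..t2} (rate h))^2" proof -
 define z where "z = incr h"
 define I where "I = integral {t1..t2} (rate h)"
 have z: "z t \<in> X0 s Omega" if "t > 0" for t unfolding z_def using that h by(intro incr) auto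
 note f = z[THEN X0D(1)]
 have t2: "t2 > 0" using t by simp
 define v where "v x = z t1 x + z t2 x" for x
 have v: "v \<in> X0 s Omega" unfolding v_def using z t(1) t2 by(intro X0_add)
 have sub: "integral {a..b} (rate h) <= I" if "t1 <= a" "a <= b" "b <= t2" for a b
  unfolding I_def using that t h by(intro integral_subset_le rate_integrable) auto
 have osc: "X0_norm s (%x. z a x - z b x) <= I" if "a \<in> {t1..t2}" "b \<in> {t1..t2}" for a b proof(cases "a <= b")
  case True thus ?thesis using incr_diff_norm[of a b h] sub[of a b] that t h by(subst X0_norm_minus_commute) (auto simp: z_def)
 next case False thus ?thesis using incr_diff_norm[of b a h] sub[of b a] that t h by(auto simp: z_def)
 qed
 have val: "frac_op s (z t2) v - frac_op s (z t1) v = (X0_norm s (z t2))^2 - (X0_norm s (z t1))^2"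
  unfolding v_def X0_norm_square[OF s] using frac_op_commute[of s "z t1" "z t2"] by(simp add: frac_op_add_right f t(1) t2)
 have "(X0_norm s (z t2))^2 - (X0_norm s (z t1))^2 <= 2 * C * S * (t2 - t1) + 2 * I * I"
 proof(rule has_integral_le_negligible[OF incr_integral[OF t h v, folded z_def, unfolded val] _ bad])
  have "((%tau. 2 * C * S) has_integral 2 * C * S * (t2 - t1)) {t1..t2}"
   using has_integral_const_real[of "2 * C * S" t1 t2] t by(simp add: mult.commute)
  thus "((%tau. 2 * C * S + 2 * I * rate h tau) has_integral 2 * C * S * (t2 - t1) + 2 * I * I) {t1..t2}"
   unfolding I_def by(intro has_integral_add has_integral_mult_right integrable_integral rate_integrable t h)
  fix tau assume "tau \<in> {t1..t2} - bad h"
  hence tau: "tau \<notin> bad h" "tau > 0" "tau \<in> {t1..t2}" using t by auto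
  note W = good(1)[OF tau(1,2) h, THEN X0D(1)] good(2)[OF tau(1,2) h, THEN X0D(1)]
  define F where "F v = frac_op s (w (tau + h)) v - frac_op s (w tau) v" for v
  have F: "F (z a) <= C * S + I * rate h tau" if a: "a \<in> {t1..t2}" for a proof -
   have a0: "a > 0" using a t by simp
   have "F (z a) = F (z tau) + F (%x. z a x - z tau x)" unfolding F_def by(simp add: frac_op_diff_right W f a0 tau(2))
   also have "F (%x. z a x - z tau x) <= rate h tau * X0_norm s (%x. z a x - z tau x)" unfolding F_def by(intro flux_diff_le tau h X0_diff z a0)
   also have "... <= rate h tau * I" by(intro mult_left_mono osc a tau) auto
   also have "F (z tau) <= C * (X0_norm s (z tau))^2" unfolding F_def z_def by(intro C h tau)
   also have "... <= C * S" using tau C(1) unfolding z_def by(intro mult_left_mono S) auto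
   finally show ?thesis by(simp add: mult.commute)
  qed
  have "frac_op s (w (tau + h)) v - frac_op s (w tau) v = F (z t1) + F (z t2)" unfolding F_def v_def by(simp add: frac_op_add_right W f t(1) t2)
  thus "frac_op s (w (tau + h)) v - frac_op s (w tau) v <= 2 * C * S + 2 * I * rate h tau" using F[of t1] F[of t2] t by simp
 qed
 thus ?thesis by(simp add: z_def I_def power2_eq_square)
qed

text \<open>The quadratic error disappears under subdivision. With the error term
  \<open>e * I a b\<close> the claim is additive over adjacent intervals, and on short ones
  \<open>I a b <= e / 2\<close> makes the quadratic error at most \<open>e * I a b\<close>.
  Bisection yields the whole interval, and then \<open>e\<close> tends to 0.\<close>

lemma incr_growth:
 assumes C: "C > 0" "!!h tau. h >= 0 ==> tau > 0 ==> tau \<notin> bad h ==>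
   frac_op s (w (tau + h)) (incr h tau) - frac_op s (w tau) (incr h tau) <= C * (X0_norm s (incr h tau))^2"
  and t: "0 < t1" "t1 <= t2" and h: "h >= 0" and S: "!!tau. t1 <= tau ==> tau <= t2 ==> (X0_norm s (incr h tau))^2 <= S"
 shows "(X0_norm s (incr h t2))^2 - (X0_norm s (incr h t1))^2 <= 2 * C * S * (t2 - t1)" proof -
 define I where "I a b = integral {a..b} (rate h)" for a b
 define y where "y t = (X0_norm s (incr h t))^2" for t
 have comb: "I a b + I b c = I a c" if "t1 <= a" "a <= b" "b <= c" for a b c
  unfolding I_def using that t h by(intro Henstock_Kurzweil_Integration.integral_combine rate_integrable) auto
 have I0: "I a b >= 0" if "t1 <= a" "a <= b" for a b
  unfolding I_def using that t h by(intro Henstock_Kurzweil_Integration.integral_nonneg rate_integrable) auto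
 have eps: "y t2 - y t1 <= 2 * C * S * (t2 - t1) + e * I t1 t2" if e: "e > 0" for e proof -
  have "uniformly_continuous_on {t1..t2} (I t1)"
   unfolding I_def by(intro compact_uniformly_continuous indefinite_integral_continuous_1 rate_integrable t h) simp
  then obtain d where d: "d > 0" "!!a b. a \<in> {t1..t2} ==> b \<in> {t1..t2} ==> dist a b < d ==> dist (I t1 a) (I t1 b) < e / 2"
   unfolding uniformly_continuous_on_def using e by(meson half_gt_zero)
  define P where "P a b \<longleftrightarrow> (t1 <= a --> b <= t2 --> y b - y a <= 2 * C * S * (b - a) + e * I a b)" for a b
  have "P t1 t2" using t(2) proof(induction rule: Bolzano)
   case (trans a b c) show ?case unfolding P_def proof(intro impI)
    assume ac: "t1 <= a" "c <= t2"
    hence "y c - y b + (y b - y a) <= 2 * C * S * (c - b) + e * I b c + (2 * C * S * (b - a) + e * I a b)"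
     using trans unfolding P_def by(intro add_mono) auto
    also have "... = 2 * C * S * (c - a) + e * I a c" using arg_cong[OF comb[of a b c], of "(*) e"] ac trans by(simp add: algebra_simps)
    finally show "y c - y a <= 2 * C * S * (c - a) + e * I a c" by simp
   qed
  next case (local x) show ?case unfolding P_def proof(intro exI[of _ d] conjI d(1) allI impI)
    fix a b assume ab: "a <= x & x <= b & b - a < d" "t1 <= a" "b <= t2"
    have "dist (I t1 a) (I t1 b) < e / 2" using ab by(intro d(2)) (auto simp: dist_real_def)
    moreover have "I t1 a + I a b = I t1 b" using ab by(intro comb) auto
    ultimately have "I a b <= e / 2" unfolding dist_real_def by linarith
    hence "2 * (I a b)^2 <= e * I a b" using mult_right_mono[of "I a b" "e / 2" "I a b"] I0[of a b] ab by(simp add: power2_eq_square)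
    moreover have "y b - y a <= 2 * C * S * (b - a) + 2 * (I a b)^2" unfolding y_def I_def using ab t by(intro incr_growth_step C h S) auto
    ultimately show "y b - y a <= 2 * C * S * (b - a) + e * I a b" by simp
   qed qed
  thus ?thesis by(simp add: P_def)
 qed
 have "y t2 - y t1 <= 2 * C * S * (t2 - t1)" proof(rule field_le_epsilon)
  fix e :: real assume "e > 0"
  hence "e / (I t1 t2 + 1) > 0" using I0[of t1 t2] t by(intro divide_pos_pos) auto
  moreover have "e / (I t1 t2 + 1) * I t1 t2 <= e" using I0[of t1 t2] t \<open>e > 0\<close> by(simp add: field_simps)
  ultimately show "y t2 - y t1 <= 2 * C * S * (t2 - t1) + e" using eps[of "e / (I t1 t2 + 1)"] by linarith
 qed
 thus ?thesis by(simp add: y_def)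
qed

text \<open>On an interval of length \<open>1 / (4 * C)\<close> the supremum \<open>S\<close> of the
  squared norms satisfies \<open>S <= y h a + S / 2\<close>, so they at most double. A fixed number
  of such intervals covers a unit of time, and the constant does not depend on
  \<open>h\<close>.\<close>

lemma incr_norm_growth:
 obtains K where "K > 0" "!!a b h. 0 < a ==> a <= b ==> b <= a + 1 ==> h >= 0 ==>
  (X0_norm s (incr h b))^2 <= K * (X0_norm s (incr h a))^2" proof -
 obtain C where C: "C > 0" "!!h tau. h >= 0 ==> tau > 0 ==> tau \<notin> bad h ==>
  frac_op s (w (tau + h)) (incr h tau) - frac_op s (w tau) (incr h tau) <= C * (X0_norm s (incr h tau))^2" using flux_incr_le by blast
 define y where "y h t = (X0_norm s (incr h t))^2" for h t
 have double: "y h b <= 2 * y h a" if t: "0 < a" "a <= b" "b <= a + 1 / (4 * C)" "h >= 0" for a b h proof -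
  \<comment> \<open>This crude bound guarantees that the supremum \<open>S\<close> is finite, as its
    absorption requires.\<close>
  define B where "B = (X0_norm s (incr h a) + integral {a..b} (rate h))^2"
  have yB: "y h tau <= B" if tau: "tau \<in> {a..b}" for tau unfolding y_def B_def proof(rule power_mono)
   have X: "incr h tau \<in> X0 s Omega" "incr h a \<in> X0 s Omega" using tau t by(auto intro: incr)
   have "X0_norm s (%x. incr h a x + (incr h tau x - incr h a x)) <= X0_norm s (incr h a) + X0_norm s (%x. incr h tau x - incr h a x)"
    by(intro X0_norm_add_le s X0D(1)[OF X(2)] X0D(1)[OF X0_diff[OF X]])
   moreover have "X0_norm s (%x. incr h tau x - incr h a x) <= integral {a..tau} (rate h)" using tau t by(intro incr_diff_norm) auto
   moreover have "integral {a..tau} (rate h) <= integral {a..b} (rate h)" using tau t by(intro integral_subset_le rate_integrable) auto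
   ultimately show "X0_norm s (incr h tau) <= X0_norm s (incr h a) + integral {a..b} (rate h)" by simp
  qed (rule X0_norm_ge0[OF s])
  define S where "S = (SUP tau\<in>{a..b}. y h tau)"
  have bdd: "bdd_above (y h ` {a..b})" using yB by(intro bdd_aboveI2) auto
  have yS: "y h tau <= S" if "tau \<in> {a..b}" for tau unfolding S_def by(rule cSUP_upper[OF that bdd])
  have S0: "S >= 0" using yS[of a] t by(auto simp: y_def intro: order_trans[OF zero_le_power2])
  have "S <= y h a + S / 2" unfolding S_def proof(rule cSUP_least)
   fix tau assume tau: "tau \<in> {a..b}"
   have "y h tau - y h a <= 2 * C * S * (tau - a)" unfolding y_def using tau t yS[unfolded y_def] by(intro incr_growth C) auto
   also have "... <= 2 * C * S * (1 / (4 * C))" using tau t S0 C by(intro mult_left_mono) auto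
   also have "... = S / 2" using C by simp
   finally show "y h tau <= y h a + (SUP tau\<in>{a..b}. y h tau) / 2" unfolding S_def by simp
  qed (use t in auto)
  thus ?thesis using yS[of b] t by simp
 qed
 obtain n :: nat where n: "4 * C < real n" using reals_Archimedean2 by blast
 hence n0: "real n > 0" using C by linarith
 show ?thesis proof(rule that[of "2 ^ n"])
  fix a b h :: real assume t: "0 < a" "a <= b" "b <= a + 1" "h >= 0"
  define d where "d = (b - a) / n"
  have d0: "d >= 0" using t n0 by(simp add: d_def)
  have "d <= 1 / n" unfolding d_def using t n0 by(intro divide_right_mono) auto
  also have "... <= 1 / (4 * C)" using n C by(intro divide_left_mono) auto
  finally have d: "d <= 1 / (4 * C)" .
  have "y h (a + real k * d) <= 2 ^ k * y h a" for k proof(induction k)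
   case (Suc k) have "y h (a + real (Suc k) * d) <= 2 * y h (a + real k * d)" using t d0 d by(intro double) (auto simp: algebra_simps add_pos_nonneg)
   thus ?case using Suc by simp
  qed simp
  from this[of n] show "(X0_norm s (incr h b))^2 <= 2 ^ n * (X0_norm s (incr h a))^2" using n0 by(simp add: y_def d_def)
 qed simp
qed

text \<open>The squared norm of a time integral is at most \<open>h\<close> times the integral of
  the squared norms. It is proved weakly, with the increment as test function and Young's inequality
  weighted by \<open>h\<close>.\<close>

lemma incr_norm_le_integral:
 assumes a: "a > 0" and h: "h > 0"
 shows "(X0_norm s (incr h a))^2 <= h * integral {a..a + h} (%t. (X0_norm s (w t))^2)" proof -
 define z where "z = incr h a"
 define J where "J = integral {a..a + h} (%t. (X0_norm s (w t))^2)"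
 have z: "z \<in> X0 s Omega" unfolding z_def using a h by(intro incr) auto
 have val: "ip (u a) z - ip (u (a + h)) z = (X0_norm s z)^2" using incr(2)[of a h z] z a h by(simp add: z_def X0_norm_square[OF s])
 have fl: "((%t. frac_op s (w t) z) has_integral ((X0_norm s z)^2)) {a..a + h}" using flux[OF z a, of "a + h"] h unfolding val by simp
 have "(X0_norm s z)^2 <= h / 2 * J + 1 / (2 * h) * (X0_norm s z)^2 * h" proof(rule has_integral_le_negligible[OF fl _ N])
  have "((%t. 1 / (2 * h) * (X0_norm s z)^2) has_integral 1 / (2 * h) * (X0_norm s z)^2 * h) {a..a + h}"
   using has_integral_const_real[of "1 / (2 * h) * (X0_norm s z)^2" a "a + h"] h by(simp add: mult.commute)
  thus "((%t. h / 2 * (X0_norm s (w t))^2 + 1 / (2 * h) * (X0_norm s z)^2) has_integral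
    h / 2 * J + 1 / (2 * h) * (X0_norm s z)^2 * h) {a..a + h}"
   unfolding J_def using a h by(intro has_integral_add has_integral_mult_right integrable_integral w2) auto
  fix t assume t: "t \<in> {a..a + h} - N"
  hence wt: "w t \<in> X0 s Omega" using a by(intro w_X0) auto
  have "frac_op s (w t) z <= X0_norm s (w t) * X0_norm s z" using frac_op_CS[OF s X0D(1)[OF wt] X0D(1)[OF z]] by linarith
  also have "... <= h / 2 * (X0_norm s (w t))^2 + 1 / (2 * h) * (X0_norm s z)^2"
   using zero_le_power2[of "h * X0_norm s (w t) - X0_norm s z"] h by(simp add: power2_eq_square field_simps)
  finally show "frac_op s (w t) z <= h / 2 * (X0_norm s (w t))^2 + 1 / (2 * h) * (X0_norm s z)^2" .
 qed
 thus ?thesis using h unfolding z_def[symmetric] J_def[symmetric] by simp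
qed

text \<open>The growth bound compares \<open>incr h b\<close> with the increments at
  \<open>n\<close> grid points of the preceding unit interval. For \<open>h = 1 / n\<close> the
  cells fill that interval exactly, so summing the cell integrals of the squared norm of
  \<open>w\<close> gives at most \<open>W\<close>, hence a squared norm of order
  \<open>h^2\<close>.\<close>

lemma incr_norm_bound:
 obtains M where "M >= 0" "!!b n. b > 1 ==> n > 0 ==> X0_norm s (incr (1 / real n) b) <= M / real n" proof -
 obtain K where K: "K > 0" "!!a b h. 0 < a ==> a <= b ==> b <= a + 1 ==> h >= 0 ==>
  (X0_norm s (incr h b))^2 <= K * (X0_norm s (incr h a))^2" using incr_norm_growth by blast
 have "0 <= integral {1..1} (%t. (X0_norm s (w t))^2)" by simp
 also have "... <= W" by(rule w2) auto
 finally have W0: "W >= 0" .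
 show ?thesis proof(rule that[of "sqrt (K * W)"])
  fix b :: real and n :: nat assume b: "b > 1" and n: "n > 0"
  define h where "h = 1 / real n"
  have h: "h > 0" "h * n = 1" using n by(auto simp: h_def)
  define f where "f t = (X0_norm s (w t))^2" for t
  define c where "c = b - 1"
  have c: "c > 0" using b by(simp add: c_def)
  have sum: "(\<Sum>i<k. integral {c + real i * h..c + real i * h + h} f) = integral {c..c + real k * h} f" for k proof(induction k)
   case (Suc k) have "integral {c..c + real k * h} f + integral {c + real k * h..c + real k * h + h} f = integral {c..c + real k * h + h} f"
    unfolding f_def using c h by(intro Henstock_Kurzweil_Integration.integral_combine w2(1)) auto
   thus ?case using Suc by(simp add: algebra_simps)
  qed simp
  have "real n * (X0_norm s (incr h b))^2 = (\<Sum>i<n. (X0_norm s (incr h b))^2)" by simp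
  also have "... <= (\<Sum>i<n. K * h * integral {c + real i * h..c + real i * h + h} f)" proof(rule sum_mono)
   fix i assume i: "i \<in> {..<n}"
   have ih: "real i * h <= real n * h" using i h by(intro mult_right_mono) auto
   have p: "c + real i * h > 0" using c h by(simp add: add_pos_nonneg)
   have "(X0_norm s (incr h b))^2 <= K * (X0_norm s (incr h (c + real i * h)))^2" using p ih h by(intro K(2)) (auto simp: c_def mult.commute)
   also have "... <= K * (h * integral {c + real i * h..c + real i * h + h} f)"
    unfolding f_def by(intro mult_left_mono incr_norm_le_integral p h) (use K in auto)
   finally show "(X0_norm s (incr h b))^2 <= K * h * integral {c + real i * h..c + real i * h + h} f" by(simp only: mult.assoc)
  qed
  also have "... = K * h * integral {c..c + real n * h} f" unfolding sum_distrib_left[symmetric] sum ..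
  also have "... <= K * h * W" unfolding f_def using K h c by(intro mult_left_mono w2) auto
  finally have "h * (real n * (X0_norm s (incr h b))^2) <= h * (K * h * W)" by(rule mult_left_mono) (use h in auto)
  hence "(X0_norm s (incr h b))^2 <= K * W * h^2" using h by(simp add: mult.assoc[symmetric] power2_eq_square) (simp add: mult_ac)
  hence "X0_norm s (incr h b) <= sqrt (K * W * h^2)" by(rule real_le_rsqrt)
  thus "X0_norm s (incr (1 / real n) b) <= sqrt (K * W) / real n" using h by(simp add: real_sqrt_mult h_def)
 qed (use K W0 in simp)
qed

end

section \<open>Pointwise bounds in time and limits along good times\<close>

lemma negligible_avoid:
 fixes a b :: real
 assumes "negligible N" "a < b"
 obtains x where "a < x" "x < b" "x \<notin> N" proof -
 have "\<not> negligible {a<..<b}" using assms(2) by(intro open_not_negligible) auto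
 hence "\<not> {a<..<b} \<subseteq> N" using negligible_subset[OF assms(1)] by blast
 then obtain x where "x \<in> {a<..<b}" "x \<notin> N" by blast
 thus ?thesis by(intro that[of x]) auto
qed

lemma negligible_avoiding_sequence:
 fixes t r :: real
 assumes N: "negligible N" and t: "t < r"
 obtains tau where "!!n::nat. t < tau n" "!!n. tau n < r" "!!n. tau n \<notin> N" "tau ----> t" proof -
 have "\<exists>tau. t < tau & tau < t + (r - t) / real (Suc n) & tau \<notin> N" for n proof -
  have "t < t + (r - t) / real (Suc n)" using t by simp
  thus ?thesis using negligible_avoid[OF N] by blast
 qed
 then obtain tau where tau: "!!n. t < tau n" "!!n. tau n < t + (r - t) / real (Suc n)" "!!n. tau n \<notin> N" by metis
 have le: "(r - t) / real (Suc n) <= (r - t) / 1" for n using t by(intro divide_left_mono) auto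
 have "tau ----> t" proof(rule tendsto_sandwich[where f = "%_. t" and h = "%n. t + (r - t) / real (Suc n)"])
  have "(%n. t + (r - t) * inverse (real (Suc n))) ----> t + (r - t) * 0" by(intro tendsto_intros LIMSEQ_inverse_real_of_nat)
  thus "(%n. t + (r - t) / real (Suc n)) ----> t" by(simp add: divide_inverse)
  show "\<forall>\<^sub>F n in sequentially. t <= tau n" "\<forall>\<^sub>F n in sequentially. tau n <= t + (r - t) / real (Suc n)"
   using tau by(auto intro!: always_eventually less_imp_le)
 qed simp
 moreover have "tau n < r" for n using tau(2)[of n] le[of n] by simp
 ultimately show ?thesis using tau by(intro that)
qed

lemma L2_limit_AE_subsequence:
 fixes f :: "nat => 'b => real"
 assumes f: "!!n. L2_fun M (f n)" and G: "L2_fun M G" and lim: "(%n. LINT x|M. (f n x - G x)^2) ----> 0"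
 obtains r where "!!k::nat. r k >= k" "AE x in M. (%k. f (r k) x) ----> G x" proof -
 have "integrable M (%x. (f n x - G x)^2)" for n by(intro L2D(2) L2_diff f G)
 from tendsto_L1_AE_subseq[of M "%n x. (f n x - G x)^2", OF this]
 obtain r where r: "strict_mono r" "AE x in M. (%k. (f (r k) x - G x)^2) ----> 0" using lim by auto
 have "AE x in M. (%k. f (r k) x) ----> G x" using r(2) proof eventually_elim
  case (elim x) have "(%k. abs (f (r k) x - G x)) ----> 0" using tendsto_real_sqrt[OF elim] by simp
  thus ?case by(simp add: tendsto_rabs_zero_iff LIM_zero_cancel)
 qed
 thus ?thesis using seq_suble[OF r(1)] by(intro that)
qed

lemma integral_square_lincomb_le:
 assumes f: "L2_fun M f" and h: "L2_fun M h"
 shows "(LINT x|M. (b * f x + c * h x)^2) <= 2 * b^2 * (LINT x|M. (f x)^2) + 2 * c^2 * (LINT x|M. (h x)^2)" proof -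
 note i = L2D(2)[OF f] L2D(2)[OF h]
 have "(LINT x|M. (b * f x + c * h x)^2) <= (LINT x|M. 2 * b^2 * (f x)^2 + 2 * c^2 * (h x)^2)"
 proof(rule integral_mono[OF L2D(2)[OF L2_lincomb[OF f h]]])
  fix x show "(b * f x + c * h x)^2 <= 2 * b^2 * (f x)^2 + 2 * c^2 * (h x)^2"
   using zero_le_power2[of "b * f x - c * h x"] by(simp add: power2_sum power2_diff power_mult_distrib)
 qed (use i in auto)
 thus ?thesis using i by simp
qed

text \<open>Where the difference \<open>d\<close> is at most 1, dominated convergence applies with
  \<open>v\<close> as majorant. Where it exceeds 1, Young's inequality leaves a small multiple of
  the bounded L^2 norm of \<open>d\<close> and the integral of \<open>v^2\<close> over a set that
  empties out.\<close>

lemma L2_bounded_AE_limit: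
 fixes f :: "nat => 'b => real"
 assumes f: "!!n. L2_fun M (f n)" "!!n. (LINT x|M. (f n x)^2) <= K" and F: "F \<in> borel_measurable M" and lim: "AE x in M. (%n. f n x) ----> F x"
  and v: "integrable M v" "L2_fun M v"
 shows "L2_fun M F" "(%n. LINT x|M. abs (f n x - F x) * abs (v x)) ----> 0" proof -
 have F2: "L2_fun M F" "(LINT x|M. (F x)^2) <= K" by(rule L2_Fatou[OF f lim F])+
 thus "L2_fun M F" by simp
 define d where "d n x = f n x - F x" for n x
 have d: "L2_fun M (d n)" for n unfolding d_def by(rule L2_diff[OF f(1) F2(1)])
 have [measurable]: "d n \<in> borel_measurable M" "v \<in> borel_measurable M" for n using d v by(auto dest: L2D)
 have dK: "(LINT x|M. (d n x)^2) <= 4 * K" for n proof -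
  have "(LINT x|M. (1 * f n x + (- 1) * F x)^2) <= 2 * 1^2 * (LINT x|M. (f n x)^2) + 2 * (- 1)^2 * (LINT x|M. (F x)^2)"
   by(rule integral_square_lincomb_le[OF f(1) F2(1)])
  thus ?thesis using f(2)[of n] F2(2) by(simp add: d_def)
 qed
 have K0: "K >= 0" using F2(2) by(rule order_trans[rotated]) simp
 have dlim: "AE x in M. (%n. d n x) ----> 0" using lim by eventually_elim (simp add: d_def LIM_zero)
 have A: "(%n. LINT x|M. min (abs (d n x)) 1 * abs (v x)) ----> (LINT x|M. 0)" proof(rule integral_dominated_convergence[where w = "%x. abs (v x)"])
  show "AE x in M. (%n. min (abs (d n x)) 1 * abs (v x)) ----> 0" using dlim proof eventually_elim
   case (elim x) have "(%n. min (abs (d n x)) 1 * abs (v x)) ----> min (abs 0) 1 * abs (v x)" by(intro tendsto_intros elim)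
   thus ?case by simp
  qed
  show "AE x in M. norm (min (abs (d n x)) 1 * abs (v x)) <= abs (v x)" for n by(intro AE_I2) (simp add: abs_mult mult_left_le_one_le)
 qed (use v in auto)
 have B: "(%n. LINT x|M. indicator {x. 1 < abs (d n x)} x * (v x)^2) ----> (LINT x|M. 0)"
 proof(rule integral_dominated_convergence[where w = "%x. (v x)^2"])
  show "AE x in M. (%n. indicator {x. 1 < abs (d n x)} x * (v x)^2) ----> 0" using dlim proof eventually_elim
   case (elim x) have "\<forall>\<^sub>F n in sequentially. abs (d n x) < 1" using order_tendstoD(2)[OF tendsto_rabs[OF elim]] by simp
   hence "\<forall>\<^sub>F n in sequentially. indicator {x. 1 < abs (d n x)} x * (v x)^2 = 0" by eventually_elim simp
   thus ?case by(rule tendsto_eventually)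
  qed
  show "AE x in M. norm (indicator {x. 1 < abs (d n x)} x * (v x)^2) <= (v x)^2" for n by(intro AE_I2) (simp add: indicator_def)
 qed (use v L2D[OF v(2)] in auto)
 show "(%n. LINT x|M. abs (f n x - F x) * abs (v x)) ----> 0" proof(rule LIMSEQ_I)
  fix e :: real assume e: "e > 0"
  \<comment> \<open>\<open>4 * K\<close> bounds the squared L^2 norms of the differences; this
    weight makes their contribution at most \<open>e / 2\<close>.\<close>
  define eta where "eta = e / (2 * (4 * K + 1))"
  have eta: "eta > 0" "eta * (4 * K) <= e / 2" using e K0 by(auto simp: eta_def field_simps)
  have le: "(LINT x|M. abs (d n x) * abs (v x)) <= (LINT x|M. min (abs (d n x)) 1 * abs (v x)) + e / 2 + 1 / eta * (LINT x|M. indicator {x. 1 < abs (d n x)} x * (v x)^2)" for n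
  proof -
   have iA: "integrable M (%x. min (abs (d n x)) 1 * abs (v x))" by(rule L1_integrable_bound[OF v(1)]) (auto simp: abs_mult mult_left_le_one_le)
   have iB: "integrable M (%x. indicator {x. 1 < abs (d n x)} x * (v x)^2)"
    by(rule L1_integrable_bound[OF L2D(2)[OF v(2)]]) (auto simp: indicator_def)
   have iD: "integrable M (%x. (d n x)^2)" by(rule L2D(2)[OF d])
   have "(LINT x|M. abs (d n x) * abs (v x)) <= (LINT x|M. (min (abs (d n x)) 1 * abs (v x) + eta * (d n x)^2) + 1 / eta * (indicator {x. 1 < abs (d n x)} x * (v x)^2))"
   proof(rule integral_mono)
    show "integrable M (%x. abs (d n x) * abs (v x))" using integrable_abs[OF L2_mult_integrable[OF d v(2)]] by(simp only: abs_mult)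
    show "integrable M (%x. (min (abs (d n x)) 1 * abs (v x) + eta * (d n x)^2) + 1 / eta * (indicator {x. 1 < abs (d n x)} x * (v x)^2))"
     by(intro L1_integrable_add integrable_mult_right iA iB iD)
    fix x
    show "abs (d n x) * abs (v x) <= (min (abs (d n x)) 1 * abs (v x) + eta * (d n x)^2) + 1 / eta * (indicator {x. 1 < abs (d n x)} x * (v x)^2)"
    proof(cases "1 < abs (d n x)")
     case True have "0 <= (eta * abs (d n x) - abs (v x))^2 / eta + abs (d n x) * abs (v x)" using eta by simp
     also have "... = eta * (d n x)^2 + 1 / eta * (v x)^2 - abs (d n x) * abs (v x)"
      using eta by(simp add: power2_diff power_mult_distrib field_simps) (simp add: power2_eq_square field_simps)
     finally show ?thesis using True by simp
    next case False thus ?thesis using eta by(simp add: min_def)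
    qed qed
   also have "... = (LINT x|M. min (abs (d n x)) 1 * abs (v x)) + eta * (LINT x|M. (d n x)^2) + 1 / eta * (LINT x|M. indicator {x. 1 < abs (d n x)} x * (v x)^2)"
    using iA iB iD by(simp add: L1_integral_add)
   also have "eta * (LINT x|M. (d n x)^2) <= e / 2" using mult_left_mono[OF dK[of n], of eta] eta by linarith
   finally show ?thesis by simp
  qed
  have "(%n. (LINT x|M. min (abs (d n x)) 1 * abs (v x)) + e / 2 + 1 / eta * (LINT x|M. indicator {x. 1 < abs (d n x)} x * (v x)^2)) ----> 0 + e / 2 + 1 / eta * 0"
   using A B by(intro tendsto_intros) simp_all
  hence "\<forall>\<^sub>F n in sequentially. (LINT x|M. min (abs (d n x)) 1 * abs (v x)) + e / 2 + 1 / eta * (LINT x|M. indicator {x. 1 < abs (d n x)} x * (v x)^2) < e"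
   by(rule order_tendstoD(2)) (use e in simp)
  hence "\<forall>\<^sub>F n in sequentially. (LINT x|M. abs (d n x) * abs (v x)) < e" by eventually_elim (rule le_less_trans[OF le])
  thus "\<exists>no. \<forall>n\<ge>no. norm ((LINT x|M. abs (f n x - F x) * abs (v x)) - 0) < e" unfolding eventually_sequentially d_def by simp
 qed qed

lemma frac_op_nonneg:
 fixes u v :: "'a::euclidean_space => real"
 assumes a: "0 < a" "a < 1" and uv: "u \<in> frac_sobolev a" "v \<in> frac_sobolev a" and nn: "!!x y. 0 <= (u x - u y) * (v x - v y)"
 shows "0 <= frac_op a u v" proof -
 have z: "(%x::'a. 0) \<in> frac_sobolev a" using X0D(1)[OF zero_in_X0] .
 have "frac_op a (%x. 0) (%x::'a. 0) <= frac_op a u v" by(rule frac_op_mono_pointwise[OF a z z uv]) (use nn in simp)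
 moreover have "frac_op a (%x. 0) (%x::'a. 0) = 0" by(simp add: frac_op_def case_prod_beta')
 ultimately show ?thesis by simp
qed

text \<open>The test function is \<open>beta\<close> of the truncated \<open>u\<close>; the
  truncation makes \<open>beta\<close> Lipschitz and so the function admissible. By monotonicity the
  energy term is nonnegative, and Cauchy-Schwarz with Fatou gives the rest.\<close>

lemma elliptic_nonlinearity_bound:
 fixes u f :: "'a::euclidean_space => real" and beta :: "real => real"
 assumes sig: "0 < sig" "sig < 1" and mono: "!!r t. r <= t ==> beta r <= beta t" and beta0: "beta 0 = 0"
  and Lip: "!!T. \<exists>L. \<forall>r\<in>{-T..T}. \<forall>t\<in>{-T..T}. abs (beta r - beta t) <= L * abs (r - t)"
  and u: "u \<in> X0 sig Omega" and f: "L2_fun lborel f" and betau: "L2_fun lborel (%x. beta (u x))"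
  and eq: "!!v. v \<in> X0 sig Omega ==> frac_op sig u v + ip (%x. beta (u x)) v = ip f v"
 shows "(LBINT x. (beta (u x))^2) <= (L2sq f)" proof -
 define cl where "cl n r = max (- real n) (min (real n) r)" for n r
 define v where "v n x = beta (cl n (u x))" for n x
 have vX: "v n \<in> X0 sig Omega" for n proof -
  obtain L where L: "\<forall>r\<in>{-real n..real n}. \<forall>t\<in>{-real n..real n}. abs (beta r - beta t) <= L * abs (r - t)" using Lip by blast
  have "(%x. (%r. beta (cl n r)) (u x)) \<in> X0 sig Omega" proof(rule X0_Lipschitz_comp[OF u])
   show "beta (cl n 0) = 0" by(simp add: cl_def beta0)
   fix r t have "abs (beta (cl n r) - beta (cl n t)) <= L * abs (cl n r - cl n t)" using L by(simp add: cl_def)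
   also have "... <= abs L * abs (r - t)" by(intro mult_mono) (auto simp: cl_def)
   finally show "abs (beta (cl n r) - beta (cl n t)) <= abs L * abs (r - t)" .
  qed
  thus ?thesis by(simp add: v_def[abs_def])
 qed
 note v2 = X0D(4)[OF vX]
 have le: "(L2sq (v n)) <= (L2sq f)" for n proof -
  define A where "A = (L2sq (v n))"
  define B where "B = (L2sq f)"
  have "0 <= frac_op sig u (v n)" proof(rule frac_op_nonneg[OF sig X0D(1)[OF u] X0D(1)[OF vX]])
   fix x y show "0 <= (u x - u y) * (v n x - v n y)" using mono[of "cl n (u x)" "cl n (u y)"] mono[of "cl n (u y)" "cl n (u x)"]
    by(cases "u x <= u y") (auto simp: v_def cl_def intro!: mult_nonneg_nonneg mult_nonpos_nonpos)
  qed
  moreover have "A <= ip (%x. beta (u x)) (v n)" unfolding A_def proof(rule integral_mono[OF X0D(5)[OF vX] L2_mult_integrable[OF betau v2]])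
   fix x show "(v n x)^2 <= beta (u x) * v n x" proof(cases "0 <= u x")
    case True hence "0 <= v n x" "v n x <= beta (u x)" using mono[of 0 "cl n (u x)"] mono[of "cl n (u x)" "u x"] by(auto simp: v_def cl_def beta0)
    thus ?thesis by(simp add: power2_eq_square mult_right_mono)
   next case False
    hence "v n x <= 0" "beta (u x) <= v n x" using mono[of "cl n (u x)" 0] mono[of "u x" "cl n (u x)"] by(auto simp: v_def cl_def beta0)
    thus ?thesis by(simp add: power2_eq_square mult_right_mono_neg)
   qed qed
  ultimately have "A <= ip f (v n)" using eq[OF vX, of n] by linarith
  also have "... <= sqrt B * sqrt A" unfolding A_def B_def using integral_CS[OF f v2, of n] by linarith
  finally have 1: "A <= sqrt B * sqrt A" .
  have A0: "A >= 0" "B >= 0" by(simp_all add: A_def B_def)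
  have "sqrt A <= sqrt B" proof(cases "A = 0")
   case False hence "sqrt A * sqrt A <= sqrt B * sqrt A" "sqrt A > 0" using 1 A0 by simp_all
   thus ?thesis by(simp only: mult_le_cancel_right_pos)
  qed (use A0 in simp)
  thus ?thesis by(simp add: A_def B_def)
 qed
 show ?thesis proof(rule L2_Fatou(2)[OF v2 le])
  show "AE x in lborel. (%n. v n x) ----> beta (u x)" proof(rule AE_I2)
   fix x obtain k :: nat where k: "abs (u x) <= real k" using real_arch_simple by blast
   have "\<forall>\<^sub>F n in sequentially. v n x = beta (u x)" unfolding eventually_sequentially proof(intro exI[of _ k] allI impI)
    fix n assume "n >= k"
    hence "real n >= abs (u x)" using k by linarith
    hence "cl n (u x) = u x" by(auto simp: cl_def)
    thus "v n x = beta (u x)" by(simp add: v_def)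
   qed
   thus "(%n. v n x) ----> beta (u x)" by(rule tendsto_eventually)
  qed
 qed (use L2D[OF betau] in simp)
qed

context cahn_hilliard_flow
begin

text \<open>Tested against a fixed \<open>v\<close>, the quotients of \<open>incr (1 / n)\<close> by
  \<open>1 / n\<close> converge to \<open>w\<close> at almost every time, by Lebesgue
  differentiation. The exceptional times depend on \<open>v\<close>; therefore only the countable
  set \<open>V\<close> is tested, which comes arbitrarily close to \<open>w t\<close> at good
  times.\<close>

lemma w_norm_bound:
 obtains M N' where "M >= 0" "negligible N'" "N \<subseteq> N'" "!!t. t > 1 ==> t \<notin> N' ==> X0_norm s (w t) <= M" proof -
 obtain M where M: "M >= 0" "!!b n. b > 1 ==> n > 0 ==> X0_norm s (incr (1 / real n) b) <= M / real n" using incr_norm_bound by blast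
 have "\<exists>N0. negligible N0 & (\<forall>t>1. t \<notin> N0 --> abs (frac_op s (w t) v) <= M * X0_norm s v)" if v: "v \<in> V" for v proof -
  have vX: "v \<in> X0 s Omega" using V v by auto
  \<comment> \<open>Cut off at time 1, where the integral identities hold, and extended by 0 to be
    integrable on every bounded interval.\<close>
  define f where "f t = (if t \<in> {1..} then frac_op s (w t) v else 0)" for t
  have "f integrable_on cbox a b" for a b proof -
   have "(%t. frac_op s (w t) v) integrable_on ({1..} \<inter> {a..b})" proof(cases "max 1 a <= b")
    case True have "{1..} \<inter> {a..b} = {max 1 a..b}" by auto
    moreover have "(%t. frac_op s (w t) v) integrable_on {max 1 a..b}" using True by(intro has_integral_integrable[OF flux[OF vX]]) auto
    ultimately show ?thesis by simp
   next case False hence "{1..} \<inter> {a..b} = {}" by auto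
    thus ?thesis by(simp only: integrable_on_empty)
   qed
   thus ?thesis unfolding f_def[abs_def] integrable_restrict_Int by simp
  qed
  then obtain N0 where N0: "negligible N0" "!!x e. [|x \<notin> N0; 0 < e|] ==>
    \<exists>d>0. \<forall>h. 0 < h & h < d --> norm (integral (cbox x (x + h *\<^sub>R One)) f /\<^sub>R h ^ DIM(real) - f x) < e"
   using integrable_ccontinuous_explicit[of f] by metis
  have "abs (frac_op s (w t) v) <= M * X0_norm s v" if t: "t > 1" "t \<notin> N0" for t proof(rule field_le_epsilon)
   fix e :: real assume e: "e > 0"
   obtain d where d: "d > 0" "!!h. 0 < h ==> h < d ==> norm (integral (cbox t (t + h *\<^sub>R One)) f /\<^sub>R h ^ DIM(real) - f t) < e"
    using N0(2)[OF t(2) e] by blast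
   obtain n :: nat where n: "n > 0" "1 / real n < d" using reals_Archimedean[OF d(1)] by(metis inverse_eq_divide zero_less_Suc)
   define h where "h = 1 / real n"
   have h: "h > 0" "h < d" using n by(auto simp: h_def)
   have "((%t. frac_op s (w t) v) has_integral (ip (u t) v - ip (u (t + h)) v)) {t..t + h}" using t h by(intro flux vX) auto
   hence "(f has_integral (ip (u t) v - ip (u (t + h)) v)) {t..t + h}" by(rule has_integral_eq[rotated]) (use t in \<open>auto simp: f_def\<close>)
   hence "integral {t..t + h} f = frac_op s (incr h t) v" using incr(2)[of t h v] t h vX by(simp add: integral_unique)
   hence F: "abs (frac_op s (incr h t) v / h - frac_op s (w t) v) < e" using d(2)[OF h] t by(simp add: f_def divide_inverse mult.commute)
   have "abs (frac_op s (incr h t) v) <= X0_norm s (incr h t) * X0_norm s v" using t h by(intro frac_op_CS s X0D(1)[OF vX] X0D(1)[OF incr(1)]) auto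
   also have "... <= M * h * X0_norm s v" using M(2)[OF t(1) n(1)] by(intro mult_right_mono X0_norm_ge0 s) (simp add: h_def)
   finally have "abs (frac_op s (incr h t) v / h) <= M * X0_norm s v" using h by(simp add: abs_divide pos_divide_le_eq mult_ac)
   thus "abs (frac_op s (w t) v) <= M * X0_norm s v + e" using F by linarith
  qed
  thus ?thesis using N0(1) by blast
 qed
 then obtain N0 where N0: "!!v. v \<in> V ==> negligible (N0 v)"
   "!!v t. v \<in> V ==> t > 1 ==> t \<notin> N0 v ==> abs (frac_op s (w t) v) <= M * X0_norm s v" by metis
 define N' where "N' = N \<union> \<Union> (N0 ` V)"
 show ?thesis proof(rule that[of M N'])
  have "negligible (\<Union> (N0 ` V))" using V(1) N0(1) by(intro negligible_countable_Union) auto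
  thus "negligible N'" using N by(simp add: N'_def)
  fix t assume t: "t > 1" "t \<notin> N'"
  have tN: "t \<notin> N" "!!v. v \<in> V ==> t \<notin> N0 v" using t(2) by(auto simp: N'_def)
  have wX: "w t \<in> X0 s Omega" using t tN by(intro w_X0) auto
  define n where "n = X0_norm s (w t)"
  have n0: "n >= 0" by(simp add: n_def X0_norm_ge0 s)
  \<comment> \<open>\<open>w t\<close> itself would be the right test function; an element of
    \<open>V\<close> replaces it with an error that is at most \<open>e\<close> in total.\<close>
  have "n * n <= M * n" proof(rule field_le_epsilon)
   fix e :: real assume e: "e > 0"
   define e' where "e' = e / (M + n + 1)"
   have e': "e' > 0" using e M(1) n0 by(auto simp: e'_def)
   have "(M + n + 1) * e' = e" using M(1) n0 by(simp add: e'_def)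
   hence Me: "M * e' + n * e' <= e" using e' by(simp add: distrib_right)
   obtain v where v: "v \<in> V" "X0_norm s (%x. v x - w t x) < e'" using V(3)[OF _ tN(1) e'] t by auto
   have vX: "v \<in> X0 s Omega" using V v by auto
   note D = X0_diff[OF vX wX]
   have "X0_norm s (%x. w t x + (v x - w t x)) <= n + X0_norm s (%x. v x - w t x)"
    unfolding n_def by(intro X0_norm_add_le s X0D(1)[OF wX] X0D(1)[OF D])
   hence v_le: "X0_norm s v <= n + e'" using v(2) by simp
   have "n * n = frac_op s (w t) v + - frac_op s (w t) (%x. v x - w t x)"
    unfolding frac_op_diff_right[OF X0D(1)[OF wX] X0D(1)[OF vX] X0D(1)[OF wX]] n_def
    using X0_norm_square[OF s, of "w t"] by(simp add: power2_eq_square)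
   also have "frac_op s (w t) v <= M * X0_norm s v" using N0(2)[OF v(1) t(1) tN(2)[OF v(1)]] by linarith
   also have "... <= M * (n + e')" by(intro mult_left_mono v_le M)
   also have "- frac_op s (w t) (%x. v x - w t x) <= n * X0_norm s (%x. v x - w t x)"
    using frac_op_CS[OF s X0D(1)[OF wX] X0D(1)[OF D]] unfolding n_def by linarith
   also have "... <= n * e'" using v(2) n0 by(intro mult_left_mono) auto
   finally show "n * n <= M * n + e" using Me by(simp add: distrib_left)
  qed
  thus "X0_norm s (w t) <= M" using n0 M(1) unfolding n_def[symmetric] by(cases "n = 0") (auto simp: mult_le_cancel_right)
 qed (use M in \<open>auto simp: N'_def\<close>)
qed

text \<open>At two good times the second equation is subtracted and tested with the difference
  \<open>d\<close>. The pairing of \<open>d\<close> with the difference of \<open>w\<close> is of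
  order \<open>t' - t\<close>, since \<open>d\<close> is that small in the dual norm of order
  \<open>s\<close>. This gives exponent 1/2 in time, and weak continuity extends the estimate to an
  exceptional time \<open>t\<close>.\<close>

lemma u_increment:
 assumes M: "M >= 0" "N \<subseteq> N'" "!!t. t > 1 ==> t \<notin> N' ==> X0_norm s (w t) <= M" and N': "negligible N'"
 obtains B where "B > 0" "!!t t'. 1 <= t ==> t < t' ==> t' <= t + 1 ==> t' \<notin> N' ==>
  X0_norm sig (%x. u t' x - u t x) <= sqrt (B * (t' - t))" proof -
 \<comment> \<open>Half of the energy is absorbed by the left-hand side.\<close>
 have "1 / (2 * (lam + 1)) > 0" using lam by simp
 from Ehrling[OF this] obtain C where C: "C > 0" "!!v m. v \<in> X0 sig Omega ==> m >= 0 ==>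
   \<forall>phi\<in>X0 s Omega. abs (ip v phi) <= m * X0_norm s phi ==>
   (L2sq v) <= 1 / (2 * (lam + 1)) * (X0_norm sig v)^2 + C * m^2" by auto
 define B where "B = 4 * M^2 + 2 * lam * C * M^2 + 1"
 have B0: "B > 0" unfolding B_def using lam C by(intro add_nonneg_pos) auto
 have good: "(X0_norm sig (%x. u t x - u t' x))^2 <= B * (t' - t)"
  if t: "1 < t" "t < t'" "t' <= t + 1" "t \<notin> N'" "t' \<notin> N'" for t t' proof -
  have tN: "t \<notin> N" "t' \<notin> N" "t > 0" "t' > 0" using t M(2) by auto
  have uX: "u t \<in> X0 sig Omega" "u t' \<in> X0 sig Omega" using tN by(auto intro: u_X0)
  have wX: "w t \<in> X0 s Omega" "w t' \<in> X0 s Omega" using tN w_X0 by auto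
  define d where "d x = u t x - u t' x" for x
  define omega where "omega x = w t x - w t' x" for x
  have d: "d \<in> X0 sig Omega" unfolding d_def by(rule X0_diff[OF uX])
  have omega: "omega \<in> X0 s Omega" unfolding omega_def by(rule X0_diff[OF wX])
  \<comment> \<open>The first equation, integrated over \<open>[t, t']\<close>, with the bound
    \<open>M\<close> on the norm of \<open>w\<close>.\<close>
  have dual: "abs (ip d phi) <= M * (t' - t) * X0_norm s phi" if phi: "phi \<in> X0 s Omega" for phi proof -
   have e: "ip d phi = ip (u t) phi - ip (u t') phi" unfolding d_def by(rule ip_diff_left; rule X0D(4)) (fact uX phi)+
   have fl: "((%t. frac_op s (w t) phi) has_integral ip d phi) {t..t'}" unfolding e using t by(intro flux phi) auto
   have c: "((%t. c * X0_norm s phi) has_integral c * (t' - t) * X0_norm s phi) {t..t'}" for c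
    using has_integral_const_real[of "c * X0_norm s phi" t t'] t by(simp add: mult_ac)
   have le: "abs (frac_op s (w tau) phi) <= M * X0_norm s phi" if "tau \<in> {t..t'} - N'" for tau proof -
    have "w tau \<in> X0 s Omega" using that t M(2) by(intro w_X0) auto
    hence "abs (frac_op s (w tau) phi) <= X0_norm s (w tau) * X0_norm s phi" by(intro frac_op_CS s X0D(1)[OF phi] X0D(1))
    also have "... <= M * X0_norm s phi" using that t by(intro mult_right_mono M X0_norm_ge0 s) auto
    finally show ?thesis .
   qed
   have "ip d phi <= M * (t' - t) * X0_norm s phi" by(rule has_integral_le_negligible[OF fl c N']) (use le in \<open>auto simp: abs_le_iff\<close>)
   moreover have "(- M) * (t' - t) * X0_norm s phi <= ip d phi"
    by(rule has_integral_le_negligible[OF c fl N']) (use le in \<open>force simp: abs_le_iff\<close>)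
   ultimately show ?thesis by(simp add: abs_le_iff)
  qed
  have gL: "L2_fun lborel (%x. g (u t x))" "L2_fun lborel (%x. g (u t' x))" using g_L2 tN by auto
  note wS = X0D(4)[OF wX(1)] X0D(4)[OF wX(2)]
  have "(X0_norm sig d)^2 = frac_op sig (u t) d - frac_op sig (u t') d"
   using frac_op_diff_left[OF X0D(1)[OF d] X0D(1)[OF uX(1)] X0D(1)[OF uX(2)]] by(simp add: d_def[abs_def] X0_norm_square[OF sig])
  also have "... = ip omega d + - ip (%x. g (u t x) - g (u t' x)) d"
   unfolding ip_diff_left[OF gL X0D(4)[OF d]] omega_def ip_diff_left[OF wS X0D(4)[OF d]] using eq[OF tN(3,1) d] eq[OF tN(4,2) d] by linarith
  also have "ip omega d <= M * (t' - t) * (2 * M)" proof -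
   have "X0_norm s omega <= 2 * M"
    using X0_norm_diff_le[OF s X0D(1)[OF wX(1)] X0D(1)[OF wX(2)]] M(3)[of t] M(3)[of t'] t unfolding omega_def by linarith
   hence "M * (t' - t) * X0_norm s omega <= M * (t' - t) * (2 * M)" using M(1) t by(intro mult_left_mono) auto
   thus ?thesis using dual[OF omega] unfolding ip_commute[of omega] by linarith
  qed
  also have "- ip (%x. g (u t x) - g (u t' x)) d <= lam * (L2sq d)" unfolding d_def by(rule g_semimonotone[OF uX gL])
  also have "(L2sq d) <= 1 / (2 * (lam + 1)) * (X0_norm sig d)^2 + C * (M * (t' - t))^2" using M(1) t dual by(intro C(2) d ballI) auto
  finally have 1: "(X0_norm sig d)^2 <= M * (t' - t) * (2 * M) + lam * (1 / (2 * (lam + 1)) * (X0_norm sig d)^2 + C * (M * (t' - t))^2)"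
   using lam by(simp add: mult_left_mono)
  have "lam / (2 * (lam + 1)) * (X0_norm sig d)^2 <= 1 / 2 * (X0_norm sig d)^2" using lam by(intro mult_right_mono) (auto simp: field_simps)
  moreover have "lam * (C * (M * (t' - t))^2) <= lam * C * M^2 * (t' - t)" proof -
   have "(t' - t)^2 <= (t' - t)" using t by(simp add: power2_eq_square mult_left_le)
   hence "(lam * C * M^2) * (t' - t)^2 <= (lam * C * M^2) * (t' - t)" using lam C by(intro mult_left_mono) auto
   thus ?thesis by(simp add: power_mult_distrib mult_ac)
  qed
  moreover have "M * (t' - t) * (2 * M) = 2 * (M^2 * (t' - t))" by(simp add: power2_eq_square)
  moreover have "lam * (1 / (2 * (lam + 1)) * (X0_norm sig d)^2) = lam / (2 * (lam + 1)) * (X0_norm sig d)^2" by simp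
  ultimately have "(X0_norm sig d)^2 <= 4 * M^2 * (t' - t) + 2 * (lam * C * M^2 * (t' - t))"
   using 1 unfolding distrib_left[of lam] mult.assoc[of 4] by linarith
  also have "... <= B * (t' - t)" using t by(simp add: B_def algebra_simps)
  finally show ?thesis by(simp add: d_def[abs_def])
 qed
 show ?thesis proof(rule that[OF B0])
  fix t t' :: real assume t: "1 <= t" "t < t'" "t' <= t + 1" "t' \<notin> N'"
  define phi where "phi x = u t' x - u t x" for x
  have uX: "u t \<in> X0 sig Omega" "u t' \<in> X0 sig Omega" using t by(auto intro: u_X0)
  have phi: "phi \<in> X0 sig Omega" unfolding phi_def by(rule X0_diff[OF uX(2,1)])
  \<comment> \<open>Good times decreasing to \<open>t\<close>; from the right they stay beyond 1
    even for \<open>t = 1\<close>.\<close>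
  obtain tau where tau: "!!n::nat. t < tau n" "!!n. tau n < t'" "!!n. tau n \<notin> N'" and lim: "tau ----> t"
   by(rule negligible_avoiding_sequence[OF N' t(2)], rule that)
  have "(%n. frac_op sig (u (tau n)) phi) ----> frac_op sig (u t) phi" proof(rule continuous_on_tendsto_compose[OF u_cont[OF phi] lim])
   have "tau n \<in> {0..}" for n using tau(1)[of n] t by simp
   thus "\<forall>\<^sub>F n in sequentially. tau n \<in> {0..}" by simp
  qed (use t in simp)
  hence "(%n. frac_op sig (u t') phi - frac_op sig (u (tau n)) phi) ----> frac_op sig (u t') phi - frac_op sig (u t) phi" by(intro tendsto_intros)
  also have "frac_op sig (u t') phi - frac_op sig (u t) phi = X0_norm sig phi * X0_norm sig phi"
   using frac_op_diff_left[OF X0D(1)[OF phi] X0D(1)[OF uX(2)] X0D(1)[OF uX(1)]] X0_norm_square[OF sig, of phi]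
   by(simp add: phi_def[abs_def] power2_eq_square)
  finally have "X0_norm sig phi * X0_norm sig phi <= sqrt (B * (t' - t)) * X0_norm sig phi" proof(rule LIMSEQ_le_const2, intro exI allI impI)
   fix n note st = tau(2)[of n]
   have uT: "u (tau n) \<in> X0 sig Omega" using tau(1)[of n] t by(intro u_X0) simp
   have "frac_op sig (u t') phi - frac_op sig (u (tau n)) phi = frac_op sig (%x. u t' x - u (tau n) x) phi"
    by(rule frac_op_diff_left[OF X0D(1)[OF phi] X0D(1)[OF uX(2)] X0D(1)[OF uT], symmetric])
   also have "... <= X0_norm sig (%x. u t' x - u (tau n) x) * X0_norm sig phi"
    using frac_op_CS[OF sig X0D(1)[OF X0_diff[OF uX(2) uT]] X0D(1)[OF phi]] by linarith
   also have "... <= sqrt (B * (t' - t)) * X0_norm sig phi" proof(intro mult_right_mono X0_norm_ge0 sig)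
    have "(X0_norm sig (%x. u (tau n) x - u t' x))^2 <= B * (t' - tau n)" using tau(1)[of n] t st tau(3)[of n] by(intro good) auto
    also have "... <= B * (t' - t)" using B0 tau(1)[of n] by(intro mult_left_mono) auto
    finally show "X0_norm sig (%x. u t' x - u (tau n) x) <= sqrt (B * (t' - t))" unfolding X0_norm_minus_commute[of sig "u t'"] by(rule real_le_rsqrt)
   qed
   finally show "frac_op sig (u t') phi - frac_op sig (u (tau n)) phi <= sqrt (B * (t' - t)) * X0_norm sig phi" .
  qed
  hence "X0_norm sig phi <= sqrt (B * (t' - t))" using X0_norm_ge0[OF sig, of phi] B0 t
   by(cases "X0_norm sig phi = 0") (auto simp: mult_le_cancel_right)
  thus "X0_norm sig (%x. u t' x - u t x) <= sqrt (B * (t' - t))" by(simp add: phi_def[abs_def])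
 qed qed

end

lemma L2_indicator_bounded:
 assumes "open Omega" "bounded (Omega :: 'a::euclidean_space set)"
 shows "L2_fun lborel (indicator Omega :: 'a => real)" proof -
 have "(%x. (indicator Omega x :: real)^2) = indicator Omega" by(auto simp: indicator_def)
 thus ?thesis using assms emeasure_bounded_finite[of Omega] by(simp add: L2_fun_def less_top[symmetric])
qed

lemma X0_times_indicator:
 assumes "v \<in> X0 a Omega" shows "AE x in lborel. indicator Omega x * v x = v x" using X0D(2)[OF assms] by eventually_elim auto

lemma X0_integrable:
 assumes Omega: "open Omega" "bounded Omega" and v: "v \<in> X0 a Omega"
 shows "integrable lborel v" proof -
 have "integrable lborel (%x. indicator Omega x * v x)" by(intro L2_mult_integrable L2_indicator_bounded Omega X0D(4)[OF v])
 thus ?thesis by(rule integrable_cong_AE_imp[OF _ X0D(3)[OF v]]) (use X0_times_indicator[OF v] in eventually_elim, simp)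
qed

context cahn_hilliard_flow
begin

abbreviation beta :: "real => real" where "beta r == g r + lam * r"

text \<open>The pair stands for \<open>u t\<close> and \<open>w t\<close> at one time. The function
  \<open>f\<close> is not tied to \<open>w\<close>, because at an exceptional time the value of
  \<open>w\<close> carries no information; \<open>M\<close> makes bounds uniform over all
  times.\<close>

definition stationary :: "real => ('a => real) => ('a => real) => bool" where
 "stationary M y f \<longleftrightarrow> y \<in> X0 sig Omega & f \<in> X0 s Omega & X0_norm s f <= M & L2_fun lborel (%x. g (y x)) &
  (\<forall>v\<in>X0 sig Omega. ip f v = frac_op sig y v + ip (%x. g (y x)) v)"

lemma stationaryD:
 assumes "stationary M y f"
 shows "y \<in> X0 sig Omega" "f \<in> X0 s Omega" "X0_norm s f <= M" "L2_fun lborel (%x. lam * y x + f x)"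
  "L2_fun lborel (%x. beta (y x))"
  "!!v. v \<in> X0 sig Omega ==> frac_op sig y v + ip (%x. beta (y x)) v = ip (%x. lam * y x + f x) v" proof -
 show y: "y \<in> X0 sig Omega" and f: "f \<in> X0 s Omega" and "X0_norm s f <= M" using assms by(auto simp: stationary_def)
 have gy: "L2_fun lborel (%x. g (y x))" using assms by(simp add: stationary_def)
 note y2 = X0D(4)[OF y] and f2 = X0D(4)[OF f]
 show "L2_fun lborel (%x. lam * y x + f x)" using L2_lincomb[OF y2 f2, of lam 1] by simp
 show "L2_fun lborel (%x. beta (y x))" using L2_lincomb[OF gy y2, of 1 lam] by simp
 fix v assume v: "v \<in> X0 sig Omega"
 note v2 = X0D(4)[OF v]
 have i: "integrable lborel (%x. g (y x) * v x)" "integrable lborel (%x. lam * (y x * v x))" "integrable lborel (%x. f x * v x)"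
  by(intro integrable_mult_right L2_mult_integrable gy v2 y2 f2)+
 have "ip (%x. beta (y x)) v = ip (%x. g (y x)) v + lam * ip y v" unfolding distrib_right mult.assoc using L1_integral_add[OF i(1,2)] by simp
 moreover have "ip (%x. lam * y x + f x) v = lam * ip y v + ip f v" unfolding distrib_right mult.assoc using L1_integral_add[OF i(2,3)] by simp
 moreover have "ip f v = frac_op sig y v + ip (%x. g (y x)) v" using assms v by(simp add: stationary_def)
 ultimately show "frac_op sig y v + ip (%x. beta (y x)) v = ip (%x. lam * y x + f x) v" by linarith
qed

lemma beta0: "beta 0 = 0" by(simp add: g0)

text \<open>At an arbitrary time the equation is the limit of the equations at nearby good times: \<open>u\<close> converges
 strongly in the energy space, and \<open>w\<close> is a Cauchy sequence in \<open>L\<^sup>2\<close> because functions in a bounded set of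
 \<open>X0 s Omega\<close> are uniformly approximated by admissible test functions.\<close>
lemma stationary_limit:
 obtains M where "M >= 0" "!!t. t >= 1 ==> \<exists>f. stationary M (u t) f" proof -
 obtain M N' where M: "M >= 0" "negligible N'" "N \<subseteq> N'" "!!t. t > 1 ==> t \<notin> N' ==> X0_norm s (w t) <= M" using w_norm_bound by blast
 obtain B where B: "B > 0" "!!t t'. 1 <= t ==> t < t' ==> t' <= t + 1 ==> t' \<notin> N' ==>
  X0_norm sig (%x. u t' x - u t x) <= sqrt (B * (t' - t))" using u_increment[OF M(1,3,4,2)] by blast
 obtain Cs where Cs: "Cs > 0" "!!v. v \<in> X0 s Omega ==> (L2sq v) <= Cs * (X0_norm s v)^2" using X0_Poincare[OF s bd] by blast
 obtain Csig where Csig: "Csig > 0" "!!v. v \<in> X0 sig Omega ==> (L2sq v) <= Csig * (X0_norm sig v)^2" using X0_Poincare[OF sig bd] by blast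
 show ?thesis proof(rule that[OF M(1)])
  fix t :: real assume t: "t >= 1"
  have ut: "u t \<in> X0 sig Omega" using t by(intro u_X0) simp
  obtain tau where tau: "!!n::nat. t < tau n" "!!n. tau n < t + 1" "!!n. tau n \<notin> N'" and lim: "tau ----> t"
   by(rule negligible_avoiding_sequence[OF M(2), of t "t + 1"]) (simp, rule that)
  have tau1: "tau n <= t + 1" "tau n > 1" for n using tau(1,2)[of n] t by linarith+
  have utau: "u (tau n) \<in> X0 sig Omega" for n using tau1(2)[of n] by(intro u_X0) simp
  define D where "D n = X0_norm sig (%x. u (tau n) x - u t x)" for n
  have D0: "D n >= 0" for n by(simp add: D_def X0_norm_ge0 sig)
  have D: "D ----> 0" proof(rule tendsto_sandwich[where f = "%_. 0" and h = "%n. sqrt (B * (tau n - t))"])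
   have "(%n. sqrt (B * (tau n - t))) ----> sqrt (B * (t - t))" by(intro tendsto_intros lim)
   thus "(%n. sqrt (B * (tau n - t))) ----> 0" by simp
   show "\<forall>\<^sub>F n in sequentially. D n <= sqrt (B * (tau n - t))" unfolding D_def using tau tau1 t by(intro always_eventually allI B) auto
  qed (use D0 in auto)
  have "(%n. LBINT x. (u (tau n) x - u t x)^2) ----> 0" proof(rule tendsto_sandwich[where f = "%_. 0" and h = "%n. Csig * (D n)^2"])
   have "(%n. Csig * (D n)^2) ----> Csig * 0^2" by(intro tendsto_intros D)
   thus "(%n. Csig * (D n)^2) ----> 0" by simp
   show "\<forall>\<^sub>F n in sequentially. (LBINT x. (u (tau n) x - u t x)^2) <= Csig * (D n)^2"
    unfolding D_def by(intro always_eventually allI Csig X0_diff utau ut)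
  qed auto
  \<comment> \<open>The nonlinearity needs pointwise convergence, which is available along a
    subsequence of the good times.\<close>
  then obtain r where r: "!!k::nat. r k >= k" "AE x in lborel. (%k. u (tau (r k)) x) ----> u t x"
   using L2_limit_AE_subsequence[of lborel "%n. u (tau n)" "u t"] X0D(4)[OF utau] X0D(4)[OF ut] by metis
  have rtop: "filterlim r at_top sequentially" by(rule filterlim_at_top_mono[OF filterlim_ident]) (use r in simp)
  define p where "p k = tau (r k)" for k
  define E where "E k = D (r k)" for k
  have p: "p ----> t" "p k > 1" "p k > 0" "p k \<notin> N'" "p k \<notin> N" for k proof -
   show "p ----> t" unfolding p_def by(rule filterlim_compose[OF lim rtop])
   show "p k > 1" "p k \<notin> N'" by(simp_all add: p_def tau tau1)
   thus "p k > 0" "p k \<notin> N" using M(3) by auto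
  qed
  have E: "E ----> 0" unfolding E_def by(rule filterlim_compose[OF D rtop])
  have E_eq: "E k = X0_norm sig (%x. u (p k) x - u t x)" for k by(simp add: E_def D_def p_def)
  have uX: "u (p k) \<in> X0 sig Omega" for k by(simp add: p_def utau)
  have wX: "w (p k) \<in> X0 s Omega" for k by(rule w_X0[OF p(3,5)])
  have wM: "X0_norm s (w (p k)) <= M" for k by(rule M(4)[OF p(2,4)])
  have gL: "L2_fun lborel (%x. g (u (p k) x))" for k by(rule g_L2[OF p(3,5)])
  note w2' = X0D(4)[OF wX] and u2' = X0D(4)[OF uX]
  have W2: "(LBINT x. (w (p k) x)^2) <= Cs * M^2" for k
   by(rule order_trans[OF Cs(2)[OF wX]]) (use Cs(1) wM in \<open>intro mult_left_mono power_mono X0_norm_ge0 s, auto\<close>)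
  obtain e0 where e0: "!!k. E k <= e0" using convergent_imp_Bseq[OF convergentI[OF E]] unfolding Bseq_def by(auto simp: abs_le_iff)
  define KU where "KU = 2 * (Csig * e0^2) + 2 * (L2sq (u t))"
  have U2: "(LBINT x. (u (p k) x)^2) <= KU" for k proof -
   have "(LBINT x. (1 * (u (p k) x - u t x) + 1 * u t x)^2) <=
     2 * 1^2 * (LBINT x. (u (p k) x - u t x)^2) + 2 * 1^2 * (L2sq (u t))"
    by(rule integral_square_lincomb_le[OF X0D(4)[OF X0_diff[OF uX ut]] X0D(4)[OF ut]])
   moreover have "(LBINT x. (u (p k) x - u t x)^2) <= Csig * (E k)^2" unfolding E_eq by(rule Csig(2)[OF X0_diff[OF uX ut]])
   moreover have "Csig * (E k)^2 <= Csig * e0^2" using Csig(1) e0[of k] D0[of "r k"] by(intro mult_left_mono power_mono) (auto simp: E_def)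
   ultimately show ?thesis by(simp add: KU_def)
  qed
  \<comment> \<open>The bound for \<open>beta (u)\<close> from
    \<open>elliptic_nonlinearity_bound\<close>, combined with the one for
    \<open>lam * u\<close>.\<close>
  define KG where "KG = 2 * (2 * lam^2 * KU + 2 * (Cs * M^2)) + 2 * lam^2 * KU"
  have G2: "(LBINT x. (g (u (p k) x))^2) <= KG" for k proof -
   have st: "stationary M (u (p k)) (w (p k))" using uX wX wM gL eq[OF p(3,5)] by(simp add: stationary_def)
   note f = stationaryD(4)[OF st] and b = stationaryD(5)[OF st]
   have "(LBINT x. (beta (u (p k) x))^2) <= (LBINT x. (lam * u (p k) x + w (p k) x)^2)"
   proof(rule elliptic_nonlinearity_bound[where beta = beta, OF sig g_mono beta0 _ uX f b stationaryD(6)[OF st]])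
    show "\<exists>L. \<forall>r\<in>{- T..T}. \<forall>t\<in>{- T..T}. abs (beta r - beta t) <= L * abs (r - t)" for T proof -
     obtain L where L: "\<forall>r\<in>{-T..T}. \<forall>t\<in>{-T..T}. abs (g r - g t) <= L * abs (r - t)" using g_Lip by blast
     have "abs (beta r - beta t) <= (L + lam) * abs (r - t)" if "r \<in> {-T..T}" "t \<in> {-T..T}" for r t proof -
      have "abs (g r - g t) <= L * abs (r - t)" using L that by blast
      moreover have "abs (lam * r - lam * t) = lam * abs (r - t)" using lam by(simp add: abs_mult right_diff_distrib[symmetric])
      ultimately show ?thesis unfolding distrib_right by linarith
     qed
     thus ?thesis by blast
    qed qed
   also have "... <= 2 * lam^2 * (LBINT x. (u (p k) x)^2) + 2 * (LBINT x. (w (p k) x)^2)"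
    using integral_square_lincomb_le[OF u2' w2', of lam k 1 k] by simp
   also have "... <= 2 * lam^2 * KU + 2 * (Cs * M^2)" by(intro add_mono mult_left_mono U2 W2) auto
   finally have 1: "(LBINT x. (g (u (p k) x) + lam * u (p k) x)^2) <= 2 * lam^2 * KU + 2 * (Cs * M^2)" .
   have "(LBINT x. (g (u (p k) x))^2) <= 2 * (LBINT x. (g (u (p k) x) + lam * u (p k) x)^2) + 2 * lam^2 * (LBINT x. (u (p k) x)^2)"
    using integral_square_lincomb_le[OF b u2'[of k], of 1 "- lam"] by simp
   also have "... <= KG" unfolding KG_def by(intro add_mono mult_left_mono 1 U2) auto
   finally show ?thesis .
  qed
  have gm: "(%x. g (u t x)) \<in> borel_measurable lborel"
   using borel_measurable_continuous_onI[OF g_cont] X0D(3)[OF ut] by(rule measurable_compose[rotated])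
  have glim: "AE x in lborel. (%k. g (u (p k) x)) ----> g (u t x)"
   using r(2) by eventually_elim (auto simp: p_def intro!: continuous_on_tendsto_compose[OF g_cont])
  note I2 = L2_indicator_bounded[OF op bd]
  have gt: "L2_fun lborel (%x. g (u t x))"
   and gconv: "!!v. v \<in> X0 sig Omega ==> (%k. LBINT x. abs (g (u (p k) x) - g (u t x)) * abs (v x)) ----> 0"
   using L2_bounded_AE_limit[OF gL G2 gm glim X0_integrable[OF op bd] X0D(4)] zero_in_X0[of sig Omega] by blast+
  \<comment> \<open>The distance of the nonlinear terms in L^1 of the domain. It suffices because
    the approximating test functions are bounded uniformly.\<close>
  define gamma where "gamma k = (LBINT x. abs (g (u (p k) x) - g (u t x)) * abs (indicator Omega x))" for k
  have gamma: "gamma ----> 0" unfolding gamma_def proof(rule L2_bounded_AE_limit(2)[OF gL G2 gm glim _ I2])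
   show "integrable lborel (indicator Omega :: 'a => real)" using L2_mult_integrable[OF I2 I2] by(simp add: indicator_inter_arith[symmetric])
  qed
  have gammai: "integrable lborel (%x. abs (g (u (p k) x) - g (u t x)) * abs (indicator Omega x))" for k unfolding abs_mult[symmetric]
   by(intro integrable_abs L2_mult_integrable L2_diff gL gt I2)
  have Cauchy: "\<exists>n0. \<forall>m\<ge>n0. \<forall>n\<ge>n0. (LBINT x. (w (p m) x - w (p n) x)^2) <= e" if e: "e > 0" for e proof -
   define P where "P = Cs * (2 * M)^2 + 1"
   have P: "P > 0" using Cs(1) by(simp add: P_def add_nonneg_pos)
   \<comment> \<open>Chosen such that the pairing of \<open>omega\<close> with its approximation
     error is at most \<open>e / 2\<close>.\<close>
   define eta where "eta = (e / 2)^2 / (P * ((2 * M)^2 + 1))"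
   have M1: "(2 * M)^2 + 1 > 0" by(simp add: add_nonneg_pos)
   have eta: "eta > 0" using e P M1 unfolding eta_def by(intro divide_pos_pos mult_pos_pos) auto
   have etaP: "P * (eta * (2 * M)^2) <= (e / 2)^2" proof -
    have "P * (eta * (2 * M)^2) <= P * (eta * ((2 * M)^2 + 1))" using P eta by(intro mult_left_mono) auto
    also have "... = (e / 2)^2" using P M1 by(simp add: eta_def)
    finally show ?thesis .
   qed
   obtain C where C: "C > 0" "!!v. v \<in> X0 s Omega ==> \<exists>phi\<in>X0 sig Omega.
     (\<forall>x. abs (phi x) <= C * sqrt (L2sq v)) & X0_norm sig phi <= C * sqrt (L2sq v) &
     (LBINT x. (v x - phi x)^2) <= eta * (X0_norm s v)^2" using X0_approximation[OF s sig op bd eta] by blast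
   define c where "c = C * sqrt P"
   have c: "c > 0" using C P by(simp add: c_def)
   have "(%k. E k + gamma k) ----> 0 + 0" by(intro tendsto_intros E gamma)
   hence "\<forall>\<^sub>F k in sequentially. E k + gamma k < e / (4 * c)" by(rule order_tendstoD(2)) (use e c in simp)
   then obtain n0 where n0: "!!k. k >= n0 ==> E k + gamma k < e / (4 * c)" unfolding eventually_sequentially by blast
   have "(LBINT x. (w (p m) x - w (p n) x)^2) <= e" if mn: "m >= n0" "n >= n0" for m n proof -
    define omega where "omega x = w (p m) x - w (p n) x" for x
    have omega: "omega \<in> X0 s Omega" unfolding omega_def by(rule X0_diff[OF wX wX])
    have omegan: "X0_norm s omega <= 2 * M"
     using X0_norm_diff_le[OF s X0D(1)[OF wX] X0D(1)[OF wX], of m n] wM[of m] wM[of n] unfolding omega_def by linarith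
    have sqn: "(X0_norm s omega)^2 <= (2 * M)^2" by(intro power_mono omegan X0_norm_ge0 s)
    have omegaP: "(L2sq omega) <= P" using Cs(2)[OF omega] mult_left_mono[OF sqn, of Cs] Cs(1) unfolding P_def by linarith
    obtain phi where phi: "phi \<in> X0 sig Omega" "!!x. abs (phi x) <= C * sqrt (L2sq omega)"
     "X0_norm sig phi <= C * sqrt (L2sq omega)" "(LBINT x. (omega x - phi x)^2) <= eta * (X0_norm s omega)^2" using C(2)[OF omega] by blast
    have "C * sqrt (L2sq omega) <= c" unfolding c_def using C(1) omegaP by(intro mult_left_mono) auto
    hence phic: "abs (phi x) <= c" "X0_norm sig phi <= c" for x using phi(2)[of x] phi(3) by linarith+
    have sq: "L2_fun lborel omega" "L2_fun lborel phi" "L2_fun lborel (%x. omega x - phi x)" by(intro L2_diff X0D(4)[OF omega] X0D(4)[OF phi(1)])+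
    have "ip omega (%x. omega x - phi x) <= sqrt (L2sq omega) * sqrt (LBINT x. (omega x - phi x)^2)" using integral_CS[OF sq(1,3)] by linarith
    also have "... <= sqrt P * sqrt (eta * (2 * M)^2)" proof(intro mult_mono real_sqrt_le_mono omegaP)
     show "(LBINT x. (omega x - phi x)^2) <= eta * (2 * M)^2" using phi(4) mult_left_mono[OF sqn, of eta] eta by linarith
    qed (use P in simp_all)
    also have "... <= e / 2" unfolding real_sqrt_mult[symmetric] using etaP e by(intro real_le_lsqrt) auto
    finally have 1: "ip omega (%x. omega x - phi x) <= e / 2" .
    have "ip omega phi = (frac_op sig (u (p m)) phi - frac_op sig (u (p n)) phi) + ip (%x. g (u (p m) x) - g (u (p n) x)) phi"
     unfolding omega_def ip_diff_left[OF w2' w2' sq(2)] ip_diff_left[OF gL gL sq(2)]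
     using eq[OF p(3,5) phi(1), of m] eq[OF p(3,5) phi(1), of n] by linarith
    also have "frac_op sig (u (p m)) phi - frac_op sig (u (p n)) phi <= c * (E m + E n)" proof -
     have b: "abs (frac_op sig (u (p k)) phi - frac_op sig (u t) phi) <= c * E k" for k proof -
      have "abs (frac_op sig (%x. u (p k) x - u t x) phi) <= E k * X0_norm sig phi"
       unfolding E_eq by(rule frac_op_CS[OF sig X0D(1)[OF X0_diff[OF uX ut]] X0D(1)[OF phi(1)]])
      also have "... <= E k * c" using D0[of "r k"] by(intro mult_left_mono phic) (simp add: E_def)
      finally show ?thesis unfolding frac_op_diff_left[OF X0D(1)[OF phi(1)] X0D(1)[OF uX] X0D(1)[OF ut]] by(simp only: mult.commute)
     qed
     show ?thesis using b[of m] b[of n] unfolding distrib_left by linarith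
    qed
    also have "ip (%x. g (u (p m) x) - g (u (p n) x)) phi <= c * (gamma m + gamma n)" proof -
     have "ip (%x. g (u (p m) x) - g (u (p n) x)) phi <= (LBINT x. c * (abs (g (u (p m) x) - g (u t x)) * abs (indicator Omega x) + abs (g (u (p n) x) - g (u t x)) * abs (indicator Omega x)))"
     proof(rule integral_mono_AE)
      show "integrable lborel (%x. (g (u (p m) x) - g (u (p n) x)) * phi x)" by(intro L2_mult_integrable L2_diff gL sq)
      show "integrable lborel (%x. c * (abs (g (u (p m) x) - g (u t x)) * abs (indicator Omega x) + abs (g (u (p n) x) - g (u t x)) * abs (indicator Omega x)))"
       by(intro integrable_mult_right L1_integrable_add gammai)
      show "AE x in lborel. (g (u (p m) x) - g (u (p n) x)) * phi x <= c * (abs (g (u (p m) x) - g (u t x)) * abs (indicator Omega x) + abs (g (u (p n) x) - g (u t x)) * abs (indicator Omega x))"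
       using X0D(2)[OF phi(1)] proof eventually_elim
       case (elim x) show ?case proof(cases "x \<in> Omega")
        case True
        have "(g (u (p m) x) - g (u (p n) x)) * phi x <= abs (g (u (p m) x) - g (u (p n) x)) * abs (phi x)" unfolding abs_mult[symmetric] by simp
        also have "... <= (abs (g (u (p m) x) - g (u t x)) + abs (g (u (p n) x) - g (u t x))) * c" by(intro mult_mono phic) auto
        finally show ?thesis using True by(simp add: mult.commute)
       qed (use elim in simp)
      qed qed
     also have "... = c * (gamma m + gamma n)" unfolding gamma_def using gammai by simp
     finally show ?thesis .
    qed
    finally have "ip omega phi <= c * ((E m + gamma m) + (E n + gamma n))" by(simp add: distrib_left)
    also have "... <= c * (e / (4 * c) + e / (4 * c))" using n0[OF mn(1)] n0[OF mn(2)] c by(intro mult_left_mono) auto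
    also have "... = e / 2" using c by simp
    finally have 2: "ip omega phi <= e / 2" .
    have "(L2sq omega) = ip omega omega" by(simp only: power2_eq_square)
    also have "... = ip omega (%x. omega x - phi x) + ip omega phi"
     using ip_diff_left[OF sq(1,2,1)] ip_commute[of omega phi] ip_commute[of omega "%x. omega x - phi x"] by linarith
    finally show ?thesis using 1 2 unfolding omega_def by linarith
   qed
   thus ?thesis by blast
  qed
  show "\<exists>f. stationary M (u t) f" proof(rule L2_complete[OF w2' Cauchy])
   fix F q assume F: "L2_fun lborel F" "(%k. LBINT x. (w (p k) x - F x)^2) ----> 0"
    and q: "\<forall>k::nat. q k >= k" "AE x in lborel. (%k. w (p (q k)) x) ----> F x"
   have FS: "F \<in> frac_sobolev s" "X0_norm s F <= M" by(rule X0_Fatou[OF s X0D(1)[OF wX] W2 wM q(2) L2D(1)[OF F(1)]])+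
   have "AE x in lborel. \<forall>k. x \<notin> Omega --> w (p (q k)) x = 0" unfolding AE_all_countable by(intro allI X0D(2)[OF wX])
   hence "AE x in lborel. x \<notin> Omega --> F x = 0" using q(2) by eventually_elim (auto intro: LIMSEQ_unique)
   hence FX: "F \<in> X0 s Omega" using FS by(simp add: X0_def)
   have "ip F v = frac_op sig (u t) v + ip (%x. g (u t x)) v" if v: "v \<in> X0 sig Omega" for v proof(rule LIMSEQ_unique)
    note v2 = X0D(4)[OF v]
    have "(%k. ip (w (p k)) v - ip F v) ----> 0" proof(rule Lim_null_comparison)
     show "(%k. sqrt (LBINT x. (w (p k) x - F x)^2) * sqrt (L2sq v)) ----> 0"
      by(rule tendsto_mult_left_zero[OF tendsto_real_sqrt[OF F(2), unfolded real_sqrt_zero]])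
     show "\<forall>\<^sub>F k in sequentially. norm (ip (w (p k)) v - ip F v) <= sqrt (LBINT x. (w (p k) x - F x)^2) * sqrt (L2sq v)"
      unfolding real_norm_def ip_diff_left[OF w2' F(1) v2, symmetric] by(intro always_eventually allI integral_CS L2_diff w2' F v2)
    qed
    thus "(%k. ip (w (p k)) v) ----> ip F v" by(rule LIM_zero_cancel)
    have "(%k. ip (%x. g (u (p k) x)) v - ip (%x. g (u t x)) v) ----> 0"
    proof(rule Lim_null_comparison[OF _ gconv[OF v]], intro always_eventually allI)
     fix k show "norm (ip (%x. g (u (p k) x)) v - ip (%x. g (u t x)) v) <= (LBINT x. abs (g (u (p k) x) - g (u t x)) * abs (v x))"
      unfolding ip_diff_left[OF gL gt v2, symmetric] abs_mult[symmetric] real_norm_def by(rule integral_abs_bound)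
    qed
    hence 1: "(%k. ip (%x. g (u (p k) x)) v) ----> ip (%x. g (u t x)) v" by(rule LIM_zero_cancel)
    have "(%k. frac_op sig (u (p k)) v) ----> frac_op sig (u t) v" proof(rule continuous_on_tendsto_compose[OF u_cont[OF v] p(1)])
     have "p k \<in> {0..}" for k using p(3)[of k] by simp
     thus "\<forall>\<^sub>F k in sequentially. p k \<in> {0..}" by simp
    qed (use t in simp)
    thus "(%k. ip (w (p k)) v) ----> frac_op sig (u t) v + ip (%x. g (u t x)) v" unfolding eq[OF p(3,5) v] by(rule tendsto_add[OF _ 1])
   qed
   thus ?thesis using FX FS gt ut unfolding stationary_def by blast
  qed qed qed

end

section \<open>From weak solutions to the pointwise-in-time equations\<close>

lemma L2_functional_ip:
 assumes v: "v \<in> X0 a Omega" and f: "f \<in> borel_measurable lborel" and op: "open Omega"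
 shows "L2_functional Omega f v = ip f v" unfolding L2_functional_def set_lebesgue_integral_def proof(rule integral_cong_AE)
 show "(%x. indicator Omega x *\<^sub>R (f x * v x)) \<in> borel_measurable lborel" "(%x. f x * v x) \<in> borel_measurable lborel"
  using f X0D(3)[OF v] op by simp_all
 show "AE x in lborel. indicator Omega x *\<^sub>R (f x * v x) = f x * v x" using X0D(2)[OF v] by eventually_elim auto
qed

lemma ip_in_X0_dual:
 assumes a: "0 < a" "a < 1" and bd: "bounded Omega" and f: "L2_fun lborel f"
 shows "(%v. ip v f) \<in> X0_dual a (Omega :: 'a::euclidean_space set)" proof -
 obtain C where C: "C > 0" "!!v. v \<in> X0 a Omega ==> (L2sq v) <= C * (X0_norm a v)^2" using X0_Poincare[OF a bd] by blast
 have "ip (%x. b * v x + c * v' x) f = b * ip v f + c * ip v' f" if v: "v \<in> X0 a Omega" "v' \<in> X0 a Omega" for v v' b c proof -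
  have i: "integrable lborel (%x. v x * f x)" "integrable lborel (%x. v' x * f x)" by(intro L2_mult_integrable f X0D(4)[OF v(1)] X0D(4)[OF v(2)])+
  show ?thesis unfolding distrib_right mult.assoc using i by simp
 qed
 moreover have "abs (ip v f) <= (sqrt C * sqrt (L2sq f)) * X0_norm a v" if v: "v \<in> X0 a Omega" for v proof -
  have "abs (ip v f) <= sqrt (L2sq v) * sqrt (L2sq f)" by(rule integral_CS[OF X0D(4)[OF v] f])
  also have "... <= (sqrt C * X0_norm a v) * sqrt (L2sq f)" proof(intro mult_right_mono)
   have "sqrt (L2sq v) <= sqrt (C * (X0_norm a v)^2)" using C(2)[OF v] by(rule real_sqrt_le_mono)
   thus "sqrt (L2sq v) <= sqrt C * X0_norm a v" using X0_norm_ge0[OF a, of v] by(simp add: real_sqrt_mult)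
  qed simp
  finally show ?thesis by(simp only: mult_ac)
 qed
 ultimately show ?thesis unfolding X0_dual_def by blast
qed

lemma frac_op_in_X0_dual:
 assumes a: "0 < a" "a < 1" and phi: "phi \<in> X0 a Omega"
 shows "(%v. frac_op a v phi) \<in> X0_dual a Omega" proof -
 have "abs (frac_op a v phi) <= X0_norm a phi * X0_norm a v" if "v \<in> X0 a Omega" for v
  using frac_op_CS[OF a X0D(1)[OF that] X0D(1)[OF phi]] by(simp only: mult.commute)
 thus ?thesis unfolding X0_dual_def by(auto intro: frac_op_lincomb_left X0D(1)[OF phi] X0D(1))
qed

lemma C1_one_sided_Lipschitz:
 fixes g :: "real => real"
 assumes g: "g C1_differentiable_on UNIV" and lam: "!!r. deriv g r >= - lam"
 shows "continuous_on UNIV g" "!!r t. r <= t ==> g r + lam * r <= g t + lam * t"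
  "!!T. \<exists>L. \<forall>r\<in>{-T..T}. \<forall>t\<in>{-T..T}. abs (g r - g t) <= L * abs (r - t)" proof -
 obtain D where D: "!!x. (g has_real_derivative D x) (at x)" "continuous_on UNIV D"
  using g by(auto simp: C1_differentiable_on_def has_real_derivative_iff_has_vector_derivative)
 have Dl: "D x >= - lam" for x using lam[of x] DERIV_imp_deriv[OF D(1)[of x]] by simp
 show "continuous_on UNIV g" using D(1) by(auto intro!: continuous_at_imp_continuous_on DERIV_isCont)
 show "g r + lam * r <= g t + lam * t" if "r <= t" for r t proof(rule DERIV_nonneg_imp_nondecreasing[OF that, of "%r. g r + lam * r"])
  fix x show "\<exists>y. ((%r. g r + lam * r) has_real_derivative y) (at x) & 0 <= y"
   using Dl[of x] by(intro exI[of _ "D x + lam"] conjI) (auto intro!: derivative_eq_intros D(1))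
 qed
 fix T have "compact (D ` {-T..T})" by(intro compact_continuous_image continuous_on_subset[OF D(2)]) auto
 hence "bounded (D ` {-T..T})" by(rule compact_imp_bounded)
 then obtain L where L: "\<forall>x\<in>D ` {-T..T}. abs x <= L" unfolding bounded_real by blast
 have "abs (g r - g t) <= L * abs (r - t)" if "r \<in> {-T..T}" "t \<in> {-T..T}" for r t proof -
  have "norm (g r - g t) <= L * norm (r - t)" by(rule field_differentiable_bound[of "{-T..T}" g D])
    (use L that D(1) in \<open>auto intro: has_field_derivative_at_within\<close>)
  thus ?thesis by simp
 qed
 thus "\<exists>L. \<forall>r\<in>{-T..T}. \<forall>t\<in>{-T..T}. abs (g r - g t) <= L * abs (r - t)" by blast
qed

lemma Lp2_L2_fun:
 assumes "f \<in> Lp 2 Omega" "f \<in> borel_measurable lborel" "AE x in lborel. x \<notin> Omega --> f x = 0"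
 shows "L2_fun lborel f" proof -
 have "integrable lborel (%x. indicator Omega x *\<^sub>R (abs (f x)) powr 2)" using assms(1) by(simp add: Lp_def set_integrable_def)
 hence "integrable lborel (%x. (f x)^2)" proof(rule integrable_cong_AE_imp)
  show "AE x in lborel. indicator Omega x *\<^sub>R (abs (f x)) powr 2 = (f x)^2"
   using assms(3) by eventually_elim (auto simp: powr_numeral indicator_def)
 qed (use assms(2) in simp)
 thus ?thesis using assms(2) by(simp add: L2_fun_def)
qed

text \<open>For a simple function the scalar is a finite sum of constants times indicators of
  measurable sets; continuity of the energy form carries measurability over to the limit.\<close>

lemma strong_limit_measurable:
 assumes a: "0 < a" "a < 1" and I: "I \<in> sets lebesgue" and v: "v \<in> X0 a Omega"
  and F: "!!k. finite (F k ` I)" "!!k. F k ` I \<subseteq> X0 a Omega" "!!k y. {t \<in> I. F k t = y} \<in> sets lebesgue"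
  and N: "N \<in> null_sets lebesgue" and w: "!!t. t \<in> I - N ==> w t \<in> X0 a Omega"
  and lim: "!!t. t \<in> I - N ==> (%k. X0_norm a (%x. F k t x - w t x)) ----> 0" and f: "!!t. t \<in> I - N ==> f t = frac_op a (w t) v"
 shows "(%t. indicator I t * f t) \<in> borel_measurable lebesgue" proof -
 define A where "A = I - N"
 have A: "A \<in> sets lebesgue" unfolding A_def using I N by auto
 have "(%t. indicator A t * f t) \<in> borel_measurable lebesgue" proof(rule borel_measurable_LIMSEQ_real)
  fix k have "(%t. \<Sum>y\<in>F k ` I. indicator ({t \<in> I. F k t = y} \<inter> A) t * frac_op a y v) \<in> borel_measurable lebesgue"
   using F(3) A by(intro borel_measurable_sum borel_measurable_times borel_measurable_indicator borel_measurable_const sets.Int)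
  also have "(%t. \<Sum>y\<in>F k ` I. indicator ({t \<in> I. F k t = y} \<inter> A) t * frac_op a y v) = (%t. indicator A t * frac_op a (F k t) v)"
  proof
   fix t show "(\<Sum>y\<in>F k ` I. indicator ({t \<in> I. F k t = y} \<inter> A) t * frac_op a y v) = indicator A t * frac_op a (F k t) v"
   proof(cases "t \<in> A")
    case True hence "t \<in> I" by(simp add: A_def)
    have "(\<Sum>y\<in>F k ` I. indicator ({t \<in> I. F k t = y} \<inter> A) t * frac_op a y v) = (\<Sum>y\<in>F k ` I. if F k t = y then frac_op a y v else 0)"
     by(intro sum.cong refl) (use True \<open>t \<in> I\<close> in \<open>auto simp: indicator_def\<close>)
    also have "... = frac_op a (F k t) v" using F(1)[of k] \<open>t \<in> I\<close> by simp
    finally show ?thesis using True by simp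
   qed simp
  qed
  finally show "(%t. indicator A t * frac_op a (F k t) v) \<in> borel_measurable lebesgue" .
 next fix t show "(%k. indicator A t * frac_op a (F k t) v) ----> indicator A t * f t" proof(cases "t \<in> A")
   case True hence t: "t \<in> I - N" "t \<in> I" by(auto simp: A_def)
   have FX: "F k t \<in> X0 a Omega" for k using F(2)[of k] t(2) by blast
   have "(%k. frac_op a (F k t) v - frac_op a (w t) v) ----> 0"
   proof(rule Lim_null_comparison[OF _ tendsto_mult_left_zero[OF lim[OF t(1)], of "X0_norm a v"]], intro always_eventually allI)
    fix k show "norm (frac_op a (F k t) v - frac_op a (w t) v) <= X0_norm a (%x. F k t x - w t x) * X0_norm a v"
     unfolding frac_op_diff_left[OF X0D(1)[OF v] X0D(1)[OF FX] X0D(1)[OF w[OF t(1)]], symmetric] real_norm_def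
     by(rule frac_op_CS[OF a X0D(1)[OF X0_diff[OF FX w[OF t(1)]]] X0D(1)[OF v]])
   qed
   thus ?thesis using True unfolding f[OF t(1)] by(simp add: LIM_zero_cancel)
  qed simp
 qed
 thus ?thesis proof(rule borel_measurable_AE)
  show "AE t in lebesgue. indicator A t * f t = indicator I t * f t" using AE_not_in[OF N] by eventually_elim (auto simp: A_def indicator_def)
 qed qed

text \<open>All almost everywhere conditions are collected in one negligible set of times, and the
  distributional derivative becomes an integral identity for each fixed test function.\<close>

lemma weak_solution_flow:
 fixes Omega :: "'a::euclidean_space set"
 assumes s: "0 < s" "s < 1" and sig: "0 < sig" "sig < 1" and Omega: "smooth_bounded_domain Omega"
  and g: "g C1_differentiable_on UNIV" "g 0 = 0" and lam: "lam >= 0" "!!r. deriv g r >= - lam"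
  and sol: "weak_solution s sig Omega g 0 \<infinity> u w"
 obtains W N V where "cahn_hilliard_flow Omega s sig lam W g u w N V" proof -
 have op: "open Omega" and bd: "bounded Omega" using Omega by(auto simp: smooth_bounded_domain_def)
 note gp = C1_one_sided_Lipschitz[OF g(1) lam(2)]
 define I where "I = {0::real<..}"
 have I: "einterval (ereal 0) \<infinity> = I" by(auto simp: einterval_def I_def)
 have IL: "I \<in> sets lebesgue" by(simp add: I_def)
 have wc: "weakly_continuous sig Omega 0 \<infinity> u" and wB: "w \<in> L2_Bochner I (X0 s Omega) (X0_norm s)"
  and gB: "(%t x. g (u t x)) \<in> L2_loc_Bochner 0 \<infinity> (Lp 2 Omega) (L2_norm Omega)" using sol unfolding weak_solution_def I by blast+
 obtain eta where eta: "has_time_derivative s Omega 0 \<infinity> u eta"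
  and etaAE: "AE t in lebesgue_on I. (\<forall>v\<in>X0 s Omega. eta t v + frac_op s (w t) v = 0) &
      (\<forall>v\<in>X0 sig Omega. L2_functional Omega (w t) v = frac_op sig (u t) v + L2_functional Omega (%x. g (u t x)) v)"
  using sol unfolding weak_solution_def I by blast
 have uX: "u t \<in> X0 sig Omega" if "t >= 0" for t using wc that by(auto simp: weakly_continuous_def)
 have dual: "continuous_on {0..} (%t. l (u t))" if "l \<in> X0_dual sig Omega" for l proof -
  have "{t. 0 <= t & ereal t < \<infinity>} = {0..}" by auto
  thus ?thesis using wc that by(simp add: weakly_continuous_def)
 qed
 obtain F where F: "!!k. finite (F k ` I)" "!!k. F k ` I \<subseteq> X0 s Omega" "!!k y. {t \<in> I. F k t = y} \<in> sets lebesgue"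
  and FAE: "AE t in lebesgue_on I. (%k. X0_norm s (%z. F k t z - w t z)) ----> 0"
  using wB unfolding L2_Bochner_def strongly_measurable_on_def by blast
 have wAE: "AE t in lebesgue_on I. w t \<in> X0 s Omega" and wint: "integrable (lebesgue_on I) (%t. (X0_norm s (w t))^2)"
  using wB by(auto simp: L2_Bochner_def)
 \<comment> \<open>Local integrability speaks of bounded intervals; countably many of them cover the
   half line with one null set.\<close>
 have gAE: "AE t in lebesgue. \<forall>n::nat. t \<in> {0<..<real n + 1} --> (%x. g (u t x)) \<in> Lp 2 Omega" unfolding AE_all_countable proof
  fix n :: nat have "(%t x. g (u t x)) \<in> L2_Bochner {0<..<real n + 1} (Lp 2 Omega) (L2_norm Omega)" using gB by(simp add: L2_loc_Bochner_def)
  thus "AE t in lebesgue. t \<in> {0<..<real n + 1} --> (%x. g (u t x)) \<in> Lp 2 Omega" by(simp add: L2_Bochner_def AE_restrict_space_iff)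
 qed
 define good where "good t \<longleftrightarrow> w t \<in> X0 s Omega & (%k. X0_norm s (%z. F k t z - w t z)) ----> 0 & (%x. g (u t x)) \<in> Lp 2 Omega &
   (\<forall>v\<in>X0 s Omega. eta t v + frac_op s (w t) v = 0) &
   (\<forall>v\<in>X0 sig Omega. L2_functional Omega (w t) v = frac_op sig (u t) v + L2_functional Omega (%x. g (u t x)) v)" for t
 have "AE t in lebesgue. t \<in> I --> good t" proof -
  have r: "(AE t in lebesgue_on I. P t) \<longleftrightarrow> (AE t in lebesgue. t \<in> I --> P t)" for P
   using IL by(simp add: AE_restrict_space_iff)
  show ?thesis using etaAE[unfolded r] FAE[unfolded r] wAE[unfolded r] gAE proof eventually_elim
   case (elim t) show ?case proof
    assume t: "t \<in> I"
    obtain n :: nat where "t <= real n" using real_arch_simple by blast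
    hence "t \<in> {0<..<real n + 1}" using t by(simp add: I_def)
    thus "good t" using elim t unfolding good_def by blast
   qed qed qed
 then obtain N where N: "negligible N" "!!t. t \<in> I ==> t \<notin> N ==> good t" unfolding eventually_ae_filter_negligible by blast
 have N0: "N \<in> null_sets lebesgue" using N(1) by(simp add: negligible_iff_null_sets)
 have int_sub: "integrable lebesgue (%t. indicator {a..b} t * (X0_norm s (w t))^2)" if "0 < a" for a b proof -
  have "integrable lebesgue (%t. indicator {a..b} t *\<^sub>R (indicator I t * (X0_norm s (w t))^2))"
   using wint IL by(intro integrable_mult_indicator) (simp_all add: lebesgue_on_integral_eq)
  moreover have "indicator {a..b} t *\<^sub>R (indicator I t * (X0_norm s (w t))^2) = indicator {a..b} t * (X0_norm s (w t))^2" for t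
   using that by(auto simp: indicator_def I_def)
  ultimately show ?thesis by(simp only:)
 qed
 have w2: "(%t. (X0_norm s (w t))^2) integrable_on {a..b}" if "0 < a" for a b
  using int_sub[OF that] by(intro integrable_on_lebesgue_on) (simp_all add: lebesgue_on_integral_eq)
 \<comment> \<open>At good times \<open>eta t v\<close> is minus the energy form of
   \<open>w t\<close> and \<open>v\<close>, which gives measurability by
   \<open>strong_limit_measurable\<close> and a majorant by Cauchy-Schwarz.\<close>
 have flux: "((%t. frac_op s (w t) v) has_integral (ip (u a) v - ip (u b) v)) {a..b}"
  if v: "v \<in> X0 s Omega" and ab: "0 < a" "a <= b" for v a b proof -
  have feta: "eta t v = - frac_op s (w t) v" if "t \<in> I - N" for t using N(2)[of t] that v by(auto simp: good_def)
  have m: "(%t. indicator I t * - eta t v) \<in> borel_measurable lebesgue"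
   by(rule strong_limit_measurable[where F = F and w = w, OF s IL v F N0]) (use N(2) in \<open>auto simp: good_def feta\<close>)
  have ieta: "integrable (lebesgue_on {a..b}) (%t. eta t v)" if ab: "0 < a" for a b proof -
   have sub: "indicator {a..b} t * (indicator I t * - eta t v) = - (indicator {a..b} t * eta t v)" for t using ab by(auto simp: indicator_def I_def)
   have "integrable lebesgue (%t. (indicator {a..b} t + indicator {a..b} t * (X0_norm s (w t))^2) * X0_norm s v)"
    by(intro integrable_mult_left L1_integrable_add int_sub ab integrable_real_indicator) (simp_all add: emeasure_lborel_Icc_eq)
   hence "integrable lebesgue (%t. - (indicator {a..b} t * eta t v))" proof(rule L1_integrable_bound)
    have "(%t. indicator {a..b} t * (indicator I t * - eta t v)) \<in> borel_measurable lebesgue"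
     by(rule borel_measurable_times[OF borel_measurable_indicator m]) simp
    thus "(%t. - (indicator {a..b} t * eta t v)) \<in> borel_measurable lebesgue" unfolding sub .
    show "AE t in lebesgue. norm (- (indicator {a..b} t * eta t v)) <=
      norm ((indicator {a..b} t + indicator {a..b} t * (X0_norm s (w t))^2) * X0_norm s v)" using AE_not_in[OF N0] proof eventually_elim
     case (elim t) show ?case proof(cases "t \<in> {a..b}")
      case True hence t: "t \<in> I" "t \<in> I - N" using ab elim by(auto simp: I_def)
      have "w t \<in> X0 s Omega" using N(2)[OF t(1) elim] by(simp add: good_def)
      hence "abs (frac_op s (w t) v) <= X0_norm s (w t) * X0_norm s v" by(intro frac_op_CS s X0D(1)[OF v] X0D(1))
      also have "... <= (1 + (X0_norm s (w t))^2) * X0_norm s v" proof(intro mult_right_mono X0_norm_ge0 s)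
       show "X0_norm s (w t) <= 1 + (X0_norm s (w t))^2" using zero_le_power2[of "X0_norm s (w t) - 1 / 2"] by(simp add: power2_diff field_simps)
      qed
      finally show ?thesis using True feta[OF t(2)] X0_norm_ge0[OF s, of v] by(simp add: abs_mult)
     qed simp
    qed qed
   hence "integrable lebesgue (%t. indicator {a..b} t * eta t v)" by simp
   thus ?thesis by(simp add: lebesgue_on_integral_eq)
  qed
  have Lip: "L2_functional Omega (u t) v = ip (u t) v" if "t >= 0" for t by(rule L2_functional_ip[OF v X0D(3)[OF uX[OF that]] op])
  have "ip (u b) v - ip (u a) v = (LINT t|lebesgue_on {a..b}. eta t v)"
  proof(rule distributional_derivative_integral[OF dual[OF ip_in_X0_dual[OF sig bd X0D(4)[OF v]]] ieta _ ab])
   fix phi assume phi: "test_function 0 \<infinity> phi"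
   have "(LINT t|lebesgue_on I. deriv phi t * L2_functional Omega (u t) v) = - (LINT t|lebesgue_on I. phi t * eta t v)"
    using eta phi v unfolding has_time_derivative_def I by blast
   moreover have "(LINT t|lebesgue_on I. deriv phi t * L2_functional Omega (u t) v) = (LINT t|lebesgue_on I. deriv phi t * ip (u t) v)"
   proof(rule L1_integral_cong[OF refl])
    fix t assume "t \<in> space (lebesgue_on I)"
    hence "t >= 0" by(simp add: I_def)
    thus "deriv phi t * L2_functional Omega (u t) v = deriv phi t * ip (u t) v" by(simp only: Lip)
   qed
   ultimately show "(LINT t|lebesgue_on {0<..}. deriv phi t * ip (u t) v) = - (LINT t|lebesgue_on {0<..}. phi t * eta t v)"
    unfolding I_def by(simp only:)
  qed
  hence "((%t. eta t v) has_integral (ip (u b) v - ip (u a) v)) {a..b}" using has_integral_integral_lebesgue_on[OF ieta[OF ab(1)], of b] by simp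
  hence "((%t. - eta t v) has_integral - (ip (u b) v - ip (u a) v)) {a..b}" by(rule has_integral_neg)
  hence "((%t. frac_op s (w t) v) has_integral - (ip (u b) v - ip (u a) v)) {a..b}"
   by(rule has_integral_spike[OF N(1), rotated]) (use feta ab in \<open>auto simp: I_def\<close>)
  thus ?thesis by simp
 qed
 \<comment> \<open>\<open>W\<close> is the total dissipation over the half line; \<open>V\<close> is
   the union of the finite ranges of the simple functions that approximate \<open>w\<close>.\<close>
 have "cahn_hilliard_flow Omega s sig lam (integral I (%t. (X0_norm s (w t))^2)) g u w N (\<Union>k. F k ` I)" proof
  show "continuous_on {0..} (%t. frac_op sig (u t) phi)" if "phi \<in> X0 sig Omega" for phi by(rule dual[OF frac_op_in_X0_dual[OF sig that]])
  show "integral {a..b} (%t. (X0_norm s (w t))^2) <= integral I (%t. (X0_norm s (w t))^2)" if "0 < a" "a <= b" for a b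
   using that wint IL by(intro integral_subset_le w2 integrable_on_lebesgue_on) (auto simp: I_def)
  show "(%t. (X0_norm s (w t))^2) integrable_on {a..b}" if "0 < a" "a <= b" for a b by(rule w2[OF that(1)])
  show "countable (\<Union>k. F k ` I)" using F(1) by(intro countable_UN) (auto intro: countable_finite)
  show "(\<Union>k. F k ` I) \<subseteq> X0 s Omega" using F(2) by blast
  fix t :: real assume t: "t > 0" "t \<notin> N"
  hence tI: "t \<in> I" by(simp add: I_def)
  have ut: "u t \<in> X0 sig Omega" using t by(intro uX) simp
  have G: "good t" using N(2) t tI by simp
  show wX: "w t \<in> X0 s Omega" using G by(simp add: good_def)
  have gm: "(%x. g (u t x)) \<in> borel_measurable lborel"
   using borel_measurable_continuous_onI[OF gp(1)] X0D(3)[OF ut] by(rule measurable_compose[rotated])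
  show "L2_fun lborel (%x. g (u t x))" proof(rule Lp2_L2_fun[OF _ gm])
   show "(%x. g (u t x)) \<in> Lp 2 Omega" using G by(simp add: good_def)
   show "AE x in lborel. x \<notin> Omega --> g (u t x) = 0" using X0D(2)[OF ut] by eventually_elim (simp add: g(2))
  qed
  show "ip (w t) v = frac_op sig (u t) v + ip (%x. g (u t x)) v" if v: "v \<in> X0 sig Omega" for v proof -
   have "L2_functional Omega (w t) v = frac_op sig (u t) v + L2_functional Omega (%x. g (u t x)) v" using G v unfolding good_def by blast
   thus ?thesis unfolding L2_functional_ip[OF v gm op] L2_functional_ip[OF v X0D(3)[OF wX] op] .
  qed
  show "\<exists>v\<in>\<Union>k. F k ` I. X0_norm s (%x. v x - w t x) < e" if e: "e > 0" for e proof -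
   have "(%k. X0_norm s (%z. F k t z - w t z)) ----> 0" using G by(simp add: good_def)
   hence "\<forall>\<^sub>F k in sequentially. X0_norm s (%z. F k t z - w t z) < e" using e by(rule order_tendstoD(2))
   then obtain k where "X0_norm s (%z. F k t z - w t z) < e" unfolding eventually_sequentially by blast
   thus ?thesis using tI by blast
  qed
 qed (fact s sig op bd lam(1) gp g(2) N(1) uX flux)+
 thus ?thesis by(rule that)
qed

section \<open>Bounds for the stationary equation\<close>

text \<open>The odd extension of the power function, so that powers of a function of changing sign
  are monotone test functions.\<close>

definition spow :: "real => real => real" where
 "spow p r = sgn r * abs r powr p"

lemma spow_simps: "spow p 0 = 0" "r >= 0 ==> spow p r = r powr p" "spow p (- r) = - spow p r" "abs (spow p r) = abs r powr p"
 by(auto simp: spow_def sgn_if abs_mult)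

lemma spow_mono:
 assumes "k >= 0" "a <= b" shows "spow k a <= spow k b" proof -
 consider "0 <= a" | "a < 0" "0 <= b" | "b < 0" by linarith
 thus ?thesis proof cases
  case 2 thus ?thesis by(auto simp: spow_def sgn_if intro: order_trans[of _ 0])
 qed (use assms in \<open>auto simp: spow_def sgn_if intro!: powr_mono2\<close>)
qed

lemma powr_diff_le:
 fixes a b :: real
 assumes p: "p >= 1" and ab: "0 <= b" "b <= a"
 shows "a powr p - b powr p <= p * a powr (p - 1) * (a - b)" proof -
 consider "b = a" | "b = 0" "a > 0" | "0 < b" "b < a" using ab by linarith
 thus ?thesis proof cases
  case 2 have "1 * (a powr (p - 1) * a) <= p * (a powr (p - 1) * a)" using p 2 by(intro mult_right_mono) auto
  moreover have "a powr (p - 1) * a = a powr p" using 2 by(simp add: powr_mult_base mult.commute)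
  ultimately show ?thesis using 2 p by(simp add: mult.assoc)
 next case 3 have "\<exists>z. z > b & z < a & a powr p - b powr p = (a - b) * (p * z powr (p - 1))"
   using 3 by(intro MVT2) (auto intro!: derivative_eq_intros simp: powr_diff)
  then obtain z where z: "z > b" "z < a" "a powr p - b powr p = (a - b) * (p * z powr (p - 1))" by blast
  have "z powr (p - 1) <= a powr (p - 1)" using z 3 p by(intro powr_mono2) auto
  hence "(a - b) * (p * z powr (p - 1)) <= (a - b) * (p * a powr (p - 1))" using 3 p by(intro mult_left_mono) auto
  thus ?thesis using z(3) by(simp add: mult_ac)
 qed simp
qed

text \<open>Exchange and simultaneous reflection reduce inequalities for odd functions to two
  configurations: ordered arguments of one sign, and arguments of opposite signs.\<close>

lemma spow_cases:
 fixes a b :: real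
 assumes sym: "!!a b. P a b ==> P b a" and neg: "!!a b. P a b ==> P (- a) (- b)"
  and same: "!!a b. 0 <= b ==> b <= a ==> P a b" and opp: "!!a b. 0 <= a ==> 0 <= b ==> P a (- b)"
 shows "P a b" proof -
 have pos: "P a b" if "0 <= a" "0 <= b" for a b using same[of a b] same[of b a] sym that by(cases "a <= b") auto
 show ?thesis using pos[of a b] neg[OF pos[of "- a" "- b"]] opp[of a "- b"] sym[OF opp[of b "- a"]] by(cases "0 <= a"; cases "0 <= b") auto
qed

lemma spow_Lipschitz:
 assumes p: "p >= 1" and T: "abs a <= T" "abs b <= T"
 shows "abs (spow p a - spow p b) <= p * T powr (p - 1) * abs (a - b)" proof -
 have T0: "T >= 0" using T by linarith
 have pT: "x powr p <= T powr (p - 1) * x" if "0 <= x" "x <= T" for x proof(cases "x = 0")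
  case False have "x powr (p - 1) * x <= T powr (p - 1) * x" using that p by(intro mult_right_mono powr_mono2) auto
  thus ?thesis using that False by(simp add: powr_mult_base mult.commute)
 qed (use p in simp)
 have "abs a <= T --> abs b <= T --> abs (spow p a - spow p b) <= p * T powr (p - 1) * abs (a - b)" proof(rule spow_cases[where a = a and b = b])
  fix a b assume ab: "0 <= b" "b <= (a::real)"
  show "abs a <= T --> abs b <= T --> abs (spow p a - spow p b) <= p * T powr (p - 1) * abs (a - b)" proof(intro impI)
   assume "abs a <= T"
   hence "a powr (p - 1) <= T powr (p - 1)" using ab p by(intro powr_mono2) auto
   hence "p * a powr (p - 1) * (a - b) <= p * T powr (p - 1) * (a - b)" using p ab by(intro mult_right_mono mult_left_mono) auto
   moreover have "b powr p <= a powr p" using ab p by(intro powr_mono2) auto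
   ultimately show "abs (spow p a - spow p b) <= p * T powr (p - 1) * abs (a - b)" using powr_diff_le[OF p ab] ab by(simp add: spow_simps)
  qed
 next fix a b :: real assume ab: "0 <= a" "0 <= b"
  show "abs a <= T --> abs (- b) <= T --> abs (spow p a - spow p (- b)) <= p * T powr (p - 1) * abs (a - - b)" proof(intro impI)
   assume "abs a <= T" "abs (- b) <= T"
   hence "a powr p + b powr p <= 1 * (T powr (p - 1) * (a + b))" using ab pT[of a] pT[of b] by(simp add: distrib_left)
   also have "... <= p * (T powr (p - 1) * (a + b))" using p ab by(intro mult_right_mono) auto
   finally show "abs (spow p a - spow p (- b)) <= p * T powr (p - 1) * abs (a - - b)" using ab by(simp add: spow_simps mult.assoc)
  qed
 qed (auto simp: spow_simps abs_minus_commute)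
 thus ?thesis using T by simp
qed

text \<open>A Stroock-Varopoulos inequality. For equal signs it follows from the mean value bound
  \<open>powr_diff_le\<close>, for opposite signs from the square of a sum; \<open>2 * p^2\<close>
  covers both.\<close>

lemma spow_square_le:
 assumes p: "p >= 1"
 shows "(spow p a - spow p b)^2 <= 2 * p^2 * ((a - b) * (spow (2 * p - 1) a - spow (2 * p - 1) b))" proof(rule spow_cases[where a = a and b = b])
 fix a b :: real assume ab: "0 <= b" "b <= a"
 have m: "b powr x <= a powr x" if "x >= 0" for x using ab that by(intro powr_mono2) auto
 have mult: "x powr (2 * (p - 1)) * x = x powr (2 * p - 1)" if "x >= 0" for x
  using that p powr_mult_base[of x "2 * (p - 1)"] by(cases "x = 0") (auto simp: mult.commute algebra_simps)
 have "(a powr p - b powr p)^2 <= (p * a powr (p - 1) * (a - b))^2" using m[of p] p powr_diff_le[OF p ab] by(intro power_mono) auto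
 also have "... = p^2 * ((a - b) * (a powr (2 * (p - 1)) * (a - b)))" using powr_add[of a "p - 1" "p - 1"] by(simp add: power2_eq_square mult_ac)
 also have "a powr (2 * (p - 1)) * (a - b) <= a powr (2 * p - 1) - b powr (2 * p - 1)" proof -
  have "b powr (2 * (p - 1)) * b <= a powr (2 * (p - 1)) * b" using m[of "2 * (p - 1)"] p ab by(intro mult_right_mono) auto
  thus ?thesis using mult[of a] mult[of b] ab by(simp add: right_diff_distrib)
 qed
 finally have "(a powr p - b powr p)^2 <= p^2 * ((a - b) * (a powr (2 * p - 1) - b powr (2 * p - 1)))" using ab by(simp add: mult_left_mono)
 moreover have "0 <= p^2 * ((a - b) * (a powr (2 * p - 1) - b powr (2 * p - 1)))" using ab m[of "2 * p - 1"] p by simp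
 ultimately show "(spow p a - spow p b)^2 <= 2 * p^2 * ((a - b) * (spow (2 * p - 1) a - spow (2 * p - 1) b))" using ab by(simp add: spow_simps)
next fix a b :: real assume ab: "0 <= a" "0 <= b"
 have mult: "(x powr p)^2 = x * x powr (2 * p - 1)" if "x >= 0" for x
  using that p powr_mult_base[of x "2 * p - 1"] by(cases "x = 0") (auto simp: powr_power mult.commute)
 have "(a powr p + b powr p)^2 <= 2 * ((a powr p)^2 + (b powr p)^2)"
  using zero_le_power2[of "a powr p - b powr p"] by(simp add: power2_sum power2_diff)
 also have "... <= 2 * ((a + b) * (a powr (2 * p - 1) + b powr (2 * p - 1)))"
  unfolding mult[OF ab(1)] mult[OF ab(2)] using ab by(simp add: distrib_left distrib_right)
 also have "... <= 2 * p^2 * ((a + b) * (a powr (2 * p - 1) + b powr (2 * p - 1)))" using ab p by(intro mult_right_mono) auto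
 finally show "(spow p a - spow p (- b))^2 <= 2 * p^2 * ((a - - b) * (spow (2 * p - 1) a - spow (2 * p - 1) (- b)))" using ab by(simp add: spow_simps)
qed (simp_all add: spow_simps power2_commute algebra_simps)

lemma powr_interpolate:
 fixes x :: real
 assumes "2 <= m" "m <= r" "x >= 0"
 shows "x powr m <= x^2 + x powr r" proof(cases "x <= 1")
 case True hence "x powr m <= x powr 2" using assms by(intro powr_mono') auto
 thus ?thesis using assms by(simp add: powr_numeral add_increasing2)
next case False hence "x powr m <= x powr r" using assms by(intro powr_mono) auto
 thus ?thesis using zero_le_power2[of x] by linarith
qed

text \<open>Testing with the odd power \<open>m - 1\<close> of \<open>u\<close> controls the energy
  of the odd power \<open>m / 2\<close>, and the Sobolev inequality for the latter yields exponent
  \<open>m * q / 2\<close>. The term with \<open>beta\<close> has a sign and is dropped.\<close>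

lemma integrability_gain:
 fixes u f :: "'a::euclidean_space => real" and beta :: "real => real"
 assumes sig: "0 < sig" "sig < 1" and mono: "!!r t. r <= t ==> beta r <= beta t" and beta0: "beta 0 = 0" and q: "q > 2" and C: "C > 0"
  and Sob: "!!v. v \<in> X0 sig Omega ==> Lq_integrable q v"
   "!!v. v \<in> X0 sig Omega ==> (Lq_int q v) <= (C * X0_norm sig v) powr q"
  and u: "u \<in> X0 sig Omega" and f: "L2_fun lborel f" and betau: "L2_fun lborel (%x. beta (u x))"
  and eq: "!!v. v \<in> X0 sig Omega ==> frac_op sig u v + ip (%x. beta (u x)) v = ip f v"
  and m: "m >= 2" and um: "Lq_integrable m u" "(Lq_int m u) <= A" and fm: "Lq_integrable m f" "(Lq_int m f) <= A"
 shows "integrable lborel (%x. abs (u x) powr (m * q / 2))"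
  "(LBINT x. abs (u x) powr (m * q / 2)) <= (C * sqrt (m^2 * A)) powr q" proof -
 define p where "p = m / 2"
 have p: "p >= 1" "2 * p - 1 = m - 1" "m - 1 >= 1" using m by(auto simp: p_def)
 \<comment> \<open>The powers are taken of the truncated \<open>u\<close>, to be Lipschitz functions
   of \<open>u\<close>; the bounds do not depend on the level, so Fatou removes it.\<close>
 define cl where "cl n r = max (- real n) (min (real n) r)" for n r
 have cl: "abs (cl n r) <= real n" "abs (cl n r) <= abs r" "abs (cl n r - cl n t) <= abs (r - t)" "cl n 0 = 0" "sgn (cl n r) = 0 \<or> sgn (cl n r) = sgn r" for n r t
  by(auto simp: cl_def sgn_if max_def min_def)
 have SX: "(%x. spow k (cl n (u x))) \<in> X0 sig Omega" if k: "k >= 1" for k n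
 proof(rule X0_Lipschitz_comp[OF u, of "%r. spow k (cl n r)" "k * real n powr (k - 1)"])
  fix r t have "abs (spow k (cl n r) - spow k (cl n t)) <= k * real n powr (k - 1) * abs (cl n r - cl n t)" by(intro spow_Lipschitz k cl)
  also have "... <= k * real n powr (k - 1) * abs (r - t)" using k by(intro mult_left_mono cl) auto
  finally show "abs (spow k (cl n r) - spow k (cl n t)) <= k * real n powr (k - 1) * abs (r - t)" .
 qed (simp add: cl spow_simps)
 define G where "G n x = spow (m - 1) (cl n (u x))" for n x
 define \<Gamma> where "\<Gamma> n x = spow p (cl n (u x))" for n x
 have GX: "G n \<in> X0 sig Omega" and \<Gamma>X: "\<Gamma> n \<in> X0 sig Omega" for n unfolding G_def \<Gamma>_def using SX p by auto
 have A: "0 <= A" using um(2) by(rule order_trans[rotated]) simp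
 have energy: "(X0_norm sig (\<Gamma> n))^2 <= m^2 * A" for n proof -
  have "frac_op sig (\<Gamma> n) (\<Gamma> n) <= frac_op sig (%x. 2 * p^2 * u x) (G n)"
  proof(rule frac_op_mono_pointwise[OF sig X0D(1)[OF \<Gamma>X] X0D(1)[OF \<Gamma>X] X0D(1)[OF X0_scale[OF u]] X0D(1)[OF GX]])
   fix x y have "(\<Gamma> n x - \<Gamma> n y) * (\<Gamma> n x - \<Gamma> n y) <= 2 * p^2 * ((cl n (u x) - cl n (u y)) * (G n x - G n y))"
    using spow_square_le[OF p(1), of "cl n (u x)" "cl n (u y)"] unfolding \<Gamma>_def G_def p(2) power2_eq_square .
   also have "(cl n (u x) - cl n (u y)) * (G n x - G n y) <= (u x - u y) * (G n x - G n y)" proof -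
    have mono: "spow (m - 1) a <= spow (m - 1) b" if "a <= b" for a b using that p by(intro spow_mono) auto
    show ?thesis proof(cases "u x <= u y")
     case True hence "G n x <= G n y" unfolding G_def by(intro mono) (auto simp: cl_def)
     moreover have "u x - u y <= cl n (u x) - cl n (u y)" using True by(auto simp: cl_def)
     ultimately show ?thesis by(intro mult_right_mono_neg) auto
    next case False hence "G n y <= G n x" unfolding G_def by(intro mono) (auto simp: cl_def)
     moreover have "cl n (u x) - cl n (u y) <= u x - u y" using False by(auto simp: cl_def)
     ultimately show ?thesis by(intro mult_right_mono) auto
    qed qed
   finally show "(\<Gamma> n x - \<Gamma> n y) * (\<Gamma> n x - \<Gamma> n y) <= (2 * p^2 * u x - 2 * p^2 * u y) * (G n x - G n y)"
    using p by(simp add: mult_left_mono algebra_simps)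
  qed
  also have "frac_op sig (%x. 2 * p^2 * u x) (G n) = 2 * p^2 * frac_op sig u (G n)"
   using frac_op_lincomb_left[OF X0D(1)[OF GX] X0D(1)[OF u] X0D(1)[OF u], of "2 * p^2" 0] by simp
  also have "frac_op sig u (G n) <= 2 * A" proof -
   have "0 <= ip (%x. beta (u x)) (G n)" proof(rule L1_integral_nonneg)
    fix x show "0 <= beta (u x) * G n x"
     using mono[of 0 "u x"] mono[of "u x" 0] by(cases "0 <= u x") (auto simp: G_def beta0 spow_def cl_def sgn_if intro!: mult_nonneg_nonneg mult_nonpos_nonneg)
   qed
   hence "frac_op sig u (G n) <= ip f (G n)" using eq[OF GX, of n] by linarith
   also have "... <= (LBINT x. abs (f x) powr m + abs (u x) powr m)"
   proof(rule integral_mono[OF L2_mult_integrable[OF f X0D(4)[OF GX]] L1_integrable_add[OF fm(1) um(1)]])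
    fix x have 1: "abs (G n x) <= abs (u x) powr (m - 1)" unfolding G_def spow_simps using p by(intro powr_mono2 cl) auto
    have "f x * G n x <= abs (f x) * abs (G n x)" unfolding abs_mult[symmetric] by simp
    also have "... <= abs (f x) * abs (u x) powr (m - 1)" by(rule mult_left_mono[OF 1]) simp
    \<comment> \<open>Both factors are compared with the larger of the two functions, whose
      \<open>m\<close>-th power is at most the sum of the two.\<close>
    also have "... <= max (abs (f x)) (abs (u x)) * max (abs (f x)) (abs (u x)) powr (m - 1)" using p by(intro mult_mono powr_mono2) auto
    also have "... = max (abs (f x)) (abs (u x)) powr m" using powr_mult_base[of "max (abs (f x)) (abs (u x))" "m - 1"] by simp
    also have "... <= abs (f x) powr m + abs (u x) powr m" by(cases "abs (f x) <= abs (u x)") (auto simp: max_def)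
    finally show "f x * G n x <= abs (f x) powr m + abs (u x) powr m" .
   qed
   also have "... <= 2 * A" using fm um by simp
   finally show ?thesis .
  qed
  finally show ?thesis using p by(simp add: X0_norm_square[OF sig] p_def power_divide mult_left_mono)
 qed
 have \<Gamma>q: "abs (\<Gamma> n x) powr q = abs (cl n (u x)) powr (m * q / 2)" for n x by(simp add: \<Gamma>_def spow_simps powr_powr p_def)
 have bd: "(LBINT x. abs (\<Gamma> n x) powr q) <= (C * sqrt (m^2 * A)) powr q" for n
  using real_le_rsqrt[OF energy[of n]] C q X0_norm_ge0[OF sig, of "\<Gamma> n"]
  by(intro order_trans[OF Sob(2)[OF \<Gamma>X]] powr_mono2 mult_left_mono) auto
 have lim: "AE x in lborel. (%n. abs (\<Gamma> n x) powr q) ----> abs (u x) powr (m * q / 2)" proof(rule AE_I2)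
  fix x obtain k :: nat where k: "abs (u x) <= real k" using real_arch_simple by blast
  have "\<forall>\<^sub>F n in sequentially. abs (\<Gamma> n x) powr q = abs (u x) powr (m * q / 2)" unfolding eventually_sequentially
  proof(intro exI[of _ k] allI impI)
   fix n assume "n >= k"
   hence "real n >= abs (u x)" using k by linarith
   hence "cl n (u x) = u x" by(auto simp: cl_def)
   thus "abs (\<Gamma> n x) powr q = abs (u x) powr (m * q / 2)" by(simp add: \<Gamma>q)
  qed
  thus "(%n. abs (\<Gamma> n x) powr q) ----> abs (u x) powr (m * q / 2)" by(rule tendsto_eventually)
 qed
 have um': "(%x. abs (u x) powr (m * q / 2)) \<in> borel_measurable lborel" using X0D(3)[OF u] by measurable
 show "integrable lborel (%x. abs (u x) powr (m * q / 2))" "(LBINT x. abs (u x) powr (m * q / 2)) <= (C * sqrt (m^2 * A)) powr q"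
  by(rule integrable_Fatou[OF Sob(1)[OF \<Gamma>X] _ bd lim um']; simp)+
qed

lemma powr_add_le:
 fixes a b :: real
 assumes "m >= 0" shows "abs (a + b) powr m <= 2 powr m * (abs a powr m + abs b powr m)" proof -
 have "abs (a + b) powr m <= (2 * max (abs a) (abs b)) powr m" using assms by(intro powr_mono2) auto
 also have "... = 2 powr m * max (abs a) (abs b) powr m" by(simp add: powr_mult)
 also have "... <= 2 powr m * (abs a powr m + abs b powr m)" by(intro mult_left_mono) (auto simp: max_def)
 finally show ?thesis .
qed

lemma integrable_powr_add:
 fixes f h :: "'b => real"
 assumes m: "m >= 0" and [measurable]: "f \<in> borel_measurable M" "h \<in> borel_measurable M"
  and f: "integrable M (%x. abs (f x) powr m)" and h: "integrable M (%x. abs (h x) powr m)"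
 shows "integrable M (%x. abs (c * f x + h x) powr m)"
  "(LINT x|M. abs (c * f x + h x) powr m) <= 2 powr m * (abs c powr m * (LINT x|M. abs (f x) powr m) + (LINT x|M. abs (h x) powr m))" proof -
 have le: "abs (c * f x + h x) powr m <= 2 powr m * (abs c powr m * abs (f x) powr m + abs (h x) powr m)" for x
  using powr_add_le[OF m, of "c * f x" "h x"] by(simp add: abs_mult powr_mult)
 have i: "integrable M (%x. 2 powr m * (abs c powr m * abs (f x) powr m + abs (h x) powr m))" using f h by simp
 show 1: "integrable M (%x. abs (c * f x + h x) powr m)"
  by(rule L1_integrable_bound[OF i]) (use le in \<open>auto intro!: AE_I2 order_trans[OF _ abs_ge_self]\<close>)
 have "(LINT x|M. abs (c * f x + h x) powr m) <= (LINT x|M. 2 powr m * (abs c powr m * abs (f x) powr m + abs (h x) powr m))"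
  by(rule integral_mono[OF 1 i le])
 thus "(LINT x|M. abs (c * f x + h x) powr m) <= 2 powr m * (abs c powr m * (LINT x|M. abs (f x) powr m) + (LINT x|M. abs (h x) powr m))"
  using f h by simp
qed

lemma integrable_powr_interpolate:
 fixes f :: "'b => real"
 assumes m: "2 <= m" "m <= r" and f: "L2_fun M f" "integrable M (%x. abs (f x) powr r)"
 shows "integrable M (%x. abs (f x) powr m)" "(LINT x|M. abs (f x) powr m) <= (LINT x|M. (f x)^2) + (LINT x|M. abs (f x) powr r)" proof -
 have [measurable]: "f \<in> borel_measurable M" using f(1) by(rule L2D)
 note i = L2D(2)[OF f(1)]
 have le: "abs (f x) powr m <= (f x)^2 + abs (f x) powr r" for x using powr_interpolate[OF m, of "abs (f x)"] by simp
 show 1: "integrable M (%x. abs (f x) powr m)"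
  by(rule L1_integrable_bound[OF L1_integrable_add[OF i f(2)]]) (use le in \<open>auto intro!: AE_I2 order_trans[OF _ abs_ge_self]\<close>)
 have "(LINT x|M. abs (f x) powr m) <= (LINT x|M. (f x)^2 + abs (f x) powr r)" by(rule integral_mono[OF 1 L1_integrable_add[OF i f(2)] le])
 thus "(LINT x|M. abs (f x) powr m) <= (LINT x|M. (f x)^2) + (LINT x|M. abs (f x) powr r)" using i f(2) by simp
qed

section \<open>Bounds that are uniform over stationary pairs\<close>

context cahn_hilliard_flow
begin

text \<open>The liminf condition far out and continuity on the compact rest bound
  \<open>g r * r\<close> below by \<open>(kappa - ev) * r^2 - K1\<close>. Testing the equation with
  \<open>y\<close> itself, the Rayleigh quotient leaves a positive share \<open>c0\<close> of the
  energy, while the pairing with \<open>f\<close> grows only linearly in the norm.\<close>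

lemma energy_bound:
 assumes kappa: "kappa > 0" and lim: "Liminf at_infinity (%r. ereal (g r * r + (first_eigenvalue sig Omega - kappa) * r^2)) > 0" and M: "M >= 0"
 shows "\<exists>K. \<forall>y f. stationary M y f --> X0_norm sig y <= K" proof -
 define ev where "ev = first_eigenvalue sig Omega"
 define G where "G r = g r * r + (ev - kappa) * r^2" for r
 have "\<forall>\<^sub>F r in at_infinity. 0 < G r" using less_LiminfD[OF lim] by(simp add: G_def ev_def zero_ereal_def)
 then obtain b where b: "!!r. norm r >= b ==> 0 < G r" unfolding eventually_at_infinity by blast
 have "compact (G ` {-b..b})" unfolding G_def by(intro compact_continuous_image continuous_intros continuous_on_subset[OF g_cont]) auto
 hence "bounded (G ` {-b..b})" by(rule compact_imp_bounded)
 then obtain K0 where K0: "\<forall>x\<in>G ` {-b..b}. abs x <= K0" unfolding bounded_real by blast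
 define K1 where "K1 = abs K0"
 have GK: "- K1 <= G r" for r proof(cases "r \<in> {-b..b}")
  case True thus ?thesis using bspec[OF K0 imageI[OF True]] unfolding K1_def by linarith
 next case False hence "0 < G r" by(intro b) auto
  thus ?thesis by(simp add: K1_def)
 qed
 obtain C where C: "C > 0" "!!v. v \<in> X0 sig Omega ==> (L2sq v) <= C * (X0_norm sig v)^2" using X0_Poincare[OF sig bd] by blast
 obtain Cs where Cs: "Cs > 0" "!!v. v \<in> X0 s Omega ==> (L2sq v) <= Cs * (X0_norm s v)^2" using X0_Poincare[OF s bd] by blast
 \<comment> \<open>The definition of the first eigenvalue, with the infimum bounded below by 0; a
   vanishing L^2 norm is trivial.\<close>
 have ray: "ev * (L2sq y) <= (X0_norm sig y)^2" if y: "y \<in> X0 sig Omega" for y proof(cases "(L2sq y) = 0")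
  case False hence nz: "\<not> (AE x in lborel. y x = 0)" using integral_nonneg_eq_0_iff_AE[OF X0D(5)[OF y]] by(auto elim: eventually_mono)
  have pos: "0 < (L2sq y)" using False by(simp add: less_le)
  have L2: "(L2_norm Omega y)^2 = (L2sq y)" proof -
   have "(LINT x:Omega|lborel. (y x)^2) = (L2sq y)" unfolding set_lebesgue_integral_def proof(rule integral_cong_AE)
    show "AE x in lborel. indicator Omega x *\<^sub>R ((y x)^2) = (y x)^2" using X0D(2)[OF y] by eventually_elim auto
   qed (use X0D(3)[OF y] op in simp_all)
   thus ?thesis using pos by(simp add: L2_norm_def)
  qed
  have "ev <= (X0_norm sig y)^2 / (L2_norm Omega y)^2" unfolding ev_def first_eigenvalue_def
   by(rule cINF_lower) (use y nz in \<open>auto intro!: bdd_belowI2[of _ 0]\<close>)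
  thus ?thesis using pos unfolding L2 by(simp add: pos_le_divide_eq)
 qed simp
 \<comment> \<open>For \<open>kappa >= ev\<close> the L^2 term is nonnegative. Otherwise
   \<open>ray\<close> shows that the fraction \<open>kappa / ev\<close> of the energy
   survives.\<close>
 obtain c0 where c0: "c0 > 0" "!!y. y \<in> X0 sig Omega ==> c0 * (X0_norm sig y)^2 <= (X0_norm sig y)^2 + (kappa - ev) * (L2sq y)"
 proof(cases "kappa >= ev")
  case True thus ?thesis by(intro that[of 1]) auto
 next case False have "kappa / ev * (X0_norm sig y)^2 <= (X0_norm sig y)^2 + (kappa - ev) * (L2sq y)" if y: "y \<in> X0 sig Omega" for y proof -
   have "(ev - kappa) / ev * (ev * (L2sq y)) <= (ev - kappa) / ev * (X0_norm sig y)^2" using False kappa by(intro mult_left_mono ray y) auto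
   moreover have "(ev - kappa) / ev * (ev * (L2sq y)) = (ev - kappa) * (L2sq y)" using False kappa by simp
   moreover have "(ev - kappa) / ev * (X0_norm sig y)^2 = (X0_norm sig y)^2 - kappa / ev * (X0_norm sig y)^2"
    using False kappa by(simp add: diff_divide_distrib left_diff_distrib)
   ultimately show ?thesis unfolding left_diff_distrib by linarith
  qed
  thus ?thesis using False kappa by(intro that[of "kappa / ev"]) auto
 qed
 define A where "A = sqrt (Cs * M^2) * sqrt C"
 define B where "B = K1 * measure lborel Omega"
 have I: "integrable lborel (indicator Omega :: 'a => real)" using op emeasure_bounded_finite[OF bd] by(intro integrable_real_indicator) auto
 have "X0_norm sig y <= max 1 ((A + B) / c0)" if st: "stationary M y f" for y f proof -
  define x where "x = X0_norm sig y"
  have x0: "x >= 0" by(simp add: x_def X0_norm_ge0 sig)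
  have y: "y \<in> X0 sig Omega" and f: "f \<in> X0 s Omega" and fM: "X0_norm s f <= M" using stationaryD[OF st] by auto
  have gy: "L2_fun lborel (%x. g (y x))" using st by(simp add: stationary_def)
  have "ip f y = x^2 + ip (%x. g (y x)) y" using st y unfolding stationary_def x_def X0_norm_square[OF sig] by blast
  moreover have "- B - (ev - kappa) * (L2sq y) <= ip (%x. g (y x)) y" proof -
   have "(LBINT x. (- K1) * indicator Omega x - (ev - kappa) * (y x)^2) <= ip (%x. g (y x)) y" proof(rule integral_mono_AE)
    show "AE x in lborel. (- K1) * indicator Omega x - (ev - kappa) * (y x)^2 <= g (y x) * y x" using X0D(2)[OF y] proof eventually_elim
     case (elim x) thus ?case using GK[of "y x"] by(cases "x \<in> Omega") (auto simp: G_def)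
    qed
   qed (use I X0D(5)[OF y] L2_mult_integrable[OF gy X0D(4)[OF y]] in auto)
   also have "(LBINT x. (- K1) * indicator Omega x - (ev - kappa) * (y x)^2) = - B - (ev - kappa) * (L2sq y)"
    using I X0D(5)[OF y] op by(simp add: B_def)
   finally show ?thesis .
  qed
  moreover have "ip f y <= A * x" proof -
   have "abs (ip f y) <= sqrt (L2sq f) * sqrt (L2sq y)" by(rule integral_CS[OF X0D(4)[OF f] X0D(4)[OF y]])
   also have "... <= sqrt (Cs * M^2) * sqrt (C * x^2)" proof(intro mult_mono real_sqrt_le_mono)
    show "(L2sq f) <= Cs * M^2"
     by(rule order_trans[OF Cs(2)[OF f]]) (use Cs(1) fM in \<open>intro mult_left_mono power_mono X0_norm_ge0 s, auto\<close>)
    show "(L2sq y) <= C * x^2" unfolding x_def by(rule C(2)[OF y])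
   qed (use Cs in auto)
   finally show ?thesis using x0 by(simp add: A_def real_sqrt_mult)
  qed
  ultimately have q: "c0 * x^2 <= A * x + B" using c0(2)[OF y] unfolding x_def[symmetric] left_diff_distrib by linarith
  have "x <= (A + B) / c0" if "x > 1" proof -
   have B0: "B >= 0" by(simp add: B_def K1_def)
   have "B * 1 <= B * x" using that B0 by(intro mult_left_mono) auto
   hence "(c0 * x) * x <= (A + B) * x" using q by(simp add: power2_eq_square algebra_simps)
   hence "c0 * x <= A + B" using that by(simp add: mult_le_cancel_right)
   thus ?thesis using c0(1) by(simp add: pos_le_divide_eq mult.commute)
  qed
  thus ?thesis unfolding x_def[symmetric] by(cases "x > 1") auto
 qed
 thus ?thesis by blast
qed

text \<open>Each round multiplies the exponent of \<open>y\<close> by \<open>q / 2 > 1\<close>,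
  starting from 2, until the exponent \<open>r\<close> of \<open>f\<close> is reached. All constants
  depend on \<open>M\<close> and \<open>K\<close> only, hence are uniform in time.\<close>

lemma integrability_bootstrap:
 assumes r: "Sobolev_exponent DIM('a) s r" and M: "M >= 0" and K: "K >= 0"
 shows "\<exists>A>0. \<forall>y f. stationary M y f --> X0_norm sig y <= K -->
  integrable lborel (%x. abs (lam * y x + f x) powr r) & (LBINT x. abs (lam * y x + f x) powr r) <= A" proof -
 have r2: "r > 2" using r by(simp add: Sobolev_exponent_def)
 obtain q where q: "Sobolev_exponent DIM('a) sig q" using ex_Sobolev_exponent[OF sig(1)] by blast
 hence q2: "q > 2" by(simp add: Sobolev_exponent_def)
 obtain C where C: "C > 0" and Sob: "!!v. v \<in> X0 sig Omega ==> Lq_integrable q v"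
   "!!v. v \<in> X0 sig Omega ==> (Lq_int q v) <= (C * X0_norm sig v) powr q" by(rule X0_Sobolev[OF sig bd q], rule that)
 obtain D where D: "D > 0" and Sobs: "!!v. v \<in> X0 s Omega ==> Lq_integrable r v"
   "!!v. v \<in> X0 s Omega ==> (Lq_int r v) <= (D * X0_norm s v) powr r" by(rule X0_Sobolev[OF s bd r], rule that)
 obtain Csig where Csig: "Csig > 0" "!!v. v \<in> X0 sig Omega ==> (L2sq v) <= Csig * (X0_norm sig v)^2" using X0_Poincare[OF sig bd] by blast
 obtain Cs where Cs: "Cs > 0" "!!v. v \<in> X0 s Omega ==> (L2sq v) <= Cs * (X0_norm s v)^2" using X0_Poincare[OF s bd] by blast
 define Af where "Af = Cs * M^2 + (D * M) powr r"
 have fm: "Lq_integrable m f" "(Lq_int m f) <= Af"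
  if m: "2 <= m" "m <= r" and st: "stationary M y f" for m y f proof -
  have f: "f \<in> X0 s Omega" and fM: "X0_norm s f <= M" using stationaryD[OF st] by auto
  note i = integrable_powr_interpolate[OF m X0D(4)[OF f] Sobs(1)[OF f]]
  show "Lq_integrable m f" by(rule i)
  have "Cs * (X0_norm s f)^2 <= Cs * M^2" using Cs(1) fM by(intro mult_left_mono power_mono X0_norm_ge0 s) auto
  moreover have "(D * X0_norm s f) powr r <= (D * M) powr r" using D fM r2 X0_norm_ge0[OF s, of f] by(intro powr_mono2 mult_left_mono) auto
  ultimately show "(Lq_int m f) <= Af" unfolding Af_def using i(2) Cs(2)[OF f] Sobs(2)[OF f] by linarith
 qed
 \<comment> \<open>The constant is quantified before the pair, which is what keeps the bounds
   uniform.\<close>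
 define P where "P m \<longleftrightarrow> (\<exists>A\<ge>0. \<forall>y f. stationary M y f --> X0_norm sig y <= K -->
  Lq_integrable m y & (Lq_int m y) <= A)" for m
 have y2: "(L2sq y) <= Csig * K^2" if "stationary M y f" "X0_norm sig y <= K" for y f by(rule order_trans[OF Csig(2)[OF stationaryD(1)[OF that(1)]]])
   (use Csig(1) that in \<open>intro mult_left_mono power_mono X0_norm_ge0 sig, auto\<close>)
 have F: "\<exists>A>0. \<forall>y f. stationary M y f --> X0_norm sig y <= K -->
  integrable lborel (%x. abs (lam * y x + f x) powr m) & (LBINT x. abs (lam * y x + f x) powr m) <= A &
  Lq_integrable m y & (Lq_int m y) <= A"
  if m: "2 <= m" "m <= r" and Pm: "P m" for m proof -
  obtain A where A: "A >= 0" "!!y f. stationary M y f ==> X0_norm sig y <= K ==>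
   Lq_integrable m y & (Lq_int m y) <= A" using Pm unfolding P_def by blast
  have Af0: "Af >= 0" using Cs(1) by(simp add: Af_def)
  show ?thesis proof(intro exI[of _ "2 powr m * (abs lam powr m * A + Af) + A + 1"] conjI allI impI)
   show "0 < 2 powr m * (abs lam powr m * A + Af) + A + 1" using A(1) Af0 by(intro add_nonneg_pos add_nonneg_nonneg mult_nonneg_nonneg) auto
   fix y f assume st: "stationary M y f" "X0_norm sig y <= K"
   have meas: "y \<in> borel_measurable lborel" "f \<in> borel_measurable lborel"
    by(rule X0D(3)[OF stationaryD(1)[OF st(1)]], rule X0D(3)[OF stationaryD(2)[OF st(1)]])
   have yA: "Lq_integrable m y" "(Lq_int m y) <= A" using A(2)[OF st] by auto
   have m0: "m >= 0" using m by simp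
   note i = integrable_powr_add[OF m0 meas yA(1) fm(1)[OF m st(1)], of lam]
   show "integrable lborel (%x. abs (lam * y x + f x) powr m)" "Lq_integrable m y" by(rule i(1), rule yA(1))
   have "2 powr m * (abs lam powr m * (Lq_int m y) + (Lq_int m f)) <= 2 powr m * (abs lam powr m * A + Af)"
    by(intro mult_left_mono add_mono yA fm(2)[OF m st(1)]) auto
   thus "(LBINT x. abs (lam * y x + f x) powr m) <= 2 powr m * (abs lam powr m * A + Af) + A + 1" using i(2) A(1) by linarith
   have "0 <= 2 powr m * (abs lam powr m * A + Af)" using A(1) Af0 by simp
   thus "(Lq_int m y) <= 2 powr m * (abs lam powr m * A + Af) + A + 1" using yA(2) by linarith
  qed qed
 have step: "P (m * q / 2)" if m: "2 <= m" "m <= r" and Pm: "P m" for m proof -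
  obtain A where A: "!!y f. stationary M y f ==> X0_norm sig y <= K ==>
   integrable lborel (%x. abs (lam * y x + f x) powr m) & (LBINT x. abs (lam * y x + f x) powr m) <= A &
   Lq_integrable m y & (Lq_int m y) <= A" using F[OF m Pm] by blast
  have "integrable lborel (%x. abs (y x) powr (m * q / 2)) & (LBINT x. abs (y x) powr (m * q / 2)) <= (C * sqrt (m^2 * A)) powr q"
   if st: "stationary M y f" "X0_norm sig y <= K" for y f proof -
   note B = A[OF st]
   show ?thesis by(intro conjI integrability_gain[where A = A, OF sig g_mono beta0 q2 C Sob stationaryD(1)[OF st(1)] stationaryD(4-6)[OF st(1)] m(1)]
      B[THEN conjunct1] B[THEN conjunct2, THEN conjunct1] B[THEN conjunct2, THEN conjunct2, THEN conjunct1] B[THEN conjunct2, THEN conjunct2, THEN conjunct2])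
  qed
  thus ?thesis unfolding P_def by(intro exI[of _ "(C * sqrt (m^2 * A)) powr q"]) auto
 qed
 have interpolate: "P m" if m: "2 <= m" "m <= m'" and Pm: "P m'" for m m' proof -
  obtain A where A: "A >= 0" "!!y f. stationary M y f ==> X0_norm sig y <= K ==>
   integrable lborel (%x. abs (y x) powr m') & (LBINT x. abs (y x) powr m') <= A" using Pm unfolding P_def by blast
  show ?thesis unfolding P_def proof(intro exI[of _ "Csig * K^2 + A"] conjI allI impI)
   show "0 <= Csig * K^2 + A" using A(1) Csig(1) by simp
   fix y f assume st: "stationary M y f" "X0_norm sig y <= K"
   have B: "integrable lborel (%x. abs (y x) powr m')" "(LBINT x. abs (y x) powr m') <= A" using A(2)[OF st] by auto
   note i = integrable_powr_interpolate[OF m X0D(4)[OF stationaryD(1)[OF st(1)]] B(1)]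
   show "Lq_integrable m y" by(rule i)
   show "(Lq_int m y) <= Csig * K^2 + A" using i(2) y2[OF st] B(2) by linarith
  qed qed
 have P2: "P 2" unfolding P_def proof(intro exI[of _ "Csig * K^2"] conjI allI impI)
  show "0 <= Csig * K^2" using Csig(1) by simp
  fix y f assume st: "stationary M y f" "X0_norm sig y <= K"
  show "Lq_integrable 2 y" "(Lq_int 2 y) <= Csig * K^2" using X0D(5)[OF stationaryD(1)[OF st(1)]] y2[OF st] by(simp_all add: powr_numeral)
 qed
 \<comment> \<open>The cap at \<open>r\<close> is due to \<open>f\<close>, which has no higher
   integrability; interpolation with exponent 2 brings an overshooting exponent back to
   \<open>r\<close>.\<close>
 have "P (min (2 * (q / 2) ^ k) r)" for k proof(induction k)
  case 0 thus ?case using P2 r2 by simp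
 next case (Suc k) have k1: "1 <= (q / 2) ^ k" using q2 by(intro one_le_power) auto
  have k2: "(q / 2) ^ k <= (q / 2) ^ Suc k" using q2 by(intro power_increasing) auto
  show ?case proof(cases "2 * (q / 2) ^ k <= r")
   case True have "P (2 * (q / 2) ^ k * q / 2)" using Suc True k1 by(intro step) (auto simp: min_def)
   hence "P (2 * (q / 2) ^ Suc k)" by(simp add: mult_ac)
   moreover have "1 <= (q / 2) ^ Suc k" using k1 k2 by linarith
   ultimately show ?thesis using r2 by(intro interpolate[of "min (2 * (q / 2) ^ Suc k) r" "2 * (q / 2) ^ Suc k"]) (simp_all del: power_Suc)
  next case False hence "min (2 * (q / 2) ^ k) r = r" "min (2 * (q / 2) ^ Suc k) r = r" using k2 by auto
   thus ?thesis using Suc by simp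
  qed qed
 moreover obtain k where "r < (q / 2) ^ k" using real_arch_pow[of "q / 2" r] q2 by auto
 moreover from this have "min (2 * (q / 2) ^ k) r = r" using r2 by auto
 ultimately have "P r" by metis
 thus ?thesis using F[of r] r2 by(meson less_imp_le order_refl)
qed

text \<open>The sign \<open>epsi\<close> treats both one-sided bounds at once. The truncation has
  the sign of \<open>epsi * y\<close>, so the term with \<open>beta\<close> is nonnegative, and
  Stampacchia's bound applies with \<open>lam * y + f\<close> as data.\<close>

lemma sup_bound:
 fixes h :: "'a => real"
 assumes q: "q > 2" and C: "C > 0" and Sob: "!!v. v \<in> X0 sig Omega ==> Lq_integrable q v"
   "!!v. v \<in> X0 sig Omega ==> (Lq_int q v) <= (C * X0_norm sig v) powr q"
  and p: "p > 1" and delta: "delta = 1 - 1 / p - 2 / q" "delta > 0" and st: "stationary M y f"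
  and h: "integrable lborel (%x. abs (lam * y x + f x) powr p)" "(LBINT x. abs (lam * y x + f x) powr p) <= H powr p" and H: "H > 0"
 shows "AE x in lborel. abs (y x) <= 2 powr (1 + 1 / (q * delta)) * C^2 * H * (measure lborel Omega + 1) powr delta" proof -
 note y = stationaryD(1)[OF st] and F2 = stationaryD(4)[OF st] and beta2 = stationaryD(5)[OF st] and eq = stationaryD(6)[OF st]
 have "AE x in lborel. epsi * y x <= 2 powr (1 + 1 / (q * delta)) * C^2 * H * (measure lborel Omega + 1) powr delta" if epsi: "epsi = 1 \<or> epsi = - 1" for epsi :: real
 proof(rule Stampacchia_bound[OF sig q C Sob p delta L2D(1)[OF F2] h H])
  fix k :: real assume k: "k >= 0"
  define T where "T t = max 0 (epsi * t - k)" for t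
  have TX: "(%x. T (y x)) \<in> X0 sig Omega" by(rule X0_Lipschitz_comp[OF y, where L = 1]) (use k epsi in \<open>auto simp: T_def\<close>)
  show "(%x. max 0 (epsi * y x - k)) \<in> X0 sig Omega" using TX by(simp add: T_def)
  define v where "v x = epsi * T (y x)" for x
  have vX: "v \<in> X0 sig Omega" unfolding v_def by(rule X0_scale[OF TX])
  have "(X0_norm sig (%x. T (y x)))^2 = frac_op sig (%x. T (y x)) (%x. T (y x))" by(rule X0_norm_square[OF sig])
  also have "... <= frac_op sig y v" proof(rule frac_op_mono_pointwise[OF sig X0D(1)[OF TX] X0D(1)[OF TX] X0D(1)[OF y] X0D(1)[OF vX]])
   fix x x' have "(T a - T b) * (T a - T b) <= (a - b) * (epsi * T a - epsi * T b)" for a b proof -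
    have "(T a - T b) * (T a - T b) <= (epsi * a - epsi * b) * (T a - T b)" proof(cases "epsi * b <= epsi * a")
     case True thus ?thesis by(intro mult_right_mono) (auto simp: T_def)
    next case False thus ?thesis by(intro mult_right_mono_neg) (auto simp: T_def)
    qed
    thus ?thesis by(simp add: algebra_simps)
   qed
   thus "(T (y x) - T (y x')) * (T (y x) - T (y x')) <= (y x - y x') * (v x - v x')" by(simp add: v_def)
  qed
  also have "frac_op sig y v <= ip (%x. lam * y x + f x) v" proof -
   have "0 <= ip (%x. beta (y x)) v" proof(rule L1_integral_nonneg)
    fix x have "0 <= epsi * beta (y x)" if "T (y x) ~= 0"
     using g_mono[of 0 "y x"] g_mono[of "y x" 0] g0 epsi k that by(auto simp: T_def max_def split: if_splits)
    moreover have "0 <= T (y x)" by(simp add: T_def)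
    ultimately have "0 <= (epsi * beta (y x)) * T (y x)" by(cases "T (y x) = 0") auto
    thus "0 <= beta (y x) * v x" by(simp only: v_def mult_ac)
   qed
   thus ?thesis using eq[OF vX] by linarith
  qed
  also have "... <= (LBINT x. abs ((lam * y x + f x) * T (y x)))"
  proof(rule integral_mono[OF L2_mult_integrable[OF F2 X0D(4)[OF vX]] integrable_abs[OF L2_mult_integrable[OF F2 X0D(4)[OF TX]]]])
   fix x have "(lam * y x + f x) * v x <= abs ((lam * y x + f x) * v x)" by simp
   also have "... = abs ((lam * y x + f x) * T (y x))" using epsi by(auto simp: v_def abs_mult)
   finally show "(lam * y x + f x) * v x <= abs ((lam * y x + f x) * T (y x))" .
  qed
  finally show "(X0_norm sig (%x. max 0 (epsi * y x - k)))^2 <= (LBINT x. abs ((lam * y x + f x) * max 0 (epsi * y x - k)))" by(simp add: T_def)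
 next show "(%x. epsi * y x) \<in> borel_measurable lborel" using X0D(3)[OF y] by simp
  show "Omega \<in> sets borel" "emeasure lborel Omega < \<infinity>" using op emeasure_bounded_finite[OF bd] by auto
  show "measure lborel Omega <= measure lborel Omega + 1" "0 < measure lborel Omega + 1" by(simp_all add: add_nonneg_pos)
  show "AE x in lborel. x \<notin> Omega --> epsi * y x <= 0" using X0D(2)[OF y] by eventually_elim simp
 qed
 from this[OF disjI1[OF refl]] this[OF disjI2[OF refl]] show ?thesis by eventually_elim (simp add: abs_le_iff)
qed

end

section \<open>Uniform Hoelder bound and the theorem\<close>

text \<open>If both critical exponents are finite, \<open>delta\<close> equals
  \<open>(2 * s + 4 * sig - N) / (2 * N)\<close>. In the other cases large finite exponents leave
  room.\<close>

lemma ex_supercritical_exponents: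
 assumes s: "0 < s" and sig: "0 < sig" and N: "0 < N" "real N < 2 * s + 4 * sig"
 obtains p q delta where "Sobolev_exponent N s p" "Sobolev_exponent N sig q" "delta = 1 - 1 / p - 2 / q" "delta > 0" proof -
 define n where "n = real N"
 have n: "n > 0" "n < 2 * s + 4 * sig" using N by(auto simp: n_def)
 \<comment> \<open>The two lower bounds give \<open>1 / p <= 1 / 5\<close>, for
   \<open>q = 5\<close>, and \<open>1 / p <= sig / n\<close>, for a critical
   \<open>q\<close>.\<close>
 define p where "p = (if 2 * s < n then 2 * n / (n - 2 * s) else max 5 (n / sig))"
 define q where "q = (if 2 * sig < n then 2 * n / (n - 2 * sig) else 5)"
 have p: "Sobolev_exponent N s p" using n s by(auto simp: Sobolev_exponent_def n_def[symmetric] p_def pos_less_divide_eq)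
 have q: "Sobolev_exponent N sig q" using n sig by(auto simp: Sobolev_exponent_def n_def[symmetric] q_def pos_less_divide_eq)
 have pi: "1 / p = 1 / 2 - s / n" if "2 * s < n" using that n by(simp add: p_def field_simps)
 have qi: "2 / q = 1 - 2 * sig / n" if "2 * sig < n" using that n by(simp add: q_def field_simps)
 have p5: "1 / p <= 1 / 5" "1 / p <= sig / n" if "\<not> 2 * s < n" proof -
  have "p >= 5" "p >= n / sig" using that by(auto simp: p_def)
  thus "1 / p <= 1 / 5" by(intro divide_left_mono) auto
  have "1 / p <= 1 / (n / sig)" using \<open>p >= n / sig\<close> \<open>p >= 5\<close> n sig by(intro divide_left_mono) auto
  thus "1 / p <= sig / n" by simp
 qed
 have sn: "s / n > 0" "sig / n > 0" using s sig n by auto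
 have "1 - 1 / p - 2 / q > 0" proof(cases "2 * s < n"; cases "2 * sig < n")
  assume a: "2 * s < n" "2 * sig < n"
  have "1 / 2 < s / n + 2 * sig / n" using n by(simp add: add_divide_distrib[symmetric] pos_less_divide_eq)
  thus ?thesis using pi[OF a(1)] qi[OF a(2)] by simp
 next assume a: "2 * s < n" "\<not> 2 * sig < n"
  hence "2 / q = 2 / 5" by(simp add: q_def)
  thus ?thesis using pi[OF a(1)] sn by simp
 next assume a: "\<not> 2 * s < n" "2 * sig < n"
  thus ?thesis using p5[OF a(1)] qi[OF a(2)] sn by simp
 next assume a: "\<not> 2 * s < n" "\<not> 2 * sig < n"
  hence "2 / q = 2 / 5" by(simp add: q_def)
  thus ?thesis using p5[OF a(1)] by simp
 qed
 thus ?thesis using that[OF p q] by blast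
qed

lemma Lp_of_integrable:
 fixes F :: "'a::euclidean_space => real"
 assumes op: "open Omega" and bd: "bounded Omega" and F[measurable]: "F \<in> borel_measurable lborel" "Lq_integrable r F" and p: "0 <= p" "p <= r"
 shows "F \<in> Lp p Omega" proof -
 have [measurable]: "Omega \<in> sets borel" using op by simp
 have I: "integrable lborel (indicator Omega :: 'a => real)" using op emeasure_bounded_finite[OF bd] by(intro integrable_real_indicator) auto
 have le: "abs t powr p <= 1 + abs t powr r" for t :: real proof(cases "abs t <= 1")
  case True hence "abs t powr p <= 1 powr p" using p by(intro powr_mono2) auto
  thus ?thesis by(simp add: add_increasing2)
 next case False hence "abs t powr p <= abs t powr r" using p by(intro powr_mono) auto
  thus ?thesis by linarith
 qed
 have "integrable lborel (%x. indicator Omega x *\<^sub>R (abs (F x)) powr p)" proof(rule L1_integrable_bound[OF L1_integrable_add[OF I F(2)]])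
  show "AE x in lborel. norm (indicator Omega x *\<^sub>R (abs (F x)) powr p) <= norm (indicator Omega x + abs (F x) powr r)"
   using le by(intro AE_I2) (auto simp: indicator_def)
 qed measurable
 thus ?thesis by(simp add: Lp_def set_borel_measurable_def set_integrable_def)
qed

lemma holder_norm_le:
 assumes "!!x. abs (v x) <= A" "!!x y. abs (v x - v y) <= B * norm (x - y) powr alpha" "A >= 0" "B >= 0"
 shows "holder_norm alpha K v <= ennreal (A + B)" proof -
 have "(SUP x\<in>K. ennreal (abs (v x))) <= ennreal A" using assms(1) by(intro SUP_least ennreal_leI)
 moreover have "(SUP (x, y)\<in>{(x, y). x \<in> K & y \<in> K & x ~= y}. ennreal (abs (v x - v y) / norm (x - y) powr alpha)) <= ennreal B"
  using assms(2) by(intro SUP_least) (auto intro!: ennreal_leI simp: pos_divide_le_eq)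
 ultimately show ?thesis unfolding holder_norm_def using assms(3,4) by(simp add: add_mono)
qed

context cahn_hilliard_flow
begin

text \<open>Once \<open>y\<close> is bounded, \<open>beta (y)\<close> is bounded as well, so the
  energy form of \<open>y\<close> is represented by \<open>h = lam * y + f - beta (y)\<close> with a
  uniform bound in L^p, and the oscillation estimate for linear equations applies.\<close>

lemma Hoelder_bound:
 fixes alpha theta :: real
 defines "c == frac_const DIM('a) sig" and "n == real DIM('a)" and "V0 == unit_ball_vol (real DIM('a))"
 assumes Omega: "smooth_bounded_domain Omega" and alpha: "0 < alpha" "alpha <= sig" and theta: "0 < theta" "theta <= 1 / 4"
  and const: "theta * (c * (LBINT z. kmin sig (z::'a))) +
    alpha * (c / sig * 2 powr (n + 3 * sig) * (LBINT w. indicator {w::'a. 1 <= norm w} w * norm w powr (- n - sig)))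
    <= c / 4 * V0 * 9 powr (- (n + 2 * sig))" and decay: "1 - theta / 2 <= 4 powr (- alpha)"
  and p: "Sobolev_exponent DIM('a) s p" and q: "Sobolev_exponent DIM('a) sig q"
  and delta: "delta = 1 - 1 / p - 2 / q" "delta > 0" "alpha <= n * delta" and M: "M >= 0" and K: "K >= 0"
 shows "\<exists>B. \<forall>y f. stationary M y f --> X0_norm sig y <= K -->
  (\<exists>v. (AE x in lborel. v x = y x) & holder_norm alpha (closure Omega) v <= ennreal B)" proof -
 have p2: "p > 2" and q2: "q > 2" using p q by(auto simp: Sobolev_exponent_def)
 have p1: "p > 1" using p2 by simp
 obtain C where C: "C > 0" and Sob: "!!v. v \<in> X0 sig Omega ==> Lq_integrable q v"
   "!!v. v \<in> X0 sig Omega ==> (Lq_int q v) <= (C * X0_norm sig v) powr q" by(rule X0_Sobolev[OF sig bd q], rule that)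
 obtain A where A: "A > 0" "!!y f. stationary M y f ==> X0_norm sig y <= K ==>
  integrable lborel (%x. abs (lam * y x + f x) powr p) & (LBINT x. abs (lam * y x + f x) powr p) <= A"
  using integrability_bootstrap[OF p M K] by blast
 have root: "(B powr (1 / p)) powr p = B" if "B > 0" for B using that p2 by(simp add: powr_powr)
 define H0 where "H0 = A powr (1 / p)"
 have H0: "H0 > 0" "H0 powr p = A" using A(1) root by(auto simp: H0_def)
 define U where "U = 2 powr (1 + 1 / (q * delta)) * C^2 * H0 * (measure lborel Omega + 1) powr delta"
 have U0: "U >= 0" using H0 C by(simp add: U_def)
 \<comment> \<open>The bound \<open>b\<close> for \<open>beta\<close> on the range of
   \<open>y\<close>.\<close>
 have "compact (beta ` {-U..U})" by(intro compact_continuous_image continuous_intros continuous_on_subset[OF g_cont]) auto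
 hence "bounded (beta ` {-U..U})" by(rule compact_imp_bounded)
 then obtain b where b: "\<forall>x\<in>beta ` {-U..U}. abs x <= b" unfolding bounded_real by blast
 have b0: "b >= 0" using bspec[OF b imageI, of U] U0 by auto
 define A2 where "A2 = 2 powr p * (b powr p * measure lborel Omega + A)"
 have A2: "A2 > 0" using A(1) by(simp add: A2_def add_nonneg_pos)
 define H where "H = A2 powr (1 / p)"
 have H: "H > 0" "H powr p = A2" using A2 root by(auto simp: H_def)
 obtain R where R: "R > 0" "!!x r. x \<in> frontier Omega ==> 0 < r ==> r <= R ==>
  \<exists>y. ball y (r / 4) \<subseteq> ball x r & ball y (r / 4) \<inter> Omega = {}" using exterior_balls[OF Omega] by blast
 define r0 where "r0 = R / 3"
 have r0: "r0 > 0" "3 * r0 <= R" using R by(auto simp: r0_def)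
 define S where "S = 2 powr (1 + 1 / (q * delta)) * C^2 * H * (V0 powr delta * (r0 / 2) powr (n * delta))"
 have S0: "S >= 0" using H C by(simp add: S_def)
 \<comment> \<open>Large enough for the first interval to contain the range of \<open>y\<close> and
   for the data to be small relative to \<open>theta * Q0\<close> on the first scale.\<close>
 define Q0 where "Q0 = 2 * U + 4 * S / theta + 1"
 have "theta * Q0 / 4 = theta * (2 * U + 1) / 4 + S" using theta by(simp add: Q0_def field_simps)
 moreover have "0 <= theta * (2 * U + 1) / 4" using theta U0 by simp
 moreover have "4 * S / theta >= 0" using S0 theta by simp
 ultimately have Q0: "Q0 > 0" "2 * U <= Q0" "S <= theta * Q0 / 4" using U0 by(auto simp: Q0_def)
 have "\<exists>v. (AE x in lborel. v x = y x) & holder_norm alpha (closure Omega) v <= ennreal ((U + Q0) + 2 * (U + Q0) * (8 / r0) powr alpha)"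
  if st: "stationary M y f" and yK: "X0_norm sig y <= K" for y f proof -
  note y = stationaryD(1)[OF st] and F2 = stationaryD(4)[OF st] and beta2 = stationaryD(5)[OF st] and eq = stationaryD(6)[OF st]
  have Fp: "integrable lborel (%x. abs (lam * y x + f x) powr p)" "(LBINT x. abs (lam * y x + f x) powr p) <= A" using A(2)[OF st yK] by auto
  have yU: "AE x in lborel. abs (y x) <= U" unfolding U_def
   using Fp unfolding H0(2)[symmetric] by(intro sup_bound[OF q2 C Sob p1 delta(1,2) st] H0(1))
  define h where "h x = - 1 * beta (y x) + (lam * y x + f x)" for x
  have hm: "h \<in> borel_measurable lborel" unfolding h_def[abs_def]
   by(rule borel_measurable_add[OF borel_measurable_times[OF borel_measurable_const L2D(1)[OF beta2]] L2D(1)[OF F2]])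
  have I: "integrable lborel (indicator Omega :: 'a => real)" using op emeasure_bounded_finite[OF bd] by(intro integrable_real_indicator) auto
  have le: "AE x in lborel. abs (beta (y x)) powr p <= b powr p * indicator Omega x" using yU X0D(2)[OF y] proof eventually_elim
   case (elim x) show ?case proof(cases "x \<in> Omega")
    case True have "abs (beta (y x)) <= b" using elim(1) by(intro bspec[OF b] imageI) (auto simp: abs_le_iff)
    hence "abs (beta (y x)) powr p <= b powr p" using p2 by(intro powr_mono2) auto
    thus ?thesis using True by simp
   qed (use elim in \<open>simp add: g0\<close>)
  qed
  have ibeta: "integrable lborel (%x. abs (beta (y x)) powr p)" proof(rule L1_integrable_bound[OF integrable_mult_right[OF I, of "b powr p"]])
   show "AE x in lborel. norm (abs (beta (y x)) powr p) <= norm (b powr p * indicator Omega x)" using le by eventually_elim simp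
   show "(%x. abs (beta (y x)) powr p) \<in> borel_measurable lborel" using L2D(1)[OF beta2] by measurable
  qed
  have betap: "(LBINT x. abs (beta (y x)) powr p) <= b powr p * measure lborel Omega"
   using integral_mono_AE[OF ibeta integrable_mult_right[OF I, of "b powr p"] le] op by simp
  have p0: "p >= 0" using p2 by simp
  note ip_h = integrable_powr_add[OF p0 L2D(1)[OF beta2] L2D(1)[OF F2] ibeta Fp(1), of "- 1"]
  have hp: "Lq_integrable p h" unfolding h_def by(rule ip_h(1))
  have "(Lq_int p h) <= 2 powr p * (abs (- 1) powr p * (LBINT x. abs (beta (y x)) powr p) + (LBINT x. abs (lam * y x + f x) powr p))"
   unfolding h_def by(rule ip_h(2))
  also have "... <= A2" unfolding A2_def using betap Fp(2) by(intro mult_left_mono add_mono) auto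
  finally have hH: "(Lq_int p h) <= H powr p" unfolding H(2) .
  have heq: "frac_op sig y phi = ip h phi" if phi: "phi \<in> X0 sig Omega" for phi
   using ip_diff_left[OF F2 beta2 X0D(4)[OF phi]] eq[OF phi] by(simp add: h_def)
  have osc: "\<exists>m. AE z in lborel. z \<in> ball x0 (r0 * (1 / 4) ^ j) --> m <= y z & y z <= m + Q0 * 4 powr (- alpha * real j)" for x0 j
   by(rule oscillation_decay[OF sig alpha theta const[unfolded c_def n_def V0_def] decay q2 C Sob p1 delta(1,2) delta(3)[unfolded n_def]
      hm hp hH H(1) y heq op R(2) r0 yU Q0(1,2) Q0(3)[unfolded S_def n_def V0_def]])
  obtain v where v: "AE x in lborel. v x = y x" "!!x. abs (v x) <= U + Q0"
   "!!x z. abs (v x - v z) <= 2 * (U + Q0) * (8 / r0) powr alpha * norm (x - z) powr alpha"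
   by(rule Hoelder_representative[OF r0(1) alpha(1) Q0(1) yU U0 osc], rule that)
  have "holder_norm alpha (closure Omega) v <= ennreal ((U + Q0) + 2 * (U + Q0) * (8 / r0) powr alpha)"
   by(rule holder_norm_le[OF v(2,3)]) (use U0 Q0 in auto)
  thus ?thesis using v(1) by blast
 qed
 thus ?thesis by blast
qed

text \<open>For a single pair the norm of \<open>y\<close> itself can serve as the energy bound in
  the bootstrap.\<close>

lemma stationary_integrability:
 assumes st: "stationary M y f" and M: "M >= 0" and r: "Sobolev_exponent DIM('a) s r" and p: "0 <= p" "p <= r"
 shows "(%x. lam * y x + f x) \<in> Lp p Omega" proof -
 obtain A where "!!z h. stationary M z h ==> X0_norm sig z <= X0_norm sig y ==>
  integrable lborel (%x. abs (lam * z x + h x) powr r)" using integrability_bootstrap[OF r M X0_norm_ge0[OF sig, of y]] by blast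
 hence "integrable lborel (%x. abs (lam * y x + f x) powr r)" using st by blast
 thus ?thesis by(intro Lp_of_integrable[OF op bd L2D(1)[OF stationaryD(4)[OF st]] _ p])
qed

end

lemma weak_solution_regularity:
 fixes Omega :: "'a::euclidean_space set"
 assumes flow: "cahn_hilliard_flow Omega s sig lam W g u w N V"
 shows "\<exists>w'. (AE t in lebesgue_on {0<..}. AE x in lborel. w' t x = w t x) &
    (\<forall>t\<ge>1. w' t \<in> X0 s Omega & (%x. g (u t x) + lam * u t x) \<in> Lp 2 Omega &
     (\<forall>v\<in>X0 sig Omega. frac_op sig (u t) v + L2_functional Omega (%x. g (u t x) + lam * u t x) v =
       L2_functional Omega (%x. lam * u t x + w' t x) v) &
     (real DIM('a) > 2 * s -->
       (%x. lam * u t x + w' t x) \<in> Lp (2 * real DIM('a) / (real DIM('a) - 2 * s)) Omega) &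
     (real DIM('a) <= 2 * s -->
       (\<forall>p\<ge>1. (%x. lam * u t x + w' t x) \<in> Lp p Omega)))" proof -
 interpret cahn_hilliard_flow Omega s sig lam W g u w N V by(rule flow)
 obtain M where M: "M >= 0" "!!t. t >= 1 ==> \<exists>f. stationary M (u t) f" using stationary_limit by blast
 \<comment> \<open>At good times \<open>w t\<close> already solves the stationary equation and is
   kept, so \<open>w'\<close> is a representative of \<open>w\<close>; at the remaining times from 1
   on it is replaced by a limit of good times.\<close>
 define w' where "w' t = (if t < 1 \<or> stationary (X0_norm s (w t)) (u t) (w t) then w t else (SOME f. stationary M (u t) f))" for t
 have w: "stationary (X0_norm s (w t)) (u t) (w t)" if t: "t > 0" "t \<notin> N" for t
  using t w_X0[OF t] g_L2[OF t] eq[OF t] u_X0[of t] by(simp add: stationary_def)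
 have AE: "AE t in lebesgue_on {0<..}. AE x in lborel. w' t x = w t x" proof -
  have "AE t in lebesgue. t \<notin> N" using N by(intro AE_not_in) (simp add: negligible_iff_null_sets)
  hence "AE t in lebesgue. t \<in> {0<..} --> (AE x in lborel. w' t x = w t x)" by eventually_elim (auto simp: w'_def w)
  thus ?thesis by(simp add: AE_restrict_space_iff)
 qed
 have st: "\<exists>M'\<ge>0. stationary M' (u t) (w' t)" if t: "t >= 1" for t proof(cases "stationary (X0_norm s (w t)) (u t) (w t)")
  case True thus ?thesis using X0_norm_ge0[OF s, of "w t"] by(auto simp: w'_def)
 next case False from M(2)[OF t] have "stationary M (u t) (SOME f. stationary M (u t) f)" by(rule someI_ex)
  thus ?thesis using False t M(1) by(auto simp: w'_def)
 qed
 show ?thesis proof(intro exI[of _ w'] conjI AE allI impI)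
  fix t :: real assume "1 <= t"
  then obtain M' where M': "M' >= 0" "stationary M' (u t) (w' t)" using st by blast
  note S = stationaryD[OF M'(2)]
  show "w' t \<in> X0 s Omega" by(rule S)
  have "integrable lborel (%x. abs (beta (u t x)) powr 2)" using L2D(2)[OF S(5)] by(simp add: powr_numeral)
  thus "(%x. beta (u t x)) \<in> Lp 2 Omega" by(intro Lp_of_integrable[OF op bd L2D(1)[OF S(5)], of 2]) auto
  show "\<forall>v\<in>X0 sig Omega. frac_op sig (u t) v + L2_functional Omega (%x. beta (u t x)) v = L2_functional Omega (%x. lam * u t x + w' t x) v"
  proof
   fix v assume v: "v \<in> X0 sig Omega"
   show "frac_op sig (u t) v + L2_functional Omega (%x. beta (u t x)) v = L2_functional Omega (%x. lam * u t x + w' t x) v"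
    unfolding L2_functional_ip[OF v L2D(1)[OF S(5)] op] L2_functional_ip[OF v L2D(1)[OF S(4)] op] by(rule S(6)[OF v])
  qed
  show "(%x. lam * u t x + w' t x) \<in> Lp (2 * real DIM('a) / (real DIM('a) - 2 * s)) Omega" if N: "real DIM('a) > 2 * s"
  proof(rule stationary_integrability[OF M'(2,1)])
   show "Sobolev_exponent DIM('a) s (2 * real DIM('a) / (real DIM('a) - 2 * s))" using N s by(auto simp: Sobolev_exponent_def pos_less_divide_eq)
  qed (use N in auto)
  show "(%x. lam * u t x + w' t x) \<in> Lp p Omega" if N: "real DIM('a) <= 2 * s" and p: "1 <= p" for p
  proof(rule stationary_integrability[OF M'(2,1)])
   show "Sobolev_exponent DIM('a) s (max p 3)" using N by(simp add: Sobolev_exponent_def)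
  qed (use p in auto)
 qed qed

text \<open>The exponent is quantified before domain, nonlinearity and solution, which expresses
  that it depends on \<open>N\<close>, \<open>s\<close> and \<open>\<sigma>\<close> only. As
  \<open>w\<close> is determined at almost every time, the identity at every time is stated for a
  representative \<open>w'\<close>; the Hoelder norm likewise refers to a representative of
  \<open>u t\<close>.\<close>

theorem proposition3p1:
 fixes s \<sigma> :: real
 assumes "0 < s" "s < 1" "0 < \<sigma>" "\<sigma> < 1"
 shows "\<exists>\<alpha>>0. \<forall>(\<Omega> :: 'a::euclidean_space set) (g :: real \<Rightarrow> real) (lam :: real)
   (\<beta> :: real \<Rightarrow> real) (\<beta>hat :: real \<Rightarrow> real) (u\<^sub>0 :: 'a \<Rightarrow> real)
   (u :: real \<Rightarrow> 'a \<Rightarrow> real) (w :: real \<Rightarrow> 'a \<Rightarrow> real).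
  smooth_bounded_domain \<Omega> \<and>
  g C1_differentiable_on UNIV \<and> g 0 = 0 \<and>
  lam \<ge> 0 \<and> (\<forall>r. deriv g r \<ge> - lam) \<and>
  (\<exists>\<kappa>>0. Liminf at_infinity
    (\<lambda>r. ereal (g r * r + (first_eigenvalue \<sigma> \<Omega> - \<kappa>) * r\<^sup>2)) > 0) \<and>
  \<beta> = (\<lambda>r. g r + lam * r) \<and>
  (\<forall>r. (\<beta>hat has_real_derivative \<beta> r) (at r)) \<and>
  u\<^sub>0 \<in> X0 \<sigma> \<Omega> \<and> (\<lambda>x. \<beta>hat (u\<^sub>0 x)) \<in> Lp 1 \<Omega> \<and>
  weak_solution s \<sigma> \<Omega> g 0 \<infinity> u w \<and> (AE x in lborel. u 0 x = u\<^sub>0 x)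
  \<longrightarrow>
  (\<exists>w'. (AE t in lebesgue_on {0<..}. AE x in lborel. w' t x = w t x) \<and>
    (\<forall>t\<ge>1. w' t \<in> X0 s \<Omega> \<and> (\<lambda>x. \<beta> (u t x)) \<in> Lp 2 \<Omega> \<and>
     (\<forall>v\<in>X0 \<sigma> \<Omega>. frac_op \<sigma> (u t) v + L2_functional \<Omega> (\<lambda>x. \<beta> (u t x)) v =
       L2_functional \<Omega> (\<lambda>x. lam * u t x + w' t x) v) \<and>
     (real DIM('a) > 2 * s \<longrightarrow>
       (\<lambda>x. lam * u t x + w' t x) \<in> Lp (2 * real DIM('a) / (real DIM('a) - 2 * s)) \<Omega>) \<and>
     (real DIM('a) \<le> 2 * s \<longrightarrow>
       (\<forall>p\<ge>1. (\<lambda>x. lam * u t x + w' t x) \<in> Lp p \<Omega>)))) \<and>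
  (2 * s + 4 * \<sigma> > real DIM('a) \<longrightarrow>
    (\<exists>C :: real. \<forall>t\<ge>1. \<exists>v. (AE x in lborel. x \<in> \<Omega> \<longrightarrow> v x = u t x) \<and>
     holder_norm \<alpha> (closure \<Omega>) v \<le> ennreal C))" proof -
 note s = assms(1,2) and \<sigma> = assms(3,4)
 define c where "c = frac_const DIM('a) \<sigma>"
 define n where "n = real DIM('a)"
 define V0 where "V0 = unit_ball_vol (real DIM('a))"
 \<comment> \<open>\<open>K1\<close> belongs to the error of the cutoff, \<open>K2\<close> to the
   tail and \<open>K3\<close> to the gain from the set \<open>A\<close> in the oscillation
   step.\<close>
 define K1 where "K1 = c * (LBINT z. kmin \<sigma> (z::'a))"
 define K2 where "K2 = c / \<sigma> * 2 powr (n + 3 * \<sigma>) * (LBINT w. indicator {w::'a. 1 <= norm w} w * norm w powr (- n - \<sigma>))"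
 define K3 where "K3 = c / 4 * V0 * 9 powr (- (n + 2 * \<sigma>))"
 have c: "c > 0" unfolding c_def by(rule frac_const_pos[OF \<sigma>])
 have V0: "V0 > 0" unfolding V0_def by(rule unit_ball_vol_pos) simp
 have K: "K1 >= 0" "K2 >= 0" "K3 > 0" proof -
  have "0 <= (LBINT z. kmin \<sigma> (z::'a))" by(intro L1_integral_nonneg kmin_nonneg)
  thus "K1 >= 0" using c by(simp add: K1_def)
  have "0 <= (LBINT w. indicator {w::'a. 1 <= norm w} w * norm w powr (- n - \<sigma>))" by(intro L1_integral_nonneg) simp
  thus "K2 >= 0" using c \<sigma> by(simp add: K2_def)
  show "K3 > 0" using c V0 by(simp add: K3_def)
 qed
 \<comment> \<open>Below the threshold the claim about the Hoelder norm is void, and 1 is an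
   arbitrary choice.\<close>
 obtain \<alpha> where \<alpha>: "\<alpha> > 0" "2 * s + 4 * \<sigma> > n --> (\<exists>theta p q delta. \<alpha> <= \<sigma> & 0 < theta & theta <= 1 / 4 & theta * K1 + \<alpha> * K2 <= K3 &
   1 - theta / 2 <= 4 powr (- \<alpha>) & Sobolev_exponent DIM('a) s p & Sobolev_exponent DIM('a) \<sigma> q &
   delta = 1 - 1 / p - 2 / q & delta > 0 & \<alpha> <= n * delta)" proof(cases "2 * s + 4 * \<sigma> > n")
  case True obtain p q delta where e: "Sobolev_exponent DIM('a) s p" "Sobolev_exponent DIM('a) \<sigma> q" "delta = 1 - 1 / p - 2 / q" "delta > 0"
   by(rule ex_supercritical_exponents[OF s(1) \<sigma>(1) DIM_positive[where 'a = 'a]]) (use True in \<open>simp_all add: n_def\<close>)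
  have "n * delta > 0" using e(4) by(simp add: n_def)
  from oscillation_constants[OF \<sigma>(1) K this] obtain theta \<alpha> where
   "0 < theta" "theta <= 1 / 4" "0 < \<alpha>" "\<alpha> <= \<sigma>" "\<alpha> <= n * delta" "theta * K1 + \<alpha> * K2 <= K3" "1 - theta / 2 <= 4 powr (- \<alpha>)" by blast
  thus ?thesis using e by(intro that[of \<alpha>]) blast+
 next case False thus ?thesis by(intro that[of 1]) auto
 qed
 show ?thesis proof(rule exI[of _ \<alpha>], rule conjI[OF \<alpha>(1)], intro allI, rule impI, (rule conjI; (rule impI)?), goal_cases)
  case (1 \<Omega> g lam \<beta> \<beta>hat u\<^sub>0 u w)
  then obtain W N V where "cahn_hilliard_flow \<Omega> s \<sigma> lam W g u w N V"
   using weak_solution_flow[OF s \<sigma>, of \<Omega> g lam u w] by blast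
  from weak_solution_regularity[OF this] 1 show ?case by simp
 next case (2 \<Omega> g lam \<beta> \<beta>hat u\<^sub>0 u w)
  then obtain W N V where flow: "cahn_hilliard_flow \<Omega> s \<sigma> lam W g u w N V"
   using weak_solution_flow[OF s \<sigma>, of \<Omega> g lam u w] by blast
  interpret cahn_hilliard_flow \<Omega> s \<sigma> lam W g u w N V by(rule flow)
  obtain theta p q delta where c': "\<alpha> <= \<sigma>" "0 < theta" "theta <= 1 / 4" "theta * K1 + \<alpha> * K2 <= K3"
   "1 - theta / 2 <= 4 powr (- \<alpha>)" "Sobolev_exponent DIM('a) s p" "Sobolev_exponent DIM('a) \<sigma> q"
   "delta = 1 - 1 / p - 2 / q" "delta > 0" "\<alpha> <= n * delta" using \<alpha>(2) 2 by(auto simp: n_def)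
  obtain \<kappa> where \<kappa>: "\<kappa> > 0" "Liminf at_infinity (%r. ereal (g r * r + (first_eigenvalue \<sigma> \<Omega> - \<kappa>) * r^2)) > 0" using 2 by blast
  obtain M where M: "M >= 0" "!!t. t >= 1 ==> \<exists>f. stationary M (u t) f" using stationary_limit by blast
  obtain K where K: "!!y f. stationary M y f ==> X0_norm \<sigma> y <= K" using energy_bound[OF \<kappa> M(1)] by blast
  have K': "X0_norm \<sigma> y <= abs K" if "stationary M y f" for y f using K[OF that] by linarith
  have \<Omega>: "smooth_bounded_domain \<Omega>" using 2 by blast
  obtain B where B: "!!y f. stationary M y f ==> X0_norm \<sigma> y <= abs K ==>
   (\<exists>v. (AE x in lborel. v x = y x) & holder_norm \<alpha> (closure \<Omega>) v <= ennreal B)"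
   using Hoelder_bound[OF \<Omega> \<alpha>(1) c'(1-3) c'(4)[unfolded K1_def K2_def K3_def c_def n_def V0_def] c'(5-9) c'(10)[unfolded n_def] M(1) abs_ge_zero, of K] by blast
  show ?case proof(intro exI[of _ B] allI impI)
   fix t :: real assume t: "1 <= t"
   then obtain f where f: "stationary M (u t) f" using M(2) by blast
   obtain v where v: "AE x in lborel. v x = u t x" "holder_norm \<alpha> (closure \<Omega>) v <= ennreal B" using B[OF f K'[OF f]] by blast
   have "AE x in lborel. x \<in> \<Omega> --> v x = u t x" using v(1) by eventually_elim simp
   thus "\<exists>v. (AE x in lborel. x \<in> \<Omega> --> v x = u t x) & holder_norm \<alpha> (closure \<Omega>) v <= ennreal B" using v(2) by blast
  qed qed qed

end
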